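(* Let $\mathcal{C}$ be a coring over an associative ring $A$. Then the category $\mathcal{C}\text{-}\mathrm{Comod}_{A\text{-flat}}$ of $A$-flat left $\mathcal{C}$-comodules is $\aleph_1$-accessible. The $\aleph_1$-presentable objects of $\mathcal{C}\text{-}\mathrm{Comod}_{A\text{-flat}}$ are precisely all the $A$-countably presentable $A$-flat $\mathcal{C}$-comodules. Consequently, every $A$-flat $\mathcal{C}$-comodule is an $\aleph_1$-directed colimit of $A$-countably presentable $A$-flat $\mathcal{C}$-comodules.
   Context: Rings are associative and unital. A coring $\mathcal{C}$ over a ring $A$ is an $A$-$A$-bimodule with $A$-$A$-bimodule maps $\mu\colon\mathcal{C}\to\mathcal{C}\otimes_A\mathcal{C}$ and $\epsilon\colon\mathcal{C}\to A$ such that $(\mu\otimes\mathrm{id})\mu=(\mathrm{id}\otimes\mu)\mu$ and $(\epsilon\otimes\mathrm{id})\mu=\mathrm{id}_{\mathcal{C}}=(\mathrm{id}\otimes\epsilon)\mu$. A left $\mathcal{C}$-comodule is a left $A$-module $\mathcal{M}$ with a left $A$-module map $\nu\colon\mathcal{M}\to\mathcal{C}\otimes_A\mathcal{M}$ such that $(\mu\otimes\mathrm{id})\nu=(\mathrm{id}\otimes\nu)\nu$ and $(\epsilon\otimes\mathrm{id})\nu=\mathrm{id}_{\mathcal{M}}$; morphisms are left $A$-module maps commuting with the coactions $\nu$. $\mathcal{C}\text{-}\mathrm{Comod}$ is the additive category of left $\mathcal{C}$-comodules ("$\mathcal{C}$-comodule" means left $\mathcal{C}$-comodule). A $\mathcal{C}$-comodule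 is $A$-flat (resp. $A$-countably presentable) if its underlying left $A$-module is flat (resp. countably presentable, i.e. the cokernel of a morphism of free $A$-modules with at most countable sets of generators). $\mathcal{C}\text{-}\mathrm{Comod}_{A\text{-flat}}\subset\mathcal{C}\text{-}\mathrm{Comod}$ is the full subcategory of $A$-flat comodules. A poset is $\aleph_1$-directed if every countable subset has an upper bound; an $\aleph_1$-directed colimit is a colimit of a diagram indexed by an $\aleph_1$-directed poset. In a category with $\aleph_1$-directed colimits, an object $S$ is $\aleph_1$-presentable if $\mathrm{Hom}(S,-)$ preserves $\aleph_1$-directed colimits. A category is $\aleph_1$-accessible if it has $\aleph_1$-directed colimits and there is a set of $\aleph_1$-presentable objects such that every object is an $\aleph_1$-directed colimit of objects from this set. *)

theory Defs
  imports
    "HOL-Algebra.Module"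
    "HOL-Algebra.AbelCoset"
    "HOL-Algebra.Generated_Groups"
    "HOL-Algebra.Free_Abelian_Groups"
begin

unbundle cardinal_syntax

section \<open>Size\<close>

text \<open>
  HOL has no proper classes, so ``the category of all comodules'' is taken relative to a universe:
  an infinite cardinal \<open>\<kappa>\<close> (a relation on a type \<open>'u\<close>), with ``small'' meaning
  ``of cardinality less than \<open>\<kappa>\<close>''.  Comodules have a small subset of \<open>'u\<close> as carrier and diagrams
  have a small subset of \<open>'u\<close> as index set.  Strongly inaccessible \<open>\<kappa>\<close> (Grothendieck
  universes) are an instance, but only regularity and closure under countable powers are required;
  cardinals of this kind provably exist above any given cardinality, see
  \<open>universe_cardinal_exists\<close>.  Closure under countable powers makes \<open>\<kappa>\<close> uncountable.
\<close>

definition small :: "'u rel \<Rightarrow> 'b set \<Rightarrow> bool" where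
  "small \<kappa> X \<longleftrightarrow> card_of X <o \<kappa>"

definition universe_cardinal :: "'u rel \<Rightarrow> bool" where
  "universe_cardinal \<kappa> \<longleftrightarrow> Cinfinite \<kappa> \<and> regularCard \<kappa> \<and>
     (\<forall>X :: 'u set. small \<kappa> X \<longrightarrow> small \<kappa> ((UNIV :: nat set) \<rightarrow>\<^sub>E X))"

lemma universe_cardinal_exists:
  assumes inf: "infinite (UNIV :: 'x set)"
  shows "universe_cardinal (cardSuc (card_of (UNIV :: 'x set set)))"
proof -
  let ?k = "card_of (UNIV :: 'x set)"
  let ?L = "card_of (UNIV :: 'x set set)"
  have infL: "infinite (UNIV :: 'x set set)"
    using inf by (simp add: Finite_Set.finite_set)
  have L: "Cinfinite ?L"
    using infL by (simp add: BNF_Cardinal_Arithmetic.cinfinite_def Field_card_of card_of_Card_order)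
  have k: "Cinfinite ?k"
    using inf by (simp add: BNF_Cardinal_Arithmetic.cinfinite_def Field_card_of card_of_Card_order)
  have pow: "?L =o ctwo ^c ?k"
    using card_of_Pow_Func[of "UNIV :: 'x set"]
    by (simp add: BNF_Cardinal_Arithmetic.cexp_def ctwo_def Field_card_of)
  have "?L ^c natLeq =o (ctwo ^c ?k) ^c natLeq"
    by (rule cexp_cong1[OF pow natLeq_Card_order])
  also have "(ctwo ^c ?k) ^c natLeq =o ctwo ^c ?k"
    using k by (intro cexp_cprod_ordLeq)
      (auto simp: Card_order_ctwo natLeq_Cinfinite Cinfinite_Cnotzero natLeq_ordLeq_cinfinite)
  also have "ctwo ^c ?k =o ?L"
    by (rule ordIso_symmetric[OF pow])
  finally have LL: "?L ^c natLeq =o ?L" .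
  have "small (cardSuc ?L) ((UNIV :: nat set) \<rightarrow>\<^sub>E X)"
    if X: "small (cardSuc ?L) X" for X :: "'x set set set"
  proof -
    have "card_of X \<le>o ?L"
      using X unfolding small_def cardSuc_ordLeq_ordLess[OF card_of_Card_order card_of_Card_order] .
    then have "card_of X ^c natLeq \<le>o ?L ^c natLeq"
      by (rule cexp_mono1[OF _ natLeq_Card_order])
    then have "card_of X ^c natLeq \<le>o ?L"
      using LL by (rule ordLeq_ordIso_trans)
    moreover have "(UNIV :: nat set) \<rightarrow>\<^sub>E X = Func (UNIV :: nat set) X"
      by (auto simp: Func_def)
    then have "card_of ((UNIV :: nat set) \<rightarrow>\<^sub>E X) = card_of X ^c natLeq"
      by (simp only: BNF_Cardinal_Arithmetic.cexp_def Field_card_of Field_natLeq)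
    ultimately have "card_of ((UNIV :: nat set) \<rightarrow>\<^sub>E X) \<le>o ?L"
      by simp
    then show ?thesis
      unfolding small_def using cardSuc_greater[OF card_of_Card_order]
      by (rule ordLeq_ordLess_trans)
  qed
  then show ?thesis
    unfolding universe_cardinal_def
    using Cinfinite_cardSuc[OF L] regularCard_cardSuc[OF L] by blast
qed


section \<open>Accessible categories\<close>

record ('o, 'h) cat =
  Ob :: "'o set"
  Hom :: "'o \<Rightarrow> 'o \<Rightarrow> 'h set"
  Ident :: "'o \<Rightarrow> 'h"
  Comp :: "'o \<Rightarrow> 'o \<Rightarrow> 'o \<Rightarrow> 'h \<Rightarrow> 'h \<Rightarrow> 'h"
    \<comment> \<open>\<open>Comp K X Y Z g f\<close> is the composite of \<open>f : X \<rightarrow> Y\<close> and \<open>g : Y \<rightarrow> Z\<close>.\<close>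

locale category =
  fixes K :: "('o, 'h) cat"
  assumes Ident_closed: "X \<in> Ob K \<Longrightarrow> Ident K X \<in> Hom K X X"
    and Comp_closed: "\<lbrakk>X \<in> Ob K; Y \<in> Ob K; Z \<in> Ob K; f \<in> Hom K X Y; g \<in> Hom K Y Z\<rbrakk>
      \<Longrightarrow> Comp K X Y Z g f \<in> Hom K X Z"
    and Comp_Ident_right: "\<lbrakk>X \<in> Ob K; Y \<in> Ob K; f \<in> Hom K X Y\<rbrakk>
      \<Longrightarrow> Comp K X X Y f (Ident K X) = f"
    and Comp_Ident_left: "\<lbrakk>X \<in> Ob K; Y \<in> Ob K; f \<in> Hom K X Y\<rbrakk>
      \<Longrightarrow> Comp K X Y Y (Ident K Y) f = f"
    and Comp_assoc: "\<lbrakk>W \<in> Ob K; X \<in> Ob K; Y \<in> Ob K; Z \<in> Ob K;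
        f \<in> Hom K W X; g \<in> Hom K X Y; h \<in> Hom K Y Z\<rbrakk>
      \<Longrightarrow> Comp K W X Z (Comp K X Y Z h g) f = Comp K W Y Z h (Comp K W X Y g f)"

definition full_subcategory :: "('o, 'h) cat \<Rightarrow> ('o \<Rightarrow> bool) \<Rightarrow> ('o, 'h) cat" where
  "full_subcategory K P = K\<lparr>Ob := {X \<in> Ob K. P X}\<rparr>"

definition set_cat :: "('x set, 'x \<Rightarrow> 'x) cat" where
  "set_cat = \<lparr>Ob = UNIV, Hom = (\<lambda>X Y. X \<rightarrow>\<^sub>E Y), Ident = (\<lambda>X. \<lambda>x\<in>X. x),
     Comp = (\<lambda>X Y Z g f. compose X g f)\<rparr>"

definition aleph1_directed :: "'i set \<Rightarrow> 'i rel \<Rightarrow> bool" where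
  "aleph1_directed I r \<longleftrightarrow> partial_order_on I r \<and>
     (\<forall>S. S \<subseteq> I \<and> countable S \<longrightarrow> (\<exists>u\<in>I. \<forall>s\<in>S. (s, u) \<in> r))"

definition diagram :: "('o, 'h) cat \<Rightarrow> 'i set \<Rightarrow> 'i rel \<Rightarrow> ('i \<Rightarrow> 'o) \<Rightarrow> ('i \<Rightarrow> 'i \<Rightarrow> 'h) \<Rightarrow> bool" where
  "diagram K I r D d \<longleftrightarrow>
     (\<forall>i\<in>I. D i \<in> Ob K) \<and>
     (\<forall>(i, j)\<in>r. d i j \<in> Hom K (D i) (D j)) \<and>
     (\<forall>i\<in>I. d i i = Ident K (D i)) \<and>
     (\<forall>i j k. (i, j) \<in> r \<and> (j, k) \<in> r \<longrightarrow> d i k = Comp K (D i) (D j) (D k) (d j k) (d i j))"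

definition cocone :: "('o, 'h) cat \<Rightarrow> 'i set \<Rightarrow> 'i rel \<Rightarrow> ('i \<Rightarrow> 'o) \<Rightarrow> ('i \<Rightarrow> 'i \<Rightarrow> 'h) \<Rightarrow>
    'o \<Rightarrow> ('i \<Rightarrow> 'h) \<Rightarrow> bool" where
  "cocone K I r D d L \<iota> \<longleftrightarrow>
     L \<in> Ob K \<and> (\<forall>i\<in>I. \<iota> i \<in> Hom K (D i) L) \<and>
     (\<forall>(i, j)\<in>r. Comp K (D i) (D j) L (\<iota> j) (d i j) = \<iota> i)"

definition is_colimit :: "('o, 'h) cat \<Rightarrow> 'i set \<Rightarrow> 'i rel \<Rightarrow> ('i \<Rightarrow> 'o) \<Rightarrow> ('i \<Rightarrow> 'i \<Rightarrow> 'h) \<Rightarrow>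
    'o \<Rightarrow> ('i \<Rightarrow> 'h) \<Rightarrow> bool" where
  "is_colimit K I r D d L \<iota> \<longleftrightarrow> cocone K I r D d L \<iota> \<and>
     (\<forall>N \<phi>. cocone K I r D d N \<phi> \<longrightarrow>
        (\<exists>!h. h \<in> Hom K L N \<and> (\<forall>i\<in>I. Comp K (D i) L N h (\<iota> i) = \<phi> i)))"

definition aleph1_diagram :: "'u rel \<Rightarrow> ('o, 'h) cat \<Rightarrow> 'u set \<Rightarrow> 'u rel \<Rightarrow> ('u \<Rightarrow> 'o) \<Rightarrow>
    ('u \<Rightarrow> 'u \<Rightarrow> 'h) \<Rightarrow> bool" where
  "aleph1_diagram \<kappa> K I r D d \<longleftrightarrow> small \<kappa> I \<and> aleph1_directed I r \<and> diagram K I r D d"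

definition has_aleph1_directed_colimits :: "'u rel \<Rightarrow> ('o, 'h) cat \<Rightarrow> bool" where
  "has_aleph1_directed_colimits \<kappa> K \<longleftrightarrow>
     (\<forall>I r D d. aleph1_diagram \<kappa> K I r D d \<longrightarrow> (\<exists>L \<iota>. is_colimit K I r D d L \<iota>))"

definition post_comp :: "('o, 'h) cat \<Rightarrow> 'o \<Rightarrow> 'o \<Rightarrow> 'o \<Rightarrow> 'h \<Rightarrow> 'h \<Rightarrow> 'h" where
  "post_comp K S X Y g = (\<lambda>f\<in>Hom K S X. Comp K S X Y g f)"

text \<open>
  The functor \<open>Hom(S,-)\<close> takes values in the category of all sets of elements of \<open>'h\<close>.
  No size restriction on these sets is needed: two-element sets already detect whether a cocone
  of sets is a colimit, so the choice of carrier type does not matter once it has two elements.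
\<close>

definition aleph1_presentable :: "'u rel \<Rightarrow> ('o, 'h) cat \<Rightarrow> 'o \<Rightarrow> bool" where
  "aleph1_presentable \<kappa> K S \<longleftrightarrow> S \<in> Ob K \<and>
     (\<forall>I r D d L \<iota>. aleph1_diagram \<kappa> K I r D d \<and> is_colimit K I r D d L \<iota> \<longrightarrow>
        is_colimit set_cat I r
          (\<lambda>i. Hom K S (D i)) (\<lambda>i j. post_comp K S (D i) (D j) (d i j))
          (Hom K S L) (\<lambda>i. post_comp K S (D i) L (\<iota> i)))"

definition aleph1_directed_colimit_of :: "'u rel \<Rightarrow> ('o, 'h) cat \<Rightarrow> 'o set \<Rightarrow> 'o \<Rightarrow> bool" where
  "aleph1_directed_colimit_of \<kappa> K T X \<longleftrightarrow>
     (\<exists>I r D d \<iota>. aleph1_diagram \<kappa> K I r D d \<and> (\<forall>i\<in>I. D i \<in> T) \<and> is_colimit K I r D d X \<iota>)"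

definition aleph1_accessible :: "'u rel \<Rightarrow> ('o, 'h) cat \<Rightarrow> bool" where
  "aleph1_accessible \<kappa> K \<longleftrightarrow> category K \<and> has_aleph1_directed_colimits \<kappa> K \<and>
     (\<exists>T. T \<subseteq> Ob K \<and> small \<kappa> T \<and> (\<forall>S\<in>T. aleph1_presentable \<kappa> K S) \<and>
        (\<forall>X\<in>Ob K. aleph1_directed_colimit_of \<kappa> K T X))"


section \<open>Modules over a noncommutative ring\<close>

text \<open>
  The locale \<open>module\<close> of HOL-Algebra requires a commutative ring; its record is reused here.
  As usual in HOL-Algebra, the inherited fields \<open>mult\<close> and \<open>one\<close> of a module carry no meaning.
  Right modules use the record \<open>bimodule\<close> as well, with \<open>smult\<close> ignored.
\<close>

locale left_module = R?: ring R + M?: abelian_group M for R (structure) and M (structure) +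
  assumes smult_closed: "\<lbrakk>a \<in> carrier R; x \<in> carrier M\<rbrakk> \<Longrightarrow> a \<odot>\<^bsub>M\<^esub> x \<in> carrier M"
    and smult_l_distr: "\<lbrakk>a \<in> carrier R; b \<in> carrier R; x \<in> carrier M\<rbrakk>
      \<Longrightarrow> (a \<oplus> b) \<odot>\<^bsub>M\<^esub> x = a \<odot>\<^bsub>M\<^esub> x \<oplus>\<^bsub>M\<^esub> b \<odot>\<^bsub>M\<^esub> x"
    and smult_r_distr: "\<lbrakk>a \<in> carrier R; x \<in> carrier M; y \<in> carrier M\<rbrakk>
      \<Longrightarrow> a \<odot>\<^bsub>M\<^esub> (x \<oplus>\<^bsub>M\<^esub> y) = a \<odot>\<^bsub>M\<^esub> x \<oplus>\<^bsub>M\<^esub> a \<odot>\<^bsub>M\<^esub> y"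
    and smult_assoc: "\<lbrakk>a \<in> carrier R; b \<in> carrier R; x \<in> carrier M\<rbrakk>
      \<Longrightarrow> (a \<otimes> b) \<odot>\<^bsub>M\<^esub> x = a \<odot>\<^bsub>M\<^esub> (b \<odot>\<^bsub>M\<^esub> x)"
    and smult_one: "x \<in> carrier M \<Longrightarrow> \<one> \<odot>\<^bsub>M\<^esub> x = x"

record ('a, 'b) bimodule = "('a, 'b) module" +
  rsmult :: "['b, 'a] \<Rightarrow> 'b" (infixl \<open>\<triangleleft>\<index>\<close> 70)

locale right_module = R?: ring R + M?: abelian_group M for R (structure) and M (structure) +
  assumes rsmult_closed: "\<lbrakk>a \<in> carrier R; x \<in> carrier M\<rbrakk> \<Longrightarrow> x \<triangleleft>\<^bsub>M\<^esub> a \<in> carrier M"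
    and rsmult_r_distr: "\<lbrakk>a \<in> carrier R; b \<in> carrier R; x \<in> carrier M\<rbrakk>
      \<Longrightarrow> x \<triangleleft>\<^bsub>M\<^esub> (a \<oplus> b) = x \<triangleleft>\<^bsub>M\<^esub> a \<oplus>\<^bsub>M\<^esub> x \<triangleleft>\<^bsub>M\<^esub> b"
    and rsmult_l_distr: "\<lbrakk>a \<in> carrier R; x \<in> carrier M; y \<in> carrier M\<rbrakk>
      \<Longrightarrow> (x \<oplus>\<^bsub>M\<^esub> y) \<triangleleft>\<^bsub>M\<^esub> a = x \<triangleleft>\<^bsub>M\<^esub> a \<oplus>\<^bsub>M\<^esub> y \<triangleleft>\<^bsub>M\<^esub> a"
    and rsmult_assoc: "\<lbrakk>a \<in> carrier R; b \<in> carrier R; x \<in> carrier M\<rbrakk>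
      \<Longrightarrow> x \<triangleleft>\<^bsub>M\<^esub> (a \<otimes> b) = (x \<triangleleft>\<^bsub>M\<^esub> a) \<triangleleft>\<^bsub>M\<^esub> b"
    and rsmult_one: "x \<in> carrier M \<Longrightarrow> x \<triangleleft>\<^bsub>M\<^esub> \<one> = x"

locale bimodule = left_module R M + right_module R M for R (structure) and M (structure) +
  assumes smult_rsmult: "\<lbrakk>a \<in> carrier R; b \<in> carrier R; x \<in> carrier M\<rbrakk>
      \<Longrightarrow> (a \<odot>\<^bsub>M\<^esub> x) \<triangleleft>\<^bsub>M\<^esub> b = a \<odot>\<^bsub>M\<^esub> (x \<triangleleft>\<^bsub>M\<^esub> b)"

definition add_hom :: "('b, 'x) ring_scheme \<Rightarrow> ('c, 'y) ring_scheme \<Rightarrow> ('b \<Rightarrow> 'c) set" where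
  "add_hom M N = {f \<in> carrier M \<rightarrow> carrier N.
     \<forall>x\<in>carrier M. \<forall>y\<in>carrier M. f (x \<oplus>\<^bsub>M\<^esub> y) = f x \<oplus>\<^bsub>N\<^esub> f y}"

definition lmod_hom :: "('a, 'r) ring_scheme \<Rightarrow> ('a, 'b, 'x) module_scheme \<Rightarrow>
    ('a, 'c, 'y) module_scheme \<Rightarrow> ('b \<Rightarrow> 'c) set" where
  "lmod_hom R M N = {f \<in> add_hom M N.
     \<forall>a\<in>carrier R. \<forall>x\<in>carrier M. f (a \<odot>\<^bsub>M\<^esub> x) = a \<odot>\<^bsub>N\<^esub> f x}"

definition rmod_hom :: "('a, 'r) ring_scheme \<Rightarrow> ('a, 'b, 'x) bimodule_scheme \<Rightarrow>
    ('a, 'c, 'y) bimodule_scheme \<Rightarrow> ('b \<Rightarrow> 'c) set" where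
  "rmod_hom R M N = {f \<in> add_hom M N.
     \<forall>a\<in>carrier R. \<forall>x\<in>carrier M. f (x \<triangleleft>\<^bsub>M\<^esub> a) = f x \<triangleleft>\<^bsub>N\<^esub> a}"

definition bimod_hom :: "('a, 'r) ring_scheme \<Rightarrow> ('a, 'b, 'x) bimodule_scheme \<Rightarrow>
    ('a, 'c, 'y) bimodule_scheme \<Rightarrow> ('b \<Rightarrow> 'c) set" where
  "bimod_hom R M N = lmod_hom R M N \<inter> rmod_hom R M N"

definition regular_bimodule :: "('a, 'r) ring_scheme \<Rightarrow> ('a, 'a) bimodule" where
  "regular_bimodule R = \<lparr>carrier = carrier R, monoid.mult = monoid.mult R, monoid.one = \<one>\<^bsub>R\<^esub>,
     ring.zero = \<zero>\<^bsub>R\<^esub>, add = add R, smult = monoid.mult R, rsmult = monoid.mult R\<rparr>"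

definition free_module :: "('a, 'r) ring_scheme \<Rightarrow> 'x set \<Rightarrow> ('a, 'x \<Rightarrow> 'a) module" where
  "free_module R X = \<lparr>carrier = {f. (\<forall>x\<in>X. f x \<in> carrier R) \<and> (\<forall>x. x \<notin> X \<longrightarrow> f x = \<zero>\<^bsub>R\<^esub>) \<and>
        finite {x. f x \<noteq> \<zero>\<^bsub>R\<^esub>}},
     monoid.mult = undefined, monoid.one = undefined,
     ring.zero = (\<lambda>_. \<zero>\<^bsub>R\<^esub>), add = (\<lambda>f g x. f x \<oplus>\<^bsub>R\<^esub> g x), smult = (\<lambda>a f x. a \<otimes>\<^bsub>R\<^esub> f x)\<rparr>"

text \<open>\<open>q : N \<rightarrow> P\<close> is a cokernel of \<open>f : M \<rightarrow> N\<close>, i.e. \<open>M \<rightarrow> N \<rightarrow> P \<rightarrow> 0\<close> is exact.\<close>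

definition is_cokernel :: "('a, 'r) ring_scheme \<Rightarrow> ('a, 'b, 'x) module_scheme \<Rightarrow>
    ('a, 'c, 'y) module_scheme \<Rightarrow> ('a, 'd, 'z) module_scheme \<Rightarrow> ('b \<Rightarrow> 'c) \<Rightarrow> ('c \<Rightarrow> 'd) \<Rightarrow> bool" where
  "is_cokernel R M N P f q \<longleftrightarrow> q \<in> lmod_hom R N P \<and> q ` carrier N = carrier P \<and>
     a_kernel N P q = f ` carrier M"

definition countably_presentable :: "('a, 'r) ring_scheme \<Rightarrow> ('a, 'b, 'x) module_scheme \<Rightarrow> bool" where
  "countably_presentable R M \<longleftrightarrow>
     (\<exists>(X :: nat set) (Y :: nat set) f q.
        f \<in> lmod_hom R (free_module R X) (free_module R Y) \<and>
        is_cokernel R (free_module R X) (free_module R Y) M f q)"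


section \<open>Tensor products over a noncommutative ring\<close>

text \<open>
  \<open>M \<otimes>\<^sub>R N\<close> is the quotient of the free abelian group on \<open>carrier M \<times> carrier N\<close> by
  the subgroup generated by the biadditivity and balancing relations; only the right action on
  \<open>M\<close> and the left action on \<open>N\<close> enter.
\<close>

type_synonym ('m, 'n) tens = "('m \<times> 'n \<Rightarrow>\<^sub>0 int) set"

definition tensor_rels :: "('a, 'r) ring_scheme \<Rightarrow> ('a, 'm, 'x) bimodule_scheme \<Rightarrow>
    ('a, 'n, 'y) module_scheme \<Rightarrow> ('m \<times> 'n \<Rightarrow>\<^sub>0 int) set" where
  "tensor_rels R M N =
     {frag_of (x \<oplus>\<^bsub>M\<^esub> x', y) - frag_of (x, y) - frag_of (x', y) | x x' y.
        x \<in> carrier M \<and> x' \<in> carrier M \<and> y \<in> carrier N} \<union>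
     {frag_of (x, y \<oplus>\<^bsub>N\<^esub> y') - frag_of (x, y) - frag_of (x, y') | x y y'.
        x \<in> carrier M \<and> y \<in> carrier N \<and> y' \<in> carrier N} \<union>
     {frag_of (x \<triangleleft>\<^bsub>M\<^esub> a, y) - frag_of (x, a \<odot>\<^bsub>N\<^esub> y) | x a y.
        x \<in> carrier M \<and> a \<in> carrier R \<and> y \<in> carrier N}"

definition tensor_ker :: "('a, 'r) ring_scheme \<Rightarrow> ('a, 'm, 'x) bimodule_scheme \<Rightarrow>
    ('a, 'n, 'y) module_scheme \<Rightarrow> ('m \<times> 'n \<Rightarrow>\<^sub>0 int) set" where
  "tensor_ker R M N = generate (free_Abelian_group (carrier M \<times> carrier N)) (tensor_rels R M N)"

definition tensor_group :: "('a, 'r) ring_scheme \<Rightarrow> ('a, 'm, 'x) bimodule_scheme \<Rightarrow>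
    ('a, 'n, 'y) module_scheme \<Rightarrow> ('m, 'n) tens monoid" where
  "tensor_group R M N = free_Abelian_group (carrier M \<times> carrier N) Mod tensor_ker R M N"

definition tens :: "('a, 'r) ring_scheme \<Rightarrow> ('a, 'm, 'x) bimodule_scheme \<Rightarrow>
    ('a, 'n, 'y) module_scheme \<Rightarrow> 'm \<Rightarrow> 'n \<Rightarrow> ('m, 'n) tens" where
  "tens R M N x y = tensor_ker R M N #>\<^bsub>free_Abelian_group (carrier M \<times> carrier N)\<^esub> frag_of (x, y)"

definition tensor_ab :: "('a, 'r) ring_scheme \<Rightarrow> ('a, 'm, 'x) bimodule_scheme \<Rightarrow>
    ('a, 'n, 'y) module_scheme \<Rightarrow> ('m, 'n) tens ring" where
  "tensor_ab R M N = \<lparr>carrier = carrier (tensor_group R M N), monoid.mult = undefined, monoid.one = undefined,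
     ring.zero = \<one>\<^bsub>tensor_group R M N\<^esub>, add = monoid.mult (tensor_group R M N)\<rparr>"

text \<open>
  \<open>tensor_lift G \<beta>\<close> is the additive map \<open>M \<otimes>\<^sub>R N \<rightarrow> G\<close> with \<open>x \<otimes> y \<mapsto> \<beta> x y\<close>, for
  an \<open>R\<close>-balanced biadditive \<open>\<beta>\<close>: extend \<open>\<beta>\<close> to the free abelian group and take the
  common value on the coset \<open>t\<close>.
\<close>

definition tensor_lift :: "('g, 'z) ring_scheme \<Rightarrow> ('m \<Rightarrow> 'n \<Rightarrow> 'g) \<Rightarrow> ('m, 'n) tens \<Rightarrow> 'g" where
  "tensor_lift G \<beta> t = the_elem ((\<lambda>z. \<Oplus>\<^bsub>G\<^esub>p\<in>Poly_Mapping.keys z.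
     [Poly_Mapping.lookup z p] \<cdot>\<^bsub>G\<^esub> \<beta> (fst p) (snd p)) ` t)"

definition tensor :: "('a, 'r) ring_scheme \<Rightarrow> ('a, 'm, 'x) bimodule_scheme \<Rightarrow>
    ('a, 'n, 'y) module_scheme \<Rightarrow> ('a, ('m, 'n) tens) module" where
  "tensor R M N = ring.extend (tensor_ab R M N) (module.fields
     (\<lambda>a. tensor_lift (tensor_ab R M N) (\<lambda>x y. tens R M N (a \<odot>\<^bsub>M\<^esub> x) y)))"

definition tensor_bimod :: "('a, 'r) ring_scheme \<Rightarrow> ('a, 'm, 'x) bimodule_scheme \<Rightarrow>
    ('a, 'n, 'y) bimodule_scheme \<Rightarrow> ('a, ('m, 'n) tens) bimodule" where
  "tensor_bimod R M N = module.extend (tensor R M N) (bimodule.fields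
     (\<lambda>t a. tensor_lift (tensor_ab R M N) (\<lambda>x y. tens R M N x (y \<triangleleft>\<^bsub>N\<^esub> a)) t))"

text \<open>\<open>tensor_map R M' N' f g\<close> is \<open>f \<otimes> g\<close> with target \<open>M' \<otimes>\<^sub>R N'\<close>.\<close>

definition tensor_map :: "('a, 'r) ring_scheme \<Rightarrow> ('a, 'p, 'x) bimodule_scheme \<Rightarrow>
    ('a, 'q, 'y) module_scheme \<Rightarrow> ('m \<Rightarrow> 'p) \<Rightarrow> ('n \<Rightarrow> 'q) \<Rightarrow> ('m, 'n) tens \<Rightarrow> ('p, 'q) tens" where
  "tensor_map R M' N' f g = tensor_lift (tensor_ab R M' N') (\<lambda>x y. tens R M' N' (f x) (g y))"

text \<open>The canonical isomorphisms
  \<open>(L \<otimes> M) \<otimes> N \<rightarrow> L \<otimes> (M \<otimes> N)\<close>, \<open>R \<otimes> M \<rightarrow> M\<close> and \<open>M \<otimes> R \<rightarrow> M\<close>.\<close>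

definition tensor_assoc :: "('a, 'r) ring_scheme \<Rightarrow> ('a, 'l, 'x) bimodule_scheme \<Rightarrow>
    ('a, 'm, 'y) bimodule_scheme \<Rightarrow> ('a, 'n, 'z) module_scheme \<Rightarrow>
    (('l, 'm) tens, 'n) tens \<Rightarrow> ('l, ('m, 'n) tens) tens" where
  "tensor_assoc R L M N = tensor_lift (tensor_ab R L (tensor R M N))
     (\<lambda>t z. tensor_lift (tensor_ab R L (tensor R M N))
        (\<lambda>x y. tens R L (tensor R M N) x (tens R M N y z)) t)"

definition left_unitor :: "('a, 'b, 'x) module_scheme \<Rightarrow> ('a, 'b) tens \<Rightarrow> 'b" where
  "left_unitor M = tensor_lift M (\<lambda>a x. a \<odot>\<^bsub>M\<^esub> x)"

definition right_unitor :: "('a, 'b, 'x) bimodule_scheme \<Rightarrow> ('b, 'a) tens \<Rightarrow> 'b" where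
  "right_unitor M = tensor_lift M (\<lambda>x a. x \<triangleleft>\<^bsub>M\<^esub> a)"

text \<open>
  Right modules range over the universe.  When \<open>carrier R\<close> is small this is no restriction:
  already the inclusions of right ideals into \<open>R\<close> suffice to test flatness.
\<close>

definition flat_module :: "'u rel \<Rightarrow> ('a, 'r) ring_scheme \<Rightarrow> ('a, 'b, 'x) module_scheme \<Rightarrow> bool" where
  "flat_module \<kappa> R M \<longleftrightarrow>
     (\<forall>(X :: ('a, 'u) bimodule) (Y :: ('a, 'u) bimodule) f.
        right_module R X \<and> small \<kappa> (carrier X) \<and> right_module R Y \<and> small \<kappa> (carrier Y) \<and>
        f \<in> rmod_hom R X Y \<and> inj_on f (carrier X) \<longrightarrow>
        inj_on (tensor_map R Y M f (\<lambda>m. m)) (carrier (tensor R X M)))"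


section \<open>Corings and comodules\<close>

record ('a, 'c) coring = "('a, 'c) bimodule" +
  comul :: "'c \<Rightarrow> ('c, 'c) tens"
  counit :: "'c \<Rightarrow> 'a"

locale coring = bimodule R C for R (structure) and C (structure) +
  assumes comul_hom: "comul C \<in> bimod_hom R C (tensor_bimod R C C)"
    and counit_hom: "counit C \<in> bimod_hom R C (regular_bimodule R)"
    and coassoc: "x \<in> carrier C \<Longrightarrow>
      tensor_assoc R C C C (tensor_map R (tensor_bimod R C C) C (comul C) (\<lambda>c. c) (comul C x)) =
      tensor_map R C (tensor R C C) (\<lambda>c. c) (comul C) (comul C x)"
    and counit_left: "x \<in> carrier C \<Longrightarrow>
      left_unitor C (tensor_map R (regular_bimodule R) C (counit C) (\<lambda>c. c) (comul C x)) = x"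
    and counit_right: "x \<in> carrier C \<Longrightarrow>
      right_unitor C (tensor_map R C (regular_bimodule R) (\<lambda>c. c) (counit C) (comul C x)) = x"

record ('a, 'c, 'm) comodule = "('a, 'm) module" +
  coact :: "'m \<Rightarrow> ('c, 'm) tens"

locale comodule = left_module R M for R (structure) and C (structure) and M (structure) +
  assumes coact_hom: "coact M \<in> lmod_hom R M (tensor R C M)"
    and coact_coassoc: "x \<in> carrier M \<Longrightarrow>
      tensor_assoc R C C M (tensor_map R (tensor_bimod R C C) M (comul C) (\<lambda>m. m) (coact M x)) =
      tensor_map R C (tensor R C M) (\<lambda>c. c) (coact M) (coact M x)"
    and coact_counit: "x \<in> carrier M \<Longrightarrow>
      left_unitor M (tensor_map R (regular_bimodule R) M (counit C) (\<lambda>m. m) (coact M x)) = x"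

text \<open>Morphisms are extensional functions, so that equality of morphisms is equality in HOL.\<close>

definition comod_hom :: "('a, 'r) ring_scheme \<Rightarrow> ('a, 'c, 'y) coring_scheme \<Rightarrow>
    ('a, 'c, 'm) comodule \<Rightarrow> ('a, 'c, 'n) comodule \<Rightarrow> ('m \<Rightarrow> 'n) set" where
  "comod_hom R C M N = {f \<in> carrier M \<rightarrow>\<^sub>E carrier N. f \<in> lmod_hom R M N \<and>
     (\<forall>x\<in>carrier M. coact N (f x) = tensor_map R C N (\<lambda>c. c) f (coact M x))}"

definition comod_cat :: "'u rel \<Rightarrow> ('a, 'r) ring_scheme \<Rightarrow> ('a, 'c, 'y) coring_scheme \<Rightarrow>
    (('a, 'c, 'u) comodule, 'u \<Rightarrow> 'u) cat" where
  "comod_cat \<kappa> R C = \<lparr>Ob = {M. comodule R C M \<and> small \<kappa> (carrier M)},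
     Hom = comod_hom R C, Ident = (\<lambda>M. \<lambda>x\<in>carrier M. x),
     Comp = (\<lambda>M N P g f. compose (carrier M) g f)\<rparr>"

definition comod_flat_cat :: "'u rel \<Rightarrow> ('a, 'r) ring_scheme \<Rightarrow> ('a, 'c, 'y) coring_scheme \<Rightarrow>
    (('a, 'c, 'u) comodule, 'u \<Rightarrow> 'u) cat" where
  "comod_flat_cat \<kappa> R C = full_subcategory (comod_cat \<kappa> R C) (flat_module \<kappa> R)"

end

theory Submission
  imports Defs
begin

text \<open>
  Let \<open>M\<close> be an \<open>A\<close>-flat comodule. As a module it is the colimit, over the countable sets \<open>G\<close> of
  linear relations between its elements, of the modules \<open>N(G)\<close> generated by the elements that occur
  in \<open>G\<close> subject to \<open>G\<close>. By the equational criterion, flatness of \<open>N(G)\<close> means that finitely many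
  relations can be trivialised by a substitution; as \<open>M\<close> is flat, the substitution exists in \<open>M\<close>
  and involves finitely many further relations. Likewise \<open>C \<otimes> -\<close> preserves directed colimits, so that
  lifting the coaction of \<open>M\<close> to \<open>N(G)\<close>, coassociativity and the counit law need, for each finite part
  of \<open>G\<close>, only countably many further relations. Closing up countably often, the sets \<open>G\<close> for which
  \<open>N(G)\<close> is a flat comodule mapping to \<open>M\<close> are cofinal and closed enough to be
  \<open>\<aleph>\<^sub>1\<close>-directed, and \<open>M\<close> is the colimit of these \<open>N(G)\<close>.

  A countably presentable flat comodule is \<open>\<aleph>\<^sub>1\<close>-presentable, because a morphism out of it is given by
  countably many values subject to countably many conditions. Conversely an \<open>\<aleph>\<^sub>1\<close>-presentable
  object is a retract of some \<open>N(G)\<close>.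
\<close>

section \<open>Formal integer combinations\<close>

text \<open>Injectivity of tensor maps concerns a whole module and cannot be arranged by adding
  relations one at a time. The equational criterion can: it asks for a substitution, and a
  substitution that trivialises some relations extends to larger sets of relations. The conditions
  on the lifted coaction persist in the same way. Each condition concerns a finite set of relations,
  is met at some stage and is never lost later; a countable set has countably many finite subsets,
  so one countable closing-up serves all of them.

  Generators are named by elements of \<open>M\<close> and transition maps keep the names. The index
  set is therefore a poset under inclusion, with transition maps that compose strictly, and no
  coherence of choices arises.

  Coefficients enter through formal integer combinations because the tensor product is defined as a
  quotient of a free abelian group. Additivity in the coefficient then counts as one more family of
  relations, and one calculus serves modules and tensor products alike.\<close>

type_synonym ('a, 'x) fcomb = "'a \<times> 'x \<Rightarrow>\<^sub>0 int"

text \<open>The carrier of the free abelian group on \<open>B\<close>, kept as a plain set so that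
  combinations are added with the type class operations and not with those of a group
  record.\<close>

definition frags :: "'b set \<Rightarrow> ('b \<Rightarrow>\<^sub>0 int) set" where
  "frags B = {z. Poly_Mapping.keys z \<subseteq> B}"

lemma frags_0 [simp]: "0 \<in> frags B"
  by (simp add: frags_def)

lemma frags_of [simp]: "frag_of x \<in> frags B \<longleftrightarrow> x \<in> B"
  by (simp add: frags_def)

lemma frags_add [intro]: "z \<in> frags B \<Longrightarrow> w \<in> frags B \<Longrightarrow> z + w \<in> frags B"
  using keys_add[of z w] by (auto simp: frags_def)

lemma frags_diff [intro]: "z \<in> frags B \<Longrightarrow> w \<in> frags B \<Longrightarrow> z - w \<in> frags B"
  using keys_diff[of z w] by (auto simp: frags_def)

lemma frags_uminus [intro]: "z \<in> frags B \<Longrightarrow> - z \<in> frags B"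
  by (simp add: frags_def)

lemma frags_mono: "B \<subseteq> B' \<Longrightarrow> frags B \<subseteq> frags B'"
  by (auto simp: frags_def)

lemma frags_sum: "(\<And>i. i \<in> S \<Longrightarrow> f i \<in> frags B) \<Longrightarrow> sum f S \<in> frags B"
  by (induction S rule: infinite_finite_induct) auto

lemma frags_keys: "z \<in> frags (Poly_Mapping.keys z)"
  by (simp add: frags_def)

lemma frags_keysD: "z \<in> frags B \<Longrightarrow> p \<in> Poly_Mapping.keys z \<Longrightarrow> p \<in> B"
  by (auto simp: frags_def)

text \<open>Closure under differences alone gives sums and negatives, since \<open>- w\<close> is
  \<open>0 - w\<close>; every induction on formal combinations then has one inductive case in place
  of two.\<close>

lemma frags_induct [consumes 1, case_names zero of diff]:
  assumes "z \<in> frags B" and "P 0" and "\<And>x. x \<in> B \<Longrightarrow> P (frag_of x)"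
    and "\<And>z w. \<lbrakk>z \<in> frags B; w \<in> frags B; P z; P w\<rbrakk> \<Longrightarrow> P (z - w)"
  shows "P z"
  using assms unfolding frags_def
  by (intro free_Abelian_group_induct[of z B P]) auto

lemma frag_extend_frags:
  assumes "z \<in> frags B" "\<And>p. p \<in> B \<Longrightarrow> f p \<in> frags B'"
  shows "frag_extend f z \<in> frags B'"
  using assms by (induction rule: frags_induct) (auto simp: frag_extend_diff)

lemma frag_extend_frag_extend:
  "frag_extend f (frag_extend g z) = frag_extend (\<lambda>p. frag_extend f (g p)) z"
proof -
  have "z \<in> frags UNIV" by (simp add: frags_def)
  then show ?thesis
    by (induction rule: frags_induct) (auto simp: frag_extend_diff)
qed

lemma frag_extend_cong:
  "z \<in> frags B \<Longrightarrow> (\<And>p. p \<in> B \<Longrightarrow> f p = g p) \<Longrightarrow> frag_extend f z = frag_extend g z"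
  by (intro frag_extend_eq) (auto simp: frags_def)

lemma frag_extend_id: "z \<in> frags B \<Longrightarrow> (\<And>p. p \<in> B \<Longrightarrow> f p = frag_of p) \<Longrightarrow> frag_extend f z = z"
  using frag_extend_cong[of z B f frag_of] frag_expansion[of z] by simp

text \<open>The subgroup generated by \<open>S\<close>, built by adding or subtracting one generator
  at a time. Inductions on membership thus meet a single relation per step, whereas
  \<open>generate\<close> would offer two arbitrary members.\<close>

inductive_set addspan :: "'z::ab_group_add set \<Rightarrow> 'z set" for S where
  zero: "0 \<in> addspan S"
| plus: "\<lbrakk>z \<in> addspan S; s \<in> S\<rbrakk> \<Longrightarrow> z + s \<in> addspan S"
| minus: "\<lbrakk>z \<in> addspan S; s \<in> S\<rbrakk> \<Longrightarrow> z - s \<in> addspan S"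

lemma addspan_base: "s \<in> S \<Longrightarrow> s \<in> addspan S"
  using addspan.plus[OF addspan.zero] by force

lemma addspan_add:
  assumes "z \<in> addspan S" "w \<in> addspan S" shows "z + w \<in> addspan S"
  using assms(2)
proof induction
  case (plus w s) then show ?case using addspan.plus[of "z + w" S s] by (simp add: algebra_simps)
next
  case (minus w s) then show ?case using addspan.minus[of "z + w" S s] by (simp add: algebra_simps)
qed (use assms in simp)

lemma addspan_diff:
  assumes "z \<in> addspan S" "w \<in> addspan S" shows "z - w \<in> addspan S"
  using assms(2)
proof induction
  case (plus w s) then show ?case using addspan.minus[of "z - w" S s] by (simp add: algebra_simps)
next
  case (minus w s) then show ?case using addspan.plus[of "z - w" S s] by (simp add: algebra_simps)
qed (use assms in simp)

lemma addspan_uminus: "w \<in> addspan S \<Longrightarrow> - w \<in> addspan S"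
  using addspan_diff[OF addspan.zero] by fastforce

lemma addspan_subset:
  assumes "\<And>s. s \<in> S \<Longrightarrow> s \<in> addspan T" shows "addspan S \<subseteq> addspan T"
proof
  fix z assume "z \<in> addspan S"
  then show "z \<in> addspan T"
    by induction (auto intro: addspan.zero addspan_add addspan_diff assms)
qed

lemma addspan_mono: "S \<subseteq> T \<Longrightarrow> addspan S \<subseteq> addspan T"
  by (intro addspan_subset) (auto intro: addspan_base)

lemma addspan_frags:
  assumes "S \<subseteq> frags B" shows "addspan S \<subseteq> frags B"
proof
  fix z assume "z \<in> addspan S"
  then show "z \<in> frags B" by induction (use assms in auto)
qed

text \<open>The extension of \<open>b\<close> to the free abelian group. The sum is the one inside
  \<open>tensor_lift\<close>, which therefore takes the common value of \<open>ev\<close> on a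
  coset.\<close>

definition ev :: "('g, 'z) ring_scheme \<Rightarrow> ('b \<Rightarrow> 'g) \<Rightarrow> ('b \<Rightarrow>\<^sub>0 int) \<Rightarrow> 'g" where
  "ev G b z = (\<Oplus>\<^bsub>G\<^esub>p\<in>Poly_Mapping.keys z. [Poly_Mapping.lookup z p] \<cdot>\<^bsub>G\<^esub> b p)"

context abelian_group
begin

lemma add_pow_int_closed [intro, simp]: "x \<in> carrier G \<Longrightarrow> [(k::int)] \<cdot> x \<in> carrier G"
  by (rule add.int_pow_closed)

lemma add_pow_int_zero [simp]: "[(0::int)] \<cdot> x = \<zero>"
  by (simp add: add_pow_def)

lemma add_pow_int_add: "x \<in> carrier G \<Longrightarrow> [(i + j :: int)] \<cdot> x = [i] \<cdot> x \<oplus> [j] \<cdot> x"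
  using group.int_pow_mult[OF a_group, of x i j] by (simp add: add_pow_def)

text \<open>Terms outside the support have multiplicity 0, so two combinations can be evaluated over
  one common finite index set; additivity of \<open>ev\<close> rests on this.\<close>

lemma ev_superset:
  assumes "finite S" "Poly_Mapping.keys z \<subseteq> S" "b \<in> S \<rightarrow> carrier G"
  shows "ev G b z = (\<Oplus>p\<in>S. [Poly_Mapping.lookup z p] \<cdot> b p)"
  unfolding ev_def
  by (rule add.finprod_mono_neutral_cong_left)
    (use assms in \<open>auto simp: in_keys_iff\<close>)

lemma ev_closed [intro]:
  assumes "z \<in> frags B" "b \<in> B \<rightarrow> carrier G" shows "ev G b z \<in> carrier G"
  unfolding ev_def by (rule finsum_closed) (use assms in \<open>auto simp: frags_def\<close>)

lemma ev_0 [simp]: "ev G b 0 = \<zero>"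
  by (simp add: ev_def)

lemma ev_of [simp]: "b x \<in> carrier G \<Longrightarrow> ev G b (frag_of x) = b x"
  by (simp add: ev_def add_pow_def int_pow_def2)

lemma ev_cong: "z \<in> frags B \<Longrightarrow> (\<And>p. p \<in> B \<Longrightarrow> b p = b' p) \<Longrightarrow> b' \<in> B \<rightarrow> carrier G \<Longrightarrow> ev G b z = ev G b' z"
  unfolding ev_def by (rule finsum_cong') (auto simp: frags_def)

lemma ev_add:
  assumes "z \<in> frags B" "w \<in> frags B" "b \<in> B \<rightarrow> carrier G"
  shows "ev G b (z + w) = ev G b z \<oplus> ev G b w"
proof -
  let ?S = "Poly_Mapping.keys z \<union> Poly_Mapping.keys w"
  have S: "finite ?S" "b \<in> ?S \<rightarrow> carrier G" using assms by (auto simp: frags_def)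
  have bS: "b i \<in> carrier G" if "i \<in> ?S" for i using S that by blast
  have "ev G b (z + w) = (\<Oplus>p\<in>?S. [Poly_Mapping.lookup (z + w) p] \<cdot> b p)"
    using S keys_add[of z w] by (intro ev_superset) auto
  also have "\<dots> = (\<Oplus>p\<in>?S. [Poly_Mapping.lookup z p] \<cdot> b p \<oplus> [Poly_Mapping.lookup w p] \<cdot> b p)"
    by (rule finsum_cong') (use bS in \<open>auto simp: lookup_add add_pow_int_add\<close>)
  also have "\<dots> = ev G b z \<oplus> ev G b w"
    using S by (subst finsum_addf) (auto simp: ev_superset[of ?S])
  finally show ?thesis .
qed

lemma ev_uminus:
  assumes "w \<in> frags B" "b \<in> B \<rightarrow> carrier G" shows "ev G b (- w) = \<ominus> ev G b w"
proof -
  have c: "ev G b w \<in> carrier G" "ev G b (- w) \<in> carrier G" using assms by auto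
  have "ev G b (- w) \<oplus> ev G b w = ev G b (- w + w)" using assms by (subst ev_add) auto
  then have "ev G b (- w) \<oplus> ev G b w = \<zero>" by simp
  then show ?thesis using c minus_equality by force
qed

lemma ev_diff:
  assumes "z \<in> frags B" "w \<in> frags B" "b \<in> B \<rightarrow> carrier G"
  shows "ev G b (z - w) = ev G b z \<ominus> ev G b w"
  using assms ev_add[of z B "- w" b] ev_uminus[of w B b] by (auto simp: a_minus_def)

lemma ev_frag_diff:
  assumes "b p \<in> carrier G" "b q \<in> carrier G"
  shows "ev G b (frag_of p - frag_of q) = b p \<ominus> b q"
  using assms by (subst ev_diff[of _ "{p, q}"]) auto

lemma ev_frag_diff2:
  assumes "b p \<in> carrier G" "b q \<in> carrier G" "b r \<in> carrier G"
  shows "ev G b (frag_of p - frag_of q - frag_of r) = b p \<ominus> b q \<ominus> b r"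
  using assms by (subst ev_diff[of _ "{p, q, r}"]) (auto simp: ev_frag_diff intro!: frags_diff)

lemma add_minus_minus: "x \<in> carrier G \<Longrightarrow> y \<in> carrier G \<Longrightarrow> (x \<oplus> y) \<ominus> x \<ominus> y = \<zero>"
  by (metis a_minus_def add.inv_closed add.m_closed add.m_comm add.m_assoc r_neg r_zero)

lemma ev_frag_diff_zero: "b p = b q \<Longrightarrow> b q \<in> carrier G \<Longrightarrow> ev G b (frag_of p - frag_of q) = \<zero>"
  by (simp add: ev_frag_diff a_minus_def r_neg)

lemma ev_frag_diff2_zero:
  "b p = b q \<oplus> b r \<Longrightarrow> b q \<in> carrier G \<Longrightarrow> b r \<in> carrier G \<Longrightarrow> ev G b (frag_of p - frag_of q - frag_of r) = \<zero>"
  by (simp add: ev_frag_diff2 add_minus_minus)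

end

section \<open>Additive maps between abelian groups\<close>

lemma add_hom_closed: "h \<in> add_hom G H \<Longrightarrow> x \<in> carrier G \<Longrightarrow> h x \<in> carrier H"
  by (auto simp: add_hom_def)

lemma add_hom_add:
  "h \<in> add_hom G H \<Longrightarrow> x \<in> carrier G \<Longrightarrow> y \<in> carrier G \<Longrightarrow> h (x \<oplus>\<^bsub>G\<^esub> y) = h x \<oplus>\<^bsub>H\<^esub> h y"
  by (auto simp: add_hom_def)

lemma add_hom_zero:
  assumes "abelian_group G" "abelian_group H" "h \<in> add_hom G H"
  shows "h \<zero>\<^bsub>G\<^esub> = \<zero>\<^bsub>H\<^esub>"
proof -
  interpret G: abelian_group G by fact
  interpret H: abelian_group H by fact
  have c: "h \<zero>\<^bsub>G\<^esub> \<in> carrier H" using assms by (auto intro: add_hom_closed)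
  have "h \<zero>\<^bsub>G\<^esub> \<oplus>\<^bsub>H\<^esub> h \<zero>\<^bsub>G\<^esub> = h \<zero>\<^bsub>G\<^esub>" using add_hom_add[OF assms(3), of "\<zero>\<^bsub>G\<^esub>" "\<zero>\<^bsub>G\<^esub>"] by simp
  then show ?thesis using c by (simp add: H.add.l_cancel_one')
qed

lemma add_hom_uminus:
  assumes "abelian_group G" "abelian_group H" "h \<in> add_hom G H" "x \<in> carrier G"
  shows "h (\<ominus>\<^bsub>G\<^esub> x) = \<ominus>\<^bsub>H\<^esub> h x"
proof -
  interpret G: abelian_group G by fact
  interpret H: abelian_group H by fact
  have "h (\<ominus>\<^bsub>G\<^esub> x) \<oplus>\<^bsub>H\<^esub> h x = \<zero>\<^bsub>H\<^esub>"
    using assms add_hom_add[OF assms(3), of "\<ominus>\<^bsub>G\<^esub> x" x] by (simp add: G.l_neg add_hom_zero[OF assms(1-3)])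
  then show ?thesis using assms H.minus_equality by (metis G.a_inv_closed add_hom_closed)
qed

lemma add_hom_diff:
  assumes "abelian_group G" "abelian_group H" "h \<in> add_hom G H" "x \<in> carrier G" "y \<in> carrier G"
  shows "h (x \<ominus>\<^bsub>G\<^esub> y) = h x \<ominus>\<^bsub>H\<^esub> h y"
  using assms add_hom_uminus[OF assms(1-3,5)] abelian_group.a_inv_closed[OF assms(1)]
  by (simp add: a_minus_def add_hom_add)

lemma add_hom_ev:
  assumes "abelian_group G" "abelian_group H" "h \<in> add_hom G H" "z \<in> frags B" "b \<in> B \<rightarrow> carrier G"
  shows "h (ev G b z) = ev H (\<lambda>p. h (b p)) z"
proof -
  interpret G: abelian_group G by fact
  interpret H: abelian_group H by fact
  have hb: "(\<lambda>p. h (b p)) \<in> B \<rightarrow> carrier H" using assms by (auto intro: add_hom_closed)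
  show ?thesis using assms(4)
  proof (induction rule: frags_induct)
    case zero then show ?case by (simp add: add_hom_zero[OF assms(1-3)])
  next
    case (of x) then show ?case using assms hb by (simp add: Pi_iff)
  next
    case (diff z w)
    then show ?case using assms hb
      by (simp add: G.ev_diff[of z B w] H.ev_diff[of z B w] add_hom_diff[OF assms(1-3)] G.ev_closed[of _ B])
  qed
qed

lemma add_hom_compose:
  "f \<in> add_hom G H \<Longrightarrow> g \<in> add_hom H K \<Longrightarrow> (\<lambda>x. g (f x)) \<in> add_hom G K"
  by (auto simp: add_hom_def Pi_iff)

section \<open>Tensor products\<close>

text \<open>Closure of the two actions keeps the tensor relations inside the free abelian group on
  the carriers. In this form a tensor product such as \<open>tensor_bimod R L M\<close> can serve as
  a left factor as soon as its right action is seen to be closed.\<close>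

locale tensor_pair = M?: abelian_group M + N?: abelian_group N
  for R :: "('a, 'r) ring_scheme" and M :: "('a, 'm, 'x) bimodule_scheme" and N :: "('a, 'n, 'y) module_scheme" +
  assumes rsmult_closed': "\<lbrakk>a \<in> carrier R; x \<in> carrier M\<rbrakk> \<Longrightarrow> x \<triangleleft>\<^bsub>M\<^esub> a \<in> carrier M"
    and smult_closed': "\<lbrakk>a \<in> carrier R; y \<in> carrier N\<rbrakk> \<Longrightarrow> a \<odot>\<^bsub>N\<^esub> y \<in> carrier N"

definition tcls :: "('a, 'r) ring_scheme \<Rightarrow> ('a, 'm, 'x) bimodule_scheme \<Rightarrow>
    ('a, 'n, 'y) module_scheme \<Rightarrow> ('m, 'n) fcomb \<Rightarrow> ('m, 'n) tens" where
  "tcls R M N z = tensor_ker R M N #>\<^bsub>free_Abelian_group (carrier M \<times> carrier N)\<^esub> z"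

lemma tens_eq_tcls: "tens R M N x y = tcls R M N (frag_of (x, y))"
  by (simp add: tens_def tcls_def)

definition balanced :: "('a, 'r) ring_scheme \<Rightarrow> ('a, 'm, 'x) bimodule_scheme \<Rightarrow>
    ('a, 'n, 'y) module_scheme \<Rightarrow> ('g, 'z) ring_scheme \<Rightarrow> ('m \<Rightarrow> 'n \<Rightarrow> 'g) \<Rightarrow> bool" where
  "balanced R M N G b \<longleftrightarrow>
    (\<forall>x\<in>carrier M. \<forall>y\<in>carrier N. b x y \<in> carrier G) \<and>
    (\<forall>x\<in>carrier M. \<forall>x'\<in>carrier M. \<forall>y\<in>carrier N. b (x \<oplus>\<^bsub>M\<^esub> x') y = b x y \<oplus>\<^bsub>G\<^esub> b x' y) \<and>
    (\<forall>x\<in>carrier M. \<forall>y\<in>carrier N. \<forall>y'\<in>carrier N. b x (y \<oplus>\<^bsub>N\<^esub> y') = b x y \<oplus>\<^bsub>G\<^esub> b x y') \<and>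
    (\<forall>x\<in>carrier M. \<forall>a\<in>carrier R. \<forall>y\<in>carrier N. b (x \<triangleleft>\<^bsub>M\<^esub> a) y = b x (a \<odot>\<^bsub>N\<^esub> y))"

lemma balancedI:
  assumes "\<And>x y. \<lbrakk>x \<in> carrier M; y \<in> carrier N\<rbrakk> \<Longrightarrow> b x y \<in> carrier G"
    and "\<And>x x' y. \<lbrakk>x \<in> carrier M; x' \<in> carrier M; y \<in> carrier N\<rbrakk> \<Longrightarrow> b (x \<oplus>\<^bsub>M\<^esub> x') y = b x y \<oplus>\<^bsub>G\<^esub> b x' y"
    and "\<And>x y y'. \<lbrakk>x \<in> carrier M; y \<in> carrier N; y' \<in> carrier N\<rbrakk> \<Longrightarrow> b x (y \<oplus>\<^bsub>N\<^esub> y') = b x y \<oplus>\<^bsub>G\<^esub> b x y'"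
    and "\<And>x a y. \<lbrakk>x \<in> carrier M; a \<in> carrier R; y \<in> carrier N\<rbrakk> \<Longrightarrow> b (x \<triangleleft>\<^bsub>M\<^esub> a) y = b x (a \<odot>\<^bsub>N\<^esub> y)"
  shows "balanced R M N G b"
  using assms unfolding balanced_def by blast

context tensor_pair
begin

abbreviation "TT \<equiv> frags (carrier M \<times> carrier N)"
abbreviation "T \<equiv> tensor_ab R M N"

lemma tensor_rels_frags: "tensor_rels R M N \<subseteq> TT"
  unfolding tensor_rels_def
  by (auto intro!: frags_diff simp: rsmult_closed' smult_closed')

text \<open>The relations lie in the carrier of the free abelian group, where the group inverse is
  negation; hence \<open>generate\<close> and \<open>addspan\<close> reach the same
  elements.\<close>

lemma tensor_ker_eq: "tensor_ker R M N = addspan (tensor_rels R M N)"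
proof
  let ?F = "free_Abelian_group (carrier M \<times> carrier N)"
  interpret F: group ?F by simp
  have sub: "tensor_rels R M N \<subseteq> carrier ?F" using tensor_rels_frags by (auto simp: frags_def)
  show "tensor_ker R M N \<subseteq> addspan (tensor_rels R M N)"
  proof
    fix z assume "z \<in> tensor_ker R M N"
    then show "z \<in> addspan (tensor_rels R M N)" unfolding tensor_ker_def
    proof (induction rule: generate.induct)
      case (inv h)
      then have "inv\<^bsub>?F\<^esub> h = - h" using sub inv by (meson carrier_free_Abelian_group_iff inv_free_Abelian_group subset_iff)
      then show ?case using inv by (auto intro: addspan_uminus addspan_base)
    qed (auto intro: addspan.zero addspan_base addspan_add)
  qed
  show "addspan (tensor_rels R M N) \<subseteq> tensor_ker R M N"
  proof
    fix z assume "z \<in> addspan (tensor_rels R M N)"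
    then show "z \<in> tensor_ker R M N" unfolding tensor_ker_def
    proof (induction)
      case zero
      then show ?case using generate.one[of ?F] by simp
    next
      case (plus z s)
      then show ?case using generate.eng[of z ?F _ s] generate.incl[of s _ ?F] by simp
    next
      case (minus z s)
      then have "inv\<^bsub>?F\<^esub> s = - s" using sub minus by (meson carrier_free_Abelian_group_iff inv_free_Abelian_group subset_iff)
      then show ?case using minus generate.eng[of z ?F _ "- s"] generate.inv[of s _ ?F] by simp
    qed
  qed
qed

lemma tensor_ker_frags: "tensor_ker R M N \<subseteq> TT"
  unfolding tensor_ker_eq by (rule addspan_frags[OF tensor_rels_frags])

lemma tcls_eq: "tcls R M N z = {v. v - z \<in> tensor_ker R M N}"
  unfolding tcls_def r_coset_def by (auto simp: algebra_simps intro!: bexI[of _ "_ - z"])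

lemma tcls_eq_iff: "tcls R M N z = tcls R M N w \<longleftrightarrow> z - w \<in> tensor_ker R M N"
proof
  assume "tcls R M N z = tcls R M N w"
  moreover have "z \<in> tcls R M N z" by (auto simp: tcls_eq tensor_ker_eq addspan.zero)
  ultimately show "z - w \<in> tensor_ker R M N" by (simp add: tcls_eq)
next
  assume d: "z - w \<in> tensor_ker R M N"
  have "v - z \<in> tensor_ker R M N \<longleftrightarrow> v - w \<in> tensor_ker R M N" for v
    using d addspan_add[of "v - z" _ "z - w"] addspan_diff[of "v - w" _ "z - w"]
    by (auto simp: tensor_ker_eq)
  then show "tcls R M N z = tcls R M N w" by (auto simp: tcls_eq)
qed

lemma normal_tensor_ker: "normal (tensor_ker R M N) (free_Abelian_group (carrier M \<times> carrier N))"
proof -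
  have "subgroup (tensor_ker R M N) (free_Abelian_group (carrier M \<times> carrier N))"
    unfolding tensor_ker_def using tensor_rels_frags
    by (intro group.generate_is_subgroup) (auto simp: frags_def)
  then show ?thesis
    using comm_group.normal_iff_subgroup[OF abelian_free_Abelian_group] by blast
qed

lemma carrier_tensor_ab: "carrier T = tcls R M N ` TT"
  by (auto simp: tensor_ab_def tensor_group_def FactGroup_def RCOSETS_def tcls_def frags_def)

lemma add_tensor_ab:
  assumes "z \<in> TT" "w \<in> TT"
  shows "tcls R M N z \<oplus>\<^bsub>T\<^esub> tcls R M N w = tcls R M N (z + w)"
proof -
  interpret n: normal "tensor_ker R M N" "free_Abelian_group (carrier M \<times> carrier N)"
    by (rule normal_tensor_ker)
  show ?thesis
    using assms n.rcos_sum[of z w]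
    by (simp add: tensor_ab_def tensor_group_def FactGroup_def tcls_def frags_def)
qed

lemma zero_tensor_ab: "\<zero>\<^bsub>T\<^esub> = tcls R M N 0"
  by (simp add: tensor_ab_def tensor_group_def FactGroup_def tcls_eq)

lemma tensor_ab_group: "abelian_group T"
proof (rule abelian_groupI)
  fix x assume "x \<in> carrier T"
  then obtain z where z: "z \<in> TT" "x = tcls R M N z" by (auto simp: carrier_tensor_ab)
  then show "\<exists>y\<in>carrier T. y \<oplus>\<^bsub>T\<^esub> x = \<zero>\<^bsub>T\<^esub>"
    by (intro bexI[of _ "tcls R M N (- z)"]) (auto simp: carrier_tensor_ab add_tensor_ab frags_uminus zero_tensor_ab)
qed (auto simp: carrier_tensor_ab add_tensor_ab frags_add zero_tensor_ab algebra_simps)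

sublocale T: abelian_group T by (rule tensor_ab_group)

lemma tcls_closed [intro]: "z \<in> TT \<Longrightarrow> tcls R M N z \<in> carrier T"
  by (simp add: carrier_tensor_ab)

lemma tcls_diff:
  assumes "z \<in> TT" "w \<in> TT"
  shows "tcls R M N (z - w) = tcls R M N z \<ominus>\<^bsub>T\<^esub> tcls R M N w"
proof -
  have "tcls R M N (z - w) \<oplus>\<^bsub>T\<^esub> tcls R M N w = tcls R M N z" using assms by (simp add: add_tensor_ab frags_diff)
  then show ?thesis using assms by (metis T.add.inv_solve_right a_minus_def frags_diff tcls_closed)
qed

lemma tens_closed [intro]: "x \<in> carrier M \<Longrightarrow> y \<in> carrier N \<Longrightarrow> tens R M N x y \<in> carrier T"
  unfolding tens_eq_tcls by auto

lemma tensor_induct [consumes 1, case_names zero tens diff]: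
  assumes "t \<in> carrier T" and "P \<zero>\<^bsub>T\<^esub>" and "\<And>x y. \<lbrakk>x \<in> carrier M; y \<in> carrier N\<rbrakk> \<Longrightarrow> P (tens R M N x y)"
    and "\<And>t u. \<lbrakk>t \<in> carrier T; u \<in> carrier T; P t; P u\<rbrakk> \<Longrightarrow> P (t \<ominus>\<^bsub>T\<^esub> u)"
  shows "P t"
proof -
  obtain z where "z \<in> TT" "t = tcls R M N z" using assms(1) by (auto simp: carrier_tensor_ab)
  moreover have "z \<in> TT \<Longrightarrow> P (tcls R M N z)" for z
    by (induction rule: frags_induct)
      (use assms in \<open>auto simp: zero_tensor_ab tens_eq_tcls tcls_diff tcls_closed\<close>)
  ultimately show ?thesis by simp
qed

lemma tens_add_left:
  "\<lbrakk>x \<in> carrier M; x' \<in> carrier M; y \<in> carrier N\<rbrakk> \<Longrightarrow>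
   tens R M N (x \<oplus>\<^bsub>M\<^esub> x') y = tens R M N x y \<oplus>\<^bsub>T\<^esub> tens R M N x' y"
  unfolding tens_eq_tcls
  by (subst add_tensor_ab; simp?; unfold tcls_eq_iff tensor_ker_eq; rule addspan_base)
    (force simp: tensor_rels_def)

lemma tens_add_right:
  "\<lbrakk>x \<in> carrier M; y \<in> carrier N; y' \<in> carrier N\<rbrakk> \<Longrightarrow>
   tens R M N x (y \<oplus>\<^bsub>N\<^esub> y') = tens R M N x y \<oplus>\<^bsub>T\<^esub> tens R M N x y'"
  unfolding tens_eq_tcls
  by (subst add_tensor_ab; simp?; unfold tcls_eq_iff tensor_ker_eq; rule addspan_base)
    (force simp: tensor_rels_def)

lemma tens_balanced:
  "\<lbrakk>x \<in> carrier M; a \<in> carrier R; y \<in> carrier N\<rbrakk> \<Longrightarrow>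
   tens R M N (x \<triangleleft>\<^bsub>M\<^esub> a) y = tens R M N x (a \<odot>\<^bsub>N\<^esub> y)"
  unfolding tens_eq_tcls tcls_eq_iff tensor_ker_eq
  by (rule addspan_base) (force simp: tensor_rels_def)

text \<open>Each of the three families of tensor relations evaluates to zero by one clause of
  \<open>balanced\<close>, and additivity of \<open>ev\<close> extends this to the subgroup they
  generate.\<close>

lemma balanced_ker:
  assumes "abelian_group G" "balanced R M N G b" "w \<in> tensor_ker R M N"
  shows "ev G (\<lambda>p. b (fst p) (snd p)) w = \<zero>\<^bsub>G\<^esub>"
proof -
  interpret G: abelian_group G by fact
  let ?b = "\<lambda>p. b (fst p) (snd p)"
  have B: "?b \<in> (carrier M \<times> carrier N) \<rightarrow> carrier G" using assms by (auto simp: balanced_def)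
  have c: "b x y \<in> carrier G" if "x \<in> carrier M" "y \<in> carrier N" for x y
    using assms that by (auto simp: balanced_def)
  have rel: "ev G ?b s = \<zero>\<^bsub>G\<^esub>" if s: "s \<in> tensor_rels R M N" for s
    using s c assms(2) unfolding tensor_rels_def balanced_def
    by (elim UnE CollectE exE conjE; simp only:)
      (rule G.ev_frag_diff2_zero G.ev_frag_diff_zero; simp add: smult_closed' rsmult_closed')+
  have "w \<in> addspan (tensor_rels R M N)" using assms by (simp add: tensor_ker_eq)
  then show ?thesis
  proof (induction)
    case (plus z s)
    then have "z \<in> TT" "s \<in> TT" using addspan_frags[OF tensor_rels_frags] tensor_rels_frags by auto
    then show ?case using plus rel by (simp add: G.ev_add[OF _ _ B])
  next
    case (minus z s)
    then have "z \<in> TT" "s \<in> TT" using addspan_frags[OF tensor_rels_frags] tensor_rels_frags by auto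
    then show ?case using minus rel by (simp add: G.ev_diff[OF _ _ B] a_minus_def)
  qed simp
qed

text \<open>Representatives of one coset differ by an element on which the extension of
  \<open>b\<close> vanishes, so the image of the coset is a singleton and \<open>the_elem\<close>
  returns its member.\<close>

lemma tensor_lift_tcls:
  assumes "abelian_group G" "balanced R M N G b" "z \<in> TT"
  shows "tensor_lift G b (tcls R M N z) = ev G (\<lambda>p. b (fst p) (snd p)) z"
proof -
  interpret G: abelian_group G by fact
  let ?b = "\<lambda>p. b (fst p) (snd p)"
  have B: "?b \<in> (carrier M \<times> carrier N) \<rightarrow> carrier G" using assms by (auto simp: balanced_def)
  have "ev G ?b v = ev G ?b z" if "v - z \<in> tensor_ker R M N" for v
  proof -
    have d: "v - z \<in> TT" using that tensor_ker_frags by auto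
    have "ev G ?b v = ev G ?b ((v - z) + z)" by simp
    also have "\<dots> = ev G ?b (v - z) \<oplus>\<^bsub>G\<^esub> ev G ?b z" using d assms(3) by (rule G.ev_add[OF _ _ B])
    also have "\<dots> = ev G ?b z" using balanced_ker[OF assms(1,2) that] G.ev_closed[OF assms(3) B] by simp
    finally show ?thesis .
  qed
  then have "\<forall>v\<in>tcls R M N z. ev G ?b v = ev G ?b z" by (simp add: tcls_eq)
  moreover have "z \<in> tcls R M N z" by (auto simp: tcls_eq tensor_ker_eq addspan.zero)
  ultimately have "ev G ?b ` tcls R M N z = {ev G ?b z}" by blast
  moreover have "tensor_lift G b (tcls R M N z) = the_elem (ev G ?b ` tcls R M N z)"
    unfolding tensor_lift_def ev_def ..
  ultimately show ?thesis by simp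
qed

lemma tensor_lift_hom:
  assumes "abelian_group G" "balanced R M N G b"
  shows "tensor_lift G b \<in> add_hom T G"
proof -
  interpret G: abelian_group G by fact
  let ?b = "\<lambda>p. b (fst p) (snd p)"
  have B: "?b \<in> (carrier M \<times> carrier N) \<rightarrow> carrier G" using assms by (auto simp: balanced_def)
  show ?thesis unfolding add_hom_def
    using G.ev_closed[OF _ B] G.ev_add[OF _ _ B]
    by (auto simp: carrier_tensor_ab add_tensor_ab tensor_lift_tcls[OF assms] frags_add)
qed

lemma tensor_lift_tens:
  assumes "abelian_group G" "balanced R M N G b" "x \<in> carrier M" "y \<in> carrier N"
  shows "tensor_lift G b (tens R M N x y) = b x y"
proof -
  interpret G: abelian_group G by fact
  have "b x y \<in> carrier G" using assms by (auto simp: balanced_def)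
  then show ?thesis using assms by (simp add: tens_eq_tcls tensor_lift_tcls)
qed

text \<open>Pure tensors generate the tensor product. Identities between maps on tensor products,
  among them the module axioms and the naturality of the associator, are reduced to pure tensors by
  this rule.\<close>

lemma tensor_hom_eqI:
  assumes "abelian_group G" "h \<in> add_hom T G" "h' \<in> add_hom T G"
    and "\<And>x y. \<lbrakk>x \<in> carrier M; y \<in> carrier N\<rbrakk> \<Longrightarrow> h (tens R M N x y) = h' (tens R M N x y)"
    and "t \<in> carrier T"
  shows "h t = h' t"
  using assms(5)
proof (induction rule: tensor_induct)
  case zero
  then show ?case by (simp add: add_hom_zero[OF tensor_ab_group assms(1) assms(2)] add_hom_zero[OF tensor_ab_group assms(1) assms(3)])
next
  case (diff t u)
  then show ?case by (simp add: add_hom_diff[OF tensor_ab_group assms(1) assms(2)] add_hom_diff[OF tensor_ab_group assms(1) assms(3)])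
qed (use assms in auto)

end

section \<open>Functoriality of the tensor product\<close>

lemma rmod_hom_add_hom: "f \<in> rmod_hom R M M' \<Longrightarrow> f \<in> add_hom M M'" by (simp add: rmod_hom_def)
lemma lmod_hom_add_hom: "f \<in> lmod_hom R M M' \<Longrightarrow> f \<in> add_hom M M'" by (simp add: lmod_hom_def)
lemma lmod_hom_closed: "f \<in> lmod_hom R M M' \<Longrightarrow> x \<in> carrier M \<Longrightarrow> f x \<in> carrier M'"
  by (auto simp: lmod_hom_def add_hom_def)
lemma lmod_hom_add: "f \<in> lmod_hom R M M' \<Longrightarrow> x \<in> carrier M \<Longrightarrow> y \<in> carrier M \<Longrightarrow>
  f (x \<oplus>\<^bsub>M\<^esub> y) = f x \<oplus>\<^bsub>M'\<^esub> f y"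
  by (auto simp: lmod_hom_def add_hom_def)
lemma lmod_hom_smult: "f \<in> lmod_hom R M M' \<Longrightarrow> a \<in> carrier R \<Longrightarrow> x \<in> carrier M \<Longrightarrow>
  f (a \<odot>\<^bsub>M\<^esub> x) = a \<odot>\<^bsub>M'\<^esub> f x"
  by (auto simp: lmod_hom_def)
lemma rmod_hom_closed: "f \<in> rmod_hom R M M' \<Longrightarrow> x \<in> carrier M \<Longrightarrow> f x \<in> carrier M'"
  by (auto simp: rmod_hom_def add_hom_def)
lemma rmod_hom_rsmult: "f \<in> rmod_hom R M M' \<Longrightarrow> a \<in> carrier R \<Longrightarrow> x \<in> carrier M \<Longrightarrow>
  f (x \<triangleleft>\<^bsub>M\<^esub> a) = f x \<triangleleft>\<^bsub>M'\<^esub> a"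
  by (auto simp: rmod_hom_def)

lemma lmod_hom_compose:
  "f \<in> lmod_hom R G H \<Longrightarrow> g \<in> lmod_hom R H K \<Longrightarrow> (\<lambda>x. g (f x)) \<in> lmod_hom R G K"
  by (auto simp: lmod_hom_def add_hom_def Pi_iff)
lemma lmod_hom_id: "(\<lambda>x. x) \<in> lmod_hom R M M"
  by (auto simp: lmod_hom_def add_hom_def)
lemma rmod_hom_id: "(\<lambda>x. x) \<in> rmod_hom R M M"
  by (auto simp: rmod_hom_def add_hom_def)
lemma lmod_hom_cong:
  assumes "f \<in> lmod_hom R M N" "\<And>x. x \<in> carrier M \<Longrightarrow> g x = f x" "left_module R M"
  shows "g \<in> lmod_hom R M N"
proof -
  interpret left_module R M by fact
  show ?thesis using assms(1,2) smult_closed unfolding lmod_hom_def add_hom_def by auto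
qed

text \<open>The map \<open>f\<close> tensor \<open>g\<close> on formal combinations. It makes sense
  for arbitrary functions and composes strictly, so it can also carry a choice of representatives or
  a naming of generators, which are not linear.\<close>

definition tmapf :: "('m \<Rightarrow> 'p) \<Rightarrow> ('n \<Rightarrow> 'q) \<Rightarrow> ('m, 'n) fcomb \<Rightarrow> ('p, 'q) fcomb" where
  "tmapf f g = frag_extend (\<lambda>(x, y). frag_of (f x, g y))"

lemma tmapf_of [simp]: "tmapf f g (frag_of (x, y)) = frag_of (f x, g y)"
  by (simp add: tmapf_def)
lemma tmapf_0 [simp]: "tmapf f g 0 = 0" by (simp add: tmapf_def)
lemma tmapf_diff: "tmapf f g (z - w) = tmapf f g z - tmapf f g w" by (simp add: tmapf_def frag_extend_diff)
lemma tmapf_add: "tmapf f g (z + w) = tmapf f g z + tmapf f g w" by (simp add: tmapf_def frag_extend_add)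

lemma tmapf_frags:
  "z \<in> frags (B \<times> D) \<Longrightarrow> f ` B \<subseteq> B' \<Longrightarrow> g ` D \<subseteq> D' \<Longrightarrow> tmapf f g z \<in> frags (B' \<times> D')"
  unfolding tmapf_def by (erule frag_extend_frags) (auto simp: image_subset_iff)

lemma tmapf_tmapf: "tmapf f' g' (tmapf f g z) = tmapf (\<lambda>x. f' (f x)) (\<lambda>y. g' (g y)) z"
  by (simp add: tmapf_def frag_extend_frag_extend case_prod_unfold)

lemma tmapf_cong:
  "z \<in> frags (B \<times> D) \<Longrightarrow> (\<And>x. x \<in> B \<Longrightarrow> f x = f' x) \<Longrightarrow> (\<And>y. y \<in> D \<Longrightarrow> g y = g' y) \<Longrightarrow>
  tmapf f g z = tmapf f' g' z"
  unfolding tmapf_def by (rule frag_extend_cong) auto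

lemma tmapf_ident: "tmapf (\<lambda>x. x) (\<lambda>y. y) z = z"
  unfolding tmapf_def by (rule frag_extend_id[of z UNIV]) (auto simp: frags_def)

lemma balanced_tensor_map:
  assumes "tensor_pair R M' N'" "f \<in> rmod_hom R M M'" "g \<in> lmod_hom R N N'"
  shows "balanced R M N (tensor_ab R M' N') (\<lambda>x y. tens R M' N' (f x) (g y))"
proof -
  interpret P: tensor_pair R M' N' by fact
  show ?thesis
    using assms(2,3)
    by (intro balancedI)
      (auto simp: rmod_hom_closed lmod_hom_closed P.tens_add_left P.tens_add_right P.tens_balanced
        add_hom_add[OF rmod_hom_add_hom] lmod_hom_add rmod_hom_rsmult lmod_hom_smult)
qed

context
  fixes R :: "('a, 'r) ring_scheme" and M :: "('a, 'm, 'x) bimodule_scheme"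
    and N :: "('a, 'n, 'y) module_scheme" and M' :: "('a, 'm1, 'x1) bimodule_scheme"
    and N' :: "('a, 'n1, 'y1) module_scheme" and f g
  assumes MN: "tensor_pair R M N" and MN': "tensor_pair R M' N'"
    and f: "f \<in> rmod_hom R M M'" and g: "g \<in> lmod_hom R N N'"
begin

interpretation P: tensor_pair R M N by (rule MN)
interpretation P': tensor_pair R M' N' by (rule MN')

lemma tensor_map_hom: "tensor_map R M' N' f g \<in> add_hom (tensor_ab R M N) (tensor_ab R M' N')"
  unfolding tensor_map_def
  by (rule P.tensor_lift_hom[OF P'.tensor_ab_group balanced_tensor_map[OF MN' f g]])

lemma tensor_map_tens:
  "x \<in> carrier M \<Longrightarrow> y \<in> carrier N \<Longrightarrow> tensor_map R M' N' f g (tens R M N x y) = tens R M' N' (f x) (g y)"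
  unfolding tensor_map_def
  by (rule P.tensor_lift_tens[OF P'.tensor_ab_group balanced_tensor_map[OF MN' f g]])

lemma tmapf_closed: "z \<in> frags (carrier M \<times> carrier N) \<Longrightarrow> tmapf f g z \<in> frags (carrier M' \<times> carrier N')"
  by (erule tmapf_frags) (use f g in \<open>auto intro: rmod_hom_closed lmod_hom_closed\<close>)

lemma tensor_map_tcls:
  assumes "z \<in> frags (carrier M \<times> carrier N)"
  shows "tensor_map R M' N' f g (tcls R M N z) = tcls R M' N' (tmapf f g z)"
  using assms
proof (induction rule: frags_induct)
  case zero
  then show ?case
    using add_hom_zero[OF P.tensor_ab_group P'.tensor_ab_group tensor_map_hom]
    by (simp add: P.zero_tensor_ab P'.zero_tensor_ab)
next
  case (of p)
  then show ?case using tensor_map_tens by (cases p) (auto simp: tens_eq_tcls)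
next
  case (diff z w)
  then show ?case
    by (simp add: tmapf_diff P'.tcls_diff tmapf_closed P.tcls_diff P.tcls_closed
        add_hom_diff[OF P.tensor_ab_group P'.tensor_ab_group tensor_map_hom])
qed

text \<open>Membership in the kernel means having the same class as 0, so the claim follows from the
  existence of the induced map, without going through the relations again.\<close>

lemma tmapf_ker: "z \<in> tensor_ker R M N \<Longrightarrow> tmapf f g z \<in> tensor_ker R M' N'"
proof -
  assume z: "z \<in> tensor_ker R M N"
  then have Z: "z \<in> frags (carrier M \<times> carrier N)" using P.tensor_ker_frags by auto
  have "tcls R M N z = tcls R M N 0" using z by (simp add: P.tcls_eq_iff)
  then have "tcls R M' N' (tmapf f g z) = tcls R M' N' (tmapf f g 0)"
    using tensor_map_tcls[OF Z] tensor_map_tcls[of 0] by simp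
  then show ?thesis by (simp add: P'.tcls_eq_iff)
qed

end

text \<open>The composite enters as \<open>f''\<close> and \<open>g''\<close>, which agree with it
  on the carriers: maps that are restricted to carriers seldom equal a composite as HOL
  functions.\<close>

lemma tensor_map_compose:
  assumes "tensor_pair R M N" "tensor_pair R M' N'" "tensor_pair R M'' N''"
    and "f \<in> rmod_hom R M M'" "g \<in> lmod_hom R N N'" "f' \<in> rmod_hom R M' M''" "g' \<in> lmod_hom R N' N''"
    and "t \<in> carrier (tensor_ab R M N)"
    and "\<And>x. x \<in> carrier M \<Longrightarrow> f'' x = f' (f x)" "\<And>y. y \<in> carrier N \<Longrightarrow> g'' y = g' (g y)"
  shows "tensor_map R M'' N'' f' g' (tensor_map R M' N' f g t) = tensor_map R M'' N'' f'' g'' t"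
proof -
  interpret P: tensor_pair R M N by fact
  have f'': "f'' \<in> rmod_hom R M M''"
    using assms(4,6,9) P.rsmult_closed' by (auto simp: rmod_hom_def add_hom_def Pi_iff)
  have g'': "g'' \<in> lmod_hom R N N''"
    using assms(5,7,10) P.smult_closed' by (auto simp: lmod_hom_def add_hom_def Pi_iff)
  obtain z where z: "z \<in> frags (carrier M \<times> carrier N)" "t = tcls R M N z"
    using assms(8) by (auto simp: P.carrier_tensor_ab)
  show ?thesis unfolding z(2)
    using z(1) assms f'' g'' tmapf_cong[OF z(1), of f'' "\<lambda>x. f' (f x)" g'' "\<lambda>x. g' (g x)"]
    by (simp add: tensor_map_tcls tmapf_closed tmapf_tmapf)
qed

lemma tensor_map_ident:
  assumes "tensor_pair R M N" "t \<in> carrier (tensor_ab R M N)"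
    "\<And>x. x \<in> carrier M \<Longrightarrow> f x = x" "\<And>y. y \<in> carrier N \<Longrightarrow> g y = y"
  shows "tensor_map R M N f g t = t"
proof -
  interpret P: tensor_pair R M N by fact
  obtain z where z: "z \<in> frags (carrier M \<times> carrier N)" "t = tcls R M N z"
    using assms(2) unfolding P.carrier_tensor_ab by blast
  have "f \<in> rmod_hom R M M"
    using assms(3) P.rsmult_closed' by (simp add: rmod_hom_def add_hom_def)
  moreover have "g \<in> lmod_hom R N N"
    using assms(4) P.smult_closed' by (simp add: lmod_hom_def add_hom_def)
  ultimately show ?thesis unfolding z(2)
    using assms(1) z(1) tmapf_cong[OF z(1), of f "\<lambda>x. x" g "\<lambda>x. x"] assms(3,4)
    by (simp add: tensor_map_tcls tmapf_ident)
qed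

section \<open>Module structures on tensor products\<close>

lemma tensor_pairI: "right_module R M \<Longrightarrow> left_module R N \<Longrightarrow> tensor_pair R M N"
  unfolding tensor_pair_def tensor_pair_axioms_def
  by (auto simp: right_module_def left_module_def right_module_axioms_def left_module_axioms_def)

lemma carrier_tensor [simp]: "carrier (tensor R M N) = carrier (tensor_ab R M N)"
  and add_tensor [simp]: "add (tensor R M N) = add (tensor_ab R M N)"
  and zero_tensor [simp]: "ring.zero (tensor R M N) = ring.zero (tensor_ab R M N)"
  by (simp_all add: tensor_def ring.defs module.defs)

lemma carrier_tensor_bimod [simp]: "carrier (tensor_bimod R M N) = carrier (tensor_ab R M N)"
  and add_tensor_bimod [simp]: "add (tensor_bimod R M N) = add (tensor_ab R M N)"
  and zero_tensor_bimod [simp]: "ring.zero (tensor_bimod R M N) = ring.zero (tensor_ab R M N)"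
  by (simp_all add: tensor_bimod_def tensor_def ring.defs module.defs bimodule.defs)

lemma smult_tensor: "a \<odot>\<^bsub>tensor R M N\<^esub> t = tensor_map R M N (\<lambda>x. a \<odot>\<^bsub>M\<^esub> x) (\<lambda>y. y) t"
  by (simp add: tensor_def ring.defs module.defs tensor_map_def)

lemma smult_tensor_bimod: "a \<odot>\<^bsub>tensor_bimod R M N\<^esub> t = a \<odot>\<^bsub>tensor R M N\<^esub> t"
  by (simp add: tensor_bimod_def module.defs bimodule.defs tensor_def)

lemma rsmult_tensor_bimod: "t \<triangleleft>\<^bsub>tensor_bimod R M N\<^esub> a = tensor_map R M N (\<lambda>x. x) (\<lambda>y. y \<triangleleft>\<^bsub>N\<^esub> a) t"
  by (simp add: tensor_bimod_def tensor_def ring.defs module.defs bimodule.defs tensor_map_def)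

text \<open>A tensor product appears as three records, of a group, a module and a bimodule, with the
  same additive structure; this moves the group axioms between them.\<close>

lemma abelian_group_cong:
  assumes "abelian_group G" "carrier H = carrier G" "add H = add G" "ring.zero H = ring.zero G"
  shows "abelian_group H"
proof -
  interpret G: abelian_group G by fact
  show ?thesis
    by (rule abelian_groupI; simp only: assms(2-4))
      (auto simp: G.a_ac intro!: bexI[of _ "\<ominus>\<^bsub>G\<^esub> _"] G.l_neg)
qed

lemma add_hom_tensor_dom: "add_hom (tensor R M N) H = add_hom (tensor_ab R M N) H"
  by (simp add: add_hom_def)
lemma add_hom_tensor_cod: "add_hom G (tensor R M N) = add_hom G (tensor_ab R M N)"
  by (simp add: add_hom_def)
lemma add_hom_tensor_bimod_dom: "add_hom (tensor_bimod R M N) H = add_hom (tensor_ab R M N) H"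
  by (simp add: add_hom_def)
lemma add_hom_tensor_bimod_cod: "add_hom G (tensor_bimod R M N) = add_hom G (tensor_ab R M N)"
  by (simp add: add_hom_def)
lemmas add_hom_tensor = add_hom_tensor_dom add_hom_tensor_cod add_hom_tensor_bimod_dom add_hom_tensor_bimod_cod

context bimodule
begin

lemma left_mult_rmod_hom: "a \<in> carrier R \<Longrightarrow> (\<lambda>x. a \<odot>\<^bsub>M\<^esub> x) \<in> rmod_hom R M M"
  by (auto simp: rmod_hom_def add_hom_def smult_closed smult_r_distr smult_rsmult)

lemma right_mult_lmod_hom: "a \<in> carrier R \<Longrightarrow> (\<lambda>x. x \<triangleleft>\<^bsub>M\<^esub> a) \<in> lmod_hom R M M"
  by (auto simp: lmod_hom_def add_hom_def rsmult_closed rsmult_l_distr smult_rsmult)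

end

lemma bimodule_right: "bimodule R M \<Longrightarrow> right_module R M"
  and bimodule_left: "bimodule R M \<Longrightarrow> left_module R M"
  by (auto simp: bimodule_def)

lemmas tensor_pair_bimod = tensor_pairI[OF bimodule_right]

lemma smult_tens:
  assumes "bimodule R M" "left_module R N" "a \<in> carrier R" "x \<in> carrier M" "y \<in> carrier N"
  shows "a \<odot>\<^bsub>tensor R M N\<^esub> tens R M N x y = tens R M N (a \<odot>\<^bsub>M\<^esub> x) y"
  unfolding smult_tensor using assms tensor_pair_bimod[OF assms(1,2)]
  by (intro tensor_map_tens) (auto intro: bimodule.left_mult_rmod_hom lmod_hom_id)

lemma rsmult_tens:
  assumes "right_module R M" "bimodule R N" "a \<in> carrier R" "x \<in> carrier M" "y \<in> carrier N"
  shows "tens R M N x y \<triangleleft>\<^bsub>tensor_bimod R M N\<^esub> a = tens R M N x (y \<triangleleft>\<^bsub>N\<^esub> a)"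
  unfolding rsmult_tensor_bimod using assms tensor_pairI[OF assms(1) bimodule_left[OF assms(2)]]
  by (intro tensor_map_tens) (auto intro: bimodule.right_mult_lmod_hom rmod_hom_id)

text \<open>Apart from closure and additivity, each axiom equates two maps that are additive in the
  tensor; on pure tensors it becomes an axiom of the left factor \<open>M\<close>.\<close>

lemma left_module_tensor:
  assumes M: "bimodule R M" and N: "left_module R N"
  shows "left_module R (tensor R M N)"
proof -
  interpret M: bimodule R M by fact
  interpret N: left_module R N by fact
  interpret P: tensor_pair R M N by (rule tensor_pair_bimod[OF M N])
  have hom: "(\<lambda>t. a \<odot>\<^bsub>tensor R M N\<^esub> t) \<in> add_hom (tensor_ab R M N) (tensor_ab R M N)" if "a \<in> carrier R" for a
    unfolding smult_tensor
    by (rule tensor_map_hom[OF P.tensor_pair_axioms P.tensor_pair_axioms M.left_mult_rmod_hom[OF that] lmod_hom_id])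
  have c: "a \<odot>\<^bsub>tensor R M N\<^esub> t \<in> carrier (tensor_ab R M N)" if "a \<in> carrier R" "t \<in> carrier (tensor_ab R M N)" for a t
    using add_hom_closed[OF hom[OF that(1)] that(2)] .
  have st: "a \<odot>\<^bsub>tensor R M N\<^esub> tens R M N x y = tens R M N (a \<odot>\<^bsub>M\<^esub> x) y"
    if "a \<in> carrier R" "x \<in> carrier M" "y \<in> carrier N" for a x y
    by (rule smult_tens[OF M N that])
  show ?thesis
  proof (intro left_module.intro left_module_axioms.intro)
    show "ring R" using N by (simp add: left_module_def)
    show "abelian_group (tensor R M N)"
      by (rule abelian_group_cong[OF P.tensor_ab_group]) simp_all
    fix a x y assume a: "a \<in> carrier R" and x: "x \<in> carrier (tensor R M N)" and y: "y \<in> carrier (tensor R M N)"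
    show "a \<odot>\<^bsub>tensor R M N\<^esub> x \<in> carrier (tensor R M N)" using c a x by simp
    show "a \<odot>\<^bsub>tensor R M N\<^esub> (x \<oplus>\<^bsub>tensor R M N\<^esub> y) = a \<odot>\<^bsub>tensor R M N\<^esub> x \<oplus>\<^bsub>tensor R M N\<^esub> (a \<odot>\<^bsub>tensor R M N\<^esub> y)"
      using add_hom_add[OF hom[OF a]] x y by simp
  next
    fix a b x assume ab: "a \<in> carrier R" "b \<in> carrier R" and x: "x \<in> carrier (tensor R M N)"
    show "(a \<oplus>\<^bsub>R\<^esub> b) \<odot>\<^bsub>tensor R M N\<^esub> x = a \<odot>\<^bsub>tensor R M N\<^esub> x \<oplus>\<^bsub>tensor R M N\<^esub> b \<odot>\<^bsub>tensor R M N\<^esub> x"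
    proof (rule P.tensor_hom_eqI[OF P.tensor_ab_group hom])
      show "(\<lambda>x. a \<odot>\<^bsub>tensor R M N\<^esub> x \<oplus>\<^bsub>tensor R M N\<^esub> b \<odot>\<^bsub>tensor R M N\<^esub> x) \<in> add_hom (tensor_ab R M N) (tensor_ab R M N)"
        using ab c add_hom_add[OF hom[OF ab(1)]] add_hom_add[OF hom[OF ab(2)]]
        by (auto simp: add_hom_def P.T.a_ac)
    qed (use ab x in \<open>simp_all add: st M.smult_l_distr P.tens_add_left M.smult_closed\<close>)
    show "(a \<otimes>\<^bsub>R\<^esub> b) \<odot>\<^bsub>tensor R M N\<^esub> x = a \<odot>\<^bsub>tensor R M N\<^esub> (b \<odot>\<^bsub>tensor R M N\<^esub> x)"
    proof (rule P.tensor_hom_eqI[OF P.tensor_ab_group hom])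
      show "(\<lambda>x. a \<odot>\<^bsub>tensor R M N\<^esub> (b \<odot>\<^bsub>tensor R M N\<^esub> x)) \<in> add_hom (tensor_ab R M N) (tensor_ab R M N)"
        by (rule add_hom_compose[OF hom hom]) (use ab in auto)
    qed (use ab x in \<open>simp_all add: st M.smult_assoc M.smult_closed\<close>)
  next
    fix x assume x: "x \<in> carrier (tensor R M N)"
    show "\<one>\<^bsub>R\<^esub> \<odot>\<^bsub>tensor R M N\<^esub> x = x"
    proof (rule P.tensor_hom_eqI[OF P.tensor_ab_group hom])
      show "(\<lambda>x. x) \<in> add_hom (tensor_ab R M N) (tensor_ab R M N)" by (simp add: add_hom_def)
    qed (use x in \<open>simp_all add: st M.smult_one\<close>)
  qed
qed

lemma tensor_map_lmod_hom:
  assumes "bimodule R M" "left_module R N" "bimodule R M'" "left_module R N'"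
    and f: "f \<in> bimod_hom R M M'" and g: "g \<in> lmod_hom R N N'"
  shows "tensor_map R M' N' f g \<in> lmod_hom R (tensor R M N) (tensor R M' N')"
proof -
  interpret P: tensor_pair R M N by (rule tensor_pair_bimod[OF assms(1,2)])
  interpret P': tensor_pair R M' N' by (rule tensor_pair_bimod[OF assms(3,4)])
  interpret T: left_module R "tensor R M N" by (rule left_module_tensor[OF assms(1,2)])
  interpret T': left_module R "tensor R M' N'" by (rule left_module_tensor[OF assms(3,4)])
  interpret M: bimodule R M by fact
  have fr: "f \<in> rmod_hom R M M'" and fl: "f \<in> lmod_hom R M M'" using f by (auto simp: bimod_hom_def)
  note h = tensor_map_hom[OF P.tensor_pair_axioms P'.tensor_pair_axioms fr g]
  note ht = tensor_map_tens[OF P.tensor_pair_axioms P'.tensor_pair_axioms fr g]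
  have "tensor_map R M' N' f g (a \<odot>\<^bsub>tensor R M N\<^esub> t) = a \<odot>\<^bsub>tensor R M' N'\<^esub> tensor_map R M' N' f g t"
    if a: "a \<in> carrier R" and t: "t \<in> carrier (tensor_ab R M N)" for a t
  proof (rule P.tensor_hom_eqI[OF P'.tensor_ab_group _ _ _ t])
    have s: "(\<lambda>t. a \<odot>\<^bsub>tensor R M N\<^esub> t) \<in> add_hom (tensor_ab R M N) (tensor_ab R M N)"
      using T.smult_closed[OF a] T.smult_r_distr[OF a] by (simp add: add_hom_def)
    have s': "(\<lambda>t. a \<odot>\<^bsub>tensor R M' N'\<^esub> t) \<in> add_hom (tensor_ab R M' N') (tensor_ab R M' N')"
      using T'.smult_closed[OF a] T'.smult_r_distr[OF a] by (simp add: add_hom_def)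
    show "(\<lambda>t. tensor_map R M' N' f g (a \<odot>\<^bsub>tensor R M N\<^esub> t)) \<in> add_hom (tensor_ab R M N) (tensor_ab R M' N')"
      by (rule add_hom_compose[OF s h])
    show "(\<lambda>t. a \<odot>\<^bsub>tensor R M' N'\<^esub> tensor_map R M' N' f g t) \<in> add_hom (tensor_ab R M N) (tensor_ab R M' N')"
      by (rule add_hom_compose[OF h s'])
    fix x y assume "x \<in> carrier M" "y \<in> carrier N"
    then show "tensor_map R M' N' f g (a \<odot>\<^bsub>tensor R M N\<^esub> tens R M N x y) = a \<odot>\<^bsub>tensor R M' N'\<^esub> tensor_map R M' N' f g (tens R M N x y)"
      using a by (simp add: smult_tens assms ht M.smult_closed lmod_hom_closed[OF fl] lmod_hom_closed[OF g] lmod_hom_smult[OF fl])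
  qed
  then show ?thesis using h by (simp add: lmod_hom_def add_hom_tensor)
qed

lemma bimod_hom_id: "(\<lambda>x. x) \<in> bimod_hom R M M"
  by (simp add: bimod_hom_def lmod_hom_id rmod_hom_id)

lemma tensor_pair_tensor_bimod:
  assumes L: "bimodule R L" and M: "bimodule R M" and N: "left_module R N"
  shows "tensor_pair R (tensor_bimod R L M) N"
proof -
  interpret P: tensor_pair R L M by (rule tensor_pair_bimod[OF L bimodule_left[OF M]])
  interpret N: left_module R N by fact
  interpret M: bimodule R M by fact
  show ?thesis
  proof (intro tensor_pair.intro tensor_pair_axioms.intro)
    show "abelian_group (tensor_bimod R L M)"
      by (rule abelian_group_cong[OF P.tensor_ab_group]) simp_all
    fix a x assume "a \<in> carrier R" "x \<in> carrier (tensor_bimod R L M)"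
    then show "x \<triangleleft>\<^bsub>tensor_bimod R L M\<^esub> a \<in> carrier (tensor_bimod R L M)"
      unfolding rsmult_tensor_bimod
      using add_hom_closed[OF tensor_map_hom[OF P.tensor_pair_axioms P.tensor_pair_axioms rmod_hom_id M.right_mult_lmod_hom]]
      by simp
  qed (auto simp: N.smult_closed N.M.abelian_group_axioms)
qed

section \<open>The associativity isomorphism\<close>

locale assoc_modules =
  L?: bimodule R L + M?: bimodule R M + N?: left_module R N
  for R :: "('a, 'r) ring_scheme" and L :: "('a, 'l, 'x) bimodule_scheme" and M :: "('a, 'm, 'y) bimodule_scheme"
    and N :: "('a, 'n, 'z) module_scheme"
begin

lemmas LB = L.bimodule_axioms and MB = M.bimodule_axioms and NL = N.left_module_axioms

lemma pair_MN: "tensor_pair R M N" by (rule tensor_pair_bimod[OF MB NL])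
lemma pair_LM: "tensor_pair R L M" by (rule tensor_pair_bimod[OF LB bimodule_left[OF MB]])
lemma pair_L_MN: "tensor_pair R L (tensor R M N)" by (rule tensor_pair_bimod[OF LB left_module_tensor[OF MB NL]])
lemma pair_LM_N: "tensor_pair R (tensor_bimod R L M) N" by (rule tensor_pair_tensor_bimod[OF LB MB NL])

sublocale MN: tensor_pair R M N by (rule pair_MN)
sublocale LM: tensor_pair R L M by (rule pair_LM)
sublocale L_MN: tensor_pair R L "tensor R M N" by (rule pair_L_MN)
sublocale LM_N: tensor_pair R "tensor_bimod R L M" N by (rule pair_LM_N)

text \<open>For fixed \<open>z\<close> the map sending \<open>u\<close> to \<open>u\<close> tensor
  \<open>z\<close> is additive, so agreement on pure \<open>u\<close> spreads to all
  \<open>u\<close>; pure tensors are then used a second time, in the outer product.\<close>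

lemma tensor3_hom_eqI:
  assumes G: "abelian_group G" and h: "h \<in> add_hom (tensor_ab R (tensor_bimod R L M) N) G"
    and h': "h' \<in> add_hom (tensor_ab R (tensor_bimod R L M) N) G"
    and eq: "\<And>x y z. \<lbrakk>x \<in> carrier L; y \<in> carrier M; z \<in> carrier N\<rbrakk> \<Longrightarrow>
      h (tens R (tensor_bimod R L M) N (tens R L M x y) z) = h' (tens R (tensor_bimod R L M) N (tens R L M x y) z)"
    and t: "t \<in> carrier (tensor_ab R (tensor_bimod R L M) N)"
  shows "h t = h' t"
proof (rule LM_N.tensor_hom_eqI[OF G h h' _ t])
  fix u z assume u: "u \<in> carrier (tensor_bimod R L M)" and z: "z \<in> carrier N"
  have a: "(\<lambda>u. tens R (tensor_bimod R L M) N u z) \<in> add_hom (tensor_ab R L M) (tensor_ab R (tensor_bimod R L M) N)"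
    using z LM_N.tens_add_left LM_N.tens_closed by (simp add: add_hom_def)
  show "h (tens R (tensor_bimod R L M) N u z) = h' (tens R (tensor_bimod R L M) N u z)"
    using LM.tensor_hom_eqI[OF G add_hom_compose[OF a h] add_hom_compose[OF a h']] eq u z by simp
qed

lemma balanced_assoc_inner:
  assumes z: "z \<in> carrier N"
  shows "balanced R L M (tensor_ab R L (tensor R M N)) (\<lambda>x y. tens R L (tensor R M N) x (tens R M N y z))"
  using z by (intro balancedI)
    (auto simp: L_MN.tens_add_left MN.tens_add_left L_MN.tens_add_right[simplified] L_MN.tens_balanced
      smult_tens[OF MB NL] M.smult_closed MN.tens_closed intro!: L_MN.tens_closed)

abbreviation "assoc_inner z \<equiv> tensor_lift (tensor_ab R L (tensor R M N)) (\<lambda>x y. tens R L (tensor R M N) x (tens R M N y z))"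

lemmas assoc_inner_hom = LM.tensor_lift_hom[OF L_MN.tensor_ab_group balanced_assoc_inner]
lemmas assoc_inner_tens = LM.tensor_lift_tens[OF L_MN.tensor_ab_group balanced_assoc_inner]

text \<open>The variable \<open>t\<close> is itself a tensor. Additivity and balancing in
  \<open>z\<close> are therefore identities between additive maps of \<open>t\<close>, tested on
  pure tensors.\<close>

lemma balanced_assoc_outer:
  "balanced R (tensor_bimod R L M) N (tensor_ab R L (tensor R M N)) (\<lambda>t z. assoc_inner z t)"
proof (rule balancedI)
  show "assoc_inner z t \<in> carrier (tensor_ab R L (tensor R M N))"
    if "t \<in> carrier (tensor_bimod R L M)" "z \<in> carrier N" for t z
    using add_hom_closed[OF assoc_inner_hom] that by simp
  show "assoc_inner z (t \<oplus>\<^bsub>tensor_bimod R L M\<^esub> t') = assoc_inner z t \<oplus>\<^bsub>tensor_ab R L (tensor R M N)\<^esub> assoc_inner z t'"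
    if "t \<in> carrier (tensor_bimod R L M)" "t' \<in> carrier (tensor_bimod R L M)" "z \<in> carrier N" for t t' z
    using add_hom_add[OF assoc_inner_hom] that by simp
next
  fix t z z' assume t: "t \<in> carrier (tensor_bimod R L M)" and z: "z \<in> carrier N" "z' \<in> carrier N"
  show "assoc_inner (z \<oplus>\<^bsub>N\<^esub> z') t = assoc_inner z t \<oplus>\<^bsub>tensor_ab R L (tensor R M N)\<^esub> assoc_inner z' t"
  proof (rule LM.tensor_hom_eqI[OF L_MN.tensor_ab_group])
    show "(\<lambda>t. assoc_inner z t \<oplus>\<^bsub>tensor_ab R L (tensor R M N)\<^esub> assoc_inner z' t)
        \<in> add_hom (tensor_ab R L M) (tensor_ab R L (tensor R M N))"
      using add_hom_add[OF assoc_inner_hom] add_hom_closed[OF assoc_inner_hom] z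
      by (auto simp: add_hom_def L_MN.T.a_ac)
  qed (use t z in \<open>simp_all add: assoc_inner_hom assoc_inner_tens MN.tens_add_right L_MN.tens_add_right[simplified] MN.tens_closed\<close>)
next
  fix t a z assume t: "t \<in> carrier (tensor_bimod R L M)" and a: "a \<in> carrier R" and z: "z \<in> carrier N"
  have r: "(\<lambda>t. t \<triangleleft>\<^bsub>tensor_bimod R L M\<^esub> a) \<in> add_hom (tensor_ab R L M) (tensor_ab R L M)"
    unfolding rsmult_tensor_bimod
    by (rule tensor_map_hom[OF pair_LM pair_LM rmod_hom_id M.right_mult_lmod_hom[OF a]])
  show "assoc_inner z (t \<triangleleft>\<^bsub>tensor_bimod R L M\<^esub> a) = assoc_inner (a \<odot>\<^bsub>N\<^esub> z) t"
  proof (rule LM.tensor_hom_eqI[OF L_MN.tensor_ab_group add_hom_compose[OF r assoc_inner_hom[OF z]]])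
    show "assoc_inner (a \<odot>\<^bsub>N\<^esub> z) \<in> add_hom (tensor_ab R L M) (tensor_ab R L (tensor R M N))"
      using a z by (intro assoc_inner_hom N.smult_closed)
  qed (use t a z in \<open>simp_all add: rsmult_tens[OF bimodule_right[OF LB] MB] assoc_inner_tens M.rsmult_closed
      N.smult_closed MN.tens_balanced\<close>)
qed

lemma tensor_assoc_hom:
  "tensor_assoc R L M N \<in> add_hom (tensor_ab R (tensor_bimod R L M) N) (tensor_ab R L (tensor R M N))"
  unfolding tensor_assoc_def by (rule LM_N.tensor_lift_hom[OF L_MN.tensor_ab_group balanced_assoc_outer])

lemma tensor_assoc_tens:
  "\<lbrakk>x \<in> carrier L; y \<in> carrier M; z \<in> carrier N\<rbrakk> \<Longrightarrow>
    tensor_assoc R L M N (tens R (tensor_bimod R L M) N (tens R L M x y) z) = tens R L (tensor R M N) x (tens R M N y z)"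
  unfolding tensor_assoc_def
  by (subst LM_N.tensor_lift_tens[OF L_MN.tensor_ab_group balanced_assoc_outer])
    (auto simp: assoc_inner_tens LM.tens_closed)

text \<open>Linearity of the associator with the scalar acting inside the first factor. In
  \<open>coassL_hom\<close> it is applied with \<open>u\<close> a value of \<open>comul\<close>,
  which passes scalars on to that place.\<close>

lemma tensor_assoc_smult:
  assumes a: "a \<in> carrier R" and u: "u \<in> carrier (tensor_ab R L M)" and z: "z \<in> carrier N"
  shows "tensor_assoc R L M N (tens R (tensor_bimod R L M) N (a \<odot>\<^bsub>tensor R L M\<^esub> u) z) =
    a \<odot>\<^bsub>tensor R L (tensor R M N)\<^esub> tensor_assoc R L M N (tens R (tensor_bimod R L M) N u z)"
proof (rule LM.tensor_hom_eqI[OF L_MN.tensor_ab_group _ _ _ u])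
  interpret T: left_module R "tensor R L M" by (rule left_module_tensor[OF LB bimodule_left[OF MB]])
  interpret T3: left_module R "tensor R L (tensor R M N)" by (rule left_module_tensor[OF LB left_module_tensor[OF MB NL]])
  have tz: "(\<lambda>u. tens R (tensor_bimod R L M) N u z) \<in> add_hom (tensor_ab R L M) (tensor_ab R (tensor_bimod R L M) N)"
    using z LM_N.tens_add_left LM_N.tens_closed by (simp add: add_hom_def)
  have s: "(\<lambda>t. a \<odot>\<^bsub>tensor R L M\<^esub> t) \<in> add_hom (tensor_ab R L M) (tensor_ab R L M)"
    using T.smult_closed[OF a] T.smult_r_distr[OF a] by (simp add: add_hom_def)
  have s': "(\<lambda>t. a \<odot>\<^bsub>tensor R L (tensor R M N)\<^esub> t) \<in> add_hom (tensor_ab R L (tensor R M N)) (tensor_ab R L (tensor R M N))"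
    using T3.smult_closed[OF a] T3.smult_r_distr[OF a] by (simp add: add_hom_def)
  note q = add_hom_compose[OF tz tensor_assoc_hom]
  show "(\<lambda>u. tensor_assoc R L M N (tens R (tensor_bimod R L M) N (a \<odot>\<^bsub>tensor R L M\<^esub> u) z)) \<in> add_hom (tensor_ab R L M) (tensor_ab R L (tensor R M N))"
    by (rule add_hom_compose[OF s q])
  show "(\<lambda>u. a \<odot>\<^bsub>tensor R L (tensor R M N)\<^esub> tensor_assoc R L M N (tens R (tensor_bimod R L M) N u z)) \<in> add_hom (tensor_ab R L M) (tensor_ab R L (tensor R M N))"
    by (rule add_hom_compose[OF q s'])
  fix x y assume "x \<in> carrier L" "y \<in> carrier M"
  then show "tensor_assoc R L M N (tens R (tensor_bimod R L M) N (a \<odot>\<^bsub>tensor R L M\<^esub> tens R L M x y) z) =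
      a \<odot>\<^bsub>tensor R L (tensor R M N)\<^esub> tensor_assoc R L M N (tens R (tensor_bimod R L M) N (tens R L M x y) z)"
    using a z by (simp add: smult_tens[OF LB bimodule_left[OF MB]] tensor_assoc_tens L.smult_closed MN.tens_closed
        smult_tens[OF LB left_module_tensor[OF MB NL]])
qed

end

lemma tensor_assoc_natural:
  assumes L: "bimodule R L" and M: "bimodule R M" and N: "left_module R N" and N': "left_module R N'"
    and f: "f \<in> lmod_hom R N N'" and t: "t \<in> carrier (tensor_ab R (tensor_bimod R L M) N)"
  shows "tensor_assoc R L M N' (tensor_map R (tensor_bimod R L M) N' (\<lambda>x. x) f t) =
    tensor_map R L (tensor R M N') (\<lambda>x. x) (tensor_map R M N' (\<lambda>x. x) f) (tensor_assoc R L M N t)"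
proof -
  interpret A: assoc_modules R L M N by (intro assoc_modules.intro L M N)
  interpret B: assoc_modules R L M N' by (intro assoc_modules.intro L M N')
  note m1 = tensor_map_hom[OF A.pair_LM_N B.pair_LM_N rmod_hom_id f]
  note f2 = tensor_map_lmod_hom[OF M N M N' bimod_hom_id f]
  note m2 = tensor_map_hom[OF A.pair_L_MN B.pair_L_MN rmod_hom_id f2]
  show ?thesis
  proof (rule A.tensor3_hom_eqI[OF B.L_MN.tensor_ab_group add_hom_compose[OF m1 B.tensor_assoc_hom] add_hom_compose[OF A.tensor_assoc_hom m2] _ t])
    fix x y z assume "x \<in> carrier L" "y \<in> carrier M" "z \<in> carrier N"
    then show "tensor_assoc R L M N' (tensor_map R (tensor_bimod R L M) N' (\<lambda>x. x) f (tens R (tensor_bimod R L M) N (tens R L M x y) z)) =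
      tensor_map R L (tensor R M N') (\<lambda>x. x) (tensor_map R M N' (\<lambda>x. x) f) (tensor_assoc R L M N (tens R (tensor_bimod R L M) N (tens R L M x y) z))"
      by (simp add: tensor_map_tens[OF A.pair_LM_N B.pair_LM_N rmod_hom_id f] A.LM.tens_closed A.tensor_assoc_tens
        tensor_map_tens[OF A.pair_L_MN B.pair_L_MN rmod_hom_id f2] A.MN.tens_closed lmod_hom_closed[OF f] B.tensor_assoc_tens
        tensor_map_tens[OF A.pair_MN B.pair_MN rmod_hom_id f])
  qed
qed

section \<open>The ring as a bimodule and the left unit isomorphism\<close>

lemma regular_bimodule_simps [simp]:
  "carrier (regular_bimodule R) = carrier R" "add (regular_bimodule R) = add R" "ring.zero (regular_bimodule R) = ring.zero R"
  "smult (regular_bimodule R) = monoid.mult R" "rsmult (regular_bimodule R) = monoid.mult R"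
  by (simp_all add: regular_bimodule_def)

lemma bimodule_regular:
  assumes "ring R" shows "bimodule R (regular_bimodule R)"
proof -
  interpret ring R by fact
  have "abelian_group (regular_bimodule R)"
    by (rule abelian_group_cong[of R]) (simp_all add: abelian_group_axioms)
  then show ?thesis
    unfolding bimodule_def left_module_def right_module_def left_module_axioms_def right_module_axioms_def bimodule_axioms_def
    by (auto simp: assms l_distr r_distr m_assoc)
qed

lemma lmod_left_module_zero:
  assumes "left_module R M" "x \<in> carrier M" shows "\<zero>\<^bsub>R\<^esub> \<odot>\<^bsub>M\<^esub> x = \<zero>\<^bsub>M\<^esub>"
proof -
  interpret left_module R M by fact
  have "\<zero>\<^bsub>R\<^esub> \<odot>\<^bsub>M\<^esub> x \<oplus>\<^bsub>M\<^esub> \<zero>\<^bsub>R\<^esub> \<odot>\<^bsub>M\<^esub> x = \<zero>\<^bsub>R\<^esub> \<odot>\<^bsub>M\<^esub> x"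
    using smult_l_distr[of "\<zero>\<^bsub>R\<^esub>" "\<zero>\<^bsub>R\<^esub>" x] assms by simp
  then show ?thesis using smult_closed[of "\<zero>\<^bsub>R\<^esub>" x] assms by (simp add: M.add.l_cancel_one')
qed

context left_module
begin

lemma pair_regular: "tensor_pair R (regular_bimodule R) M"
  by (rule tensor_pair_bimod[OF bimodule_regular left_module_axioms]) (rule R.ring_axioms)

lemma balanced_left_unitor: "balanced R (regular_bimodule R) M M (\<lambda>a x. a \<odot>\<^bsub>M\<^esub> x)"
  by (rule balancedI) (auto simp: smult_closed smult_l_distr smult_r_distr smult_assoc)

lemma left_unitor_hom: "left_unitor M \<in> add_hom (tensor_ab R (regular_bimodule R) M) M"
  unfolding left_unitor_def
  by (rule tensor_pair.tensor_lift_hom[OF pair_regular M.abelian_group_axioms balanced_left_unitor])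

lemma left_unitor_tens: "a \<in> carrier R \<Longrightarrow> x \<in> carrier M \<Longrightarrow> left_unitor M (tens R (regular_bimodule R) M a x) = a \<odot>\<^bsub>M\<^esub> x"
  unfolding left_unitor_def
  by (rule tensor_pair.tensor_lift_tens[OF pair_regular M.abelian_group_axioms balanced_left_unitor]) auto

lemma smult_add_hom: "a \<in> carrier R \<Longrightarrow> (\<lambda>x. a \<odot>\<^bsub>M\<^esub> x) \<in> add_hom M M"
  by (simp add: add_hom_def smult_closed smult_r_distr)

end

text \<open>The left side of coassociativity as a function of the coaction value \<open>t\<close>.
  It is available for any left module, and can thus be applied to a module whose coaction has not
  been constructed yet; the same holds for \<open>counitL\<close>.\<close>

definition coassL where
  "coassL R C M t = tensor_assoc R C C M (tensor_map R (tensor_bimod R C C) M (comul C) (\<lambda>m. m) t)"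

definition counitL where
  "counitL R C M t = left_unitor M (tensor_map R (regular_bimodule R) M (counit C) (\<lambda>m. m) t)"

context coring
begin

lemma CB: "bimodule R C" by (rule bimodule_axioms)

lemma comul_r: "comul C \<in> rmod_hom R C (tensor_bimod R C C)" and comul_l: "comul C \<in> lmod_hom R C (tensor_bimod R C C)"
  using comul_hom by (auto simp: bimod_hom_def)
lemma counit_r: "counit C \<in> rmod_hom R C (regular_bimodule R)" and counit_l: "counit C \<in> lmod_hom R C (regular_bimodule R)"
  using counit_hom by (auto simp: bimod_hom_def)

context
  fixes M :: "('a, 'm, 'z) module_scheme"
  assumes M: "left_module R M"
begin

interpretation M: left_module R M by (rule M)
interpretation A: assoc_modules R C C M by (intro assoc_modules.intro CB M)
interpretation T: left_module R "tensor R C M" by (rule left_module_tensor[OF CB M])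
interpretation T3: left_module R "tensor R C (tensor R C M)" by (rule left_module_tensor[OF CB T.left_module_axioms])

lemma pairC: "tensor_pair R C M" by (rule A.pair_MN)
lemma left_module_tensorC: "left_module R (tensor R C M)" by (rule T.left_module_axioms)

lemma coassL_tens: "c \<in> carrier C \<Longrightarrow> m \<in> carrier M \<Longrightarrow>
    coassL R C M (tens R C M c m) = tensor_assoc R C C M (tens R (tensor_bimod R C C) M (comul C c) m)"
  unfolding coassL_def by (simp add: tensor_map_tens[OF A.pair_MN A.pair_LM_N comul_r lmod_hom_id])

lemma coassL_add_hom: "coassL R C M \<in> add_hom (tensor_ab R C M) (tensor_ab R C (tensor R C M))"
  unfolding coassL_def[abs_def]
  by (rule add_hom_compose[OF tensor_map_hom[OF A.pair_MN A.pair_LM_N comul_r lmod_hom_id] A.tensor_assoc_hom])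

text \<open>Linearity is what later allows coassociativity to be tested on the generators of a
  presented module. The scalar passes through \<open>comul\<close> by left linearity and through the
  associator by \<open>tensor_assoc_smult\<close>.\<close>

lemma coassL_hom: "coassL R C M \<in> lmod_hom R (tensor R C M) (tensor R C (tensor R C M))"
proof -
  have "coassL R C M (a \<odot>\<^bsub>tensor R C M\<^esub> t) = a \<odot>\<^bsub>tensor R C (tensor R C M)\<^esub> coassL R C M t"
    if a: "a \<in> carrier R" and t: "t \<in> carrier (tensor_ab R C M)" for a t
  proof (rule A.MN.tensor_hom_eqI[OF A.L_MN.tensor_ab_group _ _ _ t])
    show "(\<lambda>t. coassL R C M (a \<odot>\<^bsub>tensor R C M\<^esub> t)) \<in> add_hom (tensor_ab R C M) (tensor_ab R C (tensor R C M))"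
      using add_hom_compose[OF T.smult_add_hom[OF a], of "coassL R C M"] coassL_add_hom by (simp add: add_hom_tensor)
    show "(\<lambda>t. a \<odot>\<^bsub>tensor R C (tensor R C M)\<^esub> coassL R C M t) \<in> add_hom (tensor_ab R C M) (tensor_ab R C (tensor R C M))"
      using add_hom_compose[OF coassL_add_hom, of "\<lambda>t. a \<odot>\<^bsub>tensor R C (tensor R C M)\<^esub> t"] T3.smult_add_hom[OF a] by (simp add: add_hom_tensor)
    fix x y assume xy: "x \<in> carrier C" "y \<in> carrier M"
    have "comul C x \<in> carrier (tensor_ab R C C)" using lmod_hom_closed[OF comul_l xy(1)] by simp
    then show "coassL R C M (a \<odot>\<^bsub>tensor R C M\<^esub> tens R C M x y) = a \<odot>\<^bsub>tensor R C (tensor R C M)\<^esub> coassL R C M (tens R C M x y)"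
      using a xy by (simp add: smult_tens[OF CB M] coassL_tens smult_closed lmod_hom_smult[OF comul_l] A.tensor_assoc_smult smult_tensor_bimod)
  qed
  then show ?thesis using coassL_add_hom by (simp add: lmod_hom_def add_hom_tensor)
qed

lemma counitL_tens: "c \<in> carrier C \<Longrightarrow> m \<in> carrier M \<Longrightarrow> counitL R C M (tens R C M c m) = counit C c \<odot>\<^bsub>M\<^esub> m"
  unfolding counitL_def using rmod_hom_closed[OF counit_r]
  by (simp add: tensor_map_tens[OF A.pair_MN M.pair_regular counit_r lmod_hom_id] M.left_unitor_tens)

lemma counitL_add_hom: "counitL R C M \<in> add_hom (tensor_ab R C M) M"
  unfolding counitL_def[abs_def]
  by (rule add_hom_compose[OF tensor_map_hom[OF A.pair_MN M.pair_regular counit_r lmod_hom_id] M.left_unitor_hom])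

lemma counitL_hom: "counitL R C M \<in> lmod_hom R (tensor R C M) M"
proof -
  have "counitL R C M (a \<odot>\<^bsub>tensor R C M\<^esub> t) = a \<odot>\<^bsub>M\<^esub> counitL R C M t"
    if a: "a \<in> carrier R" and t: "t \<in> carrier (tensor_ab R C M)" for a t
  proof (rule A.MN.tensor_hom_eqI[OF M.M.abelian_group_axioms _ _ _ t])
    show "(\<lambda>t. counitL R C M (a \<odot>\<^bsub>tensor R C M\<^esub> t)) \<in> add_hom (tensor_ab R C M) M"
      using add_hom_compose[OF T.smult_add_hom[OF a], of "counitL R C M"] counitL_add_hom by (simp add: add_hom_tensor)
    show "(\<lambda>t. a \<odot>\<^bsub>M\<^esub> counitL R C M t) \<in> add_hom (tensor_ab R C M) M"
      using add_hom_compose[OF counitL_add_hom M.smult_add_hom[OF a]] .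
    fix x y assume xy: "x \<in> carrier C" "y \<in> carrier M"
    have "counit C x \<in> carrier R" using lmod_hom_closed[OF counit_l xy(1)] by simp
    then show "counitL R C M (a \<odot>\<^bsub>tensor R C M\<^esub> tens R C M x y) = a \<odot>\<^bsub>M\<^esub> counitL R C M (tens R C M x y)"
      using a xy by (simp add: smult_tens[OF CB M] counitL_tens smult_closed lmod_hom_smult[OF counit_l] M.smult_assoc)
  qed
  then show ?thesis using counitL_add_hom by (simp add: lmod_hom_def add_hom_tensor)
qed

end

abbreviation "Cmap N f \<equiv> tensor_map R C N (\<lambda>c. c) f"

lemma Cmap_hom: "left_module R M \<Longrightarrow> left_module R N \<Longrightarrow> f \<in> lmod_hom R M N \<Longrightarrow> Cmap N f \<in> lmod_hom R (tensor R C M) (tensor R C N)"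
  by (rule tensor_map_lmod_hom[OF CB _ CB _ bimod_hom_id])

lemma Cmap_Cmap:
  assumes "left_module R M" "left_module R N" "left_module R P" "f \<in> lmod_hom R M N" "g \<in> lmod_hom R N P"
    "t \<in> carrier (tensor_ab R C M)" "\<And>x. x \<in> carrier M \<Longrightarrow> h x = g (f x)"
  shows "Cmap P g (Cmap N f t) = Cmap P h t"
  by (rule tensor_map_compose[OF pairC pairC pairC]) (use assms in \<open>auto intro: rmod_hom_id\<close>)

lemma Cmap_tens:
  assumes "left_module R M" "left_module R N" "f \<in> lmod_hom R M N" "c \<in> carrier C" "m \<in> carrier M"
  shows "Cmap N f (tens R C M c m) = tens R C N c (f m)"
  by (rule tensor_map_tens[OF pairC pairC]) (use assms in \<open>auto intro: rmod_hom_id\<close>)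

lemma Cmap_cong:
  assumes "left_module R M" "left_module R N" "f \<in> lmod_hom R M N" "\<And>x. x \<in> carrier M \<Longrightarrow> g x = f x"
    "t \<in> carrier (tensor_ab R C M)"
  shows "Cmap N g t = Cmap N f t"
proof -
  have "Cmap N f (Cmap M (\<lambda>x. x) t) = Cmap N g t"
    using assms by (intro Cmap_Cmap[OF _ _ _ lmod_hom_id]) auto
  moreover have "Cmap M (\<lambda>x. x) t = t" by (rule tensor_map_ident[OF pairC]) (use assms in auto)
  ultimately show ?thesis by simp
qed

lemma Cmap_id: "left_module R M \<Longrightarrow> t \<in> carrier (tensor_ab R C M) \<Longrightarrow> (\<And>x. x \<in> carrier M \<Longrightarrow> f x = x) \<Longrightarrow> Cmap M f t = t"
  by (rule tensor_map_ident[OF pairC]) auto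

text \<open>\<open>comul\<close> acts on the factor \<open>C\<close> and \<open>f\<close> on the
  module, so the two can be interchanged, and the associator is natural in its last factor. Through
  this the comodule axiom is transported along the maps of a colimit.\<close>

lemma coassL_natural:
  assumes M: "left_module R M" and N: "left_module R N" and f: "f \<in> lmod_hom R M N" and t: "t \<in> carrier (tensor_ab R C M)"
  shows "coassL R C N (Cmap N f t) = Cmap (tensor R C N) (Cmap N f) (coassL R C M t)"
proof -
  interpret A: assoc_modules R C C M by (intro assoc_modules.intro CB M)
  interpret B: assoc_modules R C C N by (intro assoc_modules.intro CB N)
  have u: "tensor_map R (tensor_bimod R C C) M (comul C) (\<lambda>m. m) t \<in> carrier (tensor_ab R (tensor_bimod R C C) M)"
    using add_hom_closed[OF tensor_map_hom[OF A.pair_MN A.pair_LM_N comul_r lmod_hom_id] t] .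
  have "tensor_map R (tensor_bimod R C C) N (comul C) (\<lambda>m. m) (Cmap N f t)
      = tensor_map R (tensor_bimod R C C) N (comul C) f t"
    by (rule tensor_map_compose[OF A.pair_MN B.pair_MN B.pair_LM_N rmod_hom_id f comul_r lmod_hom_id t]) auto
  also have "\<dots> = tensor_map R (tensor_bimod R C C) N (\<lambda>x. x) f (tensor_map R (tensor_bimod R C C) M (comul C) (\<lambda>m. m) t)"
    by (rule tensor_map_compose[OF A.pair_MN A.pair_LM_N B.pair_LM_N comul_r lmod_hom_id rmod_hom_id f t, symmetric]) auto
  finally show ?thesis
    unfolding coassL_def using tensor_assoc_natural[OF CB CB M N f u] by simp
qed

lemma counitL_natural:
  assumes M: "left_module R M" and N: "left_module R N" and f: "f \<in> lmod_hom R M N" and t: "t \<in> carrier (tensor_ab R C M)"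
  shows "counitL R C N (Cmap N f t) = f (counitL R C M t)"
proof -
  interpret P: tensor_pair R C M by (rule pairC[OF M])
  interpret M: left_module R M by fact
  interpret N: left_module R N by fact
  show ?thesis
  proof (rule P.tensor_hom_eqI[OF N.M.abelian_group_axioms _ _ _ t])
    show "(\<lambda>t. counitL R C N (Cmap N f t)) \<in> add_hom P.T N"
      using add_hom_compose[OF lmod_hom_add_hom[OF Cmap_hom[OF M N f]], of "counitL R C N"] counitL_add_hom[OF N]
      by (simp add: add_hom_tensor)
    show "(\<lambda>t. f (counitL R C M t)) \<in> add_hom P.T N"
      by (rule add_hom_compose[OF counitL_add_hom[OF M] lmod_hom_add_hom[OF f]])
    fix x y assume "x \<in> carrier C" "y \<in> carrier M"
    then show "counitL R C N (Cmap N f (tens R C M x y)) = f (counitL R C M (tens R C M x y))"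
      using lmod_hom_closed[OF counit_l]
      by (simp add: Cmap_tens[OF M N f] counitL_tens M N lmod_hom_closed[OF f] lmod_hom_smult[OF f])
  qed
qed

lemma comodule_iff:
  "comodule R C M \<longleftrightarrow> left_module R M \<and> coact M \<in> lmod_hom R M (tensor R C M) \<and>
    (\<forall>x\<in>carrier M. coassL R C M (coact M x) = Cmap (tensor R C M) (coact M) (coact M x)) \<and>
    (\<forall>x\<in>carrier M. counitL R C M (coact M x) = x)"
  unfolding comodule_def comodule_axioms_def coassL_def counitL_def by auto

end

section \<open>Directed colimits of modules\<close>

locale directed_preorder =
  fixes I :: "'i set" and r :: "'i rel"
  assumes r_sub: "r \<subseteq> I \<times> I" and r_refl: "i \<in> I \<Longrightarrow> (i, i) \<in> r"
    and r_trans: "\<lbrakk>(i, j) \<in> r; (j, k) \<in> r\<rbrakk> \<Longrightarrow> (i, k) \<in> r"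
    and I_nonempty: "I \<noteq> {}"
    and upper: "\<lbrakk>i \<in> I; j \<in> I\<rbrakk> \<Longrightarrow> \<exists>k. (i, k) \<in> r \<and> (j, k) \<in> r"
begin

lemma r_I: "(i, j) \<in> r \<Longrightarrow> i \<in> I" "(i, j) \<in> r \<Longrightarrow> j \<in> I"
  using r_sub by auto

lemma eventually_finite:
  assumes "finite S" "i \<in> I" and ex: "\<And>s. s \<in> S \<Longrightarrow> \<exists>k. (i, k) \<in> r \<and> P s k"
    and mono: "\<And>s k l. s \<in> S \<Longrightarrow> (i, k) \<in> r \<Longrightarrow> P s k \<Longrightarrow> (k, l) \<in> r \<Longrightarrow> P s l"
  shows "\<exists>k. (i, k) \<in> r \<and> (\<forall>s\<in>S. P s k)"
  using assms(1) ex mono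
proof (induction S)
  case empty
  then show ?case using r_refl[OF assms(2)] by blast
next
  case (insert s S)
  then obtain k where k: "(i, k) \<in> r" "\<forall>s\<in>S. P s k" by (metis insert_iff)
  obtain l where l: "(i, l) \<in> r" "P s l" using insert.prems(1) by blast
  obtain m where m: "(k, m) \<in> r" "(l, m) \<in> r" using upper r_I k l by metis
  have "(i, m) \<in> r" using r_trans k m by blast
  moreover have "\<forall>t\<in>insert s S. P t m" using k l m insert.prems(2) by (metis insert_iff)
  ultimately show ?case by blast
qed

end

locale dirsys = directed_preorder I r for I :: "'i set" and r +
  fixes R :: "('a, 'r) ring_scheme" and D :: "'i \<Rightarrow> ('a, 'n, 'y) module_scheme" and d :: "'i \<Rightarrow> 'i \<Rightarrow> 'n \<Rightarrow> 'n"
  assumes D_mod: "i \<in> I \<Longrightarrow> left_module R (D i)"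
    and d_hom: "(i, j) \<in> r \<Longrightarrow> d i j \<in> lmod_hom R (D i) (D j)"
    and d_id: "i \<in> I \<Longrightarrow> x \<in> carrier (D i) \<Longrightarrow> d i i x = x"
    and d_comp: "\<lbrakk>(i, j) \<in> r; (j, k) \<in> r; x \<in> carrier (D i)\<rbrakk> \<Longrightarrow> d j k (d i j x) = d i k x"
begin

lemma d_closed: "(i, j) \<in> r \<Longrightarrow> x \<in> carrier (D i) \<Longrightarrow> d i j x \<in> carrier (D j)"
  by (rule lmod_hom_closed[OF d_hom])

end

text \<open>A directed colimit of modules described by elements: every element comes from a stage,
  and elements with equal image are identified at a later stage. In this form it passes to tensor
  products and to flatness directly; the universal property among flat comodules is derived from it
  afterwards.\<close>

locale dirlim = dirsys I r R D d for I :: "'i set" and r and R :: "('a, 'r) ring_scheme"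
    and D :: "'i \<Rightarrow> ('a, 'n, 'y) module_scheme" and d +
  fixes L :: "('a, 'l, 'w) module_scheme" and \<iota> :: "'i \<Rightarrow> 'n \<Rightarrow> 'l"
  assumes L_mod: "left_module R L"
    and \<iota>_hom: "i \<in> I \<Longrightarrow> \<iota> i \<in> lmod_hom R (D i) L"
    and \<iota>_comp: "\<lbrakk>(i, j) \<in> r; x \<in> carrier (D i)\<rbrakk> \<Longrightarrow> \<iota> j (d i j x) = \<iota> i x"
    and \<iota>_surj: "l \<in> carrier L \<Longrightarrow> \<exists>i\<in>I. \<exists>y\<in>carrier (D i). \<iota> i y = l"
    and \<iota>_inj: "\<lbrakk>i \<in> I; x \<in> carrier (D i); y \<in> carrier (D i); \<iota> i x = \<iota> i y\<rbrakk> \<Longrightarrow>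
      \<exists>k. (i, k) \<in> r \<and> d i k x = d i k y"
begin

lemma \<iota>_closed: "i \<in> I \<Longrightarrow> x \<in> carrier (D i) \<Longrightarrow> \<iota> i x \<in> carrier L"
  by (rule lmod_hom_closed[OF \<iota>_hom])

lemma \<iota>_surj2:
  assumes "x \<in> carrier L" "y \<in> carrier L"
  shows "\<exists>i\<in>I. \<exists>x'\<in>carrier (D i). \<exists>y'\<in>carrier (D i). \<iota> i x' = x \<and> \<iota> i y' = y"
proof -
  obtain i x' where i: "i \<in> I" "x' \<in> carrier (D i)" "\<iota> i x' = x" using \<iota>_surj assms by blast
  obtain j y' where j: "j \<in> I" "y' \<in> carrier (D j)" "\<iota> j y' = y" using \<iota>_surj assms by blast
  obtain k where k: "(i, k) \<in> r" "(j, k) \<in> r" using upper i j by blast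
  show ?thesis
    using i j k d_closed \<iota>_comp r_I by (intro bexI[of _ k] bexI[of _ "d i k x'"] bexI[of _ "d j k y'"]) auto
qed

context
  fixes Y :: "('a, 'b, 'v) bimodule_scheme"
  assumes Y: "right_module R Y"
begin

interpretation PL: tensor_pair R Y L by (rule tensor_pairI[OF Y L_mod])

private lemma pD: "i \<in> I \<Longrightarrow> tensor_pair R Y (D i)" by (rule tensor_pairI[OF Y D_mod])

private abbreviation "FD i \<equiv> frags (carrier Y \<times> carrier (D i))"

private lemma frags_lift:
  assumes "z \<in> frags (carrier Y \<times> carrier L)"
  shows "\<exists>i\<in>I. \<exists>w\<in>FD i. tmapf (\<lambda>x. x) (\<iota> i) w = z"
  using assms
proof (induction rule: frags_induct)
  case zero
  then show ?case using I_nonempty by (auto intro!: bexI[of _ 0])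
next
  case (of p)
  then obtain c l where p: "p = (c, l)" "c \<in> carrier Y" "l \<in> carrier L" by auto
  obtain i y where "i \<in> I" "y \<in> carrier (D i)" "\<iota> i y = l" using \<iota>_surj p by blast
  then show ?case using p by (intro bexI[of _ i] bexI[of _ "frag_of (c, y)"]) auto
next
  case (diff z z')
  then obtain i w j w' where w: "i \<in> I" "w \<in> FD i" "tmapf (\<lambda>x. x) (\<iota> i) w = z"
    and w': "j \<in> I" "w' \<in> FD j" "tmapf (\<lambda>x. x) (\<iota> j) w' = z'" by blast
  obtain k where k: "(i, k) \<in> r" "(j, k) \<in> r" using upper w w' by blast
  let ?v = "tmapf (\<lambda>x. x) (d i k) w" and ?v' = "tmapf (\<lambda>x. x) (d j k) w'"
  have "?v \<in> FD k" "?v' \<in> FD k" using w w' k d_closed by (auto intro!: tmapf_frags)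
  moreover have "tmapf (\<lambda>x. x) (\<iota> k) ?v = z"
    unfolding w(3)[symmetric] tmapf_tmapf by (rule tmapf_cong[OF w(2)]) (use \<iota>_comp k in auto)
  moreover have "tmapf (\<lambda>x. x) (\<iota> k) ?v' = z'"
    unfolding w'(3)[symmetric] tmapf_tmapf by (rule tmapf_cong[OF w'(2)]) (use \<iota>_comp k in auto)
  ultimately show ?case using r_I k by (intro bexI[of _ k] bexI[of _ "?v - ?v'"]) (auto simp: tmapf_diff)
qed

lemma tensor_surj:
  assumes "t \<in> carrier (tensor_ab R Y L)"
  shows "\<exists>i\<in>I. \<exists>u\<in>carrier (tensor_ab R Y (D i)). tensor_map R Y L (\<lambda>x. x) (\<iota> i) u = t"
proof -
  obtain z where z: "z \<in> frags (carrier Y \<times> carrier L)" "t = tcls R Y L z"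
    using assms unfolding PL.carrier_tensor_ab by blast
  obtain i w where w: "i \<in> I" "w \<in> FD i" "tmapf (\<lambda>x. x) (\<iota> i) w = z" using frags_lift[OF z(1)] by blast
  show ?thesis
    using w z tensor_map_tcls[OF pD[OF w(1)] PL.tensor_pair_axioms rmod_hom_id \<iota>_hom[OF w(1)] w(2)]
      tensor_pair.tcls_closed[OF pD[OF w(1)] w(2)]
    by (intro bexI[of _ i] bexI[of _ "tcls R Y (D i) w"]) auto
qed

private lemma tmapf_d_ker: "(i, k) \<in> r \<Longrightarrow> w \<in> tensor_ker R Y (D i) \<Longrightarrow> tmapf (\<lambda>x. x) (d i k) w \<in> tensor_ker R Y (D k)"
  using tmapf_ker[OF pD pD rmod_hom_id d_hom] r_I by blast

private lemma frags_comp: "(i, k) \<in> r \<Longrightarrow> w \<in> FD i \<Longrightarrow> tmapf (\<lambda>x. x) (\<iota> k) (tmapf (\<lambda>x. x) (d i k) w) = tmapf (\<lambda>x. x) (\<iota> i) w"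
  unfolding tmapf_tmapf by (rule tmapf_cong) (use \<iota>_comp in auto)

text \<open>A tensor relation involves sums and multiples of at most two elements of
  \<open>L\<close>. These have preimages at a common stage, and since \<open>\<iota>\<close> is
  linear the relation of the same kind formed there maps to the given one.\<close>

private lemma rels_lift:
  assumes "s \<in> tensor_rels R Y L"
  shows "\<exists>i\<in>I. \<exists>w\<in>tensor_ker R Y (D i). tmapf (\<lambda>x. x) (\<iota> i) w = s"
proof -
  have base: "\<exists>i\<in>I. \<exists>w\<in>tensor_ker R Y (D i). tmapf (\<lambda>x. x) (\<iota> i) w = s"
    if "i \<in> I" "w \<in> tensor_rels R Y (D i)" "tmapf (\<lambda>x. x) (\<iota> i) w = s" for i w
    using that tensor_pair.tensor_ker_eq[OF pD] by (intro bexI[of _ i] bexI[of _ w]) (auto intro: addspan_base)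
  have "(\<exists>x x' y. x \<in> carrier Y \<and> x' \<in> carrier Y \<and> y \<in> carrier L \<and> s = frag_of (x \<oplus>\<^bsub>Y\<^esub> x', y) - frag_of (x, y) - frag_of (x', y))
    \<or> (\<exists>x y y'. x \<in> carrier Y \<and> y \<in> carrier L \<and> y' \<in> carrier L \<and> s = frag_of (x, y \<oplus>\<^bsub>L\<^esub> y') - frag_of (x, y) - frag_of (x, y'))
    \<or> (\<exists>x a y. x \<in> carrier Y \<and> a \<in> carrier R \<and> y \<in> carrier L \<and> s = frag_of (x \<triangleleft>\<^bsub>Y\<^esub> a, y) - frag_of (x, a \<odot>\<^bsub>L\<^esub> y))"
    using assms unfolding tensor_rels_def by blast
  then show ?thesis
  proof (elim disjE exE conjE)
    fix x x' y assume 1: "x \<in> carrier Y" "x' \<in> carrier Y" "y \<in> carrier L"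
      "s = frag_of (x \<oplus>\<^bsub>Y\<^esub> x', y) - frag_of (x, y) - frag_of (x', y)"
    obtain i y' where i: "i \<in> I" "y' \<in> carrier (D i)" "\<iota> i y' = y" using \<iota>_surj 1 by blast
    show ?thesis
      by (rule base[OF i(1), of "frag_of (x \<oplus>\<^bsub>Y\<^esub> x', y') - frag_of (x, y') - frag_of (x', y')"])
        (use 1 i in \<open>auto simp: tensor_rels_def tmapf_diff\<close>)
  next
    fix x y y' assume 2: "x \<in> carrier Y" "y \<in> carrier L" "y' \<in> carrier L"
      "s = frag_of (x, y \<oplus>\<^bsub>L\<^esub> y') - frag_of (x, y) - frag_of (x, y')"
    obtain i v v' where i: "i \<in> I" "v \<in> carrier (D i)" "v' \<in> carrier (D i)" "\<iota> i v = y" "\<iota> i v' = y'"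
      using \<iota>_surj2[OF 2(2,3)] by blast
    show ?thesis
      by (rule base[OF i(1), of "frag_of (x, v \<oplus>\<^bsub>D i\<^esub> v') - frag_of (x, v) - frag_of (x, v')"])
        (use 2 i lmod_hom_add[OF \<iota>_hom[OF i(1)] i(2,3)] in \<open>auto simp: tensor_rels_def tmapf_diff\<close>)
  next
    fix x a y assume 3: "x \<in> carrier Y" "a \<in> carrier R" "y \<in> carrier L"
      "s = frag_of (x \<triangleleft>\<^bsub>Y\<^esub> a, y) - frag_of (x, a \<odot>\<^bsub>L\<^esub> y)"
    obtain i v where i: "i \<in> I" "v \<in> carrier (D i)" "\<iota> i v = y" using \<iota>_surj 3 by blast
    show ?thesis
      by (rule base[OF i(1), of "frag_of (x \<triangleleft>\<^bsub>Y\<^esub> a, v) - frag_of (x, a \<odot>\<^bsub>D i\<^esub> v)"])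
        (use 3 i lmod_hom_smult[OF \<iota>_hom[OF i(1)] 3(2) i(2)] in \<open>auto simp: tensor_rels_def tmapf_diff\<close>)
  qed
qed

private lemma ker_lift_join:
  assumes "i \<in> I" "w \<in> tensor_ker R Y (D i)" "j \<in> I" "w' \<in> tensor_ker R Y (D j)"
  shows "\<exists>k\<in>I. \<exists>v\<in>tensor_ker R Y (D k). \<exists>v'\<in>tensor_ker R Y (D k).
    tmapf (\<lambda>x. x) (\<iota> k) v = tmapf (\<lambda>x. x) (\<iota> i) w \<and> tmapf (\<lambda>x. x) (\<iota> k) v' = tmapf (\<lambda>x. x) (\<iota> j) w'"
proof -
  obtain k where k: "(i, k) \<in> r" "(j, k) \<in> r" using upper assms by blast
  have f: "w \<in> FD i" "w' \<in> FD j"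
    using assms tensor_pair.tensor_ker_frags[OF pD] by blast+
  show ?thesis
    using k r_I tmapf_d_ker assms frags_comp f
    by (intro bexI[of _ k] bexI[of _ "tmapf (\<lambda>x. x) (d i k) w"] bexI[of _ "tmapf (\<lambda>x. x) (d j k) w'"]) auto
qed

private lemma ker_lift:
  assumes "z \<in> tensor_ker R Y L"
  shows "\<exists>i\<in>I. \<exists>w\<in>tensor_ker R Y (D i). tmapf (\<lambda>x. x) (\<iota> i) w = z"
proof -
  have "z \<in> addspan (tensor_rels R Y L)" using assms by (simp add: PL.tensor_ker_eq)
  then show ?thesis
  proof induction
    case zero
    then show ?case using I_nonempty tensor_pair.tensor_ker_eq[OF pD] by (auto intro!: bexI[of _ 0] addspan.zero)
  next
    case (plus z s)
    then obtain i w j w' where w: "i \<in> I" "w \<in> tensor_ker R Y (D i)" "tmapf (\<lambda>x. x) (\<iota> i) w = z"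
      and w': "j \<in> I" "w' \<in> tensor_ker R Y (D j)" "tmapf (\<lambda>x. x) (\<iota> j) w' = s" using rels_lift by metis
    obtain k v v' where "k \<in> I" "v \<in> tensor_ker R Y (D k)" "v' \<in> tensor_ker R Y (D k)"
       "tmapf (\<lambda>x. x) (\<iota> k) v = z" "tmapf (\<lambda>x. x) (\<iota> k) v' = s"
      using ker_lift_join[OF w(1,2) w'(1,2)] w w' by auto
    then show ?case using tensor_pair.tensor_ker_eq[OF pD]
      by (intro bexI[of _ k] bexI[of _ "v + v'"]) (auto simp: tmapf_add intro: addspan_add)
  next
    case (minus z s)
    then obtain i w j w' where w: "i \<in> I" "w \<in> tensor_ker R Y (D i)" "tmapf (\<lambda>x. x) (\<iota> i) w = z"
      and w': "j \<in> I" "w' \<in> tensor_ker R Y (D j)" "tmapf (\<lambda>x. x) (\<iota> j) w' = s" using rels_lift by metis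
    obtain k v v' where "k \<in> I" "v \<in> tensor_ker R Y (D k)" "v' \<in> tensor_ker R Y (D k)"
       "tmapf (\<lambda>x. x) (\<iota> k) v = z" "tmapf (\<lambda>x. x) (\<iota> k) v' = s"
      using ker_lift_join[OF w(1,2) w'(1,2)] w w' by auto
    then show ?case using tensor_pair.tensor_ker_eq[OF pD]
      by (intro bexI[of _ k] bexI[of _ "v - v'"]) (auto simp: tmapf_diff intro: addspan_diff)
  qed
qed

text \<open>The image vanishes as a formal combination, so the cancellation comes from second
  components with equal image in \<open>L\<close>. There are finitely many such pairs; at a stage
  where all of them have become equal, the transition map factors on the support through
  \<open>\<iota> j\<close>, and the image vanishes there as well.\<close>

private lemma frags_eventually_zero:
  assumes j: "j \<in> I" and v: "v \<in> FD j" and v0: "tmapf (\<lambda>x. x) (\<iota> j) v = 0"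
  shows "\<exists>k. (j, k) \<in> r \<and> tmapf (\<lambda>x. x) (d j k) v = 0"
proof -
  let ?S = "snd ` Poly_Mapping.keys v"
  have S: "?S \<subseteq> carrier (D j)" using v by (auto simp: frags_def)
  let ?Q = "{q \<in> ?S \<times> ?S. \<iota> j (fst q) = \<iota> j (snd q)}"
  have "\<exists>k. (j, k) \<in> r \<and> (\<forall>q\<in>?Q. d j k (fst q) = d j k (snd q))"
  proof (rule eventually_finite[OF _ j])
    show "finite ?Q" by simp
    show "\<exists>k. (j, k) \<in> r \<and> d j k (fst q) = d j k (snd q)" if "q \<in> ?Q" for q
    proof -
      have "fst q \<in> carrier (D j)" "snd q \<in> carrier (D j)" using that S by auto
      then show ?thesis using \<iota>_inj[OF j, of "fst q" "snd q"] that by simp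
    qed
    show "d j l (fst q) = d j l (snd q)"
      if "q \<in> ?Q" "(j, k) \<in> r" "d j k (fst q) = d j k (snd q)" "(k, l) \<in> r" for q k l
    proof -
      have "fst q \<in> carrier (D j)" "snd q \<in> carrier (D j)" using that(1) S by auto
      then show ?thesis using d_comp[OF that(2,4)] that(3) by metis
    qed
  qed
  then obtain k where k1: "(j, k) \<in> r" and k2: "\<forall>q\<in>?Q. d j k (fst q) = d j k (snd q)" by blast
  have k3: "d j k x = d j k y" if "x \<in> ?S" "y \<in> ?S" "\<iota> j x = \<iota> j y" for x y
    using bspec[OF k2, of "(x, y)"] that by simp
  \<comment> \<open>\<open>g\<close> picks a preimage in the support. By the choice of
    \<open>k\<close> the value does not depend on the pick, so \<open>d j k\<close> is
    \<open>g\<close> after \<open>\<iota> j\<close> on \<open>?S\<close>.\<close>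
  define g where "g l = d j k (SOME y. y \<in> ?S \<and> \<iota> j y = l)" for l
  have g: "d j k y = g (\<iota> j y)" if "y \<in> ?S" for y
  proof -
    have "(SOME y'. y' \<in> ?S \<and> \<iota> j y' = \<iota> j y) \<in> ?S \<and> \<iota> j (SOME y'. y' \<in> ?S \<and> \<iota> j y' = \<iota> j y) = \<iota> j y"
      by (rule someI[of _ y]) (use that in simp)
    then show ?thesis unfolding g_def using k3[OF that, of "SOME y'. y' \<in> ?S \<and> \<iota> j y' = \<iota> j y"] by simp
  qed
  have "v \<in> frags (UNIV \<times> ?S)" by (force simp: frags_def)
  then have "tmapf (\<lambda>x. x) (d j k) v = tmapf (\<lambda>x. x) g (tmapf (\<lambda>x. x) (\<iota> j) v)"
    unfolding tmapf_tmapf by (rule tmapf_cong) (use g in auto)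
  then show ?thesis using k1 v0 by auto
qed

text \<open>Equality over \<open>L\<close> is witnessed by an element of the kernel, which lifts to
  some stage. Pushed to a common stage, the difference of the representatives and the lifted kernel
  element have the same image over \<open>L\<close> as formal combinations, hence agree at a later
  stage.\<close>

lemma tensor_inj:
  assumes i: "i \<in> I" and u: "u \<in> carrier (tensor_ab R Y (D i))" and u': "u' \<in> carrier (tensor_ab R Y (D i))"
    and eq: "tensor_map R Y L (\<lambda>x. x) (\<iota> i) u = tensor_map R Y L (\<lambda>x. x) (\<iota> i) u'"
  shows "\<exists>k. (i, k) \<in> r \<and> tensor_map R Y (D k) (\<lambda>x. x) (d i k) u = tensor_map R Y (D k) (\<lambda>x. x) (d i k) u'"
proof -
  interpret Pi: tensor_pair R Y "D i" by (rule pD[OF i])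
  obtain z z' where z: "z \<in> FD i" "u = tcls R Y (D i) z" and z': "z' \<in> FD i" "u' = tcls R Y (D i) z'"
    using u u' unfolding Pi.carrier_tensor_ab by blast
  let ?y = "z - z'"
  have y: "?y \<in> FD i" using z z' by auto
  have "tmapf (\<lambda>x. x) (\<iota> i) ?y \<in> tensor_ker R Y L"
    using eq tensor_map_tcls[OF Pi.tensor_pair_axioms PL.tensor_pair_axioms rmod_hom_id \<iota>_hom[OF i]] z z'
    by (simp add: PL.tcls_eq_iff tmapf_diff)
  then obtain j w where w: "j \<in> I" "w \<in> tensor_ker R Y (D j)" "tmapf (\<lambda>x. x) (\<iota> j) w = tmapf (\<lambda>x. x) (\<iota> i) ?y"
    using ker_lift by metis
  have wF: "w \<in> FD j" using tensor_pair.tensor_ker_frags[OF pD[OF w(1)]] w by blast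
  obtain k where k: "(i, k) \<in> r" "(j, k) \<in> r" using upper i w by blast
  let ?v = "tmapf (\<lambda>x. x) (d i k) ?y - tmapf (\<lambda>x. x) (d j k) w"
  have v: "?v \<in> FD k"
    using k d_closed by (intro frags_diff[OF tmapf_frags[OF y] tmapf_frags[OF wF]]) auto
  have "tmapf (\<lambda>x. x) (\<iota> k) ?v = 0"
    unfolding tmapf_diff[of _ _ "tmapf _ _ _" "tmapf _ _ _"] by (simp only: frags_comp[OF k(1) y] frags_comp[OF k(2) wF] w(3) diff_self)
  then obtain l where l: "(k, l) \<in> r" "tmapf (\<lambda>x. x) (d k l) ?v = 0"
    using frags_eventually_zero[OF r_I(2)[OF k(1)] v] by blast
  have il: "(i, l) \<in> r" "(j, l) \<in> r" using r_trans k l by blast+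
  have 1: "tmapf (\<lambda>x. x) (d k l) (tmapf (\<lambda>x. x) (d i k) ?y) = tmapf (\<lambda>x. x) (d i l) ?y"
    unfolding tmapf_tmapf by (rule tmapf_cong[OF y]) (use d_comp k l in auto)
  have 2: "tmapf (\<lambda>x. x) (d k l) (tmapf (\<lambda>x. x) (d j k) w) = tmapf (\<lambda>x. x) (d j l) w"
    unfolding tmapf_tmapf by (rule tmapf_cong[OF wF]) (use d_comp k l in auto)
  have "tmapf (\<lambda>x. x) (d i l) ?y = tmapf (\<lambda>x. x) (d j l) w"
    using l(2) unfolding tmapf_diff[of _ _ "tmapf _ _ _" "tmapf _ _ _"] by (simp only: 1 2 right_minus_eq)
  then have "tmapf (\<lambda>x. x) (d i l) ?y \<in> tensor_ker R Y (D l)" using tmapf_d_ker[OF il(2) w(2)] by simp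
  then have "tcls R Y (D l) (tmapf (\<lambda>x. x) (d i l) z) = tcls R Y (D l) (tmapf (\<lambda>x. x) (d i l) z')"
    using tensor_pair.tcls_eq_iff[OF pD[OF r_I(2)[OF il(1)]]] by (simp add: tmapf_diff)
  then show ?thesis
    using il z z' tensor_map_tcls[OF Pi.tensor_pair_axioms pD[OF r_I(2)[OF il(1)]] rmod_hom_id d_hom[OF il(1)]]
    by auto
qed

end

text \<open>Two tensors with equal image come from one stage \<open>k\<close>. Their images in
  \<open>Y\<close> tensor \<open>D k\<close> become equal at a later stage \<open>l\<close>, where
  injectivity is known, and the equality obtained at \<open>l\<close> is carried to
  \<open>L\<close>.\<close>

lemma flat_dirlim:
  fixes \<kappa> :: "'u rel"
  assumes flat: "\<And>i. i \<in> I \<Longrightarrow> flat_module \<kappa> R (D i)"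
  shows "flat_module \<kappa> R L"
  unfolding flat_module_def
proof (intro allI impI inj_onI; elim conjE)
  fix X :: "('a, 'u) bimodule" and Y :: "('a, 'u) bimodule" and f t t'
  assume X: "right_module R X" "small \<kappa> (carrier X)" and Y: "right_module R Y" "small \<kappa> (carrier Y)"
    and f: "f \<in> rmod_hom R X Y" "inj_on f (carrier X)"
    and t: "t \<in> carrier (tensor R X L)" "t' \<in> carrier (tensor R X L)"
    and eq: "tensor_map R Y L f (\<lambda>m. m) t = tensor_map R Y L f (\<lambda>m. m) t'"
  note PXL = tensor_pairI[OF X(1) L_mod] and PYL = tensor_pairI[OF Y(1) L_mod]
  have PX: "tensor_pair R X (D i)" and PY: "tensor_pair R Y (D i)" if "i \<in> I" for i
    using tensor_pairI[OF X(1) D_mod[OF that]] tensor_pairI[OF Y(1) D_mod[OF that]] .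
  obtain i u where i: "i \<in> I" and u: "u \<in> carrier (tensor_ab R X (D i))" "tensor_map R X L (\<lambda>x. x) (\<iota> i) u = t"
    using tensor_surj[OF X(1)] t by (metis carrier_tensor)
  obtain i' u' where i': "i' \<in> I" and u': "u' \<in> carrier (tensor_ab R X (D i'))" "tensor_map R X L (\<lambda>x. x) (\<iota> i') u' = t'"
    using tensor_surj[OF X(1)] t by (metis carrier_tensor)
  obtain k where k: "(i, k) \<in> r" "(i', k) \<in> r" using upper i i' by blast
  have kI: "k \<in> I" using r_I k by blast
  define v where "v = tensor_map R X (D k) (\<lambda>x. x) (d i k) u"
  define v' where "v' = tensor_map R X (D k) (\<lambda>x. x) (d i' k) u'"
  have v: "v \<in> carrier (tensor_ab R X (D k))" "v' \<in> carrier (tensor_ab R X (D k))"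
    unfolding v_def v'_def using u u'
    by (auto intro: add_hom_closed[OF tensor_map_hom[OF PX[OF i] PX[OF kI] rmod_hom_id d_hom[OF k(1)]]]
        add_hom_closed[OF tensor_map_hom[OF PX[OF i'] PX[OF kI] rmod_hom_id d_hom[OF k(2)]]])
  have vt: "tensor_map R X L (\<lambda>x. x) (\<iota> k) v = t" unfolding v_def u(2)[symmetric]
    by (rule tensor_map_compose[OF PX[OF i] PX[OF kI] PXL rmod_hom_id d_hom[OF k(1)] rmod_hom_id \<iota>_hom[OF kI] u(1)])
      (use \<iota>_comp[OF k(1)] in auto)
  have vt': "tensor_map R X L (\<lambda>x. x) (\<iota> k) v' = t'" unfolding v'_def u'(2)[symmetric]
    by (rule tensor_map_compose[OF PX[OF i'] PX[OF kI] PXL rmod_hom_id d_hom[OF k(2)] rmod_hom_id \<iota>_hom[OF kI] u'(1)])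
      (use \<iota>_comp[OF k(2)] in auto)
  have sw: "tensor_map R Y L (\<lambda>x. x) (\<iota> k) (tensor_map R Y (D k) f (\<lambda>m. m) w) = tensor_map R Y L f (\<lambda>m. m) (tensor_map R X L (\<lambda>x. x) (\<iota> k) w)"
    if "w \<in> carrier (tensor_ab R X (D k))" for w
  proof -
    have "tensor_map R Y L (\<lambda>x. x) (\<iota> k) (tensor_map R Y (D k) f (\<lambda>m. m) w) = tensor_map R Y L f (\<iota> k) w"
      by (rule tensor_map_compose[OF PX[OF kI] PY[OF kI] PYL f(1) lmod_hom_id rmod_hom_id \<iota>_hom[OF kI] that]) auto
    also have "\<dots> = tensor_map R Y L f (\<lambda>m. m) (tensor_map R X L (\<lambda>x. x) (\<iota> k) w)"
      by (rule tensor_map_compose[OF PX[OF kI] PXL PYL rmod_hom_id \<iota>_hom[OF kI] f(1) lmod_hom_id that, symmetric]) auto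
    finally show ?thesis .
  qed
  let ?F = "\<lambda>i. tensor_map R Y (D i) f (\<lambda>m. m)"
  have Fv: "?F k v \<in> carrier (tensor_ab R Y (D k))" "?F k v' \<in> carrier (tensor_ab R Y (D k))"
    using v add_hom_closed[OF tensor_map_hom[OF PX[OF kI] PY[OF kI] f(1) lmod_hom_id]] by auto
  have "tensor_map R Y L (\<lambda>x. x) (\<iota> k) (?F k v) = tensor_map R Y L (\<lambda>x. x) (\<iota> k) (?F k v')"
    using sw v vt vt' eq by simp
  then obtain l where l: "(k, l) \<in> r" "tensor_map R Y (D l) (\<lambda>x. x) (d k l) (?F k v) = tensor_map R Y (D l) (\<lambda>x. x) (d k l) (?F k v')"
    using tensor_inj[OF Y(1) kI Fv] by blast
  have lI: "l \<in> I" using r_I l by blast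
  have sw2: "tensor_map R Y (D l) (\<lambda>x. x) (d k l) (?F k w) = ?F l (tensor_map R X (D l) (\<lambda>x. x) (d k l) w)"
    if "w \<in> carrier (tensor_ab R X (D k))" for w
  proof -
    have "tensor_map R Y (D l) (\<lambda>x. x) (d k l) (?F k w) = tensor_map R Y (D l) f (d k l) w"
      by (rule tensor_map_compose[OF PX[OF kI] PY[OF kI] PY[OF lI] f(1) lmod_hom_id rmod_hom_id d_hom[OF l(1)] that]) auto
    also have "\<dots> = ?F l (tensor_map R X (D l) (\<lambda>x. x) (d k l) w)"
      by (rule tensor_map_compose[OF PX[OF kI] PX[OF lI] PY[OF lI] rmod_hom_id d_hom[OF l(1)] f(1) lmod_hom_id that, symmetric]) auto
    finally show ?thesis .
  qed
  define w where "w = tensor_map R X (D l) (\<lambda>x. x) (d k l) v"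
  define w' where "w' = tensor_map R X (D l) (\<lambda>x. x) (d k l) v'"
  have w: "w \<in> carrier (tensor_ab R X (D l))" "w' \<in> carrier (tensor_ab R X (D l))"
    unfolding w_def w'_def using v
      add_hom_closed[OF tensor_map_hom[OF PX[OF kI] PX[OF lI] rmod_hom_id d_hom[OF l(1)]]] by auto
  have "?F l w = ?F l w'" using l(2) sw2 v by (simp add: w_def w'_def)
  moreover have "inj_on (?F l) (carrier (tensor R X (D l)))"
    using flat[OF lI] X Y f unfolding flat_module_def by blast
  ultimately have "w = w'" using w by (auto dest: inj_onD)
  moreover have "tensor_map R X L (\<lambda>x. x) (\<iota> l) w = t" unfolding w_def vt[symmetric]
    by (rule tensor_map_compose[OF PX[OF kI] PX[OF lI] PXL rmod_hom_id d_hom[OF l(1)] rmod_hom_id \<iota>_hom[OF lI] v(1)])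
      (use \<iota>_comp[OF l(1)] in auto)
  moreover have "tensor_map R X L (\<lambda>x. x) (\<iota> l) w' = t'" unfolding w'_def vt'[symmetric]
    by (rule tensor_map_compose[OF PX[OF kI] PX[OF lI] PXL rmod_hom_id d_hom[OF l(1)] rmod_hom_id \<iota>_hom[OF lI] v(2)])
      (use \<iota>_comp[OF l(1)] in auto)
  ultimately show "t = t'" by simp
qed

text \<open>The element conditions are \<open>tensor_surj\<close> and \<open>tensor_inj\<close>. The
  conclusion is again an instance of \<open>dirlim\<close>, so it can be applied twice to reach the
  double tensor product in which coassociativity takes place.\<close>

lemma dirlim_tensor:
  assumes C: "bimodule R C"
  shows "dirlim I r R (\<lambda>i. tensor R C (D i)) (\<lambda>i j. tensor_map R C (D j) (\<lambda>c. c) (d i j))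
    (tensor R C L) (\<lambda>i. tensor_map R C L (\<lambda>c. c) (\<iota> i))"
proof -
  note P = tensor_pair_bimod[OF C D_mod] and PL = tensor_pair_bimod[OF C L_mod]
  show ?thesis
  proof (intro dirlim.intro dirsys.intro dirsys_axioms.intro dirlim_axioms.intro)
    show "directed_preorder I r" by (rule directed_preorder_axioms)
  next
    fix i j k x assume ij: "(i, j) \<in> r" and jk: "(j, k) \<in> r" and x: "x \<in> carrier (tensor R C (D i))"
    show "tensor_map R C (D k) (\<lambda>c. c) (d j k) (tensor_map R C (D j) (\<lambda>c. c) (d i j) x) = tensor_map R C (D k) (\<lambda>c. c) (d i k) x"
      by (rule tensor_map_compose[OF P P P rmod_hom_id d_hom[OF ij] rmod_hom_id d_hom[OF jk]])
        (use r_I ij jk x d_comp in auto)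
  next
    fix i j x assume ij: "(i, j) \<in> r" and x: "x \<in> carrier (tensor R C (D i))"
    show "tensor_map R C L (\<lambda>c. c) (\<iota> j) (tensor_map R C (D j) (\<lambda>c. c) (d i j) x) = tensor_map R C L (\<lambda>c. c) (\<iota> i) x"
      by (rule tensor_map_compose[OF P P PL rmod_hom_id d_hom[OF ij] rmod_hom_id \<iota>_hom])
        (use r_I ij x \<iota>_comp in auto)
  next
    fix i x assume i: "i \<in> I" and x: "x \<in> carrier (tensor R C (D i))"
    show "tensor_map R C (D i) (\<lambda>c. c) (d i i) x = x"
      by (rule tensor_map_ident[OF P]) (use i x d_id in auto)
  next
    fix i x y assume "i \<in> I" "x \<in> carrier (tensor R C (D i))" "y \<in> carrier (tensor R C (D i))"
      "tensor_map R C L (\<lambda>c. c) (\<iota> i) x = tensor_map R C L (\<lambda>c. c) (\<iota> i) y"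
    then show "\<exists>k. (i, k) \<in> r \<and> tensor_map R C (D k) (\<lambda>c. c) (d i k) x = tensor_map R C (D k) (\<lambda>c. c) (d i k) y"
      using tensor_inj[OF bimodule_right[OF C]] by simp
  next
    fix x assume "x \<in> carrier (tensor R C L)"
    then show "\<exists>i\<in>I. \<exists>y\<in>carrier (tensor R C (D i)). tensor_map R C L (\<lambda>c. c) (\<iota> i) y = x"
      using tensor_surj[OF bimodule_right[OF C]] by simp
  qed (use left_module_tensor[OF C D_mod] left_module_tensor[OF C L_mod] r_I
      tensor_map_lmod_hom[OF C D_mod C D_mod bimod_hom_id d_hom]
      tensor_map_lmod_hom[OF C D_mod C L_mod bimod_hom_id \<iota>_hom] in auto)
qed

end

section \<open>Formal linear combinations and the equational criterion for flatness\<close>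

text \<open>
  An element of \<open>frags (carrier R \<times> X)\<close> stands for a formal linear combination, with
  \<open>frag_of (a, x)\<close> in the role of \<open>a x\<close>. Additivity in the coefficient is not built in: two
  combinations agree in the free module on \<open>X\<close> iff they differ by an element of \<open>linspan R X {}\<close>.
\<close>

definition lev :: "('a, 'b, 'z) module_scheme \<Rightarrow> ('x \<Rightarrow> 'b) \<Rightarrow> ('a, 'x) fcomb \<Rightarrow> 'b" where
  "lev M e z = ev M (\<lambda>p. fst p \<odot>\<^bsub>M\<^esub> e (snd p)) z"

definition lsm :: "('a, 'r) ring_scheme \<Rightarrow> 'a \<Rightarrow> ('a, 'x) fcomb \<Rightarrow> ('a, 'x) fcomb" where
  "lsm R a = tmapf (\<lambda>b. a \<otimes>\<^bsub>R\<^esub> b) (\<lambda>x. x)"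

definition lsubst :: "('a, 'r) ring_scheme \<Rightarrow> ('x \<Rightarrow> 'a \<times> 'x1 \<Rightarrow>\<^sub>0 int) \<Rightarrow> ('a, 'x) fcomb \<Rightarrow> ('a, 'x1) fcomb" where
  "lsubst R s = frag_extend (\<lambda>p. lsm R (fst p) (s (snd p)))"

text \<open>Modulo these relations, combinations over \<open>Y\<close> and \<open>X\<close> form the
  direct sum of copies of \<open>Y\<close> indexed by \<open>X\<close>. With \<open>Y\<close> the
  ring this is the free module; with \<open>Y\<close> a right module it is \<open>Y\<close> tensored
  with the free module.\<close>

definition addrels :: "('b, 'z) ring_scheme \<Rightarrow> 'x set \<Rightarrow> ('b, 'x) fcomb set" where
  "addrels Y X = {frag_of (y \<oplus>\<^bsub>Y\<^esub> y', x) - frag_of (y, x) - frag_of (y', x) | y y' x. y \<in> carrier Y \<and> y' \<in> carrier Y \<and> x \<in> X}"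

text \<open>The submodule of the free module generated by \<open>G\<close>, pulled back to formal
  combinations. Scalar multiples are put among the additive generators, so that
  \<open>addspan\<close> suffices.\<close>

definition linspan :: "('a, 'r) ring_scheme \<Rightarrow> 'x set \<Rightarrow> ('a, 'x) fcomb set \<Rightarrow> ('a, 'x) fcomb set" where
  "linspan R X G = addspan (addrels R X \<union> {lsm R a g | a g. a \<in> carrier R \<and> g \<in> G})"

abbreviation FA :: "('a, 'r) ring_scheme \<Rightarrow> 'x set \<Rightarrow> ('a, 'x) fcomb set" where
  "FA R X \<equiv> frags (carrier R \<times> X)"

definition lker :: "('a, 'r) ring_scheme \<Rightarrow> ('a, 'b, 'z) module_scheme \<Rightarrow> ('a, 'b) fcomb set" where
  "lker R M = {z \<in> FA R (carrier M). lev M (\<lambda>x. x) z = \<zero>\<^bsub>M\<^esub>}"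

text \<open>
  The equational criterion: the substitution \<open>s\<close> rewrites the elements of \<open>M\<close> as linear combinations
  so that finitely many given relations become trivial.
\<close>

definition eqflat :: "('a, 'r) ring_scheme \<Rightarrow> ('a, 'b, 'z) module_scheme \<Rightarrow> bool" where
  "eqflat R M \<longleftrightarrow> (\<forall>G0 X0. finite G0 \<and> G0 \<subseteq> lker R M \<and> finite X0 \<and> X0 \<subseteq> carrier M \<longrightarrow>
    (\<exists>s. (\<forall>x\<in>carrier M. s x \<in> FA R (carrier M)) \<and> (\<forall>x\<in>X0. lev M (\<lambda>x. x) (s x) = x) \<and>
      (\<forall>g\<in>G0. lsubst R s g \<in> linspan R (carrier M) {})))"

lemma frags_snd_keys:
  assumes "v \<in> frags (B \<times> X)"
  shows "v \<in> frags (B \<times> snd ` Poly_Mapping.keys v)" "snd ` Poly_Mapping.keys v \<subseteq> X"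
proof -
  have *: "fst p \<in> B \<and> snd p \<in> X" if "p \<in> Poly_Mapping.keys v" for p
    using frags_keysD[OF assms that] by (simp add: mem_Times_iff)
  show "v \<in> frags (B \<times> snd ` Poly_Mapping.keys v)"
    unfolding frags_def using * by (simp add: subset_iff mem_Times_iff) force
  show "snd ` Poly_Mapping.keys v \<subseteq> X" using * by blast
qed

lemma lsm_of [simp]: "lsm R a (frag_of (b, x)) = frag_of (a \<otimes>\<^bsub>R\<^esub> b, x)" by (simp add: lsm_def)
lemma lsm_0 [simp]: "lsm R a 0 = 0" by (simp add: lsm_def)
lemma lsm_diff: "lsm R a (z - w) = lsm R a z - lsm R a w" by (simp add: lsm_def tmapf_diff)
lemma lsm_add: "lsm R a (z + w) = lsm R a z + lsm R a w" by (simp add: lsm_def tmapf_add)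
lemma lsubst_of [simp]: "lsubst R s (frag_of (a, x)) = lsm R a (s x)" by (simp add: lsubst_def)
lemma lsubst_0 [simp]: "lsubst R s 0 = 0" by (simp add: lsubst_def)
lemma lsubst_diff: "lsubst R s (z - w) = lsubst R s z - lsubst R s w" by (simp add: lsubst_def frag_extend_diff)
lemma lsubst_add: "lsubst R s (z + w) = lsubst R s z + lsubst R s w" by (simp add: lsubst_def frag_extend_add)
lemma lsubst_cong: "z \<in> FA R X \<Longrightarrow> (\<And>x. x \<in> X \<Longrightarrow> s x = s' x) \<Longrightarrow> lsubst R s z = lsubst R s' z"
  unfolding lsubst_def by (rule frag_extend_cong) auto

lemma addrels_frags: "abelian_group Y \<Longrightarrow> addrels Y X \<subseteq> frags (carrier Y \<times> X)"
  by (auto simp: addrels_def abelian_groupE(1) intro!: frags_diff)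

lemma addrels_mono: "X \<subseteq> X' \<Longrightarrow> addrels Y X \<subseteq> addrels Y X'"
  unfolding addrels_def by blast

lemma linspan_mono: "X \<subseteq> X' \<Longrightarrow> G \<subseteq> G' \<Longrightarrow> linspan R X G \<subseteq> linspan R X' G'"
  unfolding linspan_def by (intro addspan_mono) (use addrels_mono[of X X'] in blast)

lemma linspan_empty: "linspan R X {} = addspan (addrels R X)"
  by (simp add: linspan_def)

lemmas linspan_0 = addspan.zero[of "addrels R X \<union> {lsm R a g | a g. a \<in> carrier R \<and> g \<in> G}" for R X G, folded linspan_def]
lemmas linspan_add = addspan_add[of _ "addrels R X \<union> {lsm R a g | a g. a \<in> carrier R \<and> g \<in> G}" for R X G, folded linspan_def]
lemmas linspan_diff = addspan_diff[of _ "addrels R X \<union> {lsm R a g | a g. a \<in> carrier R \<and> g \<in> G}" for R X G, folded linspan_def]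

lemma linspan_addrel:
  assumes "a \<in> carrier R" "b \<in> carrier R" "x \<in> X"
  shows "frag_of (a \<oplus>\<^bsub>R\<^esub> b, x) - frag_of (a, x) - frag_of (b, x) \<in> linspan R X G"
  unfolding linspan_def by (rule addspan_base) (use assms in \<open>auto simp: addrels_def\<close>)

lemma linspan_lsm_base: "a \<in> carrier R \<Longrightarrow> g \<in> G \<Longrightarrow> lsm R a g \<in> linspan R X G"
  unfolding linspan_def by (rule addspan_base) auto

lemma linspan_induct [consumes 1, case_names zero add_rel diff_rel add_gen diff_gen]:
  assumes "z \<in> linspan R X G" "P 0"
    and "\<And>z a b x. \<lbrakk>z \<in> linspan R X G; P z; a \<in> carrier R; b \<in> carrier R; x \<in> X\<rbrakk> \<Longrightarrow>
      P (z + (frag_of (a \<oplus>\<^bsub>R\<^esub> b, x) - frag_of (a, x) - frag_of (b, x)))"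
    and "\<And>z a b x. \<lbrakk>z \<in> linspan R X G; P z; a \<in> carrier R; b \<in> carrier R; x \<in> X\<rbrakk> \<Longrightarrow>
      P (z - (frag_of (a \<oplus>\<^bsub>R\<^esub> b, x) - frag_of (a, x) - frag_of (b, x)))"
    and "\<And>z a g. \<lbrakk>z \<in> linspan R X G; P z; a \<in> carrier R; g \<in> G\<rbrakk> \<Longrightarrow> P (z + lsm R a g)"
    and "\<And>z a g. \<lbrakk>z \<in> linspan R X G; P z; a \<in> carrier R; g \<in> G\<rbrakk> \<Longrightarrow> P (z - lsm R a g)"
  shows "P z"
  using assms(1) unfolding linspan_def
proof induction
  case (plus z s)
  then show ?case using assms(3)[of z] assms(5)[of z] unfolding linspan_def addrels_def by fastforce
next
  case (minus z s)
  then show ?case using assms(4)[of z] assms(6)[of z] unfolding linspan_def addrels_def by fastforce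
qed (rule assms)

context ring
begin

lemma lsm_frags: "a \<in> carrier R \<Longrightarrow> z \<in> FA R X \<Longrightarrow> lsm R a z \<in> FA R X"
  unfolding lsm_def by (erule tmapf_frags) auto

lemma lsm_one: "z \<in> FA R X \<Longrightarrow> lsm R \<one> z = z"
  by (induction rule: frags_induct) (auto simp: lsm_diff)

lemma lsm_lsm: "a \<in> carrier R \<Longrightarrow> b \<in> carrier R \<Longrightarrow> z \<in> FA R X \<Longrightarrow> lsm R a (lsm R b z) = lsm R (a \<otimes> b) z"
  by (rotate_tac 2, induction rule: frags_induct) (auto simp: lsm_diff m_assoc)

lemma lsm_add_left:
  assumes "a \<in> carrier R" "b \<in> carrier R" "z \<in> FA R X"
  shows "lsm R (a \<oplus> b) z - lsm R a z - lsm R b z \<in> linspan R X G"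
  using assms(3)
proof (induction rule: frags_induct)
  case zero then show ?case by (simp add: linspan_0)
next
  case (of p) then show ?case using assms by (auto simp: l_distr intro!: linspan_addrel)
next
  case (diff z w)
  then show ?case using linspan_diff[OF diff(3,4)] by (simp add: lsm_diff algebra_simps)
qed

text \<open>Scaling \<open>lsm R b g\<close> by \<open>a\<close> gives
  \<open>lsm R (a \<otimes> b) g\<close>, again a generator, and by distributivity an additivity
  relation is scaled to another one.\<close>

lemma lsm_linspan:
  assumes a: "a \<in> carrier R" and G: "G \<subseteq> FA R X" and z: "z \<in> linspan R X G"
  shows "lsm R a z \<in> linspan R X G"
  using z
proof (induction rule: linspan_induct)
  case (add_gen z b g)
  then have "lsm R a (lsm R b g) = lsm R (a \<otimes> b) g" using G a by (intro lsm_lsm[of _ _ _ X]) auto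
  then show ?case using linspan_add[OF add_gen.IH linspan_lsm_base[of "a \<otimes> b" R g G X]] add_gen.hyps a by (simp add: lsm_add)
next
  case (diff_gen z b g)
  then have "lsm R a (lsm R b g) = lsm R (a \<otimes> b) g" using G a by (intro lsm_lsm[of _ _ _ X]) auto
  then show ?case using linspan_diff[OF diff_gen.IH linspan_lsm_base[of "a \<otimes> b" R g G X]] diff_gen.hyps a by (simp add: lsm_diff)
next
  case (add_rel z b c x)
  then show ?case using linspan_add[OF add_rel.IH linspan_addrel[of "a \<otimes> b" R "a \<otimes> c" x X G]] a
    by (simp add: lsm_add lsm_diff r_distr)
next
  case (diff_rel z b c x)
  then show ?case using linspan_diff[OF diff_rel.IH linspan_addrel[of "a \<otimes> b" R "a \<otimes> c" x X G]] a
    by (simp add: lsm_diff r_distr)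
qed (simp add: linspan_0)

lemma addrels_FA: "addrels R X \<subseteq> FA R X"
  by (rule addrels_frags) (rule abelian_group_axioms)

lemma linspan_frags: "G \<subseteq> FA R X \<Longrightarrow> linspan R X G \<subseteq> FA R X"
  unfolding linspan_def by (rule addspan_frags) (use addrels_FA lsm_frags in blast)

lemma lsubst_frags: "z \<in> FA R X \<Longrightarrow> (\<And>x. x \<in> X \<Longrightarrow> s x \<in> FA R X') \<Longrightarrow> lsubst R s z \<in> FA R X'"
  unfolding lsubst_def by (erule frag_extend_frags) (auto intro: lsm_frags)

lemma lsubst_lsm: "a \<in> carrier R \<Longrightarrow> z \<in> FA R X \<Longrightarrow> (\<And>x. x \<in> X \<Longrightarrow> s x \<in> FA R X') \<Longrightarrow> lsubst R s (lsm R a z) = lsm R a (lsubst R s z)"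
  by (rotate_tac 1, induction rule: frags_induct) (auto simp: lsm_diff lsubst_diff lsm_lsm[of _ _ _ X'])

lemma lsubst_lsubst:
  assumes "z \<in> FA R X" "\<And>x. x \<in> X \<Longrightarrow> s x \<in> FA R X'" "\<And>x. x \<in> X' \<Longrightarrow> s' x \<in> FA R X''"
  shows "lsubst R s' (lsubst R s z) = lsubst R (\<lambda>x. lsubst R s' (s x)) z"
  using assms(1) by (induction rule: frags_induct) (use assms(2,3) in \<open>auto simp: lsubst_diff lsubst_lsm[of _ _ X' _ X'']\<close>)

lemma lsubst_ident: "z \<in> FA R X \<Longrightarrow> lsubst R (\<lambda>x. frag_of (\<one>, x)) z = z"
  by (induction rule: frags_induct) (auto simp: lsubst_diff)

text \<open>An additivity relation at \<open>x\<close> turns into the additivity of scaling the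
  combination \<open>s x\<close>, which is trivial by \<open>lsm_add_left\<close>; a multiple of a
  generator turns into the same multiple of its image.\<close>

lemma lsubst_linspan:
  assumes z: "z \<in> linspan R X G" and G: "G \<subseteq> FA R X" and G': "G' \<subseteq> FA R X'" and s: "\<And>x. x \<in> X \<Longrightarrow> s x \<in> FA R X'"
    and sG: "\<And>g. g \<in> G \<Longrightarrow> lsubst R s g \<in> linspan R X' G'"
  shows "lsubst R s z \<in> linspan R X' G'"
  using z
proof (induction rule: linspan_induct)
  case (add_gen z b g)
  then have "lsubst R s (lsm R b g) \<in> linspan R X' G'"
    using G s sG by (subst lsubst_lsm[of _ _ X]) (auto intro!: lsm_linspan G')
  then show ?case using add_gen by (auto simp: lsubst_add intro: linspan_add)
next
  case (diff_gen z b g)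
  then have "lsubst R s (lsm R b g) \<in> linspan R X' G'"
    using G s sG by (subst lsubst_lsm[of _ _ X]) (auto intro!: lsm_linspan G')
  then show ?case using diff_gen by (auto simp: lsubst_diff intro: linspan_diff)
next
  case (add_rel z b c x)
  then show ?case using linspan_add[OF add_rel.IH lsm_add_left[of b c "s x" X' G']] s by (simp add: lsubst_add lsubst_diff)
next
  case (diff_rel z b c x)
  then show ?case using linspan_diff[OF diff_rel.IH lsm_add_left[of b c "s x" X' G']] s by (simp add: lsubst_diff)
qed (simp add: linspan_0)

end

section \<open>Coordinates in a direct sum of copies of a group\<close>

context abelian_group
begin

lemma zero_addspan: "x \<in> X \<Longrightarrow> frag_of (\<zero>, x) \<in> addspan (addrels G X)"
proof -
  assume x: "x \<in> X"
  have "frag_of (\<zero> \<oplus> \<zero>, x) - frag_of (\<zero>, x) - frag_of (\<zero>, x) \<in> addspan (addrels G X)"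
    by (rule addspan_base) (use x in \<open>auto simp: addrels_def intro!: exI[of _ "\<zero>"]\<close>)
  then show ?thesis using addspan_uminus by fastforce
qed

lemma diff_addspan:
  assumes "y \<in> carrier G" "y' \<in> carrier G" "x \<in> X"
  shows "frag_of (y \<ominus> y', x) - (frag_of (y, x) - frag_of (y', x)) \<in> addspan (addrels G X)"
proof -
  have "frag_of ((y \<ominus> y') \<oplus> y', x) - frag_of (y \<ominus> y', x) - frag_of (y', x) \<in> addspan (addrels G X)"
    by (rule addspan_base) (use assms in \<open>auto simp: addrels_def\<close>)
  moreover have "(y \<ominus> y') \<oplus> y' = y" using assms by (simp add: a_minus_def a_assoc l_neg)
  ultimately have "- (frag_of (y, x) - frag_of (y \<ominus> y', x) - frag_of (y', x)) \<in> addspan (addrels G X)"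
    by (metis addspan_uminus)
  then show ?thesis by (simp add: algebra_simps)
qed

text \<open>The component at \<open>n\<close> in the direct sum of copies of the group. Being an
  instance of \<open>ev\<close>, it is additive on formal combinations at once.\<close>

definition coord :: "'x \<Rightarrow> ('a, 'x) fcomb \<Rightarrow> 'a" where
  "coord n v = ev G (\<lambda>p. if snd p = n then fst p else \<zero>) v"

lemma coord_fun: "(\<lambda>p. if snd p = n then fst p else \<zero>) \<in> carrier G \<times> X \<rightarrow> carrier G"
  by auto

lemma coord_closed: "v \<in> frags (carrier G \<times> X) \<Longrightarrow> coord n v \<in> carrier G"
  unfolding coord_def by (rule ev_closed[OF _ coord_fun])

lemma coord_diff: "v \<in> frags (carrier G \<times> X) \<Longrightarrow> w \<in> frags (carrier G \<times> X) \<Longrightarrow> coord n (v - w) = coord n v \<ominus> coord n w"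
  unfolding coord_def by (rule ev_diff[OF _ _ coord_fun])

lemma coord_add: "v \<in> frags (carrier G \<times> X) \<Longrightarrow> w \<in> frags (carrier G \<times> X) \<Longrightarrow> coord n (v + w) = coord n v \<oplus> coord n w"
  unfolding coord_def by (rule ev_add[OF _ _ coord_fun])

lemma coord_0 [simp]: "coord n 0 = \<zero>" by (simp add: coord_def)

lemma coord_of: "y \<in> carrier G \<Longrightarrow> coord n (frag_of (y, m)) = (if m = n then y else \<zero>)"
  unfolding coord_def by (subst ev_of) auto

lemma normal_form:
  assumes "finite S" "S \<subseteq> X" "v \<in> frags (carrier G \<times> S)"
  shows "v - (\<Sum>n\<in>S. frag_of (coord n v, n)) \<in> addspan (addrels G X)"
  using assms(3)
proof (induction rule: frags_induct)
  case zero
  have "(\<Sum>n\<in>S. frag_of (\<zero>, n)) \<in> addspan (addrels G X)"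
    using assms(1,2) by (induction S rule: finite_induct) (auto intro: addspan.zero addspan_add zero_addspan)
  then show ?case using addspan_uminus by fastforce
next
  case (of p)
  then obtain y m where p: "p = (y, m)" "y \<in> carrier G" "m \<in> S" by auto
  have "(\<Sum>n\<in>S. frag_of (coord n (frag_of p), n)) = frag_of p + (\<Sum>n\<in>S - {m}. frag_of (\<zero>, n))"
  proof -
    have "(\<Sum>n\<in>S - {m}. frag_of (coord n (frag_of p), n)) = (\<Sum>n\<in>S - {m}. frag_of (\<zero>, n))"
      by (rule sum.cong) (use p in \<open>auto simp: coord_of\<close>)
    then show ?thesis using assms p by (simp add: sum.remove[of S m] coord_of)
  qed
  moreover have "- (\<Sum>n\<in>S - {m}. frag_of (\<zero>, n)) \<in> addspan (addrels G X)"
  proof (rule addspan_uminus)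
    have "finite F \<Longrightarrow> F \<subseteq> X \<Longrightarrow> (\<Sum>n\<in>F. frag_of (\<zero>, n)) \<in> addspan (addrels G X)" for F
      by (induction F rule: finite_induct) (auto intro: addspan.zero addspan_add zero_addspan)
    then show "(\<Sum>n\<in>S - {m}. frag_of (\<zero>, n)) \<in> addspan (addrels G X)" using assms by (meson Diff_subset finite_Diff subset_trans)
  qed
  ultimately show ?case by simp
next
  case (diff v w)
  have "finite F \<Longrightarrow> F \<subseteq> S \<Longrightarrow> (\<Sum>n\<in>F. frag_of (coord n (v - w), n)) - ((\<Sum>n\<in>F. frag_of (coord n v, n)) - (\<Sum>n\<in>F. frag_of (coord n w, n))) \<in> addspan (addrels G X)" for F
  proof (induction F rule: finite_induct)
    case (insert n F)
    have 1: "frag_of (coord n (v - w), n) - (frag_of (coord n v, n) - frag_of (coord n w, n)) \<in> addspan (addrels G X)"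
      using diff insert assms by (simp add: coord_diff[of v S w] diff_addspan coord_closed[of _ S] subset_iff)
    have 2: "(\<Sum>n\<in>F. frag_of (coord n (v - w), n)) - ((\<Sum>n\<in>F. frag_of (coord n v, n)) - (\<Sum>n\<in>F. frag_of (coord n w, n))) \<in> addspan (addrels G X)"
      using insert by auto
    show ?case using addspan_add[OF 1 2] insert(1,2) by (simp add: algebra_simps)
  qed (simp add: addspan.zero)
  from this[OF assms(1) subset_refl]
  have 1: "(\<Sum>n\<in>S. frag_of (coord n (v - w), n)) - ((\<Sum>n\<in>S. frag_of (coord n v, n)) - (\<Sum>n\<in>S. frag_of (coord n w, n))) \<in> addspan (addrels G X)" .
  show ?case using addspan_diff[OF addspan_diff[OF diff(3,4)] 1] by (simp add: algebra_simps)
qed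

lemma coord_addspan: "v \<in> addspan (addrels G X) \<Longrightarrow> coord n v = \<zero>"
proof (induction rule: addspan.induct)
  have rel: "coord n s = \<zero>" if sr: "s \<in> addrels G X" for s
  proof -
    obtain y y' x where s: "s = frag_of (y \<oplus> y', x) - frag_of (y, x) - frag_of (y', x)" "y \<in> carrier G" "y' \<in> carrier G"
      using sr unfolding addrels_def by blast
    show ?thesis unfolding s(1) coord_def by (rule ev_frag_diff2_zero) (use s in auto)
  qed
  note sub = addspan_frags[OF addrels_frags[OF abelian_group_axioms]] addrels_frags[OF abelian_group_axioms]
  { case (plus z s)
    then have "z \<in> frags (carrier G \<times> X)" "s \<in> frags (carrier G \<times> X)" using sub by auto
    then show ?case using plus rel by (simp add: coord_add) }
  { case (minus z s)
    then have "z \<in> frags (carrier G \<times> X)" "s \<in> frags (carrier G \<times> X)" using sub by auto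
    then show ?case using minus rel by (simp add: coord_diff a_minus_def) }
qed simp

text \<open>By \<open>normal_form\<close> a combination is determined by its coordinates up to
  additivity, and terms with coefficient zero are themselves trivial. With
  \<open>coord_addspan\<close> this identifies combinations modulo additivity with their families of
  coordinates.\<close>

lemma coords_zero:
  assumes v: "v \<in> frags (carrier G \<times> X)" and 0: "\<And>n. n \<in> X \<Longrightarrow> coord n v = \<zero>"
  shows "v \<in> addspan (addrels G X)"
proof -
  let ?S = "snd ` Poly_Mapping.keys v"
  have S: "finite ?S" "?S \<subseteq> X" "v \<in> frags (carrier G \<times> ?S)"
    using frags_snd_keys[OF v] by simp_all
  have "finite F \<Longrightarrow> F \<subseteq> ?S \<Longrightarrow> (\<Sum>n\<in>F. frag_of (coord n v, n)) \<in> addspan (addrels G X)" for F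
  proof (induction F rule: finite_induct)
    case (insert n F)
    then have "n \<in> X" using S(2) by blast
    then have "frag_of (coord n v, n) \<in> addspan (addrels G X)" using 0 zero_addspan by simp
    then show ?case using insert addspan_add by simp
  qed (simp add: addspan.zero)
  from addspan_add[OF normal_form[OF S] this[OF S(1) subset_refl]] show ?thesis by simp
qed

end

section \<open>Evaluation of formal linear combinations in a module\<close>

context left_module
begin

lemma lev_fun: "e \<in> X \<rightarrow> carrier M \<Longrightarrow> (\<lambda>p. fst p \<odot>\<^bsub>M\<^esub> e (snd p)) \<in> carrier R \<times> X \<rightarrow> carrier M"
  by (auto simp: Pi_iff smult_closed)

lemma lev_0 [simp]: "lev M e 0 = \<zero>\<^bsub>M\<^esub>" by (simp add: lev_def)

lemma lev_of: "a \<in> carrier R \<Longrightarrow> e x \<in> carrier M \<Longrightarrow> lev M e (frag_of (a, x)) = a \<odot>\<^bsub>M\<^esub> e x"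
  unfolding lev_def by (subst M.ev_of) (auto intro: smult_closed)

lemma lev_closed: "e \<in> X \<rightarrow> carrier M \<Longrightarrow> z \<in> FA R X \<Longrightarrow> lev M e z \<in> carrier M"
  unfolding lev_def by (erule M.ev_closed) (rule lev_fun)

lemma lev_add: "e \<in> X \<rightarrow> carrier M \<Longrightarrow> z \<in> FA R X \<Longrightarrow> w \<in> FA R X \<Longrightarrow> lev M e (z + w) = lev M e z \<oplus>\<^bsub>M\<^esub> lev M e w"
  unfolding lev_def by (rule M.ev_add[OF _ _ lev_fun])

lemma lev_diff: "e \<in> X \<rightarrow> carrier M \<Longrightarrow> z \<in> FA R X \<Longrightarrow> w \<in> FA R X \<Longrightarrow> lev M e (z - w) = lev M e z \<ominus>\<^bsub>M\<^esub> lev M e w"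
  unfolding lev_def by (rule M.ev_diff[OF _ _ lev_fun])

lemma lev_cong: "z \<in> FA R X \<Longrightarrow> e \<in> X \<rightarrow> carrier M \<Longrightarrow> (\<And>x. x \<in> X \<Longrightarrow> e' x = e x) \<Longrightarrow> lev M e' z = lev M e z"
  unfolding lev_def by (rule M.ev_cong[OF _ _ lev_fun]) auto

lemma smult_diff: "a \<in> carrier R \<Longrightarrow> x \<in> carrier M \<Longrightarrow> y \<in> carrier M \<Longrightarrow> a \<odot>\<^bsub>M\<^esub> (x \<ominus>\<^bsub>M\<^esub> y) = a \<odot>\<^bsub>M\<^esub> x \<ominus>\<^bsub>M\<^esub> a \<odot>\<^bsub>M\<^esub> y"
  by (rule add_hom_diff[OF M.abelian_group_axioms M.abelian_group_axioms smult_add_hom])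

lemma smult_zero: "a \<in> carrier R \<Longrightarrow> a \<odot>\<^bsub>M\<^esub> \<zero>\<^bsub>M\<^esub> = \<zero>\<^bsub>M\<^esub>"
  by (rule add_hom_zero[OF M.abelian_group_axioms M.abelian_group_axioms smult_add_hom])

lemma zero_smult: "x \<in> carrier M \<Longrightarrow> \<zero>\<^bsub>R\<^esub> \<odot>\<^bsub>M\<^esub> x = \<zero>\<^bsub>M\<^esub>"
  by (rule lmod_left_module_zero[OF left_module_axioms])

lemma smult_ladd_hom: "x \<in> carrier M \<Longrightarrow> (\<lambda>a. a \<odot>\<^bsub>M\<^esub> x) \<in> add_hom R M"
  by (simp add: add_hom_def smult_closed smult_l_distr)

lemma lev_lsm:
  assumes "e \<in> X \<rightarrow> carrier M" "a \<in> carrier R" "z \<in> FA R X"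
  shows "lev M e (lsm R a z) = a \<odot>\<^bsub>M\<^esub> lev M e z"
  using assms(3)
proof (induction rule: frags_induct)
  case zero then show ?case using assms by (simp add: smult_zero)
next
  case (of p) then show ?case using assms by (auto simp: lev_of Pi_iff smult_assoc)
next
  case (diff z w) then show ?case using assms
    by (simp add: lsm_diff lev_diff[of e X] R.lsm_frags lev_closed[of e X] smult_diff)
qed

lemma lev_lsubst:
  assumes e: "e \<in> X' \<rightarrow> carrier M" and s: "\<And>x. x \<in> X \<Longrightarrow> s x \<in> FA R X'" and z: "z \<in> FA R X"
  shows "lev M e (lsubst R s z) = lev M (\<lambda>x. lev M e (s x)) z"
proof -
  have e': "(\<lambda>x. lev M e (s x)) \<in> X \<rightarrow> carrier M" using lev_closed[OF e s] by blast
  show ?thesis using z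
  proof (induction rule: frags_induct)
    case (of p) then show ?case using e e' s by (auto simp: lev_of Pi_iff lev_lsm[of e X'])
  next
    case (diff z w) then show ?case
      using e e' s by (simp add: lsubst_diff lev_diff[of e X'] lev_diff[OF e'] R.lsubst_frags)
  qed simp
qed

lemma lev_linspan:
  assumes e: "e \<in> X \<rightarrow> carrier M" and G: "G \<subseteq> FA R X" and 0: "\<And>g. g \<in> G \<Longrightarrow> lev M e g = \<zero>\<^bsub>M\<^esub>"
    and z: "z \<in> linspan R X G"
  shows "lev M e z = \<zero>\<^bsub>M\<^esub>"
  using z
proof (induction rule: linspan_induct)
  have gen: "lev M e (lsm R a g) = \<zero>\<^bsub>M\<^esub>" "lsm R a g \<in> FA R X" if "a \<in> carrier R" "g \<in> G" for a g
    using lev_lsm[OF e that(1) subsetD[OF G that(2)]] 0[OF that(2)] smult_zero[OF that(1)]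
      R.lsm_frags[OF that(1) subsetD[OF G that(2)]] by simp_all
  have rel: "lev M e (frag_of (a \<oplus>\<^bsub>R\<^esub> b, x) - frag_of (a, x) - frag_of (b, x)) = \<zero>\<^bsub>M\<^esub>
     \<and> frag_of (a \<oplus>\<^bsub>R\<^esub> b, x) - frag_of (a, x) - frag_of (b, x) \<in> FA R X"
    if "a \<in> carrier R" "b \<in> carrier R" "x \<in> X" for a b x
  proof -
    have "e x \<in> carrier M" using e that by blast
    then show ?thesis unfolding lev_def using that
      by (intro conjI M.ev_frag_diff2_zero frags_diff) (simp_all add: smult_l_distr smult_closed)
  qed
  note sub = subsetD[OF R.linspan_frags[OF G]]
  {
    case (add_rel z a b x) then show ?case using sub[OF add_rel(1)] rel[of a b x] by (simp add: lev_add[OF e])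
  next
    case (diff_rel z a b x) then show ?case using sub[OF diff_rel(1)] rel[of a b x] by (simp add: lev_diff[OF e] a_minus_def)
  next
    case (add_gen z a g) then show ?case using sub[OF add_gen(1)] gen[of a g] by (simp add: lev_add[OF e])
  next
    case (diff_gen z a g) then show ?case using sub[OF diff_gen(1)] gen[of a g] by (simp add: lev_diff[OF e] a_minus_def)
  }
qed simp

end

lemma lmod_hom_lev:
  assumes "left_module R M" "left_module R N" "h \<in> lmod_hom R M N" "e \<in> X \<rightarrow> carrier M" "z \<in> FA R X"
  shows "h (lev M e z) = lev N (\<lambda>x. h (e x)) z"
proof -
  interpret M: left_module R M by fact
  interpret N: left_module R N by fact
  have "h (lev M e z) = ev N (\<lambda>p. h (fst p \<odot>\<^bsub>M\<^esub> e (snd p))) z"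
    unfolding lev_def
    by (rule add_hom_ev[OF M.M.abelian_group_axioms N.M.abelian_group_axioms lmod_hom_add_hom[OF assms(3)] assms(5) M.lev_fun[OF assms(4)]])
  also have "\<dots> = lev N (\<lambda>x. h (e x)) z"
    unfolding lev_def
    by (rule N.M.ev_cong[OF assms(5)]) (use assms(4) in \<open>auto simp: lmod_hom_smult[OF assms(3)] lmod_hom_closed[OF assms(3)] N.smult_closed Pi_iff\<close>)
  finally show ?thesis .
qed

section \<open>Combinations with coefficients in a right module\<close>

definition rmulf :: "('a, 'b, 'z) bimodule_scheme \<Rightarrow> 'b \<Rightarrow> ('a, 'x) fcomb \<Rightarrow> ('b, 'x) fcomb" where
  "rmulf Y y = tmapf (\<lambda>a. y \<triangleleft>\<^bsub>Y\<^esub> a) (\<lambda>x. x)"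

text \<open>The substitution \<open>s\<close> tensored with \<open>Y\<close>: a term with
  coefficient \<open>y\<close> at \<open>x\<close> becomes the combination \<open>s x\<close> with
  its coefficients multiplied onto \<open>y\<close> from the right.\<close>

definition ract :: "('a, 'b, 'z) bimodule_scheme \<Rightarrow> ('x \<Rightarrow> 'a \<times> 'x1 \<Rightarrow>\<^sub>0 int) \<Rightarrow> ('b, 'x) fcomb \<Rightarrow> ('b, 'x1) fcomb" where
  "ract Y s = frag_extend (\<lambda>p. rmulf Y (fst p) (s (snd p)))"

lemma rmulf_of [simp]: "rmulf Y y (frag_of (a, x)) = frag_of (y \<triangleleft>\<^bsub>Y\<^esub> a, x)" by (simp add: rmulf_def)
lemma rmulf_0 [simp]: "rmulf Y y 0 = 0" by (simp add: rmulf_def)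
lemma rmulf_diff: "rmulf Y y (z - w) = rmulf Y y z - rmulf Y y w" by (simp add: rmulf_def tmapf_diff)
lemma rmulf_add: "rmulf Y y (z + w) = rmulf Y y z + rmulf Y y w" by (simp add: rmulf_def tmapf_add)
lemma ract_of [simp]: "ract Y s (frag_of (y, x)) = rmulf Y y (s x)" by (simp add: ract_def)
lemma ract_0 [simp]: "ract Y s 0 = 0" by (simp add: ract_def)
lemma ract_diff: "ract Y s (z - w) = ract Y s z - ract Y s w" by (simp add: ract_def frag_extend_diff)
lemma ract_add: "ract Y s (z + w) = ract Y s z + ract Y s w" by (simp add: ract_def frag_extend_add)

context right_module
begin

lemma rmulf_frags: "y \<in> carrier M \<Longrightarrow> z \<in> FA R X \<Longrightarrow> rmulf M y z \<in> frags (carrier M \<times> X)"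
  unfolding rmulf_def by (erule tmapf_frags) (auto intro: rsmult_closed)

lemma ract_frags: "z \<in> frags (carrier M \<times> X) \<Longrightarrow> (\<And>x. x \<in> X \<Longrightarrow> s x \<in> FA R X') \<Longrightarrow> ract M s z \<in> frags (carrier M \<times> X')"
  unfolding ract_def by (erule frag_extend_frags) (auto intro: rmulf_frags)

lemma rmulf_addspan:
  assumes y: "y \<in> carrier M" and "v \<in> addspan (addrels R X)"
  shows "rmulf M y v \<in> addspan (addrels M X)"
  using assms(2)
proof (induction)
  have rel: "rmulf M y s \<in> addspan (addrels M X)" if sr: "s \<in> addrels R X" for s
  proof -
    obtain a b x where s: "s = frag_of (a \<oplus>\<^bsub>R\<^esub> b, x) - frag_of (a, x) - frag_of (b, x)" "a \<in> carrier R" "b \<in> carrier R" "x \<in> X"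
      using sr unfolding addrels_def by blast
    have "frag_of (y \<triangleleft>\<^bsub>M\<^esub> a \<oplus>\<^bsub>M\<^esub> y \<triangleleft>\<^bsub>M\<^esub> b, x) - frag_of (y \<triangleleft>\<^bsub>M\<^esub> a, x) - frag_of (y \<triangleleft>\<^bsub>M\<^esub> b, x) \<in> addrels M X"
      unfolding addrels_def using s y rsmult_closed by blast
    then show ?thesis using s y by (simp add: rmulf_diff rsmult_r_distr addspan_base)
  qed
  { case (plus z s) then show ?case using rel by (simp add: rmulf_add addspan_add) 
  next
    case (minus z s) then show ?case using rel by (simp add: rmulf_diff addspan_diff) }
qed (simp add: addspan.zero)

lemma rmulf_add_left:
  assumes "y \<in> carrier M" "y' \<in> carrier M" "z \<in> FA R X"
  shows "rmulf M (y \<oplus>\<^bsub>M\<^esub> y') z - rmulf M y z - rmulf M y' z \<in> addspan (addrels M X)"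
  using assms(3)
proof (induction rule: frags_induct)
  case zero then show ?case by (simp add: addspan.zero)
next
  case (of p)
  then obtain a x where p: "p = (a, x)" "a \<in> carrier R" "x \<in> X" by auto
  have "frag_of (y \<triangleleft>\<^bsub>M\<^esub> a \<oplus>\<^bsub>M\<^esub> y' \<triangleleft>\<^bsub>M\<^esub> a, x) - frag_of (y \<triangleleft>\<^bsub>M\<^esub> a, x) - frag_of (y' \<triangleleft>\<^bsub>M\<^esub> a, x) \<in> addrels M X"
    unfolding addrels_def using p assms rsmult_closed by blast
  then show ?case using p assms by (simp add: rsmult_l_distr addspan_base)
next
  case (diff z w)
  then show ?case using addspan_diff[OF diff(3,4)] by (simp add: rmulf_diff algebra_simps)
qed

lemma rmulf_rsmult: "y \<in> carrier M \<Longrightarrow> a \<in> carrier R \<Longrightarrow> z \<in> FA R X \<Longrightarrow> rmulf M (y \<triangleleft>\<^bsub>M\<^esub> a) z = rmulf M y (lsm R a z)"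
  by (rotate_tac 2, induction rule: frags_induct) (auto simp: rmulf_diff lsm_diff rsmult_assoc)

end

text \<open>Balancing moves the coefficients of \<open>v\<close> across the tensor sign. This shows
  that a substitution which represents the given elements does not change a tensor, and it evaluates
  the tensor attached to a linear relation.\<close>

lemma tcls_rmulf:
  assumes Y: "right_module R Y" and M: "left_module R M" and y: "y \<in> carrier Y" and v: "v \<in> FA R (carrier M)"
  shows "tcls R Y M (rmulf Y y v) = tens R Y M y (lev M (\<lambda>x. x) v)"
proof -
  interpret Y: right_module R Y by fact
  interpret M: left_module R M by fact
  interpret P: tensor_pair R Y M by (rule tensor_pairI[OF Y M])
  have t: "(\<lambda>m. tens R Y M y m) \<in> add_hom M P.T" using y P.tens_add_right P.tens_closed by (simp add: add_hom_def)
  have id: "(\<lambda>x. x) \<in> carrier M \<rightarrow> carrier M" by simp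
  show ?thesis using v
  proof (induction rule: frags_induct)
    case zero then show ?case
      using add_hom_zero[OF M.M.abelian_group_axioms P.tensor_ab_group t] by (simp add: P.zero_tensor_ab)
  next
    case (of p) then show ?case using y by (auto simp: M.lev_of tens_eq_tcls[symmetric] P.tens_balanced)
  next
    case (diff z w) then show ?case using y
      by (simp add: rmulf_diff P.tcls_diff Y.rmulf_frags M.lev_diff[OF id] M.lev_closed[OF id]
        add_hom_diff[OF M.M.abelian_group_axioms P.tensor_ab_group t])
  qed
qed

lemma addrels_tensor_ker:
  assumes "tensor_pair R Y M" "v \<in> addspan (addrels Y (carrier M))"
  shows "v \<in> tensor_ker R Y M"
proof -
  interpret tensor_pair R Y M by fact
  have "addrels Y (carrier M) \<subseteq> tensor_rels R Y M"
    unfolding addrels_def tensor_rels_def by blast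
  then show ?thesis using addspan_mono assms(2) unfolding tensor_ker_eq by blast
qed

lemma tensor_rels_cases:
  assumes "w \<in> tensor_rels R M N"
  obtains (left) x x' y where "w = frag_of (x \<oplus>\<^bsub>M\<^esub> x', y) - frag_of (x, y) - frag_of (x', y)"
      "x \<in> carrier M" "x' \<in> carrier M" "y \<in> carrier N"
  | (right) x y y' where "w = frag_of (x, y \<oplus>\<^bsub>N\<^esub> y') - frag_of (x, y) - frag_of (x, y')"
      "x \<in> carrier M" "y \<in> carrier N" "y' \<in> carrier N"
  | (mid) x a y where "w = frag_of (x \<triangleleft>\<^bsub>M\<^esub> a, y) - frag_of (x, a \<odot>\<^bsub>N\<^esub> y)"
      "x \<in> carrier M" "a \<in> carrier R" "y \<in> carrier N"
  using assms unfolding tensor_rels_def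
  by (elim UnE CollectE exE conjE) (rule left right mid; assumption)+

text \<open>A relation in \<open>Y \<otimes> M\<close> involves only finitely many linear relations of \<open>M\<close>.\<close>

lemma tensor_ker_finite:
  assumes Y: "right_module R Y" and M: "left_module R M" and w: "w \<in> tensor_ker R Y M"
  shows "\<exists>G0. finite G0 \<and> G0 \<subseteq> lker R M \<and> (\<forall>s. (\<forall>x\<in>carrier M. s x \<in> FA R (carrier M)) \<and>
    (\<forall>g\<in>G0. lsubst R s g \<in> linspan R (carrier M) {}) \<longrightarrow> ract Y s w \<in> addspan (addrels Y (carrier M)))"
    (is "\<exists>G0. ?P w G0")
proof -
  interpret Y: right_module R Y by fact
  interpret M: left_module R M by fact
  interpret P: tensor_pair R Y M by (rule tensor_pairI[OF Y M])
  have id: "(\<lambda>x. x) \<in> carrier M \<rightarrow> carrier M" by simp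
  have rel: "\<exists>G0. ?P w G0" if w: "w \<in> tensor_rels R Y M" for w
    using w
  proof (cases rule: tensor_rels_cases)
    case 1: (left x x' y)
      \<comment> \<open>Additivity in the left variable survives every substitution, so no relation
        of \<open>M\<close> enters.\<close>
      have "?P w {}" unfolding 1(1) using 1(2-) by (auto simp: ract_diff intro!: Y.rmulf_add_left)
      then show ?thesis by blast
    next
    case 2: (right x y y')
      \<comment> \<open>Additivity in \<open>M\<close> comes from the linear relation stating that
        the sum is the sum; substituting in it and multiplying by \<open>x\<close> from the left
        reproduces the substituted tensor relation.\<close>
      let ?g = "frag_of (\<one>\<^bsub>R\<^esub>, y \<oplus>\<^bsub>M\<^esub> y') - frag_of (\<one>\<^bsub>R\<^esub>, y) - frag_of (\<one>\<^bsub>R\<^esub>, y')"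
      have "lev M (\<lambda>x. x) ?g = \<zero>\<^bsub>M\<^esub>" unfolding lev_def
        by (rule M.M.ev_frag_diff2_zero) (use 2 in \<open>auto simp: M.smult_one\<close>)
      then have "?g \<in> lker R M" using 2 by (auto simp: lker_def intro!: frags_diff)
      moreover have "ract Y s w \<in> addspan (addrels Y (carrier M))"
        if s: "\<forall>x\<in>carrier M. s x \<in> FA R (carrier M)" and g: "lsubst R s ?g \<in> linspan R (carrier M) {}" for s
      proof -
        have "ract Y s w = rmulf Y x (lsubst R s ?g)"
          using 2 s by (simp add: ract_diff lsubst_diff Y.lsm_one[of _ "carrier M"] rmulf_diff)
        then show ?thesis using Y.rmulf_addspan[OF 2(2)] g by (simp add: linspan_empty)
      qed
      ultimately have "?P w {?g}" by simp
      then show ?thesis by blast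
    next
    case 3: (mid x a y)
      \<comment> \<open>Balancing comes from the relation that equates the coefficient
        \<open>a\<close> at \<open>y\<close> with the coefficient one at the product of
        \<open>a\<close> and \<open>y\<close>.\<close>
      let ?g = "frag_of (a, y) - frag_of (\<one>\<^bsub>R\<^esub>, a \<odot>\<^bsub>M\<^esub> y)"
      have "lev M (\<lambda>x. x) ?g = \<zero>\<^bsub>M\<^esub>" unfolding lev_def
        by (rule M.M.ev_frag_diff_zero) (use 3 in \<open>auto simp: M.smult_one M.smult_closed\<close>)
      then have "?g \<in> lker R M" using 3 by (auto simp: lker_def M.smult_closed)
      moreover have "ract Y s w \<in> addspan (addrels Y (carrier M))"
        if s: "\<forall>x\<in>carrier M. s x \<in> FA R (carrier M)" and g: "lsubst R s ?g \<in> linspan R (carrier M) {}" for s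
      proof -
        have "ract Y s w = rmulf Y x (lsubst R s ?g)"
          using 3 s by (simp add: ract_diff lsubst_diff Y.lsm_one[of _ "carrier M"] rmulf_diff M.smult_closed Y.rmulf_rsmult[of _ _ _ "carrier M"])
        then show ?thesis using Y.rmulf_addspan[OF 3(2)] g by (simp add: linspan_empty)
      qed
      ultimately have "?P w {?g}" by simp
      then show ?thesis by blast
  qed
  have "w \<in> addspan (tensor_rels R Y M)" using w by (simp add: P.tensor_ker_eq)
  then show ?thesis
  proof induction
    case zero
    show ?case by (intro exI[of _ "{}"]) (simp add: addspan.zero)
  next
    case (plus z s)
    obtain G1 where "?P z G1" using plus.IH by (rule exE)
    moreover obtain G2 where "?P s G2" using rel[OF plus.hyps(2)] by (rule exE)
    ultimately have "?P (z + s) (G1 \<union> G2)"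
      by (auto simp: ract_add intro!: addspan_add)
    then show ?case by (rule exI)
  next
    case (minus z s)
    obtain G1 where "?P z G1" using minus.IH by (rule exE)
    moreover obtain G2 where "?P s G2" using rel[OF minus.hyps(2)] by (rule exE)
    ultimately have "?P (z - s) (G1 \<union> G2)"
      by (auto simp: ract_diff intro!: addspan_diff)
    then show ?case by (rule exI)
  qed
qed

text \<open>A tensor over \<open>X\<close> that dies over \<open>Y\<close> does so because of
  finitely many linear relations of \<open>M\<close>. A substitution that trivialises them rewrites
  the tensor, without changing its class, as an element of a direct sum of copies of
  \<open>X\<close> whose image in the direct sum of copies of \<open>Y\<close> is zero. There
  \<open>f\<close> acts coordinatewise, so its injectivity applies.\<close>

theorem eqflat_imp_flat:
  fixes \<kappa> :: "'u rel"
  assumes M: "left_module R M" and eq: "eqflat R M"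
  shows "flat_module \<kappa> R M"
  unfolding flat_module_def
proof (intro allI impI inj_onI; elim conjE)
  fix X :: "('a, 'u) bimodule" and Y :: "('a, 'u) bimodule" and f t t'
  assume X: "right_module R X" and Y: "right_module R Y"
    and f: "f \<in> rmod_hom R X Y" "inj_on f (carrier X)"
    and t: "t \<in> carrier (tensor R X M)" "t' \<in> carrier (tensor R X M)"
    and teq: "tensor_map R Y M f (\<lambda>m. m) t = tensor_map R Y M f (\<lambda>m. m) t'"
  interpret X: right_module R X by fact
  interpret Y: right_module R Y by fact
  interpret M: left_module R M by fact
  interpret PX: tensor_pair R X M by (rule tensor_pairI[OF X M])
  interpret PY: tensor_pair R Y M by (rule tensor_pairI[OF Y M])
  have id: "(\<lambda>x. x) \<in> carrier M \<rightarrow> carrier M" by simp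
  obtain z1 z2 where z: "z1 \<in> PX.TT" "t = tcls R X M z1" "z2 \<in> PX.TT" "t' = tcls R X M z2"
    using t unfolding carrier_tensor PX.carrier_tensor_ab by blast
  define z where "z = z1 - z2"
  have zF: "z \<in> PX.TT" using z by (auto simp: z_def)
  have "tmapf f (\<lambda>m. m) z \<in> tensor_ker R Y M"
    using teq z by (simp add: tensor_map_tcls[OF PX.tensor_pair_axioms PY.tensor_pair_axioms f(1) lmod_hom_id] PY.tcls_eq_iff z_def tmapf_diff)
  then obtain G0 where G0: "finite G0" "G0 \<subseteq> lker R M"
    and G0': "\<And>s. \<lbrakk>\<forall>x\<in>carrier M. s x \<in> FA R (carrier M); \<forall>g\<in>G0. lsubst R s g \<in> linspan R (carrier M) {}\<rbrakk> \<Longrightarrow>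
       ract Y s (tmapf f (\<lambda>m. m) z) \<in> addspan (addrels Y (carrier M))"
    using tensor_ker_finite[OF Y M] by metis
  \<comment> \<open>The elements of \<open>M\<close> occurring in \<open>z\<close>. The substitution
    has to represent them, which keeps the class of \<open>z\<close> unchanged.\<close>
  let ?X0 = "snd ` Poly_Mapping.keys z"
  have X0: "finite ?X0" "?X0 \<subseteq> carrier M" using zF by (auto simp: frags_def)
  obtain s where s: "\<forall>x\<in>carrier M. s x \<in> FA R (carrier M)" "\<forall>x\<in>?X0. lev M (\<lambda>x. x) (s x) = x"
    "\<forall>g\<in>G0. lsubst R s g \<in> linspan R (carrier M) {}"
    using eq[unfolded eqflat_def, rule_format, of G0 ?X0] G0 X0 by blast
  define v where "v = ract X s z"
  have v: "v \<in> PX.TT" unfolding v_def using X.ract_frags[OF zF] s by blast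
  have rf: "tmapf f (\<lambda>m. m) (rmulf X x u) = rmulf Y (f x) u" if "x \<in> carrier X" "u \<in> FA R (carrier M)" for x u
    using that(2) by (induction rule: frags_induct) (use that(1) in \<open>auto simp: rmulf_diff tmapf_diff rmod_hom_rsmult[OF f(1)]\<close>)
  have "ract Y s (tmapf f (\<lambda>m. m) z) = tmapf f (\<lambda>m. m) v" unfolding v_def
    using zF by (induction rule: frags_induct) (use s rf in \<open>auto simp: ract_diff tmapf_diff\<close>)
  then have fv: "tmapf f (\<lambda>m. m) v \<in> addspan (addrels Y (carrier M))" using G0'[OF s(1,3)] by simp
  have tf: "tmapf f (\<lambda>m. m) u \<in> PY.TT" if "u \<in> PX.TT" for u
    by (rule tmapf_frags[OF that]) (use rmod_hom_closed[OF f(1)] in auto)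
  have fc: "f (X.M.coord n u) = Y.M.coord n (tmapf f (\<lambda>m. m) u)" if "u \<in> PX.TT" for n u
    using that
  proof (induction rule: frags_induct)
    case zero then show ?case
      using add_hom_zero[OF X.M.abelian_group_axioms Y.M.abelian_group_axioms rmod_hom_add_hom[OF f(1)]] by simp
  next
    case (of p) then show ?case
      using add_hom_zero[OF X.M.abelian_group_axioms Y.M.abelian_group_axioms rmod_hom_add_hom[OF f(1)]]
      by (auto simp: X.M.coord_of Y.M.coord_of rmod_hom_closed[OF f(1)])
  next
    case (diff u w) then show ?case
      by (simp add: tmapf_diff X.M.coord_diff[OF diff(1,2)] Y.M.coord_diff[OF tf[OF diff(1)] tf[OF diff(2)]] X.M.coord_closed
        add_hom_diff[OF X.M.abelian_group_axioms Y.M.abelian_group_axioms rmod_hom_add_hom[OF f(1)]])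
  qed
  have "X.M.coord n v = \<zero>\<^bsub>X\<^esub>" for n
  proof -
    have "f (X.M.coord n v) = f \<zero>\<^bsub>X\<^esub>"
      using fc[OF v] Y.M.coord_addspan[OF fv] add_hom_zero[OF X.M.abelian_group_axioms Y.M.abelian_group_axioms rmod_hom_add_hom[OF f(1)]] by simp
    then show ?thesis using f(2) X.M.coord_closed[OF v] by (auto dest: inj_onD)
  qed
  then have vk: "v \<in> tensor_ker R X M"
    by (intro addrels_tensor_ker[OF PX.tensor_pair_axioms] X.M.coords_zero v)
  have "u \<in> frags (carrier X \<times> ?X0) \<Longrightarrow> tcls R X M (ract X s u) = tcls R X M u" for u
  proof (induction rule: frags_induct)
    case (of p)
    then obtain x m where p: "p = (x, m)" "x \<in> carrier X" "m \<in> ?X0" by auto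
    then show ?case using tcls_rmulf[OF X M, of x "s m"] s X0 by (simp add: tens_eq_tcls subset_iff)
  next
    case (diff u w)
    have uw: "u \<in> PX.TT" "w \<in> PX.TT" using frags_mono[of "carrier X \<times> ?X0" "carrier X \<times> carrier M"] X0 diff by blast+
    have "ract X s u \<in> PX.TT" "ract X s w \<in> PX.TT" using X.ract_frags uw s by blast+
    then show ?case using diff uw by (simp add: ract_diff PX.tcls_diff)
  qed simp
  moreover have "z \<in> frags (carrier X \<times> ?X0)" using zF by (force simp: frags_def)
  ultimately have "tcls R X M v = tcls R X M z" by (simp add: v_def)
  then have "v - z \<in> tensor_ker R X M" by (simp add: PX.tcls_eq_iff)
  then have "v - (v - z) \<in> tensor_ker R X M" using vk addspan_diff unfolding PX.tensor_ker_eq by blast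
  then have "z1 - z2 \<in> tensor_ker R X M" by (simp add: z_def)
  then show "t = t'" using z by (simp add: PX.tcls_eq_iff)
qed

section \<open>Flatness implies the equational criterion\<close>

lemma small_image: "small \<kappa> X \<Longrightarrow> small \<kappa> (f ` X)"
  unfolding small_def by (rule ordLeq_ordLess_trans[OF card_of_image])

lemma small_subset: "small \<kappa> X \<Longrightarrow> Y \<subseteq> X \<Longrightarrow> small \<kappa> Y"
  unfolding small_def by (rule ordLeq_ordLess_trans[OF card_of_mono1])

lemma (in abelian_group) neg_zero [simp]: "\<ominus> \<zero> = \<zero>"
  using minus_equality[of \<zero> \<zero>] by simp

lemma (in abelian_group) minus_minus_swap:
  "\<lbrakk>x \<in> carrier G; y \<in> carrier G; z \<in> carrier G; w \<in> carrier G\<rbrakk> \<Longrightarrow>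
    (x \<ominus> y) \<ominus> (z \<ominus> w) = (x \<ominus> z) \<ominus> (y \<ominus> w)"
  by (simp add: a_minus_def minus_add a_ac)

lemma lsubst_zero: "z \<in> FA R X \<Longrightarrow> lsubst R (\<lambda>_. 0) z = 0"
  by (induction rule: frags_induct) (auto simp: lsubst_diff)

context ring
begin

lemma regular_group: "abelian_group (regular_bimodule R)"
  by (rule abelian_group_cong[OF abelian_group_axioms]) simp_all

lemma regular_id_hom: "(\<lambda>x. x) \<in> add_hom (regular_bimodule R) R"
  by (simp add: add_hom_def)

lemma ev_regular: "z \<in> frags B \<Longrightarrow> b \<in> B \<rightarrow> carrier R \<Longrightarrow> ev (regular_bimodule R) b z = ev R b z"
  using add_hom_ev[OF regular_group abelian_group_axioms regular_id_hom, of z B b] by simp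

lemma minus_regular: "x \<in> carrier R \<Longrightarrow> y \<in> carrier R \<Longrightarrow> x \<ominus>\<^bsub>regular_bimodule R\<^esub> y = x \<ominus> y"
  using add_hom_diff[OF regular_group abelian_group_axioms regular_id_hom, of x y] by simp

end

context left_module
begin

lemma lev_fun_hom:
  assumes "e \<in> X \<rightarrow> carrier M" "e' \<in> X \<rightarrow> carrier M" "z \<in> FA R X"
  shows "lev M (\<lambda>x. e x \<ominus>\<^bsub>M\<^esub> e' x) z = lev M e z \<ominus>\<^bsub>M\<^esub> lev M e' z"
proof -
  have ed: "(\<lambda>x. e x \<ominus>\<^bsub>M\<^esub> e' x) \<in> X \<rightarrow> carrier M" using assms by auto
  show ?thesis using assms(3)
  proof (induction rule: frags_induct)
    case zero then show ?case by (simp add: a_minus_def M.neg_zero)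
  next
    case (of p) then show ?case using assms ed by (auto simp: lev_of Pi_iff smult_diff)
  next
    case (diff z w)
    have "lev M e z \<in> carrier M" "lev M e w \<in> carrier M" "lev M e' z \<in> carrier M" "lev M e' w \<in> carrier M"
      using diff assms lev_closed by blast+
    then show ?case using diff
      by (simp add: lev_diff[OF ed] lev_diff[OF assms(1)] lev_diff[OF assms(2)] M.minus_minus_swap)
  qed
qed

end

text \<open>
  \<open>flat_module\<close> quantifies over right modules with elements in the universe, so a right ideal
  \<open>S\<close> has to be copied there along an injection \<open>e\<close>.
\<close>

definition ring_copy :: "('a, 'r) ring_scheme \<Rightarrow> ('a \<Rightarrow> 'u) \<Rightarrow> 'a set \<Rightarrow> ('a, 'u) bimodule" where
  "ring_copy R e S = \<lparr>carrier = e ` S, monoid.mult = undefined, monoid.one = undefined, ring.zero = e \<zero>\<^bsub>R\<^esub>,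
     add = (\<lambda>u v. e (inv_into (carrier R) e u \<oplus>\<^bsub>R\<^esub> inv_into (carrier R) e v)), smult = undefined,
     rsmult = (\<lambda>u a. e (inv_into (carrier R) e u \<otimes>\<^bsub>R\<^esub> a))\<rparr>"

lemma ring_copy_simps [simp]:
  "carrier (ring_copy R e S) = e ` S" "ring.zero (ring_copy R e S) = e \<zero>\<^bsub>R\<^esub>"
  "u \<oplus>\<^bsub>ring_copy R e S\<^esub> v = e (inv_into (carrier R) e u \<oplus>\<^bsub>R\<^esub> inv_into (carrier R) e v)"
  "u \<triangleleft>\<^bsub>ring_copy R e S\<^esub> a = e (inv_into (carrier R) e u \<otimes>\<^bsub>R\<^esub> a)"
  by (simp_all add: ring_copy_def)

lemma ring_copy_right_module:
  assumes "ring R" and e: "inj_on e (carrier R)" and S: "S \<subseteq> carrier R" "\<zero>\<^bsub>R\<^esub> \<in> S"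
    and add: "\<And>u v. u \<in> S \<Longrightarrow> v \<in> S \<Longrightarrow> u \<oplus>\<^bsub>R\<^esub> v \<in> S" and neg: "\<And>u. u \<in> S \<Longrightarrow> \<ominus>\<^bsub>R\<^esub> u \<in> S"
    and mul: "\<And>u a. u \<in> S \<Longrightarrow> a \<in> carrier R \<Longrightarrow> u \<otimes>\<^bsub>R\<^esub> a \<in> S"
  shows "right_module R (ring_copy R e S)"
proof -
  interpret ring R by fact
  have SR: "u \<in> S \<Longrightarrow> u \<in> carrier R" for u using S by blast
  have inv: "u \<in> carrier R \<Longrightarrow> inv_into (carrier R) e (e u) = u" for u using inv_into_f_f[OF e] by blast
  have "abelian_group (ring_copy R e S)"
  proof (rule abelian_groupI)
    fix x assume "x \<in> carrier (ring_copy R e S)"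
    then obtain u where "u \<in> S" "x = e u" by auto
    then show "\<exists>y\<in>carrier (ring_copy R e S). y \<oplus>\<^bsub>ring_copy R e S\<^esub> x = \<zero>\<^bsub>ring_copy R e S\<^esub>"
      using neg by (intro bexI[of _ "e (\<ominus>\<^bsub>R\<^esub> u)"]) (auto simp: inv SR l_neg)
  qed (use S add in \<open>auto simp: inv SR a_ac\<close>)
  then show ?thesis
    unfolding right_module_def right_module_axioms_def
    using mul add by (auto simp: assms(1) inv SR r_distr l_distr m_assoc)
qed

text \<open>Replacing each \<open>x\<close> by \<open>k x\<close> times one fixed \<open>m\<close>
  collapses a combination, up to additivity, to a single multiple of \<open>m\<close>; the
  coefficient is the combination evaluated at \<open>k\<close> in the ring. If that value is zero,
  the substitution trivialises \<open>z\<close>.\<close>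

lemma lsubst_single:
  assumes M: "ring R" and k: "k \<in> X \<rightarrow> carrier R" and m: "m \<in> X'" and z: "z \<in> FA R X"
  shows "lsubst R (\<lambda>x. frag_of (k x, m)) z - frag_of (lev (regular_bimodule R) k z, m) \<in> linspan R X' {}"
proof -
  interpret ring R by fact
  interpret Reg: left_module R "regular_bimodule R" by (rule bimodule_left[OF bimodule_regular[OF M]])
  have k': "k \<in> X \<rightarrow> carrier (regular_bimodule R)" using k by simp
  show ?thesis using z
  proof (induction rule: frags_induct)
    case zero
    then show ?case using addspan_uminus[OF zero_addspan[OF m]] by (simp add: linspan_empty)
  next
    case (of p)
    then obtain a x where p: "p = (a, x)" "a \<in> carrier R" "x \<in> X" by auto
    have kx: "k x \<in> carrier R" using k p by auto
    then have "lev (regular_bimodule R) k (frag_of (a, x)) = a \<otimes>\<^bsub>R\<^esub> k x"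
      using p by (subst Reg.lev_of) auto
    then show ?case using p by (simp add: linspan_0)
  next
    case (diff z w)
    let ?l = "lev (regular_bimodule R) k"
    have c: "?l z \<in> carrier R" "?l w \<in> carrier R" using Reg.lev_closed[OF k'] diff by auto
    have l: "?l (z - w) = ?l z \<ominus>\<^bsub>R\<^esub> ?l w"
      using Reg.lev_diff[OF k' diff(1,2)] c by (simp add: minus_regular)
    have "frag_of (?l z \<ominus>\<^bsub>R\<^esub> ?l w, m) - (frag_of (?l z, m) - frag_of (?l w, m)) \<in> linspan R X' {}"
      unfolding linspan_empty by (rule diff_addspan[OF c m])
    from linspan_diff[OF linspan_diff[OF diff(3,4)] this] show ?case
      unfolding l by (simp add: lsubst_diff algebra_simps)
  qed
qed

text \<open>Let \<open>a x\<close> be the coefficients of the relation \<open>h\<close> and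
  \<open>I\<close> the right ideal they generate. The sum of the tensors \<open>a x\<close> with
  \<open>x\<close> vanishes over the ring, hence over \<open>I\<close> by flatness. Functions
  \<open>c\<close> map onto \<open>I\<close> by sending \<open>c\<close> to the sum of
  \<open>a x\<close> times \<open>c x\<close>; with \<open>K\<close> the kernel of this map, the
  vanishing over \<open>I\<close> writes every relevant \<open>x\<close> as a sum of terms
  \<open>k x\<close> times \<open>m\<close>, where the pairs of \<open>k\<close> in \<open>K\<close>
  and \<open>m\<close> in \<open>M\<close> do not depend on \<open>x\<close>. Substituting this sum
  for \<open>x\<close> trivialises \<open>h\<close>.\<close>

lemma single_relation:
  fixes \<kappa> :: "'u rel" and e :: "'a \<Rightarrow> 'u"
  assumes M: "left_module R M" and flat: "flat_module \<kappa> R M"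
    and e: "inj_on e (carrier R)" and sm: "small \<kappa> (carrier R)"
    and h: "h \<in> lker R M" and X1: "finite X1" "X1 \<subseteq> carrier M"
  shows "\<exists>s. (\<forall>x\<in>carrier M. s x \<in> FA R (carrier M)) \<and> (\<forall>x\<in>X1. lev M (\<lambda>x. x) (s x) = x) \<and>
    lsubst R s h \<in> linspan R (carrier M) {}"
proof -
  have R: "ring R" using M by (simp add: left_module_def)
  interpret R: ring R by (rule R)
  interpret M: left_module R M by fact
  interpret Reg: left_module R "regular_bimodule R" by (rule bimodule_left[OF bimodule_regular[OF R]])
  let ?F = "FA R (carrier M)" and ?Z = "linspan R (carrier M) {}"
  let ?l = "\<lambda>c. lev (regular_bimodule R) c h"
  have hF: "h \<in> ?F" and h0: "lev M (\<lambda>x. x) h = \<zero>\<^bsub>M\<^esub>" using h by (auto simp: lker_def)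
  have id: "(\<lambda>x. x) \<in> carrier M \<rightarrow> carrier M" by simp
  have lc: "?l c \<in> carrier R" if "c \<in> carrier M \<rightarrow> carrier R" for c
    using Reg.lev_closed[of c "carrier M" h] that hF by simp
  have ldiff: "?l (\<lambda>x. c x \<ominus>\<^bsub>R\<^esub> c' x) = ?l c \<ominus>\<^bsub>R\<^esub> ?l c'"
    if "c \<in> carrier M \<rightarrow> carrier R" "c' \<in> carrier M \<rightarrow> carrier R" for c c'
  proof -
    have "?l (\<lambda>x. c x \<ominus>\<^bsub>R\<^esub> c' x) = ?l (\<lambda>x. c x \<ominus>\<^bsub>regular_bimodule R\<^esub> c' x)"
      by (rule Reg.lev_cong[OF hF, symmetric]) (use that in \<open>auto simp: R.minus_regular Pi_iff\<close>)
    also have "\<dots> = ?l c \<ominus>\<^bsub>R\<^esub> ?l c'"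
      using Reg.lev_fun_hom[of c "carrier M" c' h] that hF R.minus_regular[OF lc[OF that(1)] lc[OF that(2)]] by simp
    finally show ?thesis .
  qed
  have lmul: "?l (\<lambda>x. c x \<otimes>\<^bsub>R\<^esub> a) = ?l c \<otimes>\<^bsub>R\<^esub> a" if c: "c \<in> carrier M \<rightarrow> carrier R" and a: "a \<in> carrier R" for c a
  proof -
    have "(\<lambda>b. b \<otimes>\<^bsub>R\<^esub> a) \<in> lmod_hom R (regular_bimodule R) (regular_bimodule R)"
      using a by (auto simp: lmod_hom_def add_hom_def R.l_distr R.m_assoc)
    from lmod_hom_lev[OF Reg.left_module_axioms Reg.left_module_axioms this, of c "carrier M" h] show ?thesis
      using c hF by simp
  qed
  \<comment> \<open>The values of \<open>?l\<close> form the right ideal generated by the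
    coefficients of \<open>h\<close>; the function supplies the right factors.\<close>
  define I where "I = ?l ` (carrier M \<rightarrow> carrier R)"
  \<comment> \<open>A mere section of the map from functions onto \<open>I\<close>. It need not be
    additive, but its defects are functions killed by \<open>?l\<close>.\<close>
  define lift where "lift v = (SOME c. c \<in> carrier M \<rightarrow> carrier R \<and> ?l c = v)" for v
  have lift: "lift v \<in> carrier M \<rightarrow> carrier R" "?l (lift v) = v" if "v \<in> I" for v
  proof -
    have "\<exists>c. c \<in> carrier M \<rightarrow> carrier R \<and> ?l c = v" using that by (auto simp: I_def)
    from someI_ex[OF this] show "lift v \<in> carrier M \<rightarrow> carrier R" "?l (lift v) = v" unfolding lift_def by blast+
  qed
  have IR: "I \<subseteq> carrier R" using lc by (auto simp: I_def)
  have zc: "(\<lambda>_. \<zero>\<^bsub>R\<^esub>) \<in> carrier M \<rightarrow> carrier R" by simp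
  have l0: "?l (\<lambda>_. \<zero>\<^bsub>R\<^esub>) = \<zero>\<^bsub>R\<^esub>"
    using ldiff[OF zc zc] lc[OF zc] by (simp add: a_minus_def R.r_neg)
  have Idiff: "u \<ominus>\<^bsub>R\<^esub> v \<in> I" if "u \<in> I" "v \<in> I" for u v
    unfolding I_def using ldiff[OF lift(1)[OF that(1)] lift(1)[OF that(2)]] lift[OF that(1)] lift[OF that(2)]
    by (intro image_eqI[of _ _ "\<lambda>x. lift u x \<ominus>\<^bsub>R\<^esub> lift v x"]) auto
  have I0: "\<zero>\<^bsub>R\<^esub> \<in> I" unfolding I_def using l0 zc by (intro image_eqI[of _ _ "\<lambda>_. \<zero>\<^bsub>R\<^esub>"]) auto
  have Ineg: "\<ominus>\<^bsub>R\<^esub> u \<in> I" if "u \<in> I" for u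
    using Idiff[OF I0 that] IR that by (auto simp: a_minus_def)
  have Iadd: "u \<oplus>\<^bsub>R\<^esub> v \<in> I" if "u \<in> I" "v \<in> I" for u v
  proof -
    have "u \<in> carrier R" "v \<in> carrier R" using IR that by auto
    then show ?thesis using Idiff[OF that(1) Ineg[OF that(2)]] by (simp add: a_minus_def)
  qed
  have Imul: "u \<otimes>\<^bsub>R\<^esub> a \<in> I" if "u \<in> I" "a \<in> carrier R" for u a
    unfolding I_def using lmul[OF lift(1)[OF that(1)] that(2)] lift[OF that(1)] that(2)
    by (intro image_eqI[of _ _ "\<lambda>x. lift u x \<otimes>\<^bsub>R\<^esub> a"]) auto
  let ?X = "ring_copy R e I" and ?Y = "ring_copy R e (carrier R)"
  have X: "right_module R ?X" by (rule ring_copy_right_module[OF R e IR I0 Iadd Ineg Imul])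
  have Y: "right_module R ?Y" by (rule ring_copy_right_module[OF R e]) auto
  interpret PX: tensor_pair R ?X M by (rule tensor_pairI[OF X M])
  interpret PY: tensor_pair R ?Y M by (rule tensor_pairI[OF Y M])
  have f: "(\<lambda>x. x) \<in> rmod_hom R ?X ?Y" using IR by (auto simp: rmod_hom_def add_hom_def)
  have inj: "inj_on (tensor_map R ?Y M (\<lambda>x. x) (\<lambda>m. m)) (carrier (tensor R ?X M))"
    using flat[unfolded flat_module_def, rule_format, of ?X ?Y "\<lambda>x. x"] X Y f small_image[OF sm, of e]
      small_image[OF small_subset[OF sm IR], of e] by simp
  let ?i = "inv_into (carrier R) e"
  have ie: "u \<in> carrier R \<Longrightarrow> ?i (e u) = u" for u using inv_into_f_f[OF e] by blast
  have iX: "?i u \<in> I" if "u \<in> carrier ?X" for u using that IR ie by auto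

  \<comment> \<open>\<open>Q u\<close> says that the family \<open>u\<close> of elements of
    \<open>M\<close> is represented by a substitution that trivialises \<open>h\<close>. Such
    families are closed under differences, contain those coming from the kernel of \<open>?l\<close>
    by \<open>Q1\<close>, and the aim is to reach the identity family on \<open>?S\<close>.\<close>
  define Q where "Q u \<longleftrightarrow> (\<exists>s. (\<forall>x\<in>carrier M. s x \<in> ?F) \<and> lsubst R s h \<in> ?Z \<and> (\<forall>x\<in>carrier M. lev M (\<lambda>x. x) (s x) = u x))" for u
  have Qdiff: "Q (\<lambda>x. u x \<ominus>\<^bsub>M\<^esub> v x)" if "Q u" "Q v" for u v
  proof -
    obtain s where s: "\<forall>x\<in>carrier M. s x \<in> ?F" "lsubst R s h \<in> ?Z" "\<forall>x\<in>carrier M. lev M (\<lambda>x. x) (s x) = u x"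
      using \<open>Q u\<close> unfolding Q_def by blast
    obtain s' where s': "\<forall>x\<in>carrier M. s' x \<in> ?F" "lsubst R s' h \<in> ?Z" "\<forall>x\<in>carrier M. lev M (\<lambda>x. x) (s' x) = v x"
      using \<open>Q v\<close> unfolding Q_def by blast
    have "lsubst R (\<lambda>x. s x - s' x) h = lsubst R s h - lsubst R s' h"
      using hF by (induction rule: frags_induct) (auto simp: lsubst_diff lsm_diff)
    then have "lsubst R (\<lambda>x. s x - s' x) h \<in> ?Z" using s s' linspan_diff by metis
    moreover have "\<forall>x\<in>carrier M. s x - s' x \<in> ?F" using s s' by auto
    moreover have "\<forall>x\<in>carrier M. lev M (\<lambda>x. x) (s x - s' x) = u x \<ominus>\<^bsub>M\<^esub> v x"
      using s s' M.lev_diff[OF id] by simp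
    ultimately show ?thesis unfolding Q_def by (intro exI[of _ "\<lambda>x. s x - s' x"]) blast
  qed
  have Qcong: "Q v" if "Q u" "\<And>x. x \<in> carrier M \<Longrightarrow> v x = u x" for u v
    using that unfolding Q_def by (metis (no_types, lifting))
  have Q0: "Q (\<lambda>_. \<zero>\<^bsub>M\<^esub>)" unfolding Q_def
  proof (intro exI conjI ballI)
    show "lsubst R (\<lambda>_. 0) h \<in> ?Z" by (simp add: lsubst_zero[OF hF] linspan_0)
  qed auto
  have Qc: "u x \<in> carrier M" if "Q u" "x \<in> carrier M" for u x
    using that M.lev_closed[OF id] unfolding Q_def by metis
  have Qadd: "Q (\<lambda>x. u x \<oplus>\<^bsub>M\<^esub> v x)" if u: "Q u" and v: "Q v" for u v
    using Qcong[OF Qdiff[OF u Qdiff[OF Q0 v]], of "\<lambda>x. u x \<oplus>\<^bsub>M\<^esub> v x"] Qc[OF u] Qc[OF v]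
    by (simp add: a_minus_def)
  have Q1: "Q (\<lambda>x. k x \<odot>\<^bsub>M\<^esub> m)" if k: "k \<in> carrier M \<rightarrow> carrier R" and k0: "?l k = \<zero>\<^bsub>R\<^esub>" and m: "m \<in> carrier M" for k m
  proof -
    have "lsubst R (\<lambda>x. frag_of (k x, m)) h - frag_of (\<zero>\<^bsub>R\<^esub>, m) \<in> ?Z"
      using lsubst_single[OF R k m hF] k0 by simp
    moreover have "frag_of (\<zero>\<^bsub>R\<^esub>, m) \<in> ?Z" using R.zero_addspan[OF m] by (simp add: linspan_empty)
    ultimately have "lsubst R (\<lambda>x. frag_of (k x, m)) h \<in> ?Z" using linspan_add by fastforce
    then show ?thesis unfolding Q_def using k m
      by (intro exI[of _ "\<lambda>x. frag_of (k x, m)"]) (auto simp: Pi_iff M.lev_of)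
  qed

  \<comment> \<open>A tensor of \<open>v\<close> in \<open>I\<close> with \<open>m\<close> is sent
    to the family with value \<open>lift v x\<close> times \<open>m\<close> at \<open>x\<close>. On
    the tensor product this is determined only up to families in \<open>Q\<close>, since
    \<open>lift\<close> is a mere section.\<close>
  define V where "V w x = ev M (\<lambda>p. lift (?i (fst p)) x \<odot>\<^bsub>M\<^esub> snd p) w" for w x
  have lx: "lift v x \<in> carrier R" if "v \<in> I" "x \<in> carrier M" for v x using lift(1) that by blast
  have Vf: "(\<lambda>p. lift (?i (fst p)) x \<odot>\<^bsub>M\<^esub> snd p) \<in> carrier ?X \<times> carrier M \<rightarrow> carrier M" if "x \<in> carrier M" for x
    using that lx iX by (intro funcsetI) (auto simp: mem_Times_iff intro!: M.smult_closed simp del: ring_copy_simps)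
  \<comment> \<open>For additivity in \<open>I\<close> and for balancing, the defect of
    \<open>lift\<close> is a function \<open>?k\<close> killed by \<open>?l\<close>, so
    \<open>Q1\<close> applies; additivity in \<open>M\<close> is respected exactly.\<close>
  have Vrel: "Q (V s)" if s: "s \<in> tensor_rels R ?X M" for s
    using s
  proof (cases rule: tensor_rels_cases)
    case (left u u' y)
    obtain v v' where v: "v \<in> I" "u = e v" "v' \<in> I" "u' = e v'" using left by auto
    have vR: "v \<in> carrier R" "v' \<in> carrier R" using v IR by auto
    let ?k = "\<lambda>x. lift (v \<oplus>\<^bsub>R\<^esub> v') x \<ominus>\<^bsub>R\<^esub> lift v x \<ominus>\<^bsub>R\<^esub> lift v' x"
    have k: "(\<lambda>x. lift (v \<oplus>\<^bsub>R\<^esub> v') x \<ominus>\<^bsub>R\<^esub> lift v x) \<in> carrier M \<rightarrow> carrier R" "?k \<in> carrier M \<rightarrow> carrier R"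
      using lx Iadd v by auto
    have "?l ?k = (v \<oplus>\<^bsub>R\<^esub> v') \<ominus>\<^bsub>R\<^esub> v \<ominus>\<^bsub>R\<^esub> v'"
      using ldiff[OF k(1) lift(1)[OF v(3)]] ldiff[OF lift(1)[OF Iadd[OF v(1,3)]] lift(1)[OF v(1)]] lift(2) v Iadd by simp
    then have "?l ?k = \<zero>\<^bsub>R\<^esub>" using R.add_minus_minus vR by simp
    from Q1[OF k(2) this left(4)] show ?thesis
    proof (rule Qcong)
      fix x assume x: "x \<in> carrier M"
      have c: "lift v x \<in> carrier R" "lift v' x \<in> carrier R" "lift (v \<oplus>\<^bsub>R\<^esub> v') x \<in> carrier R" using lx v x Iadd by auto
      show "V s x = ?k x \<odot>\<^bsub>M\<^esub> y"
        unfolding V_def left(1) using c v vR left(4) x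
        by (subst M.ev_frag_diff2)
          (auto simp: ie M.smult_closed add_hom_diff[OF R.abelian_group_axioms M.M.abelian_group_axioms M.smult_ladd_hom])
    qed
  next
    case (right u y y')
    obtain v where v: "v \<in> I" "u = e v" using right by auto
    have vR: "v \<in> carrier R" using v IR by auto
    show ?thesis
    proof (rule Qcong[OF Q0])
      fix x assume x: "x \<in> carrier M"
      show "V s x = \<zero>\<^bsub>M\<^esub>" unfolding V_def right(1) using v vR lx[OF v(1) x] right
        by (intro M.ev_frag_diff2_zero) (auto simp: ie M.smult_r_distr M.smult_closed)
    qed
  next
    case (mid u a y)
    obtain v where v: "v \<in> I" "u = e v" using mid by auto
    have vR: "v \<in> carrier R" using v IR by auto
    let ?k = "\<lambda>x. lift (v \<otimes>\<^bsub>R\<^esub> a) x \<ominus>\<^bsub>R\<^esub> lift v x \<otimes>\<^bsub>R\<^esub> a"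
    have k: "(\<lambda>x. lift v x \<otimes>\<^bsub>R\<^esub> a) \<in> carrier M \<rightarrow> carrier R" "?k \<in> carrier M \<rightarrow> carrier R"
      using lx Imul v mid by auto
    have "?l ?k = (v \<otimes>\<^bsub>R\<^esub> a) \<ominus>\<^bsub>R\<^esub> (v \<otimes>\<^bsub>R\<^esub> a)"
      using ldiff[OF lift(1)[OF Imul[OF v(1) mid(3)]] k(1)] lmul[OF lift(1)[OF v(1)] mid(3)] lift(2) v Imul mid by simp
    then have "?l ?k = \<zero>\<^bsub>R\<^esub>" using vR mid by (simp add: a_minus_def R.r_neg)
    from Q1[OF k(2) this mid(4)] show ?thesis
    proof (rule Qcong)
      fix x assume x: "x \<in> carrier M"
      have c: "lift v x \<in> carrier R" "lift (v \<otimes>\<^bsub>R\<^esub> a) x \<in> carrier R" using lx v x Imul mid by auto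
      show "V s x = ?k x \<odot>\<^bsub>M\<^esub> y"
        unfolding V_def mid(1) using c v vR mid x
        by (subst M.ev_frag_diff)
          (auto simp: ie M.smult_closed M.smult_assoc add_hom_diff[OF R.abelian_group_axioms M.M.abelian_group_axioms M.smult_ladd_hom])
    qed
  qed
  have relF: "s \<in> PX.TT" if "s \<in> tensor_rels R ?X M" for s using that PX.tensor_rels_frags by blast
  have Vadd: "V (z + w) x = V z x \<oplus>\<^bsub>M\<^esub> V w x" if "z \<in> PX.TT" "w \<in> PX.TT" "x \<in> carrier M" for z w x
    unfolding V_def by (rule M.ev_add[OF that(1,2) Vf[OF that(3)]])
  have Vdiff: "V (z - w) x = V z x \<ominus>\<^bsub>M\<^esub> V w x" if "z \<in> PX.TT" "w \<in> PX.TT" "x \<in> carrier M" for z w x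
    unfolding V_def by (rule M.ev_diff[OF that(1,2) Vf[OF that(3)]])
  have Vker: "Q (V w)" if "w \<in> tensor_ker R ?X M" for w
    using that unfolding PX.tensor_ker_eq
  proof induction
    case zero show ?case by (rule Qcong[OF Q0]) (simp add: V_def)
  next
    case (plus z s)
    have "z \<in> PX.TT" using plus.hyps addspan_frags[OF PX.tensor_rels_frags] by blast
    then show ?case using Vadd relF plus.hyps by (intro Qcong[OF Qadd[OF plus.IH Vrel[OF plus.hyps(2)]]]) auto
  next
    case (minus z s)
    have "z \<in> PX.TT" using minus.hyps addspan_frags[OF PX.tensor_rels_frags] by blast
    then show ?case using Vdiff relF minus.hyps by (intro Qcong[OF Qdiff[OF minus.IH Vrel[OF minus.hyps(2)]]]) auto
  qed
  let ?H = "\<lambda>x. R.coord x h"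
  let ?\<delta> = "\<lambda>x y. if y = x then \<one>\<^bsub>R\<^esub> else \<zero>\<^bsub>R\<^esub>"
  have H\<delta>: "?H x = ?l (?\<delta> x)" for x
  proof -
    have "ev R (\<lambda>p. if snd p = x then fst p else \<zero>\<^bsub>R\<^esub>) h = ev R (\<lambda>p. fst p \<otimes>\<^bsub>R\<^esub> ?\<delta> x (snd p)) h"
      by (rule R.ev_cong[OF hF]) auto
    moreover have "(\<lambda>p. fst p \<otimes>\<^bsub>R\<^esub> ?\<delta> x (snd p)) \<in> carrier R \<times> carrier M \<rightarrow> carrier R" by auto
    ultimately show ?thesis using R.ev_regular[OF hF, of "\<lambda>p. fst p \<otimes>\<^bsub>R\<^esub> ?\<delta> x (snd p)"] by (simp add: R.coord_def lev_def)
  qed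
  have \<delta>: "?\<delta> x \<in> carrier M \<rightarrow> carrier R" for x by auto
  have HI: "?H x \<in> I" for x unfolding H\<delta> I_def using \<delta> by blast
  have HR: "?H x \<in> carrier R" for x using HI IR by blast
  \<comment> \<open>The tensors of coefficient with element, summed over \<open>S\<close>: the sum
    that vanishes over the ring because \<open>h\<close> is a relation, and over \<open>I\<close> by
    flatness.\<close>
  let ?w = "\<lambda>S. \<Sum>x\<in>S. frag_of (e (?H x), x)"
  have wX: "?w S \<in> PX.TT" if "S \<subseteq> carrier M" for S
    by (rule frags_sum) (use that HI in auto)
  have step: "Q (\<lambda>y. V (?w S) y \<ominus>\<^bsub>M\<^esub> (if y \<in> S then y else \<zero>\<^bsub>M\<^esub>))" if "finite S" "S \<subseteq> carrier M" for S
    using that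
  proof (induction S rule: finite_induct)
    case empty
    show ?case by (rule Qcong[OF Q0]) (simp add: V_def a_minus_def)
  next
    case (insert x S)
    have xM: "x \<in> carrier M" and SM: "S \<subseteq> carrier M" using insert by auto
    \<comment> \<open>\<open>lift (?H x)\<close> and the indicator of \<open>x\<close> have the same
      image \<open>?H x\<close> in \<open>I\<close>, so their difference is killed by
      \<open>?l\<close>. Up to \<open>Q\<close> the lift may thus be replaced by the indicator,
      which turns \<open>V (?w S)\<close> into the identity on \<open>S\<close>.\<close>
    let ?k = "\<lambda>y. lift (?H x) y \<ominus>\<^bsub>R\<^esub> ?\<delta> x y"
    have k: "?k \<in> carrier M \<rightarrow> carrier R" using lx[OF HI] \<delta>[of x] by auto
    have "?l ?k = ?H x \<ominus>\<^bsub>R\<^esub> ?H x" using ldiff[OF lift(1)[OF HI] \<delta>] lift(2)[OF HI] H\<delta> by simp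
    then have k0: "?l ?k = \<zero>\<^bsub>R\<^esub>" using HR by (simp add: a_minus_def R.r_neg)
    from Qadd[OF Q1[OF k k0 xM] insert.IH[OF SM]] show ?case
    proof (rule Qcong)
      fix y assume y: "y \<in> carrier M"
      let ?A = "lift (?H x) y \<odot>\<^bsub>M\<^esub> x" and ?B = "V (?w S) y"
      have c: "lift (?H x) y \<in> carrier R" using lx[OF HI y] .
      have cA: "?A \<in> carrier M" using c xM by (rule M.smult_closed)
      have cB: "?B \<in> carrier M" unfolding V_def by (rule M.ev_closed[OF wX[OF SM] Vf[OF y]])
      have f1: "frag_of (e (?H x), x) \<in> PX.TT" using HI xM by auto
      have "V (?w (insert x S)) y = V (frag_of (e (?H x), x)) y \<oplus>\<^bsub>M\<^esub> ?B"
        using insert(1,2) Vadd[OF f1 wX[OF SM] y] by simp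
      also have "V (frag_of (e (?H x), x)) y = ?A"
        unfolding V_def using HR cA by (subst M.ev_of) (auto simp: ie)
      finally have E: "V (?w (insert x S)) y = ?A \<oplus>\<^bsub>M\<^esub> ?B" .
      show "V (?w (insert x S)) y \<ominus>\<^bsub>M\<^esub> (if y \<in> insert x S then y else \<zero>\<^bsub>M\<^esub>) =
         ?k y \<odot>\<^bsub>M\<^esub> x \<oplus>\<^bsub>M\<^esub> (?B \<ominus>\<^bsub>M\<^esub> (if y \<in> S then y else \<zero>\<^bsub>M\<^esub>))"
      proof (cases "y = x")
        case True
        have "?k y \<odot>\<^bsub>M\<^esub> x = ?A \<ominus>\<^bsub>M\<^esub> x"
          using True c xM add_hom_diff[OF R.abelian_group_axioms M.M.abelian_group_axioms M.smult_ladd_hom[OF xM] c R.one_closed]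
          by (simp add: M.smult_one)
        then show ?thesis unfolding E using True insert(2) cA cB xM by (simp add: a_minus_def M.a_ac)
      next
        case False
        have "?k y \<odot>\<^bsub>M\<^esub> x = ?A" using False c by (simp add: a_minus_def)
        then show ?thesis unfolding E using False cA cB y by (auto simp: a_minus_def M.a_ac)
      qed
    qed
  qed
  \<comment> \<open>The support of \<open>h\<close> is included so that \<open>h\<close> has its
    normal form over \<open>?S\<close>, and \<open>X1\<close> because its elements have to be
    represented. Outside \<open>?S\<close> the family is zero.\<close>
  let ?S = "snd ` Poly_Mapping.keys h \<union> X1"
  have S: "finite ?S" "?S \<subseteq> carrier M" using X1 frags_snd_keys(2)[OF hF] by auto
  have hS: "h \<in> FA R ?S" using frags_snd_keys(1)[OF hF] frags_mono[of "carrier R \<times> snd ` Poly_Mapping.keys h" "carrier R \<times> ?S"] by auto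
  have wker: "?w ?S \<in> tensor_ker R ?X M"
  proof -
    let ?n = "\<Sum>x\<in>?S. frag_of (?H x, x)"
    have nF: "?n \<in> ?F" by (rule frags_sum) (use S HR in auto)
    have "h - ?n \<in> ?Z" unfolding linspan_empty by (rule R.normal_form[OF S hS])
    then have "lev M (\<lambda>x. x) (h - ?n) = \<zero>\<^bsub>M\<^esub>" using M.lev_linspan[OF id, of "{}"] by simp
    then have n0: "lev M (\<lambda>x. x) ?n = \<zero>\<^bsub>M\<^esub>"
      using M.lev_diff[OF id hF nF] h0 M.lev_closed[OF id nF] by (simp add: a_minus_def)
    have r: "rmulf ?Y (e \<one>\<^bsub>R\<^esub>) (\<Sum>x\<in>S. frag_of (?H x, x)) = ?w S" if "finite S" for S
      using that by (induction S rule: finite_induct) (auto simp: rmulf_add ie HR)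
    have t: "(\<lambda>m. tens R ?Y M (e \<one>\<^bsub>R\<^esub>) m) \<in> add_hom M PY.T" using PY.tens_add_right PY.tens_closed by (simp add: add_hom_def)
    have "tcls R ?Y M (?w ?S) = tens R ?Y M (e \<one>\<^bsub>R\<^esub>) \<zero>\<^bsub>M\<^esub>"
      using tcls_rmulf[OF Y M, of "e \<one>\<^bsub>R\<^esub>" ?n] nF n0 r[OF S(1)] by simp
    also have "\<dots> = tcls R ?Y M 0"
      using add_hom_zero[OF M.M.abelian_group_axioms PY.tensor_ab_group t] by (simp add: PY.zero_tensor_ab)
    finally have "tensor_map R ?Y M (\<lambda>x. x) (\<lambda>m. m) (tcls R ?X M (?w ?S)) = tensor_map R ?Y M (\<lambda>x. x) (\<lambda>m. m) (tcls R ?X M 0)"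
      using tensor_map_tcls[OF PX.tensor_pair_axioms PY.tensor_pair_axioms f lmod_hom_id wX[OF S(2)]]
        tensor_map_tcls[OF PX.tensor_pair_axioms PY.tensor_pair_axioms f lmod_hom_id frags_0] by (simp add: tmapf_ident)
    then have "tcls R ?X M (?w ?S) = tcls R ?X M 0"
      using inj_onD[OF inj] PX.tcls_closed[OF wX[OF S(2)]] PX.tcls_closed[OF frags_0] by simp
    then show ?thesis by (simp add: PX.tcls_eq_iff)
  qed
  have "Q (\<lambda>y. if y \<in> ?S then y else \<zero>\<^bsub>M\<^esub>)"
  proof (rule Qcong[OF Qdiff[OF Vker[OF wker] step[OF S]]])
    fix y assume y: "y \<in> carrier M"
    have "V (?w ?S) y \<in> carrier M" using Qc[OF Vker[OF wker] y] .
    then show "(if y \<in> ?S then y else \<zero>\<^bsub>M\<^esub>) = V (?w ?S) y \<ominus>\<^bsub>M\<^esub> (V (?w ?S) y \<ominus>\<^bsub>M\<^esub> (if y \<in> ?S then y else \<zero>\<^bsub>M\<^esub>))"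
      using y by (simp add: a_minus_def M.minus_add M.a_assoc[symmetric] M.r_neg)
  qed
  then show ?thesis unfolding Q_def using X1 by (elim exE conjE) (rule exI, intro conjI; fastforce)
qed

text \<open>Relations are trivialised one after another. A substitution for the earlier ones turns
  the next relation \<open>g\<close> into a relation \<open>lsubst R s g\<close>; a second
  substitution trivialises this one, and the composite keeps the earlier ones trivial because
  substitution preserves triviality.\<close>

theorem flat_imp_eqflat:
  fixes \<kappa> :: "'u rel" and e :: "'a \<Rightarrow> 'u"
  assumes M: "left_module R M" and flat: "flat_module \<kappa> R M"
    and e: "inj_on e (carrier R)" and sm: "small \<kappa> (carrier R)"
  shows "eqflat R M"
  unfolding eqflat_def
proof (intro allI impI; elim conjE)
  fix G0 X0 assume G0: "finite G0" "G0 \<subseteq> lker R M" and X0: "finite X0" "X0 \<subseteq> carrier M"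
  interpret M: left_module R M by fact
  let ?F = "FA R (carrier M)" and ?Z = "linspan R (carrier M) {}"
  have id: "(\<lambda>x. x) \<in> carrier M \<rightarrow> carrier M" by simp
  show "\<exists>s. (\<forall>x\<in>carrier M. s x \<in> ?F) \<and> (\<forall>x\<in>X0. lev M (\<lambda>x. x) (s x) = x) \<and> (\<forall>g\<in>G0. lsubst R s g \<in> ?Z)"
    using G0 X0
  proof (induction G0 arbitrary: X0 rule: finite_induct)
    case empty
    show ?case by (intro exI[of _ "\<lambda>x. frag_of (\<one>\<^bsub>R\<^esub>, x)"]) (use empty in \<open>auto simp: M.lev_of M.smult_one\<close>)
  next
    case (insert g G0)
    have gF: "g \<in> ?F" and g0: "lev M (\<lambda>x. x) g = \<zero>\<^bsub>M\<^esub>" using insert by (auto simp: lker_def)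
    \<comment> \<open>The generators of \<open>g\<close> are added because \<open>s\<close> must
      represent them for \<open>lsubst R s g\<close> to evaluate to zero again.\<close>
    let ?X = "X0 \<union> snd ` Poly_Mapping.keys g"
    have "finite ?X" "?X \<subseteq> carrier M" using insert frags_snd_keys(2)[OF gF] by auto
    then obtain s where s: "\<forall>x\<in>carrier M. s x \<in> ?F" "\<forall>x\<in>?X. lev M (\<lambda>x. x) (s x) = x" "\<forall>g\<in>G0. lsubst R s g \<in> ?Z"
      using insert.IH[of ?X] insert.prems by blast
    have sF: "\<And>x. x \<in> carrier M \<Longrightarrow> s x \<in> ?F" using s by blast
    let ?h = "lsubst R s g"
    have hF: "?h \<in> ?F" by (rule M.lsubst_frags[OF gF sF])
    have "lev M (\<lambda>x. x) ?h = lev M (\<lambda>x. lev M (\<lambda>x. x) (s x)) g" by (rule M.lev_lsubst[OF id sF gF])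
    also have "\<dots> = lev M (\<lambda>x. x) g"
      using s(2) insert(4,5) frags_snd_keys[OF gF] by (intro M.lev_cong[of _ "snd ` Poly_Mapping.keys g"]) auto
    finally have h: "?h \<in> lker R M" using hF g0 by (simp add: lker_def)
    \<comment> \<open>The generators used in rewriting \<open>X0\<close>; the second substitution
      must represent these for the composite to represent \<open>X0\<close>.\<close>
    let ?X1 = "\<Union>x\<in>X0. snd ` Poly_Mapping.keys (s x)"
    have fX1: "finite ?X1" using insert by auto
    have sX1: "?X1 \<subseteq> carrier M" using frags_snd_keys(2)[OF sF] insert.prems by blast
    from single_relation[OF M flat e sm h fX1 sX1] obtain s1 where s1: "\<forall>x\<in>carrier M. s1 x \<in> ?F" "\<forall>x\<in>?X1. lev M (\<lambda>x. x) (s1 x) = x" "lsubst R s1 ?h \<in> ?Z"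
      by (elim exE conjE) (rule that)
    have s1F: "\<And>x. x \<in> carrier M \<Longrightarrow> s1 x \<in> ?F" using s1 by blast
    let ?s = "\<lambda>x. lsubst R s1 (s x)"
    have 1: "\<forall>x\<in>carrier M. ?s x \<in> ?F" by (intro ballI) (rule M.lsubst_frags[OF sF s1F])
    have 2: "lev M (\<lambda>x. x) (?s x) = x" if x: "x \<in> X0" for x
    proof -
      have xM: "x \<in> carrier M" using x insert.prems by blast
      have "lev M (\<lambda>x. x) (?s x) = lev M (\<lambda>x. lev M (\<lambda>x. x) (s1 x)) (s x)" by (rule M.lev_lsubst[OF id s1F sF[OF xM]])
      also have "\<dots> = lev M (\<lambda>x. x) (s x)"
        using s1(2) x frags_snd_keys[OF sF[OF xM]] by (intro M.lev_cong[of _ "snd ` Poly_Mapping.keys (s x)"]) auto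
      also have "\<dots> = x" using s(2) x by simp
      finally show ?thesis .
    qed
    have 3: "lsubst R ?s g' \<in> ?Z" if g': "g' \<in> insert g G0" for g'
    proof -
      have g'F: "g' \<in> ?F" using g' insert.prems by (auto simp: lker_def)
      have e1: "lsubst R ?s g' = lsubst R s1 (lsubst R s g')" by (rule M.lsubst_lsubst[OF g'F sF s1F, symmetric])
      show ?thesis
      proof (cases "g' = g")
        case True then show ?thesis using s1(3) e1 by simp
      next
        case False
        then have "lsubst R s g' \<in> ?Z" using s(3) g' by simp
        then show ?thesis unfolding e1 by (rule M.lsubst_linspan[OF _ empty_subsetI empty_subsetI s1F]) simp_all
      qed
    qed
    have "\<forall>x\<in>X0. lev M (\<lambda>x. x) (?s x) = x" by (intro ballI 2)
    moreover have "\<forall>g\<in>insert g G0. lsubst R ?s g \<in> ?Z" by (intro ballI 3)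
    ultimately show ?case using 1 by (intro exI[of _ ?s] conjI)
  qed
qed

section \<open>Directed colimits of comodules\<close>

text \<open>The element conditions of \<open>dirlim\<close> with a bare set as target. They force
  the module structure on the set, and for comodules the coaction, which is how colimits are
  constructed.\<close>

locale setlim = dirsys I r R D d for I :: "'i set" and r and R :: "('a, 'r) ring_scheme"
    and D :: "'i \<Rightarrow> ('a, 'n, 'y) module_scheme" and d +
  fixes S :: "'l set" and \<iota> :: "'i \<Rightarrow> 'n \<Rightarrow> 'l"
  assumes \<iota>_in: "i \<in> I \<Longrightarrow> x \<in> carrier (D i) \<Longrightarrow> \<iota> i x \<in> S"
    and \<iota>_comp: "\<lbrakk>(i, j) \<in> r; x \<in> carrier (D i)\<rbrakk> \<Longrightarrow> \<iota> j (d i j x) = \<iota> i x"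
    and \<iota>_surj: "l \<in> S \<Longrightarrow> \<exists>i\<in>I. \<exists>y\<in>carrier (D i). \<iota> i y = l"
    and \<iota>_inj: "\<lbrakk>i \<in> I; x \<in> carrier (D i); y \<in> carrier (D i); \<iota> i x = \<iota> i y\<rbrakk> \<Longrightarrow>
      \<exists>k. (i, k) \<in> r \<and> d i k x = d i k y"
begin

lemma \<iota>_meet:
  assumes "i \<in> I" "j \<in> I" "x \<in> carrier (D i)" "y \<in> carrier (D j)" "\<iota> i x = \<iota> j y"
  shows "\<exists>k. (i, k) \<in> r \<and> (j, k) \<in> r \<and> d i k x = d j k y"
proof -
  obtain k where k: "(i, k) \<in> r" "(j, k) \<in> r" using upper assms by blast
  have kI: "k \<in> I" using r_I k by blast
  have c: "d i k x \<in> carrier (D k)" "d j k y \<in> carrier (D k)" using k d_closed assms by auto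
  have "\<iota> k (d i k x) = \<iota> k (d j k y)" using \<iota>_comp k assms by simp
  then obtain l where l: "(k, l) \<in> r" "d k l (d i k x) = d k l (d j k y)" using \<iota>_inj[OF kI c] by blast
  have "(i, l) \<in> r" "(j, l) \<in> r" using r_trans k l by blast+
  then show ?thesis using l(2) d_comp[OF k(1) l(1) assms(3)] d_comp[OF k(2) l(1) assms(4)] by auto
qed

lemma \<iota>_surj2:
  assumes "x \<in> S" "y \<in> S"
  shows "\<exists>i\<in>I. \<exists>x'\<in>carrier (D i). \<exists>y'\<in>carrier (D i). \<iota> i x' = x \<and> \<iota> i y' = y"
proof -
  obtain i x' where i: "i \<in> I" "x' \<in> carrier (D i)" "\<iota> i x' = x" using \<iota>_surj assms by blast
  obtain j y' where j: "j \<in> I" "y' \<in> carrier (D j)" "\<iota> j y' = y" using \<iota>_surj assms by blast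
  obtain k where k: "(i, k) \<in> r" "(j, k) \<in> r" using upper i j by blast
  show ?thesis
    using i j k d_closed \<iota>_comp r_I by (intro bexI[of _ k] bexI[of _ "d i k x'"] bexI[of _ "d j k y'"]) auto
qed

lemma \<iota>_surj3:
  assumes "x \<in> S" "y \<in> S" "z \<in> S"
  shows "\<exists>i\<in>I. \<exists>x'\<in>carrier (D i). \<exists>y'\<in>carrier (D i). \<exists>z'\<in>carrier (D i). \<iota> i x' = x \<and> \<iota> i y' = y \<and> \<iota> i z' = z"
proof -
  obtain i x' y' where i: "i \<in> I" "x' \<in> carrier (D i)" "\<iota> i x' = x" "y' \<in> carrier (D i)" "\<iota> i y' = y"
    using \<iota>_surj2 assms by blast
  obtain j z' where j: "j \<in> I" "z' \<in> carrier (D j)" "\<iota> j z' = z" using \<iota>_surj assms by blast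
  obtain k where k: "(i, k) \<in> r" "(j, k) \<in> r" using upper i j by blast
  show ?thesis
    using i j k d_closed \<iota>_comp r_I
    by (intro bexI[of _ k] bexI[of _ "d i k x'"] bexI[of _ "d i k y'"] bexI[of _ "d j k z'"]) auto
qed

definition lim_add where
  "lim_add x y = (SOME z. \<exists>i\<in>I. \<exists>x'\<in>carrier (D i). \<exists>y'\<in>carrier (D i). \<iota> i x' = x \<and> \<iota> i y' = y \<and> z = \<iota> i (x' \<oplus>\<^bsub>D i\<^esub> y'))"
definition lim_smult where
  "lim_smult a x = (SOME z. \<exists>i\<in>I. \<exists>x'\<in>carrier (D i). \<iota> i x' = x \<and> z = \<iota> i (a \<odot>\<^bsub>D i\<^esub> x'))"
definition lim_zero where
  "lim_zero = (SOME z. \<exists>i\<in>I. z = \<iota> i \<zero>\<^bsub>D i\<^esub>)"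

lemma add_closed': "i \<in> I \<Longrightarrow> x \<in> carrier (D i) \<Longrightarrow> y \<in> carrier (D i) \<Longrightarrow> x \<oplus>\<^bsub>D i\<^esub> y \<in> carrier (D i)"
  and zero_closed': "i \<in> I \<Longrightarrow> \<zero>\<^bsub>D i\<^esub> \<in> carrier (D i)"
  using D_mod by (auto simp: left_module_def abelian_groupE)

lemma smult_closed'': "i \<in> I \<Longrightarrow> a \<in> carrier R \<Longrightarrow> x \<in> carrier (D i) \<Longrightarrow> a \<odot>\<^bsub>D i\<^esub> x \<in> carrier (D i)"
  by (rule left_module.smult_closed[OF D_mod])

text \<open>Both pairs of preimages become equal at one common stage, and the sum formed there is
  the image of either sum. This makes the choice in \<open>lim_add\<close> harmless.\<close>

lemma add_unique:
  assumes i: "i \<in> I" "x \<in> carrier (D i)" "y \<in> carrier (D i)" and j: "j \<in> I" "x' \<in> carrier (D j)" "y' \<in> carrier (D j)"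
    and eq: "\<iota> i x = \<iota> j x'" "\<iota> i y = \<iota> j y'"
  shows "\<iota> i (x \<oplus>\<^bsub>D i\<^esub> y) = \<iota> j (x' \<oplus>\<^bsub>D j\<^esub> y')"
proof -
  obtain k where k: "(i, k) \<in> r" "(j, k) \<in> r" "d i k x = d j k x'" using \<iota>_meet i j eq by blast
  obtain l where l: "(i, l) \<in> r" "(j, l) \<in> r" "d i l y = d j l y'" using \<iota>_meet i j eq by blast
  obtain m where m: "(k, m) \<in> r" "(l, m) \<in> r" using upper r_I k l by metis
  have im: "(i, m) \<in> r" "(j, m) \<in> r" using r_trans k m by blast+
  have "d i m x = d j m x'" using d_comp[OF k(1) m(1) i(2)] d_comp[OF k(2) m(1) j(2)] k(3) by simp
  moreover have "d i m y = d j m y'" using d_comp[OF l(1) m(2) i(3)] d_comp[OF l(2) m(2) j(3)] l(3) by simp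
  ultimately have "d i m (x \<oplus>\<^bsub>D i\<^esub> y) = d j m (x' \<oplus>\<^bsub>D j\<^esub> y')"
    using lmod_hom_add[OF d_hom[OF im(1)]] lmod_hom_add[OF d_hom[OF im(2)]] i j by simp
  then show ?thesis
    using \<iota>_comp[OF im(1) add_closed'[OF i]] \<iota>_comp[OF im(2) add_closed'[OF j]] by simp
qed

lemma lim_add_eq:
  assumes "i \<in> I" "x \<in> carrier (D i)" "y \<in> carrier (D i)"
  shows "lim_add (\<iota> i x) (\<iota> i y) = \<iota> i (x \<oplus>\<^bsub>D i\<^esub> y)"
  unfolding lim_add_def
proof (rule some_equality)
  show "\<exists>j\<in>I. \<exists>x'\<in>carrier (D j). \<exists>y'\<in>carrier (D j). \<iota> j x' = \<iota> i x \<and> \<iota> j y' = \<iota> i y \<and> \<iota> i (x \<oplus>\<^bsub>D i\<^esub> y) = \<iota> j (x' \<oplus>\<^bsub>D j\<^esub> y')"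
    using assms by blast
  fix z assume "\<exists>j\<in>I. \<exists>x'\<in>carrier (D j). \<exists>y'\<in>carrier (D j). \<iota> j x' = \<iota> i x \<and> \<iota> j y' = \<iota> i y \<and> z = \<iota> j (x' \<oplus>\<^bsub>D j\<^esub> y')"
  then show "z = \<iota> i (x \<oplus>\<^bsub>D i\<^esub> y)" using add_unique assms by metis
qed

lemma lim_smult_eq:
  assumes a: "a \<in> carrier R" and "i \<in> I" "x \<in> carrier (D i)"
  shows "lim_smult a (\<iota> i x) = \<iota> i (a \<odot>\<^bsub>D i\<^esub> x)"
  unfolding lim_smult_def
proof (rule some_equality)
  show "\<exists>j\<in>I. \<exists>x'\<in>carrier (D j). \<iota> j x' = \<iota> i x \<and> \<iota> i (a \<odot>\<^bsub>D i\<^esub> x) = \<iota> j (a \<odot>\<^bsub>D j\<^esub> x')"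
    using assms by blast
  fix z assume "\<exists>j\<in>I. \<exists>x'\<in>carrier (D j). \<iota> j x' = \<iota> i x \<and> z = \<iota> j (a \<odot>\<^bsub>D j\<^esub> x')"
  then obtain j x' where j: "j \<in> I" "x' \<in> carrier (D j)" "\<iota> j x' = \<iota> i x" "z = \<iota> j (a \<odot>\<^bsub>D j\<^esub> x')" by blast
  obtain k where k: "(i, k) \<in> r" "(j, k) \<in> r" "d i k x = d j k x'" using \<iota>_meet[OF assms(2) j(1) assms(3) j(2)] j(3) by auto
  have "d i k (a \<odot>\<^bsub>D i\<^esub> x) = d j k (a \<odot>\<^bsub>D j\<^esub> x')"
    using lmod_hom_smult[OF d_hom[OF k(1)]] lmod_hom_smult[OF d_hom[OF k(2)]] k assms j by simp
  then show "z = \<iota> i (a \<odot>\<^bsub>D i\<^esub> x)"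
    using \<iota>_comp[OF k(1) smult_closed''[OF assms(2) a assms(3)]] \<iota>_comp[OF k(2) smult_closed''[OF j(1) a j(2)]] j(4) by simp
qed

lemma lim_zero_eq:
  assumes "i \<in> I" shows "lim_zero = \<iota> i \<zero>\<^bsub>D i\<^esub>"
  unfolding lim_zero_def
proof (rule some_equality)
  show "\<exists>j\<in>I. \<iota> i \<zero>\<^bsub>D i\<^esub> = \<iota> j \<zero>\<^bsub>D j\<^esub>" using assms by blast
  fix z assume "\<exists>j\<in>I. z = \<iota> j \<zero>\<^bsub>D j\<^esub>"
  then obtain j where j: "j \<in> I" "z = \<iota> j \<zero>\<^bsub>D j\<^esub>" by blast
  obtain k where k: "(i, k) \<in> r" "(j, k) \<in> r" using upper assms j by blast
  have gr: "\<And>i. i \<in> I \<Longrightarrow> abelian_group (D i)" using D_mod by (auto simp: left_module_def)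
  have "d i k \<zero>\<^bsub>D i\<^esub> = \<zero>\<^bsub>D k\<^esub>" "d j k \<zero>\<^bsub>D j\<^esub> = \<zero>\<^bsub>D k\<^esub>"
    using add_hom_zero[OF gr gr lmod_hom_add_hom[OF d_hom]] k r_I by blast+
  then show "z = \<iota> i \<zero>\<^bsub>D i\<^esub>"
    using \<iota>_comp[OF k(1) zero_closed'[OF assms]] \<iota>_comp[OF k(2) zero_closed'[OF j(1)]] j(2) by simp
qed

text \<open>A module axiom involves at most three elements, which have preimages at a single stage,
  where the axiom holds. The structure of \<open>L\<close> is described by equations so that a
  comodule record is covered as well.\<close>

lemma lim_dirlim:
  fixes L :: "('a, 'l, 'w) module_scheme"
  assumes L: "carrier L = S" "\<And>x y. x \<in> S \<Longrightarrow> y \<in> S \<Longrightarrow> x \<oplus>\<^bsub>L\<^esub> y = lim_add x y" "\<zero>\<^bsub>L\<^esub> = lim_zero"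
    "\<And>a x. a \<in> carrier R \<Longrightarrow> x \<in> S \<Longrightarrow> a \<odot>\<^bsub>L\<^esub> x = lim_smult a x"
  shows "dirlim I r R D d L \<iota>"
proof -
  have add: "\<iota> i x \<oplus>\<^bsub>L\<^esub> \<iota> i y = \<iota> i (x \<oplus>\<^bsub>D i\<^esub> y)" if "i \<in> I" "x \<in> carrier (D i)" "y \<in> carrier (D i)" for i x y
    using L(2) \<iota>_in lim_add_eq that by simp
  have zero: "\<zero>\<^bsub>L\<^esub> = \<iota> i \<zero>\<^bsub>D i\<^esub>" if "i \<in> I" for i
    using L(3) lim_zero_eq that by simp
  have smult: "a \<odot>\<^bsub>L\<^esub> \<iota> i x = \<iota> i (a \<odot>\<^bsub>D i\<^esub> x)" if "a \<in> carrier R" "i \<in> I" "x \<in> carrier (D i)" for a i x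
    using L(4) \<iota>_in lim_smult_eq that by simp
  note simps = add smult add_closed' smult_closed'' zero_closed'
  have ab: "abelian_group (D i)" if "i \<in> I" for i using D_mod[OF that] by (simp add: left_module_def)
  obtain i0 where i0: "i0 \<in> I" using I_nonempty by blast
  have mod: "left_module R L"
  proof (intro left_module.intro left_module_axioms.intro)
    show "ring R" using D_mod[OF i0] by (simp add: left_module_def)
    show "abelian_group L"
    proof (rule abelian_groupI)
      fix x y assume "x \<in> carrier L" "y \<in> carrier L"
      then obtain i x' y' where i: "i \<in> I" "x' \<in> carrier (D i)" "y' \<in> carrier (D i)" "\<iota> i x' = x" "\<iota> i y' = y"
        using \<iota>_surj2 L(1) by metis
      show "x \<oplus>\<^bsub>L\<^esub> y \<in> carrier L" unfolding i(4,5)[symmetric] L(1) using i(1-3) by (simp add: simps \<iota>_in)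
      show "x \<oplus>\<^bsub>L\<^esub> y = y \<oplus>\<^bsub>L\<^esub> x" unfolding i(4,5)[symmetric] using i(1-3) abelian_groupE(4)[OF ab[OF i(1)]] by (simp add: simps)
    next
      fix x y z assume "x \<in> carrier L" "y \<in> carrier L" "z \<in> carrier L"
      then obtain i x' y' z' where i: "i \<in> I" "x' \<in> carrier (D i)" "y' \<in> carrier (D i)" "z' \<in> carrier (D i)"
          "\<iota> i x' = x" "\<iota> i y' = y" "\<iota> i z' = z"
        using \<iota>_surj3[of x y z] L(1) by auto
      show "x \<oplus>\<^bsub>L\<^esub> y \<oplus>\<^bsub>L\<^esub> z = x \<oplus>\<^bsub>L\<^esub> (y \<oplus>\<^bsub>L\<^esub> z)"
        unfolding i(5-7)[symmetric] using i(1-4) abelian_groupE(3)[OF ab[OF i(1)]] by (simp add: simps)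
    next
      fix x assume "x \<in> carrier L"
      then obtain i x' where i: "i \<in> I" "x' \<in> carrier (D i)" "\<iota> i x' = x" using \<iota>_surj L(1) by metis
      interpret Di: abelian_group "D i" by (rule ab[OF i(1)])
      show "\<zero>\<^bsub>L\<^esub> \<oplus>\<^bsub>L\<^esub> x = x" unfolding i(3)[symmetric] zero[OF i(1)] using i(1,2) by (simp add: simps)
      show "\<exists>y\<in>carrier L. y \<oplus>\<^bsub>L\<^esub> x = \<zero>\<^bsub>L\<^esub>"
        unfolding i(3)[symmetric] zero[OF i(1)] L(1) using i(1,2)
        by (intro bexI[of _ "\<iota> i (\<ominus>\<^bsub>D i\<^esub> x')"]) (auto simp: simps \<iota>_in Di.l_neg)
    next
      show "\<zero>\<^bsub>L\<^esub> \<in> carrier L" unfolding zero[OF i0] L(1) using i0 by (simp add: \<iota>_in zero_closed')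
    qed
  next
    fix a x assume a: "a \<in> carrier R" and "x \<in> carrier L"
    then obtain i x' where i: "i \<in> I" "x' \<in> carrier (D i)" "\<iota> i x' = x" using \<iota>_surj L(1) by metis
    show "a \<odot>\<^bsub>L\<^esub> x \<in> carrier L" unfolding i(3)[symmetric] L(1) using i(1,2) a by (simp add: simps \<iota>_in)
  next
    fix a b x assume a: "a \<in> carrier R" "b \<in> carrier R" and "x \<in> carrier L"
    then obtain i x' where i: "i \<in> I" "x' \<in> carrier (D i)" "\<iota> i x' = x" using \<iota>_surj L(1) by metis
    interpret Di: left_module R "D i" by (rule D_mod[OF i(1)])
    show "(a \<oplus>\<^bsub>R\<^esub> b) \<odot>\<^bsub>L\<^esub> x = a \<odot>\<^bsub>L\<^esub> x \<oplus>\<^bsub>L\<^esub> b \<odot>\<^bsub>L\<^esub> x"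
      unfolding i(3)[symmetric] using i(1,2) a by (simp add: simps Di.smult_l_distr)
    show "(a \<otimes>\<^bsub>R\<^esub> b) \<odot>\<^bsub>L\<^esub> x = a \<odot>\<^bsub>L\<^esub> (b \<odot>\<^bsub>L\<^esub> x)"
      unfolding i(3)[symmetric] using i(1,2) a by (simp add: simps Di.smult_assoc)
  next
    fix a x y assume a: "a \<in> carrier R" and "x \<in> carrier L" "y \<in> carrier L"
    then obtain i x' y' where i: "i \<in> I" "x' \<in> carrier (D i)" "y' \<in> carrier (D i)" "\<iota> i x' = x" "\<iota> i y' = y"
      using \<iota>_surj2 L(1) by metis
    interpret Di: left_module R "D i" by (rule D_mod[OF i(1)])
    show "a \<odot>\<^bsub>L\<^esub> (x \<oplus>\<^bsub>L\<^esub> y) = a \<odot>\<^bsub>L\<^esub> x \<oplus>\<^bsub>L\<^esub> a \<odot>\<^bsub>L\<^esub> y"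
      unfolding i(4,5)[symmetric] using i(1-3) a by (simp add: simps Di.smult_r_distr)
  next
    fix x assume "x \<in> carrier L"
    then obtain i x' where i: "i \<in> I" "x' \<in> carrier (D i)" "\<iota> i x' = x" using \<iota>_surj L(1) by metis
    interpret Di: left_module R "D i" by (rule D_mod[OF i(1)])
    show "\<one>\<^bsub>R\<^esub> \<odot>\<^bsub>L\<^esub> x = x" unfolding i(3)[symmetric] using i(1,2) by (simp add: simps Di.smult_one)
  qed
  show ?thesis
  proof (intro dirlim.intro dirlim_axioms.intro mod)
    show "dirsys I r R D d" by (rule dirsys_axioms)
    show "\<iota> i \<in> lmod_hom R (D i) L" if "i \<in> I" for i
      using that by (auto simp: lmod_hom_def add_hom_def L(1) \<iota>_in simps)
  qed (use \<iota>_comp \<iota>_surj \<iota>_inj L(1) in auto)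
qed

end

text \<open>The right factor enters through its carrier, addition and scalar multiplication. A
  comodule record may therefore receive its coaction after the tensor product in which the coaction
  takes values has been formed.\<close>

lemma tensor_cong:
  assumes "carrier N' = carrier N" "add N' = add N" "smult N' = smult N"
  shows "tensor R M N' = tensor R M N" "tens R M N' = tens R M N" "tensor_ab R M N' = tensor_ab R M N"
    "tensor_map R M N' f g = tensor_map R M N f g"
proof -
  have "tensor_rels R M N' = tensor_rels R M N" unfolding tensor_rels_def assms ..
  then have k: "tensor_ker R M N' = tensor_ker R M N" unfolding tensor_ker_def assms by simp
  then have g: "tensor_group R M N' = tensor_group R M N" unfolding tensor_group_def assms by simp
  then show ab: "tensor_ab R M N' = tensor_ab R M N" unfolding tensor_ab_def assms by simp
  show t: "tens R M N' = tens R M N" by (intro ext) (simp add: tens_def k assms)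
  show "tensor R M N' = tensor R M N" unfolding tensor_def ab t ..
  show "tensor_map R M N' f g = tensor_map R M N f g" unfolding tensor_map_def ab t ..
qed

text \<open>The coaction of an element is computed at any stage where it has a preimage;
  compatibility of the transition maps with the coactions makes the result independent of the stage.
  The comodule axioms hold at the stage and are carried over by naturality of \<open>coassL\<close>
  and \<open>counitL\<close>.\<close>

lemma (in coring) setlim_comodule:
  fixes D :: "'i \<Rightarrow> ('a, 'c, 'n) comodule" and S :: "'l set"
  assumes lim: "setlim I r R D d S \<iota>" and D: "\<And>i. i \<in> I \<Longrightarrow> comodule R C (D i)"
    and d: "\<And>i j x. (i, j) \<in> r \<Longrightarrow> x \<in> carrier (D i) \<Longrightarrow> coact (D j) (d i j x) = Cmap (D j) (d i j) (coact (D i) x)"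
  shows "\<exists>L :: ('a, 'c, 'l) comodule. carrier L = S \<and> comodule R C L \<and> dirlim I r R D d L \<iota> \<and>
    (\<forall>i\<in>I. \<forall>x\<in>carrier (D i). coact L (\<iota> i x) = Cmap L (\<iota> i) (coact (D i) x))"
proof -
  interpret setlim I r R D d S \<iota> by (rule lim)
  \<comment> \<open>The coaction takes values in a tensor product with the record that is to contain
    it. \<open>L0\<close> therefore carries a placeholder, and \<open>CL\<close> shows that
    replacing it changes no tensor map.\<close>
  define L0 :: "('a, 'c, 'l) comodule" where "L0 = \<lparr>carrier = S, monoid.mult = undefined, monoid.one = undefined,
    ring.zero = lim_zero, add = lim_add, smult = lim_smult, coact = undefined\<rparr>"
  define \<nu> where "\<nu> x = (SOME t. \<exists>i\<in>I. \<exists>y\<in>carrier (D i). \<iota> i y = x \<and> t = Cmap L0 (\<iota> i) (coact (D i) y))" for x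
  define L where "L = L0\<lparr>coact := \<nu>\<rparr>"
  have CL: "Cmap L f = Cmap L0 f" for f :: "'n \<Rightarrow> 'l"
    by (rule tensor_cong) (simp_all add: L_def)
  interpret L: dirlim I r R D d L \<iota>
    by (rule lim_dirlim) (simp_all add: L_def L0_def)
  have cL: "carrier L = S" by (simp add: L_def L0_def)
  have dc: "coact (D i) x \<in> carrier (tensor_ab R C (D i))" if "i \<in> I" "x \<in> carrier (D i)" for i x
    using lmod_hom_closed[of "coact (D i)" R "D i" "tensor R C (D i)" x] D[OF that(1)] that(2) by (simp add: comodule_iff)
  have dh: "coact (D i) \<in> lmod_hom R (D i) (tensor R C (D i))" if "i \<in> I" for i
    using D[OF that] by (simp add: comodule_iff)
  have Ci: "Cmap L (\<iota> i) \<in> lmod_hom R (tensor R C (D i)) (tensor R C L)" if "i \<in> I" for i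
    by (rule Cmap_hom[OF D_mod[OF that] L.L_mod L.\<iota>_hom[OF that]])
  have \<nu>_step: "Cmap L (\<iota> k) (coact (D k) (d i k x)) = Cmap L (\<iota> i) (coact (D i) x)"
    if ik: "(i, k) \<in> r" and x: "x \<in> carrier (D i)" for i k x
  proof -
    have I: "i \<in> I" "k \<in> I" using r_I ik by blast+
    show ?thesis unfolding d[OF ik x]
      by (rule Cmap_Cmap[OF D_mod[OF I(1)] D_mod[OF I(2)] L.L_mod d_hom[OF ik] L.\<iota>_hom[OF I(2)] dc[OF I(1) x]])
        (simp add: \<iota>_comp[OF ik])
  qed
  have \<nu>_eq: "\<nu> (\<iota> i x) = Cmap L (\<iota> i) (coact (D i) x)" if i: "i \<in> I" and x: "x \<in> carrier (D i)" for i x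
    unfolding \<nu>_def CL
  proof (rule some_equality)
    show "\<exists>j\<in>I. \<exists>y\<in>carrier (D j). \<iota> j y = \<iota> i x \<and> Cmap L0 (\<iota> i) (coact (D i) x) = Cmap L0 (\<iota> j) (coact (D j) y)"
      using i x by blast
    fix t assume "\<exists>j\<in>I. \<exists>y\<in>carrier (D j). \<iota> j y = \<iota> i x \<and> t = Cmap L0 (\<iota> j) (coact (D j) y)"
    then obtain j y where j: "j \<in> I" "y \<in> carrier (D j)" "\<iota> j y = \<iota> i x" "t = Cmap L (\<iota> j) (coact (D j) y)"
      unfolding CL by blast
    obtain k where k: "(i, k) \<in> r" "(j, k) \<in> r" "d i k x = d j k y" using \<iota>_meet[OF i j(1) x j(2)] j(3) by auto
    have "t = Cmap L (\<iota> i) (coact (D i) x)"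
      unfolding j(4) using \<nu>_step[OF k(1) x] \<nu>_step[OF k(2) j(2)] k(3) by simp
    then show "t = Cmap L0 (\<iota> i) (coact (D i) x)" unfolding CL .
  qed
  have co: "coact L = \<nu>" by (simp add: L_def)
  have \<nu>_hom: "\<nu> \<in> lmod_hom R L (tensor R C L)"
    unfolding lmod_hom_def add_hom_def
  proof (intro CollectI conjI ballI funcsetI)
    fix x assume "x \<in> carrier L"
    then obtain i x' where i: "i \<in> I" "x' \<in> carrier (D i)" "\<iota> i x' = x" using L.\<iota>_surj by blast
    show "\<nu> x \<in> carrier (tensor R C L)"
      unfolding i(3)[symmetric] \<nu>_eq[OF i(1,2)] using lmod_hom_closed[OF Ci[OF i(1)]] dc[OF i(1,2)] by simp
  next
    fix x y assume "x \<in> carrier L" "y \<in> carrier L"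
    then obtain i x' y' where i: "i \<in> I" "x' \<in> carrier (D i)" "y' \<in> carrier (D i)" "\<iota> i x' = x" "\<iota> i y' = y" using L.\<iota>_surj2 by metis
    show "\<nu> (x \<oplus>\<^bsub>L\<^esub> y) = \<nu> x \<oplus>\<^bsub>tensor R C L\<^esub> \<nu> y"
      unfolding i(4,5)[symmetric] lmod_hom_add[OF L.\<iota>_hom[OF i(1)] i(2,3), symmetric]
      using i(1-3) add_closed'[OF i(1-3)] dc lmod_hom_add[OF dh[OF i(1)] i(2,3)] lmod_hom_add[OF Ci[OF i(1)]] by (simp add: \<nu>_eq)
  next
    fix a x assume a: "a \<in> carrier R" and "x \<in> carrier L"
    then obtain i x' where i: "i \<in> I" "x' \<in> carrier (D i)" "\<iota> i x' = x" using L.\<iota>_surj by blast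
    show "\<nu> (a \<odot>\<^bsub>L\<^esub> x) = a \<odot>\<^bsub>tensor R C L\<^esub> \<nu> x"
      unfolding i(3)[symmetric] lmod_hom_smult[OF L.\<iota>_hom[OF i(1)] a i(2), symmetric]
      using i(1,2) a smult_closed''[OF i(1) a i(2)] dc lmod_hom_smult[OF dh[OF i(1)] a i(2)] lmod_hom_smult[OF Ci[OF i(1)] a] by (simp add: \<nu>_eq)
  qed
  have "comodule R C L" unfolding comodule_iff co
  proof (intro conjI ballI L.L_mod \<nu>_hom)
    fix x assume "x \<in> carrier L"
    then obtain i y where i: "i \<in> I" "y \<in> carrier (D i)" "\<iota> i y = x" using L.\<iota>_surj by blast
    note Di = D_mod[OF i(1)] and Dc = D[OF i(1), unfolded comodule_iff]
    let ?t = "coact (D i) y"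
    have t: "?t \<in> carrier (tensor_ab R C (D i))" by (rule dc[OF i(1,2)])
    have "coassL R C L (\<nu> x) = Cmap (tensor R C L) (Cmap L (\<iota> i)) (coassL R C (D i) ?t)"
      unfolding i(3)[symmetric] \<nu>_eq[OF i(1,2)] by (rule coassL_natural[OF Di L.L_mod L.\<iota>_hom[OF i(1)] t])
    also have "\<dots> = Cmap (tensor R C L) (Cmap L (\<iota> i)) (Cmap (tensor R C (D i)) (coact (D i)) ?t)"
      using Dc i(2) by simp
    also have "\<dots> = Cmap (tensor R C L) (\<lambda>y. Cmap L (\<iota> i) (coact (D i) y)) ?t"
      by (rule Cmap_Cmap[OF Di left_module_tensorC[OF Di] left_module_tensorC[OF L.L_mod] dh[OF i(1)] Ci[OF i(1)] t]) simp
    also have "\<dots> = Cmap (tensor R C L) \<nu> (Cmap L (\<iota> i) ?t)"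
      by (rule Cmap_Cmap[OF Di L.L_mod left_module_tensorC[OF L.L_mod] L.\<iota>_hom[OF i(1)] \<nu>_hom t, symmetric]) (simp add: \<nu>_eq[OF i(1)])
    finally show "coassL R C L (\<nu> x) = Cmap (tensor R C L) \<nu> (\<nu> x)"
      using \<nu>_eq[OF i(1,2)] i(3) by simp
    have "counitL R C L (\<nu> x) = \<iota> i (counitL R C (D i) ?t)"
      unfolding i(3)[symmetric] \<nu>_eq[OF i(1,2)] by (rule counitL_natural[OF Di L.L_mod L.\<iota>_hom[OF i(1)] t])
    then show "counitL R C L (\<nu> x) = x" using Dc i by simp
  qed
  then show ?thesis using cL L.dirlim_axioms co \<nu>_eq by (intro exI[of _ L]) simp
qed

section \<open>Small sets\<close>

text \<open>Carriers and index sets of constructions that live in other types are moved into the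
  universe type by such injections.\<close>

lemma small_inj:
  fixes \<kappa> :: "'u rel"
  assumes "universe_cardinal \<kappa>" "small \<kappa> X"
  obtains f :: "'b \<Rightarrow> 'u" where "inj_on f X"
proof -
  have "Card_order \<kappa>" using assms by (auto simp: universe_cardinal_def)
  then have "\<kappa> =o card_of (Field \<kappa>)" using card_of_Field_ordIso ordIso_symmetric by blast
  then have "card_of X <o card_of (Field \<kappa>)" using assms(2) unfolding small_def by (rule ordLess_ordIso_trans[rotated])
  then have "card_of X \<le>o card_of (Field \<kappa>)" by (rule ordLess_imp_ordLeq)
  then obtain f where "inj_on f X" "f ` X \<subseteq> Field \<kappa>" using card_of_ordLeq[of X "Field \<kappa>"] by auto
  then show ?thesis using that by blast
qed

lemma small_inj_on: "inj_on f X \<Longrightarrow> f ` X \<subseteq> Y \<Longrightarrow> small \<kappa> Y \<Longrightarrow> small \<kappa> X"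
  unfolding small_def using card_of_ordLeq[of X Y] ordLeq_ordLess_trans by blast

context
  fixes \<kappa> :: "'u rel"
  assumes \<kappa>: "universe_cardinal \<kappa>"
begin

lemma small_UN: "small \<kappa> X \<Longrightarrow> (\<And>x. x \<in> X \<Longrightarrow> small \<kappa> (F x)) \<Longrightarrow> small \<kappa> (\<Union>x\<in>X. F x)"
  using card_of_UNION_ordLess_infinite_Field_regularCard[of \<kappa> X F] \<kappa>
  unfolding small_def universe_cardinal_def by blast

lemma small_finite: "finite X \<Longrightarrow> small \<kappa> X"
proof -
  assume "finite X"
  moreover have "Well_order \<kappa>" "infinite (Field \<kappa>)"
    using \<kappa> card_order_on_well_order_on by (auto simp: universe_cardinal_def cinfinite_def)
  ultimately show ?thesis
    unfolding small_def using finite_ordLess_infinite[OF card_of_Well_order[of X], of \<kappa>] by (simp add: Field_card_of)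
qed

lemma small_Sigma:
  assumes "small \<kappa> X" "\<And>x. x \<in> X \<Longrightarrow> small \<kappa> (F x)" shows "small \<kappa> (Sigma X F)"
proof -
  have "Sigma X F = (\<Union>x\<in>X. Pair x ` F x)" by auto
  then show ?thesis using small_UN[OF assms(1), of "\<lambda>x. Pair x ` F x"] small_image assms(2) by metis
qed

text \<open>Closure under countable powers is assumed for subsets of the universe type; an injection
  transfers it to small sets of any type.\<close>

lemma small_funcs:
  assumes "small \<kappa> (X :: 'b set)" shows "small \<kappa> ((UNIV :: nat set) \<rightarrow>\<^sub>E X)"
proof -
  obtain f :: "'b \<Rightarrow> 'u" where f: "inj_on f X" using small_inj[OF \<kappa> assms] .
  have s: "small \<kappa> ((UNIV :: nat set) \<rightarrow>\<^sub>E f ` X)"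
    using \<kappa> small_image[OF assms] unfolding universe_cardinal_def by blast
  show ?thesis
  proof (rule small_inj_on[OF _ _ s])
    show "inj_on (\<lambda>g n. f (g n)) ((UNIV :: nat set) \<rightarrow>\<^sub>E X)"
    proof (rule inj_onI)
      fix g h :: "nat \<Rightarrow> 'b" assume gh: "g \<in> UNIV \<rightarrow>\<^sub>E X" "h \<in> UNIV \<rightarrow>\<^sub>E X" "(\<lambda>n. f (g n)) = (\<lambda>n. f (h n))"
      have "f (g n) = f (h n)" for n using gh(3) by (rule fun_cong)
      then have "g n = h n" for n using inj_onD[OF f] gh(1,2) by blast
      then show "g = h" by blast
    qed
  qed auto
qed

lemma small_countable: "countable X \<Longrightarrow> small \<kappa> X"
proof -
  assume X: "countable X"
  \<comment> \<open>Naturals embed into Boolean sequences as singletons, and these sequences form a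
    countable power of a finite set; this yields uncountability of the universe.\<close>
  have "inj_on (\<lambda>n k. k = n) (UNIV :: nat set)" by (rule inj_onI) (metis)
  then have N: "small \<kappa> (UNIV :: nat set)"
    by (rule small_inj_on[OF _ _ small_funcs[OF small_finite[of "UNIV :: bool set"]]]) auto
  show "small \<kappa> X"
    using small_inj_on[of "to_nat_on X" X UNIV] N inj_on_to_nat_on[OF X] by blast
qed

lemma small_countable_subsets:
  assumes "small \<kappa> X" shows "small \<kappa> {U. U \<subseteq> X \<and> countable U}"
proof -
  have "{U. U \<subseteq> X \<and> countable U} \<subseteq> {{}} \<union> range ` ((UNIV :: nat set) \<rightarrow>\<^sub>E X)"
  proof
    fix U assume U: "U \<in> {U. U \<subseteq> X \<and> countable U}"
    show "U \<in> {{}} \<union> range ` ((UNIV :: nat set) \<rightarrow>\<^sub>E X)"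
    proof (cases "U = {}")
      case False
      then have "U = range (from_nat_into U)" "from_nat_into U \<in> UNIV \<rightarrow>\<^sub>E X"
        using U from_nat_into[OF False] by (auto simp: range_from_nat_into)
      then show ?thesis by blast
    qed simp
  qed
  moreover have "small \<kappa> ({{}} \<union> range ` ((UNIV :: nat set) \<rightarrow>\<^sub>E X))"
  proof -
    have "small \<kappa> (\<Union>b\<in>{True, False}. if b then {{}} else range ` ((UNIV :: nat set) \<rightarrow>\<^sub>E X))"
      by (rule small_UN[OF small_finite]) (auto intro: small_finite small_image small_funcs assms)
    then show ?thesis by (rule small_subset) auto
  qed
  ultimately show ?thesis using small_subset by blast
qed

text \<open>An infinite set is equipotent with the free abelian group on it. For finite
  \<open>B\<close> the combinations are countable, being sums of finite lists of integer multiples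
  of basis elements.\<close>

lemma small_frags:
  assumes "small \<kappa> (B :: 'b set)" shows "small \<kappa> (frags B)"
proof (cases "finite B")
  case True
  let ?f = "\<lambda>l. sum_list (map (\<lambda>(k, b). frag_cmul k (frag_of b)) l) :: 'b \<Rightarrow>\<^sub>0 int"
  have "frags B \<subseteq> ?f ` lists (UNIV \<times> B)"
  proof
    fix z assume "z \<in> frags B"
    then show "z \<in> ?f ` lists (UNIV \<times> B)"
    proof (induction rule: frags_induct)
      case zero show ?case by (rule image_eqI[of _ _ "[]"]) auto
    next
      case (of x) then show ?case by (intro image_eqI[of _ _ "[(1, x)]"]) auto
    next
      case (diff z w)
      then obtain l l' where l: "l \<in> lists (UNIV \<times> B)" "z = ?f l" "l' \<in> lists (UNIV \<times> B)" "w = ?f l'" by blast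
      have "?f (map (\<lambda>(k, b). (- k, b)) l') = - ?f l'" by (induction l') auto
      then show ?case using l by (intro image_eqI[of _ _ "l @ map (\<lambda>(k, b). (- k, b)) l'"]) (auto simp: in_lists_conv_set)
    qed
  qed
  moreover have "countable (lists ((UNIV :: int set) \<times> B))" using True by (simp add: countable_finite)
  ultimately show ?thesis using small_countable countable_subset countable_image by metis
next
  case False
  have "carrier (free_Abelian_group B) \<approx> B" by (rule eqpoll_free_Abelian_group_infinite[OF False])
  moreover have "carrier (free_Abelian_group B) = frags B" by (auto simp: frags_def)
  ultimately obtain f where "inj_on f (frags B)" "f ` frags B \<subseteq> B"
    unfolding eqpoll_def bij_betw_def by auto
  then show ?thesis using small_inj_on assms by blast
qed

end

section \<open>The category of flat comodules\<close>

context coring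
begin

lemma comod_flat_cat_simps:
  "Ob (comod_flat_cat \<kappa> R C) = {M. comodule R C M \<and> small \<kappa> (carrier M) \<and> flat_module \<kappa> R M}"
  "Hom (comod_flat_cat \<kappa> R C) = comod_hom R C"
  "Ident (comod_flat_cat \<kappa> R C) = (\<lambda>M. \<lambda>x\<in>carrier M. x)"
  "Comp (comod_flat_cat \<kappa> R C) = (\<lambda>M N P g f. compose (carrier M) g f)"
  by (auto simp: comod_flat_cat_def full_subcategory_def comod_cat_def)

lemma comodule_left: "comodule R C M \<Longrightarrow> left_module R M"
  by (simp add: comodule_iff)

lemma coact_lmod_hom: "comodule R C M \<Longrightarrow> coact M \<in> lmod_hom R M (tensor R C M)"
  by (simp add: comodule_iff)

lemma coact_closed: "comodule R C M \<Longrightarrow> x \<in> carrier M \<Longrightarrow> coact M x \<in> carrier (tensor_ab R C M)"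
  using lmod_hom_closed[OF coact_lmod_hom] by fastforce

lemma comod_homI:
  assumes "comodule R C M" "f \<in> extensional (carrier M)" "f \<in> lmod_hom R M N"
    "\<And>x. x \<in> carrier M \<Longrightarrow> coact N (f x) = Cmap N f (coact M x)"
  shows "f \<in> comod_hom R C M N"
  using assms lmod_hom_closed[OF assms(3)] by (auto simp: comod_hom_def PiE_def)

lemma comod_homD:
  assumes "f \<in> comod_hom R C M N"
  shows "f \<in> extensional (carrier M)" "f \<in> lmod_hom R M N"
    "x \<in> carrier M \<Longrightarrow> f x \<in> carrier N" "x \<in> carrier M \<Longrightarrow> coact N (f x) = Cmap N f (coact M x)"
  using assms by (auto simp: comod_hom_def PiE_def)

lemma comod_hom_restrict:
  assumes M: "comodule R C M" and N: "comodule R C N" and f: "f \<in> lmod_hom R M N"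
    and co: "\<And>x. x \<in> carrier M \<Longrightarrow> coact N (f x) = Cmap N f (coact M x)"
  shows "restrict f (carrier M) \<in> comod_hom R C M N"
proof (rule comod_homI[OF M restrict_extensional])
  show "restrict f (carrier M) \<in> lmod_hom R M N"
    by (rule lmod_hom_cong[OF f _ comodule_left[OF M]]) simp
  fix x assume x: "x \<in> carrier M"
  show "coact N (restrict f (carrier M) x) = Cmap N (restrict f (carrier M)) (coact M x)"
    using x co[OF x] Cmap_cong[OF comodule_left[OF M] comodule_left[OF N] f _ coact_closed[OF M x], of "restrict f (carrier M)"] by simp
qed

lemma comod_hom_comp:
  assumes M: "comodule R C M" and N: "comodule R C N" and P: "comodule R C P"
    and f: "f \<in> comod_hom R C M N" and g: "g \<in> comod_hom R C N P"
  shows "compose (carrier M) g f \<in> comod_hom R C M P"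
proof -
  note f' = comod_homD[OF f] and g' = comod_homD[OF g]
  have "restrict (\<lambda>x. g (f x)) (carrier M) \<in> comod_hom R C M P"
  proof (rule comod_hom_restrict[OF M P lmod_hom_compose[OF f'(2) g'(2)]])
    fix x assume x: "x \<in> carrier M"
    have "Cmap P g (Cmap N f (coact M x)) = Cmap P (\<lambda>x. g (f x)) (coact M x)"
      by (rule Cmap_Cmap[OF comodule_left[OF M] comodule_left[OF N] comodule_left[OF P] f'(2) g'(2) coact_closed[OF M x]]) simp
    then show "coact P (g (f x)) = Cmap P (\<lambda>x. g (f x)) (coact M x)"
      using g'(4)[OF f'(3)[OF x]] f'(4)[OF x] by simp
  qed
  then show ?thesis by (simp add: compose_def)
qed

lemma comod_hom_ident: "comodule R C M \<Longrightarrow> (\<lambda>x\<in>carrier M. x) \<in> comod_hom R C M M"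
  by (rule comod_hom_restrict) (auto intro: lmod_hom_id simp: Cmap_id coact_closed comodule_left)

lemma category_comod_flat_cat: "category (comod_flat_cat \<kappa> R C)"
proof
  fix X Y Z W f g h
  let ?K = "comod_flat_cat \<kappa> R C"
  assume X: "X \<in> Ob ?K"
  then have XC: "comodule R C X" by (simp add: comod_flat_cat_simps)
  show "Ident ?K X \<in> Hom ?K X X" unfolding comod_flat_cat_simps by (rule comod_hom_ident[OF XC])
  assume Y: "Y \<in> Ob ?K" and f: "f \<in> Hom ?K X Y"
  then have YC: "comodule R C Y" and f: "f \<in> comod_hom R C X Y" by (simp_all add: comod_flat_cat_simps)
  have fe: "f \<in> extensional (carrier X)" "f \<in> carrier X \<rightarrow> carrier Y" using comod_homD[OF f] by auto
  show "Comp ?K X X Y f (Ident ?K X) = f" unfolding comod_flat_cat_simps by (rule compose_Id[OF fe(2,1)])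
  show "Comp ?K X Y Y (Ident ?K Y) f = f" unfolding comod_flat_cat_simps by (rule Id_compose[OF fe(2,1)])
  assume Z: "Z \<in> Ob ?K" and g: "g \<in> Hom ?K Y Z"
  then have ZC: "comodule R C Z" and g: "g \<in> comod_hom R C Y Z" by (simp_all add: comod_flat_cat_simps)
  show "Comp ?K X Y Z g f \<in> Hom ?K X Z" unfolding comod_flat_cat_simps by (rule comod_hom_comp[OF XC YC ZC f g])
  show "Comp ?K X Y W (Comp ?K Y Z W h g) f = Comp ?K X Z W h (Comp ?K X Y Z g f)"
    unfolding comod_flat_cat_simps by (rule compose_assoc[OF fe(2), symmetric])
qed

lemma diagram_dirsys:
  assumes "aleph1_directed I r" and "diagram (comod_flat_cat \<kappa> R C) I r D d"
  shows "dirsys I r R D d"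
proof -
  have po: "r \<subseteq> I \<times> I" "\<And>i. i \<in> I \<Longrightarrow> (i, i) \<in> r" "trans r"
    using assms(1) unfolding aleph1_directed_def partial_order_on_def preorder_on_def refl_on_def by auto
  have up: "\<exists>u\<in>I. \<forall>s\<in>S. (s, u) \<in> r" if "S \<subseteq> I" "countable S" for S
    using assms(1) that unfolding aleph1_directed_def by blast
  note dd = assms(2)[unfolded diagram_def comod_flat_cat_simps]
  show ?thesis
  proof (intro dirsys.intro directed_preorder.intro dirsys_axioms.intro)
    \<comment> \<open>The empty set is countable and hence has an upper bound in
      \<open>I\<close>.\<close>
    show "I \<noteq> {}" using up[of "{}"] by auto
    show "\<exists>k. (i, k) \<in> r \<and> (j, k) \<in> r" if "i \<in> I" "j \<in> I" for i j using up[of "{i, j}"] that by auto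
    show "(i, k) \<in> r" if "(i, j) \<in> r" "(j, k) \<in> r" for i j k using po(3) that by (rule transD)
    show "left_module R (D i)" if "i \<in> I" for i using dd that comodule_left by blast
    show "d i j \<in> lmod_hom R (D i) (D j)" if "(i, j) \<in> r" for i j using dd that comod_homD(2) by blast
    show "d i i x = x" if "i \<in> I" "x \<in> carrier (D i)" for i x using dd that by simp
    show "d j k (d i j x) = d i k x" if "(i, j) \<in> r" "(j, k) \<in> r" "x \<in> carrier (D i)" for i j k x
    proof -
      have "d i k = compose (carrier (D i)) (d j k) (d i j)" using dd that by blast
      then show ?thesis using that by (simp add: compose_def)
    qed
  qed (use po in auto)
qed

text \<open>The mediating map is dictated by its values on images of the stages, and the element
  conditions make it well defined and unique. Extensionality of morphisms turns agreement on
  carriers into equality.\<close>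

theorem dirlim_is_colimit:
  fixes D :: "'i \<Rightarrow> ('a, 'c, 'u) comodule"
  assumes dia: "diagram (comod_flat_cat \<kappa> R C) I r D d"
    and L: "L \<in> Ob (comod_flat_cat \<kappa> R C)" and \<iota>: "\<And>i. i \<in> I \<Longrightarrow> \<iota> i \<in> comod_hom R C (D i) L"
    and lim: "dirlim I r R D d L \<iota>"
  shows "is_colimit (comod_flat_cat \<kappa> R C) I r D d L \<iota>"
proof -
  interpret dirlim I r R D d L \<iota> by (rule lim)
  note dd = dia[unfolded diagram_def comod_flat_cat_simps]
  have DC: "comodule R C (D i)" if "i \<in> I" for i using dd that by blast
  have LC: "comodule R C L" using L by (simp add: comod_flat_cat_simps)
  have coc: "cocone (comod_flat_cat \<kappa> R C) I r D d L \<iota>"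
    unfolding cocone_def
  proof (intro conjI ballI L, simp_all only: comod_flat_cat_simps \<iota>)
    fix p assume "p \<in> r"
    then obtain i j where p: "p = (i, j)" "(i, j) \<in> r" by (cases p) auto
    have "compose (carrier (D i)) (\<iota> j) (d i j) = \<iota> i"
      using comod_homD(1)[OF \<iota>[OF r_I(1)[OF p(2)]]] \<iota>_comp[OF p(2)]
      by (auto simp: compose_def restrict_def extensional_def fun_eq_iff)
    then show "case p of (i, j) \<Rightarrow> compose (carrier (D i)) (\<iota> j) (d i j) = \<iota> i" using p by simp
  qed
  have "\<exists>!h. h \<in> comod_hom R C L N \<and> (\<forall>i\<in>I. compose (carrier (D i)) h (\<iota> i) = \<phi> i)"
    if N: "cocone (comod_flat_cat \<kappa> R C) I r D d N \<phi>" for N \<phi>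
  proof -
    note nn = N[unfolded cocone_def comod_flat_cat_simps]
    have NC: "comodule R C N" using nn by blast
    have \<phi>: "\<phi> i \<in> comod_hom R C (D i) N" if "i \<in> I" for i using nn that by blast
    have \<phi>c: "\<phi> j (d i j x) = \<phi> i x" if "(i, j) \<in> r" "x \<in> carrier (D i)" for i j x
    proof -
      have "compose (carrier (D i)) (\<phi> j) (d i j) = \<phi> i" using nn that by blast
      then show ?thesis using that(2) by (metis compose_eq)
    qed
    define h where "h = (\<lambda>x\<in>carrier L. SOME z. \<exists>i\<in>I. \<exists>y\<in>carrier (D i). \<iota> i y = x \<and> z = \<phi> i y)"
    have h: "h (\<iota> i x) = \<phi> i x" if i: "i \<in> I" "x \<in> carrier (D i)" for i x
    proof -
      have "(SOME z. \<exists>j\<in>I. \<exists>y\<in>carrier (D j). \<iota> j y = \<iota> i x \<and> z = \<phi> j y) = \<phi> i x"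
      proof (rule some_equality)
        show "\<exists>j\<in>I. \<exists>y\<in>carrier (D j). \<iota> j y = \<iota> i x \<and> \<phi> i x = \<phi> j y" using i by blast
        fix z assume "\<exists>j\<in>I. \<exists>y\<in>carrier (D j). \<iota> j y = \<iota> i x \<and> z = \<phi> j y"
        then obtain j y where j: "j \<in> I" "y \<in> carrier (D j)" "\<iota> j y = \<iota> i x" "z = \<phi> j y" by blast
        obtain k where k: "(i, k) \<in> r" "(j, k) \<in> r" using upper i j by blast
        have "\<iota> k (d i k x) = \<iota> k (d j k y)" using \<iota>_comp k i j by simp
        then obtain l where l: "(k, l) \<in> r" "d k l (d i k x) = d k l (d j k y)"
          using \<iota>_inj[of k "d i k x" "d j k y"] r_I k d_closed i j by blast
        have "\<phi> l (d k l (d i k x)) = \<phi> i x" "\<phi> l (d k l (d j k y)) = \<phi> j y"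
          using \<phi>c[OF l(1) d_closed[OF k(1) i(2)]] \<phi>c[OF k(1) i(2)]
            \<phi>c[OF l(1) d_closed[OF k(2) j(2)]] \<phi>c[OF k(2) j(2)] by simp_all
        then show "z = \<phi> i x" using j(4) l(2) by simp
      qed
      then show ?thesis unfolding h_def using \<iota>_closed[OF i] by simp
    qed
    have hl: "h \<in> lmod_hom R L N" unfolding lmod_hom_def add_hom_def
    proof (intro CollectI conjI ballI funcsetI)
      fix x assume "x \<in> carrier L"
      then obtain i x' where i: "i \<in> I" "x' \<in> carrier (D i)" "\<iota> i x' = x" using \<iota>_surj by blast
      show "h x \<in> carrier N" unfolding i(3)[symmetric] h[OF i(1,2)] by (rule comod_homD(3)[OF \<phi>[OF i(1)] i(2)])
    next
      fix x y assume "x \<in> carrier L" "y \<in> carrier L"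
      then obtain i x' y' where i: "i \<in> I" "x' \<in> carrier (D i)" "y' \<in> carrier (D i)" "\<iota> i x' = x" "\<iota> i y' = y" using \<iota>_surj2 by metis
      interpret Di: left_module R "D i" by (rule D_mod[OF i(1)])
      show "h (x \<oplus>\<^bsub>L\<^esub> y) = h x \<oplus>\<^bsub>N\<^esub> h y"
        unfolding i(4,5)[symmetric] lmod_hom_add[OF \<iota>_hom[OF i(1)] i(2,3), symmetric]
        using i(1-3) lmod_hom_add[OF comod_homD(2)[OF \<phi>[OF i(1)]] i(2,3)] by (simp add: h)
    next
      fix a x assume a: "a \<in> carrier R" and "x \<in> carrier L"
      then obtain i x' where i: "i \<in> I" "x' \<in> carrier (D i)" "\<iota> i x' = x" using \<iota>_surj by blast
      interpret Di: left_module R "D i" by (rule D_mod[OF i(1)])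
      show "h (a \<odot>\<^bsub>L\<^esub> x) = a \<odot>\<^bsub>N\<^esub> h x"
        unfolding i(3)[symmetric] lmod_hom_smult[OF \<iota>_hom[OF i(1)] a i(2), symmetric]
        using i(1,2) a Di.smult_closed[OF a i(2)] lmod_hom_smult[OF comod_homD(2)[OF \<phi>[OF i(1)]] a i(2)] by (simp add: h)
    qed
    have hc: "h \<in> comod_hom R C L N"
    proof (rule comod_homI[OF LC _ hl])
      show "h \<in> extensional (carrier L)" by (simp add: h_def)
      fix x assume "x \<in> carrier L"
      then obtain i x' where i: "i \<in> I" "x' \<in> carrier (D i)" "\<iota> i x' = x" using \<iota>_surj by blast
      have "Cmap N h (Cmap L (\<iota> i) (coact (D i) x')) = Cmap N (\<phi> i) (coact (D i) x')"
        by (rule Cmap_Cmap[OF D_mod[OF i(1)] L_mod comodule_left[OF NC] \<iota>_hom[OF i(1)] hl coact_closed[OF DC[OF i(1)] i(2)]])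
          (simp add: h i(1))
      then show "coact N (h x) = Cmap N h (coact L x)"
        unfolding i(3)[symmetric] h[OF i(1,2)]
        using comod_homD(4)[OF \<iota>[OF i(1)] i(2)] comod_homD(4)[OF \<phi>[OF i(1)] i(2)] by simp
    qed
    have hi: "compose (carrier (D i)) h (\<iota> i) = \<phi> i" if i: "i \<in> I" for i
      using comod_homD(1)[OF \<phi>[OF i]] h[OF i] by (auto simp: compose_def restrict_def extensional_def fun_eq_iff)
    show ?thesis
    proof (rule ex1I[of _ h])
      show "h \<in> comod_hom R C L N \<and> (\<forall>i\<in>I. compose (carrier (D i)) h (\<iota> i) = \<phi> i)" using hc hi by blast
      fix g assume g: "g \<in> comod_hom R C L N \<and> (\<forall>i\<in>I. compose (carrier (D i)) g (\<iota> i) = \<phi> i)"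
      show "g = h"
      proof (rule extensionalityI[of _ "carrier L"])
        show "g \<in> extensional (carrier L)" using g comod_homD(1) by blast
        show "h \<in> extensional (carrier L)" by (simp add: h_def)
        fix x assume "x \<in> carrier L"
        then obtain i x' where i: "i \<in> I" "x' \<in> carrier (D i)" "\<iota> i x' = x" using \<iota>_surj by blast
        have "g (\<iota> i x') = \<phi> i x'" using g i by (metis compose_eq)
        then show "g x = h x" using h[OF i(1,2)] i(3) by simp
      qed
    qed
  qed
  then show ?thesis unfolding is_colimit_def comod_flat_cat_simps using coc[unfolded comod_flat_cat_simps]
    by (simp add: comod_flat_cat_simps)
qed

text \<open>The underlying set is the disjoint union of the stages modulo eventual equality. It is
  small, so its classes can be renamed by elements of the universe type; flatness is inherited by
  \<open>flat_dirlim\<close>.\<close>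

theorem colimit_exists:
  fixes \<kappa> :: "'u rel"
  assumes \<kappa>: "universe_cardinal \<kappa>" and dia: "aleph1_diagram \<kappa> (comod_flat_cat \<kappa> R C) I r D d"
  shows "\<exists>L \<iota>. is_colimit (comod_flat_cat \<kappa> R C) I r D d L \<iota> \<and> dirlim I r R D d L \<iota>"
proof -
  have sI: "small \<kappa> I" and dir: "aleph1_directed I r" and dg: "diagram (comod_flat_cat \<kappa> R C) I r D d"
    using dia by (auto simp: aleph1_diagram_def)
  interpret dirsys I r R D d by (rule diagram_dirsys[OF dir dg])
  note dd = dg[unfolded diagram_def comod_flat_cat_simps]
  have DC: "comodule R C (D i)" and Ds: "small \<kappa> (carrier (D i))" and Df: "flat_module \<kappa> R (D i)" if "i \<in> I" for i
    using dd that by blast+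
  have dh: "d i j \<in> comod_hom R C (D i) (D j)" if "(i, j) \<in> r" for i j using dd that by blast
  define P where "P = Sigma I (\<lambda>i. carrier (D i))"
  define eqv where "eqv p q \<longleftrightarrow> (\<exists>k. (fst p, k) \<in> r \<and> (fst q, k) \<in> r \<and> d (fst p) k (snd p) = d (fst q) k (snd q))" for p q
  define cl where "cl p = {q \<in> P. eqv p q}" for p
  have sP: "small \<kappa> P" unfolding P_def by (rule small_Sigma[OF \<kappa> sI Ds])
  obtain e :: "(_ \<times> _) set \<Rightarrow> 'u" where e: "inj_on e (cl ` P)" using small_inj[OF \<kappa> small_image[OF sP]] by blast
  have trans: "eqv p s" if "eqv p q" "eqv q s" "p \<in> P" "q \<in> P" "s \<in> P" for p q s
  proof -
    obtain k where k: "(fst p, k) \<in> r" "(fst q, k) \<in> r" "d (fst p) k (snd p) = d (fst q) k (snd q)" using \<open>eqv p q\<close> unfolding eqv_def by blast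
    obtain l where l: "(fst q, l) \<in> r" "(fst s, l) \<in> r" "d (fst q) l (snd q) = d (fst s) l (snd s)" using \<open>eqv q s\<close> unfolding eqv_def by blast
    obtain m where m: "(k, m) \<in> r" "(l, m) \<in> r" using upper r_I k l by metis
    have c: "snd p \<in> carrier (D (fst p))" "snd q \<in> carrier (D (fst q))" "snd s \<in> carrier (D (fst s))" using that(3-5) by (auto simp: P_def)
    have "d (fst p) m (snd p) = d (fst s) m (snd s)"
      using d_comp[OF k(1) m(1) c(1)] d_comp[OF k(2) m(1) c(2)] d_comp[OF l(1) m(2) c(2)] d_comp[OF l(2) m(2) c(3)] k(3) l(3) by metis
    moreover have "(fst p, m) \<in> r" "(fst s, m) \<in> r" using r_trans k l m by blast+
    ultimately show ?thesis unfolding eqv_def by blast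
  qed
  have refl: "eqv p p" if "p \<in> P" for p using that r_refl unfolding eqv_def P_def by (intro exI[of _ "fst p"]) auto
  have sym: "eqv q p" if pq: "eqv p q" for p q
  proof -
    obtain k where "(fst p, k) \<in> r" "(fst q, k) \<in> r" "d (fst p) k (snd p) = d (fst q) k (snd q)"
      using pq unfolding eqv_def by blast
    then show ?thesis unfolding eqv_def by (intro exI[of _ k]) simp
  qed
  have cl_eq: "cl p = cl q \<longleftrightarrow> eqv p q" if "p \<in> P" "q \<in> P" for p q
  proof
    assume "cl p = cl q"
    moreover have "q \<in> cl q" using refl that by (simp add: cl_def)
    ultimately have "q \<in> cl p" by simp
    then show "eqv p q" by (simp add: cl_def)
  next
    assume "eqv p q"
    then show "cl p = cl q" unfolding cl_def using trans[OF _ _ that(1,2)] trans[OF _ _ that(2,1)] sym[of p q] by blast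
  qed
  define S where "S = e ` cl ` P"
  define \<iota> where "\<iota> i = (\<lambda>x\<in>carrier (D i). e (cl (i, x)))" for i
  have P: "(i, x) \<in> P" if "i \<in> I" "x \<in> carrier (D i)" for i x using that by (simp add: P_def)
  have \<iota>eq: "\<iota> i x = \<iota> j y \<longleftrightarrow> eqv (i, x) (j, y)" if "i \<in> I" "x \<in> carrier (D i)" "j \<in> I" "y \<in> carrier (D j)" for i x j y
    using that cl_eq[OF P P, of i x j y] inj_onD[OF e, of "cl (i, x)" "cl (j, y)"] P by (auto simp: \<iota>_def)
  have lim: "setlim I r R D d S \<iota>"
  proof (intro setlim.intro setlim_axioms.intro)
    show "dirsys I r R D d" by (rule dirsys_axioms)
    show "\<iota> i x \<in> S" if "i \<in> I" "x \<in> carrier (D i)" for i x using that P by (simp add: \<iota>_def S_def)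
    show "\<iota> j (d i j x) = \<iota> i x" if "(i, j) \<in> r" "x \<in> carrier (D i)" for i j x
    proof -
      have "eqv (j, d i j x) (i, x)" unfolding eqv_def using that r_I r_refl d_id d_closed by (intro exI[of _ j]) auto
      then show ?thesis using \<iota>eq that r_I d_closed by blast
    qed
    show "\<exists>i\<in>I. \<exists>y\<in>carrier (D i). \<iota> i y = l" if lS: "l \<in> S" for l
    proof -
      obtain p where p: "p \<in> P" "l = e (cl p)" using lS by (auto simp: S_def)
      then show ?thesis by (intro bexI[of _ "fst p"] bexI[of _ "snd p"]) (auto simp: \<iota>_def P_def)
    qed
    show "\<exists>k. (i, k) \<in> r \<and> d i k x = d i k y" if "i \<in> I" "x \<in> carrier (D i)" "y \<in> carrier (D i)" "\<iota> i x = \<iota> i y" for i x y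
      using \<iota>eq[OF that(1,2,1,3)] that(4) by (auto simp: eqv_def)
  qed
  obtain L :: "('a, 'c, 'u) comodule" where L: "carrier L = S" "comodule R C L" "dirlim I r R D d L \<iota>"
    "\<And>i x. i \<in> I \<Longrightarrow> x \<in> carrier (D i) \<Longrightarrow> coact L (\<iota> i x) = Cmap L (\<iota> i) (coact (D i) x)"
    using setlim_comodule[OF lim DC comod_homD(4)[OF dh]] by blast
  interpret L: dirlim I r R D d L \<iota> by (rule L(3))
  have "L \<in> Ob (comod_flat_cat \<kappa> R C)"
    using L(1,2) small_image[OF small_image[OF sP]] L.flat_dirlim[OF Df] by (simp add: comod_flat_cat_simps S_def)
  moreover have "\<iota> i \<in> comod_hom R C (D i) L" if "i \<in> I" for i
    by (rule comod_homI[OF DC[OF that] _ L.\<iota>_hom[OF that] L(4)[OF that]]) (auto simp: \<iota>_def extensional_def)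
  ultimately have "is_colimit (comod_flat_cat \<kappa> R C) I r D d L \<iota>"
    using dirlim_is_colimit[OF dg _ _ L(3)] by blast
  then show ?thesis using L(3) by blast
qed

text \<open>A colimit given by its universal property is isomorphic to the constructed one,
  compatibly with the cocones, so the element conditions carry over. Presentability speaks about
  arbitrary colimits, which thereby become accessible to arguments with elements.\<close>

theorem colimit_dirlim:
  fixes \<kappa> :: "'u rel"
  assumes \<kappa>: "universe_cardinal \<kappa>" and dia: "aleph1_diagram \<kappa> (comod_flat_cat \<kappa> R C) I r D d"
    and col: "is_colimit (comod_flat_cat \<kappa> R C) I r D d L \<iota>"
  shows "dirlim I r R D d L \<iota>"
proof -
  let ?K = "comod_flat_cat \<kappa> R C"
  obtain L0 \<iota>0 where L0: "is_colimit ?K I r D d L0 \<iota>0" "dirlim I r R D d L0 \<iota>0" using colimit_exists[OF \<kappa> dia] by blast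
  interpret L0: dirlim I r R D d L0 \<iota>0 by (rule L0(2))
  have c: "cocone ?K I r D d L \<iota>" and c0: "cocone ?K I r D d L0 \<iota>0"
    using col L0(1) by (auto simp: is_colimit_def)
  note cc = c[unfolded cocone_def comod_flat_cat_simps] and cc0 = c0[unfolded cocone_def comod_flat_cat_simps]
  note u = col[unfolded is_colimit_def comod_flat_cat_simps, THEN conjunct2, rule_format]
  note u0 = L0(1)[unfolded is_colimit_def comod_flat_cat_simps, THEN conjunct2, rule_format]
  have LC: "comodule R C L" "comodule R C L0" using cc cc0 by auto
  have DC: "comodule R C (D i)" if "i \<in> I" for i using dia that unfolding aleph1_diagram_def diagram_def comod_flat_cat_simps by blast
  have \<iota>: "\<iota> i \<in> comod_hom R C (D i) L" if "i \<in> I" for i using cc that by blast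
  have \<iota>0: "\<iota>0 i \<in> comod_hom R C (D i) L0" if "i \<in> I" for i using cc0 that by blast
  obtain g where g: "g \<in> comod_hom R C L L0" "\<forall>i\<in>I. compose (carrier (D i)) g (\<iota> i) = \<iota>0 i"
    using u[OF c0[unfolded comod_flat_cat_simps]] by blast
  obtain h where h: "h \<in> comod_hom R C L0 L" "\<forall>i\<in>I. compose (carrier (D i)) h (\<iota>0 i) = \<iota> i"
    using u0[OF c[unfolded comod_flat_cat_simps]] by blast
  have gi: "g (\<iota> i x) = \<iota>0 i x" if "i \<in> I" "x \<in> carrier (D i)" for i x using g(2) that by (metis compose_eq)
  have hi: "h (\<iota>0 i x) = \<iota> i x" if "i \<in> I" "x \<in> carrier (D i)" for i x using h(2) that by (metis compose_eq)
  have "compose (carrier L) h g = (\<lambda>x\<in>carrier L. x)"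
  proof -
    have "\<exists>!f. f \<in> comod_hom R C L L \<and> (\<forall>i\<in>I. compose (carrier (D i)) f (\<iota> i) = \<iota> i)"
      by (rule u[OF c[unfolded comod_flat_cat_simps]])
    moreover have "compose (carrier L) h g \<in> comod_hom R C L L" by (rule comod_hom_comp[OF LC(1,2,1) g(1) h(1)])
    moreover have "compose (carrier (D i)) (compose (carrier L) h g) (\<iota> i) = \<iota> i" if "i \<in> I" for i
      using gi[OF that] hi[OF that] comod_homD(1,3)[OF \<iota>[OF that]]
      by (auto simp: compose_def restrict_def extensional_def fun_eq_iff)
    moreover have "(\<lambda>x\<in>carrier L. x) \<in> comod_hom R C L L" by (rule comod_hom_ident[OF LC(1)])
    moreover have "compose (carrier (D i)) (\<lambda>x\<in>carrier L. x) (\<iota> i) = \<iota> i" if "i \<in> I" for i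
      using comod_homD(1,3)[OF \<iota>[OF that]] by (auto simp: compose_def restrict_def extensional_def fun_eq_iff)
    ultimately show ?thesis by blast
  qed
  then have hg: "h (g x) = x" if "x \<in> carrier L" for x using that by (metis compose_eq restrict_apply')
  show ?thesis
  proof (intro dirlim.intro dirlim_axioms.intro)
    show "dirsys I r R D d" by (rule L0.dirsys_axioms)
    show "left_module R L" by (rule comodule_left[OF LC(1)])
    show "\<iota> i \<in> lmod_hom R (D i) L" if "i \<in> I" for i by (rule comod_homD(2)[OF \<iota>[OF that]])
    show "\<iota> j (d i j x) = \<iota> i x" if "(i, j) \<in> r" "x \<in> carrier (D i)" for i j x
      using hi[OF L0.r_I(2)[OF that(1)] L0.d_closed[OF that]] hi[OF L0.r_I(1)[OF that(1)] that(2)] L0.\<iota>_comp[OF that] by simp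
    show "\<exists>i\<in>I. \<exists>y\<in>carrier (D i). \<iota> i y = l" if lL: "l \<in> carrier L" for l
    proof -
      obtain i y where i: "i \<in> I" "y \<in> carrier (D i)" "\<iota>0 i y = g l" using L0.\<iota>_surj[OF comod_homD(3)[OF g(1) lL]] by blast
      then show ?thesis using hi[OF i(1,2)] hg[OF lL] by auto
    qed
    show "\<exists>k. (i, k) \<in> r \<and> d i k x = d i k y" if "i \<in> I" "x \<in> carrier (D i)" "y \<in> carrier (D i)" "\<iota> i x = \<iota> i y" for i x y
      using L0.\<iota>_inj[OF that(1-3)] gi[OF that(1,2)] gi[OF that(1,3)] that(4) by simp
  qed
qed

end

section \<open>Presentations\<close>

text \<open>Relations are combinations of indices, not of elements of the module, so different
  modules can be compared by sharing the same \<open>X\<close> and \<open>G\<close>.\<close>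

definition presented :: "('a, 'r) ring_scheme \<Rightarrow> ('a, 'b, 'z) module_scheme \<Rightarrow> 'x set \<Rightarrow> ('x \<Rightarrow> 'b) \<Rightarrow> ('a, 'x) fcomb set \<Rightarrow> bool" where
  "presented R M X e G \<longleftrightarrow> e \<in> X \<rightarrow> carrier M \<and> G \<subseteq> FA R X \<and>
    (\<forall>x\<in>carrier M. \<exists>z\<in>FA R X. lev M e z = x) \<and> (\<forall>z\<in>FA R X. lev M e z = \<zero>\<^bsub>M\<^esub> \<longleftrightarrow> z \<in> linspan R X G)"

lemma presentedD:
  assumes "presented R M X e G"
  shows "e \<in> X \<rightarrow> carrier M" "G \<subseteq> FA R X" "x \<in> carrier M \<Longrightarrow> \<exists>z\<in>FA R X. lev M e z = x"
    "z \<in> FA R X \<Longrightarrow> lev M e z = \<zero>\<^bsub>M\<^esub> \<longleftrightarrow> z \<in> linspan R X G"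
  using assms unfolding presented_def by blast+

lemma (in abelian_group) minus_eq_zero: "x \<in> carrier G \<Longrightarrow> y \<in> carrier G \<Longrightarrow> x \<ominus> y = \<zero> \<longleftrightarrow> x = y"
  by (metis a_minus_def add.inv_closed minus_equality minus_minus r_neg)

lemmas (in left_module) lev_linspan_r = lev_linspan[rotated 3]

lemma presented_hom_eq:
  assumes p: "presented R M X e G" and M: "left_module R M" and P: "left_module R P"
    and f: "f \<in> lmod_hom R M P" and f': "f' \<in> lmod_hom R M P" and eq: "\<And>x. x \<in> X \<Longrightarrow> f (e x) = f' (e x)"
    and x: "x \<in> carrier M"
  shows "f x = f' x"
proof -
  interpret P: left_module R P by fact
  obtain z where z: "z \<in> FA R X" "lev M e z = x" using presentedD(3)[OF p x] by blast
  have e: "(\<lambda>x. f' (e x)) \<in> X \<rightarrow> carrier P" using presentedD(1)[OF p] lmod_hom_closed[OF f'] by auto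
  have "f x = lev P (\<lambda>x. f (e x)) z" unfolding z(2)[symmetric] by (rule lmod_hom_lev[OF M P f presentedD(1)[OF p] z(1)])
  also have "\<dots> = lev P (\<lambda>x. f' (e x)) z" by (rule P.lev_cong[OF z(1) e eq])
  also have "\<dots> = f' x" unfolding z(2)[symmetric] by (rule lmod_hom_lev[OF M P f' presentedD(1)[OF p] z(1), symmetric])
  finally show ?thesis .
qed

text \<open>The map on generators extends to combinations and vanishes on the span of
  \<open>G\<close>, which is the kernel of evaluation in \<open>M\<close>; so any representative of
  an element gives the same value.\<close>

lemma presented_lift:
  assumes p: "presented R M X e G" and M: "left_module R M" and P: "left_module R P"
    and h: "h \<in> X \<rightarrow> carrier P" and G: "\<And>g. g \<in> G \<Longrightarrow> lev P h g = \<zero>\<^bsub>P\<^esub>"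
  shows "\<exists>f. f \<in> lmod_hom R M P \<and> (\<forall>z\<in>FA R X. f (lev M e z) = lev P h z)"
proof -
  interpret M: left_module R M by fact
  interpret P: left_module R P by fact
  note e = presentedD(1)[OF p]
  define f where "f m = lev P h (SOME z. z \<in> FA R X \<and> lev M e z = m)" for m
  have f: "f (lev M e z) = lev P h z" if z: "z \<in> FA R X" for z
  proof -
    define w where "w = (SOME w. w \<in> FA R X \<and> lev M e w = lev M e z)"
    have w: "w \<in> FA R X" "lev M e w = lev M e z" unfolding w_def using someI[of "\<lambda>w. w \<in> FA R X \<and> lev M e w = lev M e z" z] z by auto
    have "lev M e (w - z) = \<zero>\<^bsub>M\<^esub>" using M.lev_diff[OF e w(1) z] w(2) M.lev_closed[OF e z] by (simp add: M.minus_eq_zero)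
    then have "w - z \<in> linspan R X G" using presentedD(4)[OF p] w(1) z by blast
    then have "lev P h (w - z) = \<zero>\<^bsub>P\<^esub>" by (rule P.lev_linspan_r[OF _ h presentedD(2)[OF p] G])
    then have "lev P h w = lev P h z"
      using P.lev_diff[OF h w(1) z] P.lev_closed[OF h w(1)] P.lev_closed[OF h z] by (simp add: P.minus_eq_zero)
    then show ?thesis unfolding f_def w_def .
  qed
  have "f \<in> lmod_hom R M P"
    unfolding lmod_hom_def add_hom_def
  proof (intro CollectI conjI ballI funcsetI)
    fix x assume "x \<in> carrier M"
    then obtain z where z: "z \<in> FA R X" "lev M e z = x" using presentedD(3)[OF p] by blast
    show "f x \<in> carrier P" unfolding z(2)[symmetric] f[OF z(1)] by (rule P.lev_closed[OF h z(1)])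
    fix a assume a: "a \<in> carrier R"
    show "f (a \<odot>\<^bsub>M\<^esub> x) = a \<odot>\<^bsub>P\<^esub> f x"
      unfolding z(2)[symmetric] M.lev_lsm[OF e a z(1), symmetric]
      by (simp add: f z(1) a M.lsm_frags P.lev_lsm[OF h a z(1)])
  next
    fix x y assume "x \<in> carrier M" "y \<in> carrier M"
    then obtain z w where z: "z \<in> FA R X" "lev M e z = x" "w \<in> FA R X" "lev M e w = y" using presentedD(3)[OF p] by metis
    show "f (x \<oplus>\<^bsub>M\<^esub> y) = f x \<oplus>\<^bsub>P\<^esub> f y"
      unfolding z(2,4)[symmetric] M.lev_add[OF e z(1,3), symmetric]
      by (simp add: f z(1,3) frags_add P.lev_add[OF h z(1,3)])
  qed
  then show ?thesis using f by blast
qed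

text \<open>This moves countable presentations to sets of naturals, as countable presentability is
  defined with. Renaming and its inverse are substitutions with unit coefficients.\<close>

lemma presented_reindex:
  assumes p: "presented R M X e G" and M: "left_module R M" and \<phi>: "bij_betw \<phi> X X'"
  shows "presented R M X' (\<lambda>y. e (inv_into X \<phi> y)) (lsubst R (\<lambda>x. frag_of (\<one>\<^bsub>R\<^esub>, \<phi> x)) ` G)"
proof -
  interpret M: left_module R M by fact
  let ?\<psi> = "inv_into X \<phi>" and ?a = "lsubst R (\<lambda>x. frag_of (\<one>\<^bsub>R\<^esub>, \<phi> x))" and ?b = "lsubst R (\<lambda>x. frag_of (\<one>\<^bsub>R\<^esub>, inv_into X \<phi> x))"
  note e = presentedD(1)[OF p] and G = presentedD(2)[OF p]
  have \<phi>X: "\<phi> x \<in> X'" "?\<psi> (\<phi> x) = x" if "x \<in> X" for x using \<phi> that by (auto simp: bij_betw_def)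
  have \<psi>X: "?\<psi> y \<in> X" "\<phi> (?\<psi> y) = y" if "y \<in> X'" for y using \<phi> that by (auto simp: bij_betw_def inv_into_into f_inv_into_f)
  have a: "?a z \<in> FA R X'" if "z \<in> FA R X" for z by (rule M.lsubst_frags[OF that]) (use \<phi>X in auto)
  have b: "?b z \<in> FA R X" if "z \<in> FA R X'" for z by (rule M.lsubst_frags[OF that]) (use \<psi>X in auto)
  have ab: "?a (?b z) = z" if z: "z \<in> FA R X'" for z
  proof -
    have "?a (?b z) = lsubst R (\<lambda>x. ?a (frag_of (\<one>\<^bsub>R\<^esub>, ?\<psi> x))) z"
      by (rule M.lsubst_lsubst[OF z, of _ X _ X']) (use \<phi>X \<psi>X in auto)
    also have "\<dots> = lsubst R (\<lambda>x. frag_of (\<one>\<^bsub>R\<^esub>, x)) z"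
      by (rule lsubst_cong[OF z]) (use \<psi>X in simp)
    finally show ?thesis using M.lsubst_ident[OF z] by simp
  qed
  have e': "(\<lambda>y. e (?\<psi> y)) \<in> X' \<rightarrow> carrier M" using e \<psi>X by auto
  have lb: "lev M e (?b z) = lev M (\<lambda>y. e (?\<psi> y)) z" if z: "z \<in> FA R X'" for z
  proof -
    have "lev M e (?b z) = lev M (\<lambda>y. lev M e (frag_of (\<one>\<^bsub>R\<^esub>, ?\<psi> y))) z"
      by (rule M.lev_lsubst[OF e _ z]) (use \<psi>X in auto)
    also have "\<dots> = lev M (\<lambda>y. e (?\<psi> y)) z"
      by (rule M.lev_cong[OF z e']) (use e \<psi>X in \<open>auto simp: M.lev_of M.smult_one Pi_iff\<close>)
    finally show ?thesis .
  qed
  have la: "lev M (\<lambda>y. e (?\<psi> y)) (?a z) = lev M e z" if z: "z \<in> FA R X" for z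
  proof -
    have "lev M (\<lambda>y. e (?\<psi> y)) (?a z) = lev M (\<lambda>x. lev M (\<lambda>y. e (?\<psi> y)) (frag_of (\<one>\<^bsub>R\<^esub>, \<phi> x))) z"
      by (rule M.lev_lsubst[OF e' _ z]) (use \<phi>X in auto)
    also have "\<dots> = lev M e z"
      by (rule M.lev_cong[OF z e]) (use e \<phi>X in \<open>auto simp: M.lev_of M.smult_one Pi_iff\<close>)
    finally show ?thesis .
  qed
  have G': "?a ` G \<subseteq> FA R X'" using G a by blast
  show ?thesis unfolding presented_def
  proof (intro conjI ballI e' G')
    fix x assume "x \<in> carrier M"
    then obtain z where "z \<in> FA R X" "lev M e z = x" using presentedD(3)[OF p] by blast
    then show "\<exists>z\<in>FA R X'. lev M (\<lambda>y. e (?\<psi> y)) z = x" using a la by (intro bexI[of _ "?a z"]) auto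
  next
    fix z assume z: "z \<in> FA R X'"
    show "lev M (\<lambda>y. e (?\<psi> y)) z = \<zero>\<^bsub>M\<^esub> \<longleftrightarrow> z \<in> linspan R X' (?a ` G)"
    proof
      assume "lev M (\<lambda>y. e (?\<psi> y)) z = \<zero>\<^bsub>M\<^esub>"
      then have "?b z \<in> linspan R X G" using presentedD(4)[OF p b[OF z]] lb[OF z] by simp
      then have "?a (?b z) \<in> linspan R X' (?a ` G)"
      proof (rule M.lsubst_linspan[OF _ G G'])
        fix g assume "g \<in> G"
        then have "lsm R \<one>\<^bsub>R\<^esub> (?a g) \<in> linspan R X' (?a ` G)" by (intro linspan_lsm_base) auto
        then show "?a g \<in> linspan R X' (?a ` G)" using M.lsm_one[OF a] G \<open>g \<in> G\<close> by auto
      qed (use \<phi>X in auto)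
      then show "z \<in> linspan R X' (?a ` G)" by (simp add: ab[OF z])
    next
      assume "z \<in> linspan R X' (?a ` G)"
      then show "lev M (\<lambda>y. e (?\<psi> y)) z = \<zero>\<^bsub>M\<^esub>"
      proof (rule M.lev_linspan_r[OF _ e' G'])
        fix g' assume "g' \<in> ?a ` G"
        then obtain g where g: "g \<in> G" "g' = ?a g" by blast
        have gF: "g \<in> FA R X" using g G by blast
        have "lsm R \<one>\<^bsub>R\<^esub> g \<in> linspan R X G" using g(1) by (intro linspan_lsm_base) auto
        then have "lev M e g = \<zero>\<^bsub>M\<^esub>" using presentedD(4)[OF p gF] M.lsm_one[OF gF] by simp
        then show "lev M (\<lambda>y. e (?\<psi> y)) g' = \<zero>\<^bsub>M\<^esub>" using la[OF gF] g by simp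
      qed
    qed
  qed
qed

text \<open>A retract is presented on the same generators by imposing in addition that the
  idempotent act as the identity: each generator \<open>x\<close> is identified with a combination
  \<open>w x\<close> that represents its image under \<open>i\<close> after \<open>q\<close>.
  Countably many generators cost countably many new relations.\<close>

lemma presented_retract:
  assumes p: "presented R M' X e G" and M': "left_module R M'" and M: "left_module R M"
    and i: "i \<in> lmod_hom R M M'" and q: "q \<in> lmod_hom R M' M" and qi: "\<And>x. x \<in> carrier M \<Longrightarrow> q (i x) = x"
    and X: "countable X" and G: "countable G"
  shows "\<exists>G'. countable G' \<and> presented R M X (\<lambda>x. q (e x)) G'"
proof -
  interpret M: left_module R M by fact
  interpret M': left_module R M' by fact
  note e = presentedD(1)[OF p] and GF = presentedD(2)[OF p]
  have e': "(\<lambda>x. q (e x)) \<in> X \<rightarrow> carrier M" using e lmod_hom_closed[OF q] by auto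
  have "\<exists>w. \<forall>x\<in>X. w x \<in> FA R X \<and> lev M' e (w x) = i (q (e x))"
    using presentedD(3)[OF p] e' lmod_hom_closed[OF i] by (intro bchoice) blast
  then obtain w where w: "\<And>x. x \<in> X \<Longrightarrow> w x \<in> FA R X" "\<And>x. x \<in> X \<Longrightarrow> lev M' e (w x) = i (q (e x))" by blast
  let ?N = "(\<lambda>x. frag_of (\<one>\<^bsub>R\<^esub>, x) - w x) ` X"
  let ?G = "G \<union> ?N"
  have GF': "?G \<subseteq> FA R X" using GF w by auto
  have lq: "lev M (\<lambda>x. q (e x)) z = q (lev M' e z)" if "z \<in> FA R X" for z
    by (rule lmod_hom_lev[OF M' M q e that, symmetric])
  have zero_G: "lev M' e g = \<zero>\<^bsub>M'\<^esub>" if "g \<in> G" for g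
  proof -
    have "lsm R \<one>\<^bsub>R\<^esub> g \<in> linspan R X G" using that by (intro linspan_lsm_base) auto
    moreover have "g \<in> FA R X" using that GF by blast
    ultimately show ?thesis using presentedD(4)[OF p] M.lsm_one by metis
  qed
  have q0: "q \<zero>\<^bsub>M'\<^esub> = \<zero>\<^bsub>M\<^esub>" by (rule add_hom_zero[OF M'.M.abelian_group_axioms M.M.abelian_group_axioms lmod_hom_add_hom[OF q]])
  have i0: "i \<zero>\<^bsub>M\<^esub> = \<zero>\<^bsub>M'\<^esub>" by (rule add_hom_zero[OF M.M.abelian_group_axioms M'.M.abelian_group_axioms lmod_hom_add_hom[OF i]])
  have "presented R M X (\<lambda>x. q (e x)) ?G" unfolding presented_def
  proof (intro conjI ballI e' GF')
    fix x assume x: "x \<in> carrier M"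
    obtain z where z: "z \<in> FA R X" "lev M' e z = i x" using presentedD(3)[OF p lmod_hom_closed[OF i x]] by blast
    then show "\<exists>z\<in>FA R X. lev M (\<lambda>x. q (e x)) z = x" using lq[OF z(1)] qi[OF x] by (intro bexI[of _ z]) auto
  next
    fix z assume z: "z \<in> FA R X"
    show "lev M (\<lambda>x. q (e x)) z = \<zero>\<^bsub>M\<^esub> \<longleftrightarrow> z \<in> linspan R X ?G"
    proof
      assume 0: "lev M (\<lambda>x. q (e x)) z = \<zero>\<^bsub>M\<^esub>"
      \<comment> \<open>Substituting \<open>w\<close> applies the idempotent. If \<open>z\<close>
        dies in \<open>M\<close>, then \<open>?v\<close> evaluates to zero already in
        \<open>M'\<close> and lies in the span of \<open>G\<close>, while \<open>z - ?v\<close> lies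
        in the span of the new relations.\<close>
      let ?v = "lsubst R w z"
      have v: "?v \<in> FA R X" by (rule M.lsubst_frags[OF z w(1)])
      have "lev M' e ?v = lev M' (\<lambda>x. lev M' e (w x)) z" by (rule M'.lev_lsubst[OF e w(1) z])
      also have "\<dots> = lev M' (\<lambda>x. i (q (e x))) z"
        by (rule M'.lev_cong[OF z]) (use w(2) e' lmod_hom_closed[OF i] in auto)
      also have "\<dots> = i (lev M (\<lambda>x. q (e x)) z)" by (rule lmod_hom_lev[OF M M' i e' z, symmetric])
      finally have "?v \<in> linspan R X G" using 0 i0 presentedD(4)[OF p v] by simp
      then have 1: "?v \<in> linspan R X ?G" using linspan_mono[of X X G ?G R] by blast
      have 2: "y - lsubst R w y \<in> linspan R X ?G" if "y \<in> FA R X" for y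
        using that
      proof (induction rule: frags_induct)
        case zero show ?case by (simp add: linspan_0)
      next
        case (of p')
        then obtain a x where p': "p' = (a, x)" "a \<in> carrier R" "x \<in> X" by auto
        have "lsm R a (frag_of (\<one>\<^bsub>R\<^esub>, x) - w x) \<in> linspan R X ?G" using p' by (intro linspan_lsm_base) auto
        then show ?case using p' by (simp add: lsm_diff)
      next
        case (diff y y') then show ?case using linspan_diff[OF diff(3,4)] by (simp add: lsubst_diff algebra_simps)
      qed
      show "z \<in> linspan R X ?G" using linspan_add[OF 2[OF z] 1] by simp
    next
      assume "z \<in> linspan R X ?G"
      then show "lev M (\<lambda>x. q (e x)) z = \<zero>\<^bsub>M\<^esub>"
      proof (rule M.lev_linspan_r[OF _ e' GF'])
        fix g assume "g \<in> ?G"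
        then show "lev M (\<lambda>x. q (e x)) g = \<zero>\<^bsub>M\<^esub>"
        proof
          assume "g \<in> G" then show ?thesis using lq zero_G GF q0 by auto
        next
          assume "g \<in> ?N"
          then obtain x where x: "x \<in> X" "g = frag_of (\<one>\<^bsub>R\<^esub>, x) - w x" by blast
          have ex: "q (e x) \<in> carrier M" using e' x by auto
          have "lev M (\<lambda>x. q (e x)) g = q (e x) \<ominus>\<^bsub>M\<^esub> q (i (q (e x)))"
          proof -
            have "e x \<in> carrier M'" using e x by auto
            then show ?thesis unfolding x(2) using x(1) w[OF x(1)] ex
              by (subst M.lev_diff[OF e']) (simp_all add: lq M'.lev_of M'.smult_one)
          qed
          then show ?thesis using qi[OF ex] ex by (simp add: M.minus_eq_zero)
        qed
      qed
    qed
  qed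
  moreover have "countable ?G" using X G by simp
  ultimately show ?thesis by blast
qed

text \<open>Taking coordinates identifies formal combinations modulo additivity with the free module.\<close>

lemma (in ring) coord_free:
  assumes "z \<in> FA R X" shows "(\<lambda>y. coord y z) \<in> carrier (free_module R X)"
proof -
  have z0: "coord y z = \<zero>" if "y \<notin> snd ` Poly_Mapping.keys z" for y
  proof -
    have "coord y z = ev R (\<lambda>p. \<zero>) z"
      unfolding coord_def by (rule ev_cong[OF frags_keys]) (use that in force)+
    also have "ev R (\<lambda>p. \<zero>) z = \<zero>" unfolding ev_def by (rule add.finprod_one_eqI) simp
    finally show ?thesis .
  qed
  have "{y. coord y z \<noteq> \<zero>} \<subseteq> snd ` Poly_Mapping.keys z" using z0 by blast
  then have "finite {y. coord y z \<noteq> \<zero>}" by (rule finite_subset) simp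
  moreover have "coord y z = \<zero>" if "y \<notin> X" for y using z0 frags_snd_keys(2)[OF assms] that by blast
  ultimately show ?thesis using coord_closed[OF assms] by (simp add: free_module_def)
qed

text \<open>A section of the passage from combinations to coordinate vectors, with one term for each
  nonzero coordinate.\<close>

definition free_rep :: "('a, 'r) ring_scheme \<Rightarrow> ('x \<Rightarrow> 'a) \<Rightarrow> ('a, 'x) fcomb" where
  "free_rep R v = (\<Sum>y\<in>{y. v y \<noteq> \<zero>\<^bsub>R\<^esub>}. frag_of (v y, y))"

context ring
begin

lemma free_rep_frags: "v \<in> carrier (free_module R X) \<Longrightarrow> free_rep R v \<in> FA R X"
  unfolding free_rep_def by (rule frags_sum) (auto simp: free_module_def)

lemma coord_free_rep:
  assumes v: "v \<in> carrier (free_module R X)" shows "coord y (free_rep R v) = v y"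
proof -
  have "coord y (\<Sum>y\<in>S. frag_of (v y, y)) = (if y \<in> S then v y else \<zero>)" if "finite S" "S \<subseteq> X" for S
    using that
  proof (induction S rule: finite_induct)
    case (insert x S)
    have vx: "v x \<in> carrier R" "v y \<in> carrier R" using v insert by (auto simp: free_module_def)
    have F: "frag_of (v x, x) \<in> FA R X" "(\<Sum>y\<in>S. frag_of (v y, y)) \<in> FA R X"
      using v insert by (auto simp: free_module_def intro!: frags_sum)
    show ?case using insert vx by (auto simp: coord_add[OF F] coord_of)
  qed simp
  moreover have "finite {y. v y \<noteq> \<zero>}" "{y. v y \<noteq> \<zero>} \<subseteq> X" using v by (auto simp: free_module_def)
  ultimately show ?thesis unfolding free_rep_def by simp
qed

lemma coord_lsm: "a \<in> carrier R \<Longrightarrow> z \<in> FA R X \<Longrightarrow> coord y (lsm R a z) = a \<otimes> coord y z"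
proof (rotate_tac 1, induction rule: frags_induct)
  case (diff z w)
  then show ?case by (simp add: lsm_diff coord_diff[of _ X] lsm_frags coord_closed[of _ X] a_minus_def r_distr r_minus)
qed (auto simp: coord_of)

lemma coord_eq_iff:
  assumes "z \<in> FA R X" "w \<in> FA R X"
  shows "(\<forall>y. coord y z = coord y w) \<longleftrightarrow> z - w \<in> linspan R X {}"
proof
  assume "\<forall>y. coord y z = coord y w"
  then show "z - w \<in> linspan R X {}" unfolding linspan_empty
    using assms coord_closed[OF assms(1)] by (intro coords_zero) (auto simp: coord_diff[of _ X] a_minus_def r_neg)
next
  assume "z - w \<in> linspan R X {}"
  then have "coord y (z - w) = \<zero>" for y unfolding linspan_empty by (rule coord_addspan)
  then show "\<forall>y. coord y z = coord y w"
    using assms coord_closed[OF assms(1)] coord_closed[OF assms(2)] by (simp add: coord_diff[of _ X] minus_eq_zero)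
qed

lemma free_rep_coord: "z \<in> FA R X \<Longrightarrow> free_rep R (\<lambda>y. coord y z) - z \<in> linspan R X {}"
  using coord_eq_iff[OF free_rep_frags[OF coord_free] , of z X z] coord_free_rep[OF coord_free, of z X] by simp

lemma coord_free_add: "z \<in> FA R X \<Longrightarrow> w \<in> FA R X \<Longrightarrow>
    (\<lambda>y. coord y z) \<oplus>\<^bsub>free_module R X\<^esub> (\<lambda>y. coord y w) = (\<lambda>y. coord y (z + w))"
  by (auto simp: free_module_def coord_add[of _ X])

lemma coord_free_smult: "a \<in> carrier R \<Longrightarrow> z \<in> FA R X \<Longrightarrow>
    a \<odot>\<^bsub>free_module R X\<^esub> (\<lambda>y. coord y z) = (\<lambda>y. coord y (lsm R a z))"
  by (auto simp: free_module_def coord_lsm[of _ _ X])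

lemma free_module_closed: "f \<in> carrier (free_module R X) \<Longrightarrow> f x \<in> carrier R"
  by (cases "x \<in> X") (auto simp: free_module_def)

lemma free_module_group: "abelian_group (free_module R X)"
proof (rule abelian_groupI)
  fix f g assume fg: "f \<in> carrier (free_module R X)" "g \<in> carrier (free_module R X)"
  have "{x. f x \<oplus> g x \<noteq> \<zero>} \<subseteq> {x. f x \<noteq> \<zero>} \<union> {x. g x \<noteq> \<zero>}" by auto
  then have "finite {x. f x \<oplus> g x \<noteq> \<zero>}" by (rule finite_subset) (use fg in \<open>auto simp: free_module_def\<close>)
  then show "f \<oplus>\<^bsub>free_module R X\<^esub> g \<in> carrier (free_module R X)" using fg by (auto simp: free_module_def)
  have c: "f x \<in> carrier R" "g x \<in> carrier R" for x using fg by (auto intro: free_module_closed)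
  show "f \<oplus>\<^bsub>free_module R X\<^esub> g = g \<oplus>\<^bsub>free_module R X\<^esub> f" using c by (auto simp: free_module_def a_comm)
next
  fix f assume f: "f \<in> carrier (free_module R X)"
  have c: "f x \<in> carrier R" for x by (rule free_module_closed[OF f])
  show "\<zero>\<^bsub>free_module R X\<^esub> \<oplus>\<^bsub>free_module R X\<^esub> f = f" using c by (auto simp: free_module_def)
  have "{x. \<ominus> f x \<noteq> \<zero>} \<subseteq> {x. f x \<noteq> \<zero>}" by auto
  then have "finite {x. \<ominus> f x \<noteq> \<zero>}" by (rule finite_subset) (use f in \<open>auto simp: free_module_def\<close>)
  then show "\<exists>g\<in>carrier (free_module R X). g \<oplus>\<^bsub>free_module R X\<^esub> f = \<zero>\<^bsub>free_module R X\<^esub>"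
    using f c by (intro bexI[of _ "\<lambda>x. \<ominus> f x"]) (auto simp: free_module_def l_neg)
next
  fix f g h assume fg: "f \<in> carrier (free_module R X)" "g \<in> carrier (free_module R X)" "h \<in> carrier (free_module R X)"
  have c: "f x \<in> carrier R" "g x \<in> carrier R" "h x \<in> carrier R" for x using fg by (auto intro: free_module_closed)
  show "f \<oplus>\<^bsub>free_module R X\<^esub> g \<oplus>\<^bsub>free_module R X\<^esub> h = f \<oplus>\<^bsub>free_module R X\<^esub> (g \<oplus>\<^bsub>free_module R X\<^esub> h)"
    using c by (auto simp: free_module_def a_assoc)
qed (auto simp: free_module_def)

end

section \<open>Presentations and cokernels of maps of free modules\<close>

lemma a_kernel_eq: "a_kernel N P q = {x \<in> carrier N. q x = \<zero>\<^bsub>P\<^esub>}"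
  by (simp add: a_kernel_def kernel_def)

text \<open>Evaluation and substitution respect additivity, so they descend along coordinates to the
  maps \<open>q\<close> and \<open>f\<close> of free modules. The kernel of \<open>q\<close>
  consists of the span of the relations, and each element of that span is, modulo additivity, a
  substituted combination of indices of relations.\<close>

theorem presented_imp_countably_presentable:
  assumes p: "presented R M X e G" and M: "left_module R M" and X: "countable X" and G: "countable G"
  shows "countably_presentable R M"
proof -
  interpret R: ring R using M by (simp add: left_module_def)
  interpret M: left_module R M by fact
  obtain Y :: "nat set" and e' G' where p: "presented R M Y e' G'" and G: "countable G'"
  proof -
    have "bij_betw (to_nat_on X) X (to_nat_on X ` X)" using inj_on_to_nat_on[OF X] by (simp add: bij_betw_def)
    from presented_reindex[OF p M this] show ?thesis using that G by blast
  qed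
  note e = presentedD(1)[OF p] and GF = presentedD(2)[OF p]
  let ?K = "to_nat_on G' ` G'"
  \<comment> \<open>Relations are numbered, since the source of the presenting map is also free on a
    set of naturals.\<close>
  define \<gamma> where "\<gamma> k = inv_into G' (to_nat_on G') k" for k
  have \<gamma>: "\<gamma> k \<in> G'" if "k \<in> ?K" for k unfolding \<gamma>_def using that by (rule inv_into_into)
  have \<gamma>F: "\<gamma> k \<in> FA R Y" if "k \<in> ?K" for k using \<gamma>[OF that] GF by blast
  have \<gamma>s: "\<exists>k\<in>?K. \<gamma> k = g" if "g \<in> G'" for g
    using that inv_into_f_f[OF inj_on_to_nat_on[OF G]] by (auto simp: \<gamma>_def)
  define q where "q v = lev M e' (free_rep R v)" for v
  define f where "f u = (\<lambda>y. R.coord y (lsubst R \<gamma> (free_rep R u)))" for u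
  let ?\<pi> = "\<lambda>z y. R.coord y z"
  have q: "q (?\<pi> z) = lev M e' z" if z: "z \<in> FA R Y" for z
  proof -
    have F: "free_rep R (?\<pi> z) \<in> FA R Y" by (rule R.free_rep_frags[OF R.coord_free[OF z]])
    have "lev M e' (free_rep R (?\<pi> z) - z) = \<zero>\<^bsub>M\<^esub>" by (rule M.lev_linspan[OF e _ _ R.free_rep_coord[OF z]]) auto
    then show ?thesis unfolding q_def using M.lev_diff[OF e F z] M.lev_closed[OF e F] M.lev_closed[OF e z] by (simp add: M.minus_eq_zero)
  qed
  have lF: "lsubst R \<gamma> u \<in> FA R Y" if "u \<in> FA R ?K" for u by (rule R.lsubst_frags[OF that \<gamma>F])
  have f: "f (?\<pi> u) = ?\<pi> (lsubst R \<gamma> u)" if u: "u \<in> FA R ?K" for u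
  proof -
    have F: "free_rep R (?\<pi> u) \<in> FA R ?K" by (rule R.free_rep_frags[OF R.coord_free[OF u]])
    have "lsubst R \<gamma> (free_rep R (?\<pi> u) - u) \<in> linspan R Y {}"
      by (rule R.lsubst_linspan[OF R.free_rep_coord[OF u] empty_subsetI empty_subsetI \<gamma>F]) simp_all
    then show ?thesis unfolding f_def using R.coord_eq_iff[OF lF[OF F] lF[OF u]] by (simp add: lsubst_diff)
  qed
  have surj: "\<exists>z\<in>FA R W. v = ?\<pi> z" if "v \<in> carrier (free_module R W)" for v and W :: "nat set"
    using R.free_rep_frags[OF that] R.coord_free_rep[OF that] by (intro bexI[of _ "free_rep R v"]) auto
  have fh: "f \<in> lmod_hom R (free_module R ?K) (free_module R Y)"
    unfolding lmod_hom_def add_hom_def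
  proof (intro CollectI conjI ballI funcsetI)
    fix v assume "v \<in> carrier (free_module R ?K)"
    then obtain z where z: "z \<in> FA R ?K" "v = ?\<pi> z" using surj by blast
    show "f v \<in> carrier (free_module R Y)" unfolding z(2) f[OF z(1)] by (rule R.coord_free[OF lF[OF z(1)]])
    fix a assume a: "a \<in> carrier R"
    show "f (a \<odot>\<^bsub>free_module R ?K\<^esub> v) = a \<odot>\<^bsub>free_module R Y\<^esub> f v"
    proof -
      have "lsubst R \<gamma> (lsm R a z) = lsm R a (lsubst R \<gamma> z)" by (rule R.lsubst_lsm[OF a z(1)]) (rule \<gamma>F)
      then show ?thesis
        unfolding z(2) R.coord_free_smult[OF a z(1)] f[OF z(1)] f[OF R.lsm_frags[OF a z(1)]] R.coord_free_smult[OF a lF[OF z(1)]] by simp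
    qed
  next
    fix v v' assume "v \<in> carrier (free_module R ?K)" "v' \<in> carrier (free_module R ?K)"
    then obtain z z' where z: "z \<in> FA R ?K" "v = ?\<pi> z" "z' \<in> FA R ?K" "v' = ?\<pi> z'" using surj by metis
    show "f (v \<oplus>\<^bsub>free_module R ?K\<^esub> v') = f v \<oplus>\<^bsub>free_module R Y\<^esub> f v'"
      unfolding z(2,4) R.coord_free_add[OF z(1,3)] f[OF z(1)] f[OF z(3)] f[OF frags_add[OF z(1,3)]] R.coord_free_add[OF lF[OF z(1)] lF[OF z(3)]]
        lsubst_add ..
  qed
  have qh: "q \<in> lmod_hom R (free_module R Y) M"
    unfolding lmod_hom_def add_hom_def
  proof (intro CollectI conjI ballI funcsetI)
    fix v assume "v \<in> carrier (free_module R Y)"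
    then obtain z where z: "z \<in> FA R Y" "v = ?\<pi> z" using surj by blast
    show "q v \<in> carrier M" unfolding z(2) q[OF z(1)] by (rule M.lev_closed[OF e z(1)])
    fix a assume a: "a \<in> carrier R"
    show "q (a \<odot>\<^bsub>free_module R Y\<^esub> v) = a \<odot>\<^bsub>M\<^esub> q v"
      unfolding z(2) R.coord_free_smult[OF a z(1)] q[OF z(1)] q[OF R.lsm_frags[OF a z(1)]] M.lev_lsm[OF e a z(1)] ..
  next
    fix v v' assume "v \<in> carrier (free_module R Y)" "v' \<in> carrier (free_module R Y)"
    then obtain z z' where z: "z \<in> FA R Y" "v = ?\<pi> z" "z' \<in> FA R Y" "v' = ?\<pi> z'" using surj by metis
    show "q (v \<oplus>\<^bsub>free_module R Y\<^esub> v') = q v \<oplus>\<^bsub>M\<^esub> q v'"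
      unfolding z(2,4) R.coord_free_add[OF z(1,3)] q[OF z(1)] q[OF z(3)] q[OF frags_add[OF z(1,3)]] M.lev_add[OF e z(1,3)] ..
  qed
  have img: "q ` carrier (free_module R Y) = carrier M"
  proof
    show "q ` carrier (free_module R Y) \<subseteq> carrier M" using lmod_hom_closed[OF qh] by blast
    show "carrier M \<subseteq> q ` carrier (free_module R Y)"
    proof
      fix x assume "x \<in> carrier M"
      then obtain z where z: "z \<in> FA R Y" "lev M e' z = x" using presentedD(3)[OF p] by blast
      then show "x \<in> q ` carrier (free_module R Y)" using q[OF z(1)] R.coord_free[OF z(1)] by (intro image_eqI[of _ _ "?\<pi> z"]) auto
    qed
  qed
  have span: "\<exists>u\<in>FA R ?K. z - lsubst R \<gamma> u \<in> linspan R Y {}" if "z \<in> linspan R Y G'" for z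
    using that
  proof (induction rule: linspan_induct)
    case zero show ?case by (intro bexI[of _ 0]) (auto simp: linspan_0)
  next
    case (add_rel z a b x)
    then obtain u where "u \<in> FA R ?K" "z - lsubst R \<gamma> u \<in> linspan R Y {}" by blast
    then show ?case using linspan_add[OF _ linspan_addrel[OF add_rel.hyps(2-4), of "{}"], of "z - lsubst R \<gamma> u"]
      by (intro bexI[of _ u]) (simp_all add: algebra_simps)
  next
    case (diff_rel z a b x)
    then obtain u where "u \<in> FA R ?K" "z - lsubst R \<gamma> u \<in> linspan R Y {}" by blast
    then show ?case using linspan_diff[OF _ linspan_addrel[OF diff_rel.hyps(2-4), of "{}"], of "z - lsubst R \<gamma> u"]
      by (intro bexI[of _ u]) (simp_all add: algebra_simps)
  next
    case (add_gen z a g)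
    then obtain u where u: "u \<in> FA R ?K" "z - lsubst R \<gamma> u \<in> linspan R Y {}" by blast
    obtain k where k: "k \<in> ?K" "\<gamma> k = g" using \<gamma>s add_gen by blast
    show ?case using u k add_gen by (intro bexI[of _ "u + frag_of (a, k)"]) (auto simp: lsubst_add algebra_simps)
  next
    case (diff_gen z a g)
    then obtain u where u: "u \<in> FA R ?K" "z - lsubst R \<gamma> u \<in> linspan R Y {}" by blast
    obtain k where k: "k \<in> ?K" "\<gamma> k = g" using \<gamma>s diff_gen by blast
    show ?case using u k diff_gen by (intro bexI[of _ "u - frag_of (a, k)"]) (auto simp: lsubst_diff algebra_simps)
  qed
  have lG: "lsubst R \<gamma> u \<in> linspan R Y G'" if "u \<in> FA R ?K" for u
    using that by (induction rule: frags_induct) (auto simp: lsubst_diff linspan_0 intro!: linspan_diff linspan_lsm_base \<gamma>)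
  have ker: "a_kernel (free_module R Y) M q = f ` carrier (free_module R ?K)"
  proof
    show "a_kernel (free_module R Y) M q \<subseteq> f ` carrier (free_module R ?K)"
    proof
      fix v assume "v \<in> a_kernel (free_module R Y) M q"
      then have v: "v \<in> carrier (free_module R Y)" "q v = \<zero>\<^bsub>M\<^esub>" by (auto simp: a_kernel_eq)
      obtain z where z: "z \<in> FA R Y" "v = ?\<pi> z" using surj[OF v(1)] by blast
      have "z \<in> linspan R Y G'" using v(2) q[OF z(1)] presentedD(4)[OF p z(1)] z(2) by simp
      then obtain u where u: "u \<in> FA R ?K" "z - lsubst R \<gamma> u \<in> linspan R Y {}" using span by blast
      have "\<forall>y. R.coord y z = R.coord y (lsubst R \<gamma> u)" using R.coord_eq_iff[OF z(1) lF[OF u(1)]] u(2) by simp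
      then have "v = f (?\<pi> u)" unfolding z(2) f[OF u(1)] by simp
      then show "v \<in> f ` carrier (free_module R ?K)" using R.coord_free[OF u(1)] by blast
    qed
    show "f ` carrier (free_module R ?K) \<subseteq> a_kernel (free_module R Y) M q"
    proof
      fix v assume "v \<in> f ` carrier (free_module R ?K)"
      then obtain w where w: "w \<in> carrier (free_module R ?K)" "v = f w" by blast
      obtain u where u: "u \<in> FA R ?K" "w = ?\<pi> u" using surj[OF w(1)] by blast
      have "q v = \<zero>\<^bsub>M\<^esub>" unfolding w(2) u(2) f[OF u(1)] q[OF lF[OF u(1)]] using lG[OF u(1)] presentedD(4)[OF p lF[OF u(1)]] by simp
      then show "v \<in> a_kernel (free_module R Y) M q" using lmod_hom_closed[OF fh w(1)] w(2) by (simp add: a_kernel_eq)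
    qed
  qed
  show ?thesis unfolding countably_presentable_def is_cokernel_def
    by (rule exI[of _ ?K], rule exI[of _ Y], rule exI[of _ f], rule exI[of _ q]) (use fh qh img ker in blast)
qed

text \<open>The relations are the images of the basis vectors under the presenting map, written as
  combinations by \<open>free_rep\<close>; their span is the image of that map, which is the kernel
  of \<open>q\<close>.\<close>

theorem countably_presentable_imp_presented:
  assumes cp: "countably_presentable R M" and M: "left_module R M"
  shows "\<exists>(Y :: nat set) e G. countable G \<and> presented R M Y e G"
proof -
  interpret R: ring R using M by (simp add: left_module_def)
  interpret M: left_module R M by fact
  obtain X Y :: "nat set" and f q where f: "f \<in> lmod_hom R (free_module R X) (free_module R Y)"
    and q: "q \<in> lmod_hom R (free_module R Y) M" and img: "q ` carrier (free_module R Y) = carrier M"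
    and ker: "a_kernel (free_module R Y) M q = f ` carrier (free_module R X)"
    using cp unfolding countably_presentable_def is_cokernel_def by blast
  let ?\<pi> = "\<lambda>z y. R.coord y z"
  define \<delta> where "\<delta> n = ?\<pi> (frag_of (\<one>\<^bsub>R\<^esub>, n))" for n :: nat
  have \<delta>: "\<delta> n \<in> carrier (free_module R W)" if "n \<in> W" for n and W :: "nat set"
    unfolding \<delta>_def by (rule R.coord_free) (use that in simp)
  define e where "e n = q (\<delta> n)" for n
  have e: "e \<in> Y \<rightarrow> carrier M" using lmod_hom_closed[OF q \<delta>] by (auto simp: e_def)
  have gen: "?\<pi> (frag_of (a, n)) = a \<odot>\<^bsub>free_module R W\<^esub> \<delta> n" if "a \<in> carrier R" "n \<in> W" for a n and W :: "nat set"
    unfolding \<delta>_def using R.coord_free_smult[of a "frag_of (\<one>\<^bsub>R\<^esub>, n)" W] that by simp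
  have \<pi>_hom: "?\<pi> (z - w) = ?\<pi> z \<ominus>\<^bsub>free_module R W\<^esub> ?\<pi> w" if "z \<in> FA R W" "w \<in> FA R W" for z w and W :: "nat set"
  proof -
    interpret F: abelian_group "free_module R W" by (rule R.free_module_group)
    have "?\<pi> (z - w) \<oplus>\<^bsub>free_module R W\<^esub> ?\<pi> w = ?\<pi> z" using R.coord_free_add[OF frags_diff[OF that] that(2)] by simp
    then show ?thesis using R.coord_free[OF that(1)] R.coord_free[OF that(2)] R.coord_free[OF frags_diff[OF that]]
      by (metis a_minus_def F.add.inv_solve_right)
  qed
  have lq: "q (?\<pi> z) = lev M e z" if "z \<in> FA R Y" for z
    using that
  proof (induction rule: frags_induct)
    case zero
    have "?\<pi> 0 = \<zero>\<^bsub>free_module R Y\<^esub>" by (simp add: free_module_def)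
    then show ?case using add_hom_zero[OF R.free_module_group M.M.abelian_group_axioms lmod_hom_add_hom[OF q]] by simp
  next
    case (of p)
    then obtain a n where p: "p = (a, n)" "a \<in> carrier R" "n \<in> Y" by auto
    have "e n \<in> carrier M" using e p by auto
    then show ?case using p gen[OF p(2,3)] lmod_hom_smult[OF q p(2) \<delta>[OF p(3)]] by (simp add: M.lev_of e_def)
  next
    case (diff z w)
    then show ?case using \<pi>_hom[OF diff(1,2)] M.lev_diff[OF e diff(1,2)]
      add_hom_diff[OF R.free_module_group M.M.abelian_group_axioms lmod_hom_add_hom[OF q] R.coord_free[OF diff(1)] R.coord_free[OF diff(2)]] by simp
  qed
  define s where "s n = free_rep R (f (\<delta> n))" for n
  have s: "s n \<in> FA R Y" if "n \<in> X" for n unfolding s_def by (rule R.free_rep_frags[OF lmod_hom_closed[OF f \<delta>[OF that]]])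
  have ls: "f (?\<pi> u) = ?\<pi> (lsubst R s u)" if "u \<in> FA R X" for u
    using that
  proof (induction rule: frags_induct)
    case zero
    have "?\<pi> 0 = \<zero>\<^bsub>free_module R X\<^esub>" "?\<pi> 0 = \<zero>\<^bsub>free_module R Y\<^esub>" by (simp_all add: free_module_def)
    then show ?case using add_hom_zero[OF R.free_module_group R.free_module_group lmod_hom_add_hom[OF f]] by simp
  next
    case (of p)
    then obtain a n where p: "p = (a, n)" "a \<in> carrier R" "n \<in> X" by auto
    have "?\<pi> (s n) = f (\<delta> n)" unfolding s_def using R.coord_free_rep[OF lmod_hom_closed[OF f \<delta>[OF p(3)]]] by auto
    then show ?case using p gen[OF p(2,3)] lmod_hom_smult[OF f p(2) \<delta>[OF p(3)]] R.coord_free_smult[OF p(2) s[OF p(3)]] by simp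
  next
    case (diff z w)
    then show ?case
      using \<pi>_hom[OF diff(1,2)] \<pi>_hom[OF R.lsubst_frags[OF diff(1) s] R.lsubst_frags[OF diff(2) s]]
      add_hom_diff[OF R.free_module_group R.free_module_group lmod_hom_add_hom[OF f] R.coord_free[OF diff(1)] R.coord_free[OF diff(2)]]
      by (simp add: lsubst_diff)
  qed
  let ?G = "s ` X"
  have GF: "?G \<subseteq> FA R Y" using s by blast
  have "presented R M Y e ?G" unfolding presented_def
  proof (intro conjI ballI e GF)
    fix x assume "x \<in> carrier M"
    then obtain v where v: "v \<in> carrier (free_module R Y)" "x = q v" using img by blast
    have "?\<pi> (free_rep R v) = v" using R.coord_free_rep[OF v(1)] by auto
    then show "\<exists>z\<in>FA R Y. lev M e z = x" using lq[OF R.free_rep_frags[OF v(1)]] v R.free_rep_frags[OF v(1)] by (intro bexI[of _ "free_rep R v"]) auto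
  next
    fix z assume z: "z \<in> FA R Y"
    show "lev M e z = \<zero>\<^bsub>M\<^esub> \<longleftrightarrow> z \<in> linspan R Y ?G"
    proof
      assume "lev M e z = \<zero>\<^bsub>M\<^esub>"
      then have "?\<pi> z \<in> f ` carrier (free_module R X)" unfolding ker[symmetric] a_kernel_eq using lq[OF z] R.coord_free[OF z] by simp
      then obtain v where v: "v \<in> carrier (free_module R X)" "?\<pi> z = f v" by blast
      let ?u = "free_rep R v"
      have u: "?u \<in> FA R X" by (rule R.free_rep_frags[OF v(1)])
      have "?\<pi> ?u = v" using R.coord_free_rep[OF v(1)] by auto
      then have "?\<pi> z = ?\<pi> (lsubst R s ?u)" using v(2) ls[OF u] by simp
      then have "\<forall>y. R.coord y z = R.coord y (lsubst R s ?u)" by (simp add: fun_eq_iff)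
      then have 1: "z - lsubst R s ?u \<in> linspan R Y {}" using R.coord_eq_iff[OF z R.lsubst_frags[OF u s]] by simp
      have 2: "lsubst R s u \<in> linspan R Y ?G" if "u \<in> FA R X" for u
        using that by (induction rule: frags_induct) (auto simp: lsubst_diff linspan_0 intro!: linspan_diff linspan_lsm_base)
      have "z - lsubst R s ?u \<in> linspan R Y ?G" using 1 linspan_mono[of Y Y "{}" ?G R] by blast
      from linspan_add[OF this 2[OF u]] show "z \<in> linspan R Y ?G" by simp
    next
      assume "z \<in> linspan R Y ?G"
      then show "lev M e z = \<zero>\<^bsub>M\<^esub>"
      proof (rule M.lev_linspan_r[OF _ e GF])
        fix g assume "g \<in> ?G"
        then obtain n where n: "n \<in> X" "g = s n" by blast
        have "f (\<delta> n) \<in> a_kernel (free_module R Y) M q" unfolding ker using \<delta>[OF n(1)] by blast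
        moreover have "?\<pi> (s n) = f (\<delta> n)" unfolding s_def using R.coord_free_rep[OF lmod_hom_closed[OF f \<delta>[OF n(1)]]] by auto
        ultimately show "lev M e g = \<zero>\<^bsub>M\<^esub>" using lq[OF s[OF n(1)]] n(2) by (simp add: a_kernel_eq)
      qed
    qed
  qed
  then show ?thesis by (intro exI[of _ Y] exI[of _ e] exI[of _ ?G] conjI countable_image countableI_type)
qed

section \<open>Countably presentable comodules are presentable\<close>

text \<open>The countably many witnessing stages have one upper bound. \<open>i\<close> is inserted
  among them so that the bound lies above \<open>i\<close> also when \<open>S\<close> is
  empty.\<close>

lemma (in directed_preorder) eventually_countable:
  assumes cdir: "\<And>S. S \<subseteq> I \<Longrightarrow> countable S \<Longrightarrow> \<exists>u\<in>I. \<forall>s\<in>S. (s, u) \<in> r"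
    and S: "countable S" and i: "i \<in> I" and ex: "\<And>s. s \<in> S \<Longrightarrow> \<exists>k. (i, k) \<in> r \<and> P s k"
    and mono: "\<And>s k l. s \<in> S \<Longrightarrow> (i, k) \<in> r \<Longrightarrow> P s k \<Longrightarrow> (k, l) \<in> r \<Longrightarrow> P s l"
  shows "\<exists>k. (i, k) \<in> r \<and> (\<forall>s\<in>S. P s k)"
proof -
  obtain K where K: "\<And>s. s \<in> S \<Longrightarrow> (i, K s) \<in> r \<and> P s (K s)" using bchoice[of S "\<lambda>s k. (i, k) \<in> r \<and> P s k"] ex by blast
  have "insert i (K ` S) \<subseteq> I" using K r_I i by blast
  moreover have "countable (insert i (K ` S))" using S by simp
  ultimately obtain u where u: "u \<in> I" "\<forall>s\<in>insert i (K ` S). (s, u) \<in> r" using cdir by blast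
  have "P s u" if "s \<in> S" for s
    by (rule mono[OF that]) (use K[OF that] u(2) that in auto)
  then show ?thesis using u by blast
qed

context dirlim
begin

text \<open>The images of countably many generators are lifted to a common stage; countably many
  relations, true in \<open>L\<close>, become true at a later one, where the presentation yields a
  linear map.\<close>

lemma factor_hom:
  assumes cdir: "\<And>S. S \<subseteq> I \<Longrightarrow> countable S \<Longrightarrow> \<exists>u\<in>I. \<forall>s\<in>S. (s, u) \<in> r"
    and p: "presented R M X e G" and X: "countable X" and G: "countable G" and M: "left_module R M"
    and h: "h \<in> lmod_hom R M L"
  shows "\<exists>i\<in>I. \<exists>f\<in>lmod_hom R M (D i). \<forall>x\<in>carrier M. \<iota> i (f x) = h x"
proof -
  interpret M: left_module R M by fact
  interpret L: left_module R L by (rule L_mod)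
  note e = presentedD(1)[OF p] and GF = presentedD(2)[OF p]
  have ex: "\<exists>q. fst q \<in> I \<and> snd q \<in> carrier (D (fst q)) \<and> \<iota> (fst q) (snd q) = h (e x)" if "x \<in> X" for x
  proof -
    have "h (e x) \<in> carrier L" using e that by (intro lmod_hom_closed[OF h]) auto
    then obtain i y where "i \<in> I" "y \<in> carrier (D i)" "\<iota> i y = h (e x)" using \<iota>_surj by blast
    then show ?thesis by (intro exI[of _ "(i, y)"]) simp
  qed
  then obtain Q where Q: "\<And>x. x \<in> X \<Longrightarrow> fst (Q x) \<in> I \<and> snd (Q x) \<in> carrier (D (fst (Q x))) \<and> \<iota> (fst (Q x)) (snd (Q x)) = h (e x)"
    using bchoice[of X "\<lambda>x q. fst q \<in> I \<and> snd q \<in> carrier (D (fst q)) \<and> \<iota> (fst q) (snd q) = h (e x)"] by blast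
  have "(\<lambda>x. fst (Q x)) ` X \<subseteq> I" "countable ((\<lambda>x. fst (Q x)) ` X)" using Q X by auto
  from cdir[OF this] obtain u where u: "u \<in> I" "\<forall>x\<in>X. (fst (Q x), u) \<in> r" by auto
  interpret U: left_module R "D u" by (rule D_mod[OF u(1)])
  define l where "l x = d (fst (Q x)) u (snd (Q x))" for x
  have l: "l \<in> X \<rightarrow> carrier (D u)" using Q u(2) d_closed by (auto simp: l_def)
  have \<iota>l: "\<iota> u (l x) = h (e x)" if "x \<in> X" for x
    unfolding l_def using \<iota>_comp[OF u(2)[rule_format, OF that]] Q[OF that] by simp
  have G0: "lev M e g = \<zero>\<^bsub>M\<^esub>" "g \<in> FA R X" if "g \<in> G" for g
  proof -
    show gF: "g \<in> FA R X" using that GF by blast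
    have "lsm R \<one>\<^bsub>R\<^esub> g \<in> linspan R X G" using that by (intro linspan_lsm_base) auto
    then show "lev M e g = \<zero>\<^bsub>M\<^esub>" using presentedD(4)[OF p gF] M.lsm_one[OF gF] by simp
  qed
  have zero: "h \<zero>\<^bsub>M\<^esub> = \<zero>\<^bsub>L\<^esub>" "\<iota> u \<zero>\<^bsub>D u\<^esub> = \<zero>\<^bsub>L\<^esub>"
    using add_hom_zero[OF M.M.abelian_group_axioms L.M.abelian_group_axioms lmod_hom_add_hom[OF h]]
      add_hom_zero[OF U.M.abelian_group_axioms L.M.abelian_group_axioms lmod_hom_add_hom[OF \<iota>_hom[OF u(1)]]] .
  have "\<exists>k. (u, k) \<in> r \<and> (\<forall>g\<in>G. d u k (lev (D u) l g) = d u k \<zero>\<^bsub>D u\<^esub>)"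
  proof (rule eventually_countable[OF cdir G u(1)])
    fix g assume g: "g \<in> G"
    have "\<iota> u (lev (D u) l g) = lev L (\<lambda>x. \<iota> u (l x)) g"
      by (rule lmod_hom_lev[OF U.left_module_axioms L_mod \<iota>_hom[OF u(1)] l G0(2)[OF g]])
    also have "\<dots> = lev L (\<lambda>x. h (e x)) g"
      by (rule L.lev_cong[OF G0(2)[OF g]]) (use \<iota>l e lmod_hom_closed[OF h] in auto)
    also have "\<dots> = h (lev M e g)" by (rule lmod_hom_lev[OF M L_mod h e G0(2)[OF g], symmetric])
    finally have "\<iota> u (lev (D u) l g) = \<iota> u \<zero>\<^bsub>D u\<^esub>" using G0(1)[OF g] zero by simp
    then show "\<exists>k. (u, k) \<in> r \<and> d u k (lev (D u) l g) = d u k \<zero>\<^bsub>D u\<^esub>"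
      using \<iota>_inj[OF u(1) U.lev_closed[OF l G0(2)[OF g]] U.M.zero_closed] by simp
  next
    fix g k k' assume g: "g \<in> G" and k: "(u, k) \<in> r" "d u k (lev (D u) l g) = d u k \<zero>\<^bsub>D u\<^esub>" "(k, k') \<in> r"
    show "d u k' (lev (D u) l g) = d u k' \<zero>\<^bsub>D u\<^esub>"
      using d_comp[OF k(1,3) U.lev_closed[OF l G0(2)[OF g]]] d_comp[OF k(1,3) U.M.zero_closed] k(2) by simp
  qed
  then obtain k where k: "(u, k) \<in> r" "\<And>g. g \<in> G \<Longrightarrow> d u k (lev (D u) l g) = d u k \<zero>\<^bsub>D u\<^esub>" by blast
  have kI: "k \<in> I" using r_I k by blast
  interpret Kk: left_module R "D k" by (rule D_mod[OF kI])
  have l': "(\<lambda>x. d u k (l x)) \<in> X \<rightarrow> carrier (D k)" using l d_closed[OF k(1)] by auto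
  have "lev (D k) (\<lambda>x. d u k (l x)) g = \<zero>\<^bsub>D k\<^esub>" if g: "g \<in> G" for g
    using lmod_hom_lev[OF U.left_module_axioms Kk.left_module_axioms d_hom[OF k(1)] l G0(2)[OF g]] k(2)[OF g]
      add_hom_zero[OF U.M.abelian_group_axioms Kk.M.abelian_group_axioms lmod_hom_add_hom[OF d_hom[OF k(1)]]] by simp
  from presented_lift[OF p M Kk.left_module_axioms l' this] obtain f where f: "f \<in> lmod_hom R M (D k)"
    "\<forall>z\<in>FA R X. f (lev M e z) = lev (D k) (\<lambda>x. d u k (l x)) z" by blast
  have "\<iota> k (f x) = h x" if "x \<in> carrier M" for x
  proof (rule presented_hom_eq[OF p M L_mod lmod_hom_compose[OF f(1) \<iota>_hom[OF kI]] h _ that])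
    fix x assume x: "x \<in> X"
    have ex: "e x \<in> carrier M" "l x \<in> carrier (D u)" using e l x by auto
    have "f (e x) = f (lev M e (frag_of (\<one>\<^bsub>R\<^esub>, x)))" using ex by (simp add: M.lev_of M.smult_one)
    also have "\<dots> = lev (D k) (\<lambda>x. d u k (l x)) (frag_of (\<one>\<^bsub>R\<^esub>, x))" using f(2) x by simp
    also have "\<dots> = d u k (l x)" using d_closed[OF k(1) ex(2)] by (simp add: Kk.lev_of Kk.smult_one)
    finally show "\<iota> k (f (e x)) = h (e x)" using \<iota>_comp[OF k(1) ex(2)] \<iota>l[OF x] by simp
  qed
  then show ?thesis using kI f(1) by blast
qed

text \<open>Linear maps out of \<open>M\<close> are compared on its countably many generators, each
  of which contributes one stage.\<close>

lemma eventually_hom_eq: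
  assumes cdir: "\<And>S. S \<subseteq> I \<Longrightarrow> countable S \<Longrightarrow> \<exists>u\<in>I. \<forall>s\<in>S. (s, u) \<in> r"
    and p: "presented R M X e G" and X: "countable X" and M: "left_module R M"
    and i: "i \<in> I" and f: "f \<in> lmod_hom R M (D i)" "f' \<in> lmod_hom R M (D i)"
    and eq: "\<And>x. x \<in> carrier M \<Longrightarrow> \<iota> i (f x) = \<iota> i (f' x)"
  shows "\<exists>k. (i, k) \<in> r \<and> (\<forall>x\<in>carrier M. d i k (f x) = d i k (f' x))"
proof -
  note e = presentedD(1)[OF p]
  have c: "f (e x) \<in> carrier (D i)" "f' (e x) \<in> carrier (D i)" if "x \<in> X" for x
    using e that by (auto intro: lmod_hom_closed[OF f(1)] lmod_hom_closed[OF f(2)])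
  have "\<exists>k. (i, k) \<in> r \<and> (\<forall>x\<in>X. d i k (f (e x)) = d i k (f' (e x)))"
  proof (rule eventually_countable[OF cdir X i])
    fix x assume x: "x \<in> X"
    then have "e x \<in> carrier M" using e by auto
    from \<iota>_inj[OF i c[OF x] eq[OF this]] show "\<exists>k. (i, k) \<in> r \<and> d i k (f (e x)) = d i k (f' (e x))" .
  next
    fix x k k' assume x: "x \<in> X" and k: "(i, k) \<in> r" "d i k (f (e x)) = d i k (f' (e x))" "(k, k') \<in> r"
    show "d i k' (f (e x)) = d i k' (f' (e x))"
      using d_comp[OF k(1,3) c(1)[OF x]] d_comp[OF k(1,3) c(2)[OF x]] k(2) by simp
  qed
  then obtain k where k: "(i, k) \<in> r" "\<And>x. x \<in> X \<Longrightarrow> d i k (f (e x)) = d i k (f' (e x))" by blast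
  have "d i k (f x) = d i k (f' x)" if "x \<in> carrier M" for x
    by (rule presented_hom_eq[OF p M D_mod[OF r_I(2)[OF k(1)]] lmod_hom_compose[OF f(1) d_hom[OF k(1)]]
        lmod_hom_compose[OF f(2) d_hom[OF k(1)]] k(2) that])
  then show ?thesis using k(1) by blast
qed

end

text \<open>The two element conditions imply the universal property in sets: the mediating map is
  read off at any stage that reaches the given element.\<close>

lemma set_colimitI:
  assumes "directed_preorder I r"
    and t: "\<And>i j. (i, j) \<in> r \<Longrightarrow> t i j \<in> F i \<rightarrow>\<^sub>E F j" and l: "\<And>i. i \<in> I \<Longrightarrow> l i \<in> F i \<rightarrow>\<^sub>E L"
    and comp: "\<And>i j x. (i, j) \<in> r \<Longrightarrow> x \<in> F i \<Longrightarrow> l j (t i j x) = l i x"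
    and surj: "\<And>y. y \<in> L \<Longrightarrow> \<exists>i\<in>I. \<exists>x\<in>F i. l i x = y"
    and inj: "\<And>i x y. i \<in> I \<Longrightarrow> x \<in> F i \<Longrightarrow> y \<in> F i \<Longrightarrow> l i x = l i y \<Longrightarrow> \<exists>k. (i, k) \<in> r \<and> t i k x = t i k y"
  shows "is_colimit set_cat I r F t L l"
proof -
  interpret directed_preorder I r by fact
  have coc: "cocone set_cat I r F t L l"
    unfolding cocone_def set_cat_def
  proof (simp, intro conjI ballI)
    show "l i \<in> F i \<rightarrow>\<^sub>E L" if "i \<in> I" for i by (rule l[OF that])
    fix p assume "p \<in> r"
    then obtain i j where p: "p = (i, j)" "(i, j) \<in> r" by (cases p) auto
    have "compose (F i) (l j) (t i j) = l i"
      using comp[OF p(2)] l[OF r_I(1)[OF p(2)]] by (auto simp: compose_def PiE_def extensional_def fun_eq_iff)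
    then show "case p of (i, j) \<Rightarrow> compose (F i) (l j) (t i j) = l i" using p by simp
  qed
  have "\<exists>!h. h \<in> L \<rightarrow>\<^sub>E N \<and> (\<forall>i\<in>I. compose (F i) h (l i) = \<phi> i)" if N: "cocone set_cat I r F t N \<phi>" for N \<phi>
  proof -
    have \<phi>: "\<phi> i \<in> F i \<rightarrow>\<^sub>E N" if "i \<in> I" for i using N that by (simp add: cocone_def set_cat_def)
    have \<phi>c: "\<phi> j (t i j x) = \<phi> i x" if "(i, j) \<in> r" "x \<in> F i" for i j x
    proof -
      have "compose (F i) (\<phi> j) (t i j) = \<phi> i" using N that(1) by (auto simp: cocone_def set_cat_def)
      then show ?thesis using that(2) by (metis compose_eq)
    qed
    define h where "h = (\<lambda>y\<in>L. SOME z. \<exists>i\<in>I. \<exists>x\<in>F i. l i x = y \<and> z = \<phi> i x)"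
    have h: "h (l i x) = \<phi> i x" if i: "i \<in> I" "x \<in> F i" for i x
    proof -
      have "(SOME z. \<exists>j\<in>I. \<exists>y\<in>F j. l j y = l i x \<and> z = \<phi> j y) = \<phi> i x"
      proof (rule some_equality)
        show "\<exists>j\<in>I. \<exists>y\<in>F j. l j y = l i x \<and> \<phi> i x = \<phi> j y" using i by blast
        fix z assume "\<exists>j\<in>I. \<exists>y\<in>F j. l j y = l i x \<and> z = \<phi> j y"
        then obtain j y where j: "j \<in> I" "y \<in> F j" "l j y = l i x" "z = \<phi> j y" by blast
        obtain k where k: "(i, k) \<in> r" "(j, k) \<in> r" using upper i j by blast
        have tk: "t i k x \<in> F k" "t j k y \<in> F k" using PiE_mem[OF t[OF k(1)] i(2)] PiE_mem[OF t[OF k(2)] j(2)] .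
        have "l k (t i k x) = l k (t j k y)" using comp k i j by simp
        then obtain m where m: "(k, m) \<in> r" "t k m (t i k x) = t k m (t j k y)"
          using inj[OF r_I(2)[OF k(1)] tk] by blast
        have "\<phi> m (t k m (t i k x)) = \<phi> i x" "\<phi> m (t k m (t j k y)) = \<phi> j y"
          using \<phi>c[OF m(1) tk(1)] \<phi>c[OF k(1) i(2)] \<phi>c[OF m(1) tk(2)] \<phi>c[OF k(2) j(2)] by simp_all
        then show "z = \<phi> i x" using j(4) m(2) by simp
      qed
      then show ?thesis unfolding h_def using PiE_mem[OF l[OF i(1)] i(2)] by simp
    qed
    have hN: "h \<in> L \<rightarrow>\<^sub>E N"
    proof (rule PiE_I)
      fix y assume "y \<in> L"
      then obtain i x where i: "i \<in> I" "x \<in> F i" "l i x = y" using surj by blast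
      show "h y \<in> N" unfolding i(3)[symmetric] h[OF i(1,2)] by (rule PiE_mem[OF \<phi>[OF i(1)] i(2)])
    qed (simp add: h_def)
    show ?thesis
    proof (rule ex1I[of _ h])
      show "h \<in> L \<rightarrow>\<^sub>E N \<and> (\<forall>i\<in>I. compose (F i) h (l i) = \<phi> i)"
        using hN h \<phi> by (auto simp: compose_def PiE_def extensional_def fun_eq_iff)
      fix g assume g: "g \<in> L \<rightarrow>\<^sub>E N \<and> (\<forall>i\<in>I. compose (F i) g (l i) = \<phi> i)"
      show "g = h"
      proof (rule extensionalityI[of _ L])
        show "g \<in> extensional L" "h \<in> extensional L" using g hN by (auto simp: PiE_def)
        fix y assume "y \<in> L"
        then obtain i x where i: "i \<in> I" "x \<in> F i" "l i x = y" using surj by blast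
        have "g (l i x) = \<phi> i x" using g i by (metis compose_eq)
        then show "g y = h y" using h[OF i(1,2)] i(3) by simp
      qed
    qed
  qed
  then show ?thesis unfolding is_colimit_def using coc by (simp add: set_cat_def)
qed

text \<open>A comodule map into the colimit is first factored as a linear map. Compatibility of the
  factor with the coactions equates two linear maps into \<open>C\<close> tensor a stage. The
  equation holds over the colimit, and since tensoring with \<open>C\<close> preserves the colimit
  it holds from some stage on.\<close>

theorem (in coring) countably_presentable_imp_presentable:
  fixes \<kappa> :: "'u rel"
  assumes \<kappa>: "universe_cardinal \<kappa>" and S: "S \<in> Ob (comod_flat_cat \<kappa> R C)" and cp: "countably_presentable R S"
  shows "aleph1_presentable \<kappa> (comod_flat_cat \<kappa> R C) S"
  unfolding aleph1_presentable_def
proof (intro conjI allI impI S; elim conjE)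
  let ?K = "comod_flat_cat \<kappa> R C"
  fix I r D d L \<iota> assume dia: "aleph1_diagram \<kappa> ?K I r D d" and col: "is_colimit ?K I r D d L \<iota>"
  have SC: "comodule R C S" using S by (simp add: comod_flat_cat_simps)
  note SM = comodule_left[OF SC]
  obtain Y :: "nat set" and e G where G: "countable G" and p: "presented R S Y e G"
    using countably_presentable_imp_presented[OF cp SM] by blast
  have Y: "countable Y" by simp
  interpret dirlim I r R D d L \<iota> by (rule colimit_dirlim[OF \<kappa> dia col])
  have cdir: "\<exists>u\<in>I. \<forall>s\<in>T. (s, u) \<in> r" if "T \<subseteq> I" "countable T" for T
    using dia that unfolding aleph1_diagram_def aleph1_directed_def by blast
  have dg: "diagram ?K I r D d" using dia by (simp add: aleph1_diagram_def)
  note dd = dg[unfolded diagram_def comod_flat_cat_simps]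
  have DC: "comodule R C (D i)" if "i \<in> I" for i using dd that by blast
  have dh: "d i j \<in> comod_hom R C (D i) (D j)" if "(i, j) \<in> r" for i j using dd that by blast
  have cc: "cocone ?K I r D d L \<iota>" using col by (simp add: is_colimit_def)
  note cc = cc[unfolded cocone_def comod_flat_cat_simps]
  have LC: "comodule R C L" using cc by simp
  have \<iota>h: "\<iota> i \<in> comod_hom R C (D i) L" if "i \<in> I" for i using cc that by blast
  interpret T: dirlim I r R "\<lambda>i. tensor R C (D i)" "\<lambda>i j. Cmap (D j) (d i j)" "tensor R C L" "\<lambda>i. Cmap L (\<iota> i)"
    by (rule dirlim_tensor[OF CB])
  show "is_colimit set_cat I r (\<lambda>i. Hom ?K S (D i)) (\<lambda>i j. post_comp ?K S (D i) (D j) (d i j)) (Hom ?K S L)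
      (\<lambda>i. post_comp ?K S (D i) L (\<iota> i))"
    unfolding post_comp_def comod_flat_cat_simps
  proof (rule set_colimitI)
    show "directed_preorder I r" by (rule directed_preorder_axioms)
    show "(\<lambda>f\<in>comod_hom R C S (D i). compose (carrier S) (d i j) f) \<in> comod_hom R C S (D i) \<rightarrow>\<^sub>E comod_hom R C S (D j)"
      if "(i, j) \<in> r" for i j
      using comod_hom_comp[OF SC DC[OF r_I(1)[OF that]] DC[OF r_I(2)[OF that]] _ dh[OF that]] by simp
    show "(\<lambda>f\<in>comod_hom R C S (D i). compose (carrier S) (\<iota> i) f) \<in> comod_hom R C S (D i) \<rightarrow>\<^sub>E comod_hom R C S L"
      if "i \<in> I" for i
      using comod_hom_comp[OF SC DC[OF that] LC _ \<iota>h[OF that]] by simp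
    show "(\<lambda>f\<in>comod_hom R C S (D j). compose (carrier S) (\<iota> j) f) ((\<lambda>f\<in>comod_hom R C S (D i). compose (carrier S) (d i j) f) x)
        = (\<lambda>f\<in>comod_hom R C S (D i). compose (carrier S) (\<iota> i) f) x"
      if ij: "(i, j) \<in> r" and x: "x \<in> comod_hom R C S (D i)" for i j x
    proof -
      have "compose (carrier S) (d i j) x \<in> comod_hom R C S (D j)"
        by (rule comod_hom_comp[OF SC DC[OF r_I(1)[OF ij]] DC[OF r_I(2)[OF ij]] x dh[OF ij]])
      moreover have "compose (carrier S) (\<iota> j) (compose (carrier S) (d i j) x) = compose (carrier S) (\<iota> i) x"
        using \<iota>_comp[OF ij comod_homD(3)[OF x]] by (auto simp: compose_def restrict_def fun_eq_iff)
      ultimately show ?thesis using x by simp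
    qed
  next
    fix g assume g: "g \<in> comod_hom R C S L"
    obtain i f where i: "i \<in> I" and f: "f \<in> lmod_hom R S (D i)" "\<forall>x\<in>carrier S. \<iota> i (f x) = g x"
      using factor_hom[OF cdir p Y G SM comod_homD(2)[OF g]] by blast
    note Di = D_mod[OF i]
    have h1: "(\<lambda>x. coact (D i) (f x)) \<in> lmod_hom R S (tensor R C (D i))"
      by (rule lmod_hom_compose[OF f(1) coact_lmod_hom[OF DC[OF i]]])
    have h2: "(\<lambda>x. Cmap (D i) f (coact S x)) \<in> lmod_hom R S (tensor R C (D i))"
      by (rule lmod_hom_compose[OF coact_lmod_hom[OF SC] Cmap_hom[OF SM Di f(1)]])
    have eq: "Cmap L (\<iota> i) (coact (D i) (f x)) = Cmap L (\<iota> i) (Cmap (D i) f (coact S x))" if x: "x \<in> carrier S" for x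
    proof -
      have "Cmap L (\<iota> i) (Cmap (D i) f (coact S x)) = Cmap L g (coact S x)"
        by (rule Cmap_Cmap[OF SM Di L_mod f(1) \<iota>_hom[OF i] coact_closed[OF SC x]]) (use f(2) in simp)
      then show ?thesis
        using comod_homD(4)[OF \<iota>h[OF i] lmod_hom_closed[OF f(1) x]] comod_homD(4)[OF g x] f(2) x by simp
    qed
    obtain k where k: "(i, k) \<in> r" "\<forall>x\<in>carrier S. Cmap (D k) (d i k) (coact (D i) (f x)) = Cmap (D k) (d i k) (Cmap (D i) f (coact S x))"
      using T.eventually_hom_eq[OF cdir p Y SM i h1 h2 eq] by blast
    have kI: "k \<in> I" using r_I k by blast
    let ?f = "restrict (\<lambda>x. d i k (f x)) (carrier S)"
    have "?f \<in> comod_hom R C S (D k)"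
    proof (rule comod_hom_restrict[OF SC DC[OF kI] lmod_hom_compose[OF f(1) d_hom[OF k(1)]]])
      fix x assume x: "x \<in> carrier S"
      have "Cmap (D k) (d i k) (Cmap (D i) f (coact S x)) = Cmap (D k) (\<lambda>x. d i k (f x)) (coact S x)"
        by (rule Cmap_Cmap[OF SM Di D_mod[OF kI] f(1) d_hom[OF k(1)] coact_closed[OF SC x]]) simp
      then show "coact (D k) (d i k (f x)) = Cmap (D k) (\<lambda>x. d i k (f x)) (coact S x)"
        using comod_homD(4)[OF dh[OF k(1)] lmod_hom_closed[OF f(1) x]] k(2) x by simp
    qed
    moreover have "compose (carrier S) (\<iota> k) ?f = g"
    proof (rule extensionalityI[of _ "carrier S"])
      show "compose (carrier S) (\<iota> k) ?f \<in> extensional (carrier S)" by (rule compose_extensional)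
      show "g \<in> extensional (carrier S)" by (rule comod_homD(1)[OF g])
      fix x assume x: "x \<in> carrier S"
      then show "compose (carrier S) (\<iota> k) ?f x = g x"
        using \<iota>_comp[OF k(1) lmod_hom_closed[OF f(1) x]] f(2) by (simp add: compose_eq)
    qed
    ultimately show "\<exists>i\<in>I. \<exists>f\<in>comod_hom R C S (D i). (\<lambda>f\<in>comod_hom R C S (D i). compose (carrier S) (\<iota> i) f) f = g"
      using kI by (intro bexI[of _ k] bexI[of _ ?f]) simp_all
  next
    fix i f f' assume i: "i \<in> I" and f: "f \<in> comod_hom R C S (D i)" and f': "f' \<in> comod_hom R C S (D i)"
      and "(\<lambda>f\<in>comod_hom R C S (D i). compose (carrier S) (\<iota> i) f) f = (\<lambda>f\<in>comod_hom R C S (D i). compose (carrier S) (\<iota> i) f) f'"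
    then have c: "compose (carrier S) (\<iota> i) f = compose (carrier S) (\<iota> i) f'" by simp
    have "\<iota> i (f x) = \<iota> i (f' x)" if "x \<in> carrier S" for x using c that by (metis compose_eq)
    from eventually_hom_eq[OF cdir p Y SM i comod_homD(2)[OF f] comod_homD(2)[OF f'] this]
    obtain k where k: "(i, k) \<in> r" "\<forall>x\<in>carrier S. d i k (f x) = d i k (f' x)" by blast
    then have "compose (carrier S) (d i k) f = compose (carrier S) (d i k) f'"
      by (auto simp: compose_def restrict_def fun_eq_iff)
    then show "\<exists>k. (i, k) \<in> r \<and> (\<lambda>f\<in>comod_hom R C S (D i). compose (carrier S) (d i k) f) f = (\<lambda>f\<in>comod_hom R C S (D i). compose (carrier S) (d i k) f) f'"
      using k(1) f f' by (intro exI[of _ k]) simp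
  qed
qed

section \<open>Countably presentable pieces of a flat comodule\<close>

definition pcls :: "('a, 'r) ring_scheme \<Rightarrow> 'x set \<Rightarrow> ('a, 'x) fcomb set \<Rightarrow> ('a, 'x) fcomb \<Rightarrow> ('a, 'x) fcomb set" where
  "pcls R X G z = {w. w - z \<in> linspan R X G}"

definition prep :: "('a, 'r) ring_scheme \<Rightarrow> 'x set \<Rightarrow> ('a, 'x) fcomb set \<Rightarrow> ('a, 'x) fcomb set \<Rightarrow> ('a, 'x) fcomb" where
  "prep R X G A = (SOME z. z \<in> FA R X \<and> pcls R X G z = A)"

text \<open>The module generated by \<open>X\<close> subject to \<open>G\<close>, with cosets of
  combinations as elements. The coaction is a parameter because it can be constructed only once the
  module is there.\<close>

definition pcomod :: "('a, 'r) ring_scheme \<Rightarrow> 'x set \<Rightarrow> ('a, 'x) fcomb set \<Rightarrow>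
    (('a, 'x) fcomb set \<Rightarrow> ('c, ('a, 'x) fcomb set) tens) \<Rightarrow> ('a, 'c, ('a, 'x) fcomb set) comodule" where
  "pcomod R X G \<nu> = \<lparr>carrier = pcls R X G ` FA R X, monoid.mult = undefined, monoid.one = undefined,
     ring.zero = pcls R X G 0, add = (\<lambda>A B. pcls R X G (prep R X G A + prep R X G B)),
     smult = (\<lambda>a A. pcls R X G (lsm R a (prep R X G A))), coact = \<nu>\<rparr>"

lemma pcomod_simps:
  "carrier (pcomod R X G \<nu>) = pcls R X G ` FA R X" "\<zero>\<^bsub>pcomod R X G \<nu>\<^esub> = pcls R X G 0"
  "A \<oplus>\<^bsub>pcomod R X G \<nu>\<^esub> B = pcls R X G (prep R X G A + prep R X G B)"
  "a \<odot>\<^bsub>pcomod R X G \<nu>\<^esub> A = pcls R X G (lsm R a (prep R X G A))"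
  "coact (pcomod R X G \<nu>) = \<nu>"
  by (simp_all add: pcomod_def)

lemma pcls_eq_iff: "pcls R X G z = pcls R X G w \<longleftrightarrow> z - w \<in> linspan R X G"
proof
  assume "pcls R X G z = pcls R X G w"
  moreover have "z \<in> pcls R X G z" by (simp add: pcls_def linspan_0)
  ultimately show "z - w \<in> linspan R X G" by (simp add: pcls_def)
next
  assume d: "z - w \<in> linspan R X G"
  have "v - z \<in> linspan R X G \<longleftrightarrow> v - w \<in> linspan R X G" for v
    using linspan_add[of "v - z" R X G "z - w"] linspan_diff[of "v - w" R X G "z - w"] d by auto
  then show "pcls R X G z = pcls R X G w" by (simp add: pcls_def)
qed

lemma pcls_prep:
  assumes "A \<in> pcls R X G ` FA R X" shows "prep R X G A \<in> FA R X" "pcls R X G (prep R X G A) = A"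
proof -
  have "\<exists>z. z \<in> FA R X \<and> pcls R X G z = A" using assms by blast
  from someI_ex[OF this] show "prep R X G A \<in> FA R X" "pcls R X G (prep R X G A) = A" unfolding prep_def by blast+
qed

lemma prep_pcls:
  assumes "z \<in> FA R X"
  shows "prep R X G (pcls R X G z) \<in> FA R X" "prep R X G (pcls R X G z) - z \<in> linspan R X G"
  using pcls_prep[OF imageI[OF assms], of G] unfolding pcls_eq_iff .

text \<open>Membership is reached in finitely many steps. This passes from a relation that holds in
  a presented module to finitely many of its defining relations.\<close>

lemma linspan_finite:
  assumes "z \<in> linspan R X G" shows "\<exists>F. finite F \<and> F \<subseteq> G \<and> z \<in> linspan R X F"
  using assms
proof (induction rule: linspan_induct)
  case zero show ?case by (intro exI[of _ "{}"]) (simp add: linspan_0)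
next
  case (add_rel z a b x)
  then obtain F where "finite F" "F \<subseteq> G" "z \<in> linspan R X F" by blast
  then show ?case using linspan_add[OF _ linspan_addrel[OF add_rel.hyps(2-4)]] by blast
next
  case (diff_rel z a b x)
  then obtain F where "finite F" "F \<subseteq> G" "z \<in> linspan R X F" by blast
  then show ?case using linspan_diff[OF _ linspan_addrel[OF diff_rel.hyps(2-4)]] by blast
next
  case (add_gen z a g)
  then obtain F where F: "finite F" "F \<subseteq> G" "z \<in> linspan R X F" by blast
  then have "z \<in> linspan R X (insert g F)" using linspan_mono[of X X F "insert g F" R] by blast
  then have "z + lsm R a g \<in> linspan R X (insert g F)" by (rule linspan_add) (use add_gen in \<open>auto intro: linspan_lsm_base\<close>)
  then show ?case using F add_gen by (intro exI[of _ "insert g F"]) auto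
next
  case (diff_gen z a g)
  then obtain F where F: "finite F" "F \<subseteq> G" "z \<in> linspan R X F" by blast
  then have "z \<in> linspan R X (insert g F)" using linspan_mono[of X X F "insert g F" R] by blast
  then have "z - lsm R a g \<in> linspan R X (insert g F)" by (rule linspan_diff) (use diff_gen in \<open>auto intro: linspan_lsm_base\<close>)
  then show ?case using F diff_gen by (intro exI[of _ "insert g F"]) auto
qed

context ring
begin

context
  fixes X :: "'x set" and G :: "('a, 'x) fcomb set" and \<nu> :: "('a, 'x) fcomb set \<Rightarrow> ('c, ('a, 'x) fcomb set) tens"
  assumes G: "G \<subseteq> FA R X"
begin

abbreviation (input) "PN \<equiv> pcomod R X G \<nu>"
abbreviation (input) "pc \<equiv> pcls R X G"

lemma pcls_add: "z \<in> FA R X \<Longrightarrow> w \<in> FA R X \<Longrightarrow> pc z \<oplus>\<^bsub>PN\<^esub> pc w = pc (z + w)"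
proof -
  assume z: "z \<in> FA R X" and w: "w \<in> FA R X"
  have "prep R X G (pc z) - z \<in> linspan R X G" "prep R X G (pc w) - w \<in> linspan R X G"
    by (rule prep_pcls(2)[OF z], rule prep_pcls(2)[OF w])
  from linspan_add[OF this] show ?thesis by (simp add: pcomod_simps pcls_eq_iff algebra_simps)
qed

lemma pcls_smult: "a \<in> carrier R \<Longrightarrow> z \<in> FA R X \<Longrightarrow> a \<odot>\<^bsub>PN\<^esub> pc z = pc (lsm R a z)"
proof -
  assume a: "a \<in> carrier R" and z: "z \<in> FA R X"
  have "prep R X G (pc z) - z \<in> linspan R X G"
    by (rule prep_pcls(2)[OF z])
  from lsm_linspan[OF a G this] show ?thesis by (simp add: pcomod_simps pcls_eq_iff lsm_diff)
qed

lemma left_module_pcomod: "left_module R PN"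
proof (intro left_module.intro left_module_axioms.intro)
  show "ring R" by (rule ring_axioms)
  show "abelian_group PN"
  proof (rule abelian_groupI)
    fix A assume "A \<in> carrier PN"
    then obtain z where z: "z \<in> FA R X" "A = pc z" by (auto simp: pcomod_simps)
    show "\<zero>\<^bsub>PN\<^esub> \<oplus>\<^bsub>PN\<^esub> A = A" unfolding z(2) pcomod_simps(2) using z(1) by (simp add: pcls_add)
    show "\<exists>B\<in>carrier PN. B \<oplus>\<^bsub>PN\<^esub> A = \<zero>\<^bsub>PN\<^esub>"
      by (rule bexI[of _ "pc (- z)"]) (use z in \<open>auto simp: pcls_add frags_uminus pcomod_simps(1,2)\<close>)
  next
    fix A B assume "A \<in> carrier PN" "B \<in> carrier PN"
    then obtain z w where z: "z \<in> FA R X" "A = pc z" "w \<in> FA R X" "B = pc w" by (auto simp: pcomod_simps)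
    show "A \<oplus>\<^bsub>PN\<^esub> B \<in> carrier PN" unfolding z(2,4) pcls_add[OF z(1,3)] using z(1,3) by (auto simp: pcomod_simps(1))
    show "A \<oplus>\<^bsub>PN\<^esub> B = B \<oplus>\<^bsub>PN\<^esub> A" unfolding z(2,4) pcls_add[OF z(1,3)] pcls_add[OF z(3,1)] by (simp add: add.commute)
  next
    fix A B D assume "A \<in> carrier PN" "B \<in> carrier PN" "D \<in> carrier PN"
    then obtain z w v where z: "z \<in> FA R X" "A = pc z" "w \<in> FA R X" "B = pc w" "v \<in> FA R X" "D = pc v" by (auto simp: pcomod_simps)
    show "A \<oplus>\<^bsub>PN\<^esub> B \<oplus>\<^bsub>PN\<^esub> D = A \<oplus>\<^bsub>PN\<^esub> (B \<oplus>\<^bsub>PN\<^esub> D)"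
      unfolding z(2,4,6) using z(1,3,5) by (simp add: pcls_add frags_add add.assoc)
  qed (auto simp: pcomod_simps(1,2))
next
  fix a A assume a: "a \<in> carrier R" and "A \<in> carrier PN"
  then obtain z where z: "z \<in> FA R X" "A = pc z" by (auto simp: pcomod_simps)
  show "a \<odot>\<^bsub>PN\<^esub> A \<in> carrier PN" unfolding z(2) pcls_smult[OF a z(1)] using lsm_frags[OF a z(1)] by (simp add: pcomod_simps(1))
next
  fix a b A assume a: "a \<in> carrier R" "b \<in> carrier R" and "A \<in> carrier PN"
  then obtain z where z: "z \<in> FA R X" "A = pc z" by (auto simp: pcomod_simps)
  have "lsm R (a \<oplus> b) z - (lsm R a z + lsm R b z) \<in> linspan R X G"
    using lsm_add_left[OF a z(1), of G] by (simp add: algebra_simps)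
  then show "(a \<oplus> b) \<odot>\<^bsub>PN\<^esub> A = a \<odot>\<^bsub>PN\<^esub> A \<oplus>\<^bsub>PN\<^esub> b \<odot>\<^bsub>PN\<^esub> A"
    unfolding z(2) using a z(1) by (simp add: pcls_smult pcls_add lsm_frags pcls_eq_iff)
  show "(a \<otimes> b) \<odot>\<^bsub>PN\<^esub> A = a \<odot>\<^bsub>PN\<^esub> (b \<odot>\<^bsub>PN\<^esub> A)"
    unfolding z(2) using a z(1) by (simp add: pcls_smult lsm_frags lsm_lsm[OF a z(1)])
next
  fix a A B assume a: "a \<in> carrier R" and "A \<in> carrier PN" "B \<in> carrier PN"
  then obtain z w where z: "z \<in> FA R X" "A = pc z" "w \<in> FA R X" "B = pc w" by (auto simp: pcomod_simps)
  show "a \<odot>\<^bsub>PN\<^esub> (A \<oplus>\<^bsub>PN\<^esub> B) = a \<odot>\<^bsub>PN\<^esub> A \<oplus>\<^bsub>PN\<^esub> a \<odot>\<^bsub>PN\<^esub> B"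
    unfolding z(2,4) using a z(1,3) by (simp add: pcls_smult pcls_add lsm_frags frags_add lsm_add)
next
  fix A assume "A \<in> carrier PN"
  then obtain z where z: "z \<in> FA R X" "A = pc z" by (auto simp: pcomod_simps)
  show "\<one> \<odot>\<^bsub>PN\<^esub> A = A" unfolding z(2) using z(1) by (simp add: pcls_smult lsm_one)
qed

lemma lev_pcomod:
  assumes z: "z \<in> FA R X" shows "lev PN (\<lambda>x. pc (frag_of (\<one>, x))) z = pc z"
proof -
  interpret N: left_module R PN by (rule left_module_pcomod)
  have e: "(\<lambda>x. pc (frag_of (\<one>, x))) \<in> X \<rightarrow> carrier PN" by (auto simp: pcomod_simps)
  show ?thesis using z
  proof (induction rule: frags_induct)
    case zero then show ?case by (simp add: pcomod_simps(2))
  next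
    case (of p)
    then obtain a x where p: "p = (a, x)" "a \<in> carrier R" "x \<in> X" by auto
    have "pc (frag_of (\<one>, x)) \<in> carrier PN" using e p by auto
    then show ?case using p by (simp add: N.lev_of pcls_smult)
  next
    case (diff z w)
    have "pc (z - w) \<oplus>\<^bsub>PN\<^esub> pc w = pc z" using diff by (simp add: pcls_add frags_diff)
    moreover have "pc z \<in> carrier PN" "pc w \<in> carrier PN" "pc (z - w) \<in> carrier PN" using diff by (auto simp: pcomod_simps(1))
    ultimately have "pc (z - w) = pc z \<ominus>\<^bsub>PN\<^esub> pc w" by (metis N.M.add.inv_solve_right a_minus_def)
    then show ?case using N.lev_diff[OF e diff(1,2)] diff by simp
  qed
qed

lemma presented_pcomod: "presented R PN X (\<lambda>x. pc (frag_of (\<one>, x))) G"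
  unfolding presented_def
proof (intro conjI ballI G)
  show "(\<lambda>x. pc (frag_of (\<one>, x))) \<in> X \<rightarrow> carrier PN" by (auto simp: pcomod_simps)
  fix A assume "A \<in> carrier PN"
  then show "\<exists>z\<in>FA R X. lev PN (\<lambda>x. pc (frag_of (\<one>, x))) z = A" using lev_pcomod by (auto simp: pcomod_simps(1))
next
  fix z assume z: "z \<in> FA R X"
  show "lev PN (\<lambda>x. pc (frag_of (\<one>, x))) z = \<zero>\<^bsub>PN\<^esub> \<longleftrightarrow> z \<in> linspan R X G"
    unfolding lev_pcomod[OF z] pcomod_simps(2) pcls_eq_iff by simp
qed

end

end

text \<open>A finite subset of the union is contained in one of the increasing stages, and its
  demand \<open>W F\<close> is met at the next, so countably many rounds suffice. Each stage stays
  countable, as a countable set has countably many finite subsets.\<close>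

lemma countable_closure:
  assumes W: "\<And>F. finite F \<Longrightarrow> F \<subseteq> E \<Longrightarrow> countable (W F) \<and> W F \<subseteq> E" and U: "countable U" "U \<subseteq> E"
  shows "\<exists>V. countable V \<and> U \<subseteq> V \<and> V \<subseteq> E \<and> (\<forall>F. finite F \<and> F \<subseteq> V \<longrightarrow> W F \<subseteq> V)"
proof -
  define step where "step A = A \<union> (\<Union>F\<in>{F. finite F \<and> F \<subseteq> A}. W F)" for A
  define V where "V n = (step ^^ n) U" for n
  have V: "countable (V n) \<and> V n \<subseteq> E" for n
  proof (induction n)
    case 0 show ?case using U by (simp add: V_def)
  next
    case (Suc n)
    have "countable {F. finite F \<and> F \<subseteq> V n}" using Suc by (simp add: countable_Collect_finite_subset)
    then show ?case using W Suc by (auto simp: V_def step_def)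
  qed
  have inc: "V n \<subseteq> V (Suc n)" for n by (auto simp: V_def step_def)
  have mono: "m \<le> n \<Longrightarrow> V m \<subseteq> V n" for m n by (rule lift_Suc_mono_le[of V]) (use inc in auto)
  have "W F \<subseteq> (\<Union>n. V n)" if F: "finite F" "F \<subseteq> (\<Union>n. V n)" for F
  proof -
    have "\<exists>n. F \<subseteq> V n" using F
    proof (induction F rule: finite_induct)
      case (insert x F)
      then obtain m n where "F \<subseteq> V m" "x \<in> V n" by auto
      then have "insert x F \<subseteq> V (max m n)" using mono[of m "max m n"] mono[of n "max m n"] by auto
      then show ?case by blast
    qed simp
    then obtain n where "F \<subseteq> V n" by blast
    then have "W F \<subseteq> V (Suc n)" using F by (auto simp: V_def step_def)
    then show ?thesis by blast
  qed
  moreover have "U \<subseteq> (\<Union>n. V n)" using UN_upper[of 0 UNIV V] by (simp add: V_def)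
  moreover have "countable (\<Union>n. V n)" "(\<Union>n. V n) \<subseteq> E" using V by auto
  ultimately show ?thesis by (intro exI[of _ "\<Union>n. V n"]) blast
qed

text \<open>Preimages and coincidences found at an arbitrary stage are pushed to a stage of
  \<open>J\<close> above it.\<close>

lemma dirlim_cofinal:
  assumes lim: "dirlim I r R D d L \<iota>" and J: "J \<subseteq> I" and cof: "\<And>i. i \<in> I \<Longrightarrow> \<exists>j\<in>J. (i, j) \<in> r"
  shows "dirlim J (r \<inter> J \<times> J) R D d L \<iota>"
proof -
  interpret dirlim I r R D d L \<iota> by (rule lim)
  show ?thesis
  proof (intro dirlim.intro dirsys.intro directed_preorder.intro dirsys_axioms.intro dirlim_axioms.intro)
    show "J \<noteq> {}" using I_nonempty cof by blast
    show "\<exists>k. (i, k) \<in> r \<inter> J \<times> J \<and> (j, k) \<in> r \<inter> J \<times> J" if ij: "i \<in> J" "j \<in> J" for i j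
    proof -
      obtain k where k: "(i, k) \<in> r" "(j, k) \<in> r" using upper[of i j] ij J by blast
      obtain l where "l \<in> J" "(k, l) \<in> r" using cof r_I k by blast
      then show ?thesis using ij r_trans k by blast
    qed
    show "\<exists>i\<in>J. \<exists>y\<in>carrier (D i). \<iota> i y = l" if lL: "l \<in> carrier L" for l
    proof -
      obtain i y where i: "i \<in> I" "y \<in> carrier (D i)" "\<iota> i y = l" using \<iota>_surj[OF lL] by blast
      obtain j where j: "j \<in> J" "(i, j) \<in> r" using cof i by blast
      then show ?thesis using i \<iota>_comp[OF j(2) i(2)] d_closed[OF j(2) i(2)] by (intro bexI[of _ j] bexI[of _ "d i j y"]) simp_all
    qed
    show "\<exists>k. (i, k) \<in> r \<inter> J \<times> J \<and> d i k x = d i k y"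
      if i: "i \<in> J" "x \<in> carrier (D i)" "y \<in> carrier (D i)" "\<iota> i x = \<iota> i y" for i x y
    proof -
      obtain k where k: "(i, k) \<in> r" "d i k x = d i k y" using \<iota>_inj[of i x y] i J by blast
      obtain l where l: "l \<in> J" "(k, l) \<in> r" using cof r_I k by blast
      have "d i l x = d i l y" using d_comp[OF k(1) l(2) i(2)] d_comp[OF k(1) l(2) i(3)] k(2) by simp
      then show ?thesis using l r_trans[OF k(1) l(2)] i(1) by blast
    qed
  qed (use J r_refl r_trans D_mod d_hom d_id d_comp L_mod \<iota>_hom \<iota>_comp in auto)
qed

locale flat_comodule = coring R C for R :: "('a, 'r) ring_scheme" and C :: "('a, 'c, 'y) coring_scheme" +
  fixes M :: "('a, 'c, 'u) comodule"
  assumes MC: "comodule R C M" and eqf: "eqflat R M"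
begin

lemma Mmod: "left_module R M" by (rule comodule_left[OF MC])

sublocale L: left_module R M by (rule Mmod)

abbreviation "Ker \<equiv> lker R M"

text \<open>
  A set \<open>G\<close> of relations of \<open>M\<close> carries its own generators: those occurring in \<open>G\<close>. The
  trivial relation \<open>frag_of (\<zero>, m)\<close> therefore serves to add the generator \<open>m\<close>. The coaction of \<open>N0 G\<close> is junk.
\<close>

definition gens :: "('a, 'u) fcomb set \<Rightarrow> 'u set" where "gens G = (\<Union>g\<in>G. snd ` Poly_Mapping.keys g)"

definition N0 :: "('a, 'u) fcomb set \<Rightarrow> ('a, 'c, ('a, 'u) fcomb set) comodule" where
  "N0 G = pcomod R (gens G) G undefined"

abbreviation "pG G \<equiv> pcls R (gens G) G"
abbreviation "rep G \<equiv> prep R (gens G) G"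

text \<open>A transition map keeps the representative, because generators of a smaller set of
  relations are generators of the larger one under the same name.\<close>

definition "tr (G :: ('a, 'u) fcomb set) G' A = pG G' (rep G A)"
definition "pr G A = lev M (\<lambda>x. x) (rep G A)"
definition "I0 = {G. G \<subseteq> Ker \<and> countable G}"
definition "r0 = {(G, G'). G \<in> I0 \<and> G' \<in> I0 \<and> G \<subseteq> G'}"

lemma idM: "(\<lambda>x. x) \<in> carrier M \<rightarrow> carrier M" by simp

lemma KerF: "g \<in> Ker \<Longrightarrow> g \<in> FA R (carrier M)" by (simp add: lker_def)

lemma gens_mono: "G \<subseteq> G' \<Longrightarrow> gens G \<subseteq> gens G'" by (auto simp: gens_def)

lemma gens_M: "G \<subseteq> Ker \<Longrightarrow> gens G \<subseteq> carrier M"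
  unfolding gens_def using frags_snd_keys(2)[OF KerF] by blast

lemma G_FA: "G \<subseteq> Ker \<Longrightarrow> G \<subseteq> FA R (gens G)"
proof
  fix g assume G: "G \<subseteq> Ker" and g: "g \<in> G"
  have "g \<in> FA R (snd ` Poly_Mapping.keys g)" using frags_snd_keys(1)[OF KerF] G g by blast
  moreover have "snd ` Poly_Mapping.keys g \<subseteq> gens G" using g by (auto simp: gens_def)
  ultimately show "g \<in> FA R (gens G)" using frags_mono[of "carrier R \<times> snd ` Poly_Mapping.keys g" "carrier R \<times> gens G"] by auto
qed

lemma countable_XG: "countable G \<Longrightarrow> countable (gens G)"
  unfolding gens_def by (intro countable_UN) (auto simp: countable_finite)

lemma zero_Ker: "m \<in> carrier M \<Longrightarrow> frag_of (\<zero>\<^bsub>R\<^esub>, m) \<in> Ker"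
  by (simp add: lker_def L.lev_of L.zero_smult)

lemma gens_zero: "frag_of (\<zero>\<^bsub>R\<^esub>, m) \<in> G \<Longrightarrow> m \<in> gens G"
  unfolding gens_def by (auto intro!: bexI[of _ "frag_of (\<zero>\<^bsub>R\<^esub>, m)"])

lemma N0_mod: "G \<subseteq> Ker \<Longrightarrow> left_module R (N0 G)"
  unfolding N0_def by (rule R.left_module_pcomod[OF G_FA])

lemma N0_presented: "G \<subseteq> Ker \<Longrightarrow> presented R (N0 G) (gens G) (\<lambda>x. pG G (frag_of (\<one>\<^bsub>R\<^esub>, x))) G"
  unfolding N0_def by (rule R.presented_pcomod[OF G_FA])

lemma N0_lev: "G \<subseteq> Ker \<Longrightarrow> z \<in> FA R (gens G) \<Longrightarrow> lev (N0 G) (\<lambda>x. pG G (frag_of (\<one>\<^bsub>R\<^esub>, x))) z = pG G z"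
  unfolding N0_def by (rule R.lev_pcomod[OF G_FA])

lemma N0_carrier: "carrier (N0 G) = pG G ` FA R (gens G)"
  by (simp add: N0_def pcomod_simps)

lemma FA_sub: "G \<subseteq> G' \<Longrightarrow> FA R (gens G) \<subseteq> FA R (gens G')"
  by (intro frags_mono) (use gens_mono in auto)

lemma FA_M: "G \<subseteq> Ker \<Longrightarrow> FA R (gens G) \<subseteq> FA R (carrier M)"
  by (intro frags_mono) (use gens_M in auto)

lemma linspan_gens_mono: "G \<subseteq> G' \<Longrightarrow> linspan R (gens G) G \<subseteq> linspan R (gens G') G'"
  by (rule linspan_mono[OF gens_mono])

lemma tr_pG:
  assumes "G \<subseteq> G'" "z \<in> FA R (gens G)" shows "tr G G' (pG G z) = pG G' z"
proof -
  have "rep G (pG G z) - z \<in> linspan R (gens G) G"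
    by (rule prep_pcls(2)[OF assms(2)])
  then show ?thesis unfolding tr_def pcls_eq_iff using linspan_gens_mono[OF assms(1)] by blast
qed

lemma lev_Ker: "G \<subseteq> Ker \<Longrightarrow> z \<in> linspan R (gens G) G \<Longrightarrow> lev M (\<lambda>x. x) z = \<zero>\<^bsub>M\<^esub>"
  by (rule L.lev_linspan_r[of _ "gens G" G]) (use gens_M[of G] G_FA[of G] in \<open>auto simp: lker_def\<close>)

lemma pr_pG:
  assumes "G \<subseteq> Ker" "z \<in> FA R (gens G)" shows "pr G (pG G z) = lev M (\<lambda>x. x) z"
proof -
  have F: "rep G (pG G z) \<in> FA R (gens G)" by (rule prep_pcls(1)[OF assms(2)])
  have "rep G (pG G z) - z \<in> linspan R (gens G) G"
    by (rule prep_pcls(2)[OF assms(2)])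
  then have 0: "lev M (\<lambda>x. x) (rep G (pG G z) - z) = \<zero>\<^bsub>M\<^esub>" by (rule lev_Ker[OF assms(1)])
  have FM: "rep G (pG G z) \<in> FA R (carrier M)" "z \<in> FA R (carrier M)" using F assms(2) FA_M[OF assms(1)] by auto
  show ?thesis
    unfolding pr_def using 0 L.lev_diff[OF idM FM] abelian_group.minus_eq_zero[OF L.M.abelian_group_axioms L.lev_closed[OF idM FM(1)] L.lev_closed[OF idM FM(2)]]
    by simp
qed

lemma pG_eq: "G \<subseteq> Ker \<Longrightarrow> g \<in> G \<Longrightarrow> z - w = g \<Longrightarrow> pG G z = pG G w"
  unfolding pcls_eq_iff using linspan_lsm_base[of "\<one>\<^bsub>R\<^esub>" R g G "gens G"] R.lsm_one[of g "gens G"] G_FA[of G] by auto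

lemma cpos: "I0 \<noteq> {}" by (auto simp: I0_def)

lemma N0_add: "G \<subseteq> Ker \<Longrightarrow> z \<in> FA R (gens G) \<Longrightarrow> w \<in> FA R (gens G) \<Longrightarrow> pG G z \<oplus>\<^bsub>N0 G\<^esub> pG G w = pG G (z + w)"
  unfolding N0_def by (rule R.pcls_add[OF G_FA])

lemma N0_smult: "G \<subseteq> Ker \<Longrightarrow> a \<in> carrier R \<Longrightarrow> z \<in> FA R (gens G) \<Longrightarrow> a \<odot>\<^bsub>N0 G\<^esub> pG G z = pG G (lsm R a z)"
  unfolding N0_def by (rule R.pcls_smult[OF G_FA])

lemma tr_hom:
  assumes "G \<subseteq> G'" "G' \<subseteq> Ker" shows "tr G G' \<in> lmod_hom R (N0 G) (N0 G')"
proof -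
  have GK: "G \<subseteq> Ker" using assms by blast
  note s = N0_add[OF GK] N0_add[OF assms(2)] N0_smult[OF GK] N0_smult[OF assms(2)]
  have F: "z \<in> FA R (gens G')" if "z \<in> FA R (gens G)" for z using that FA_sub[OF assms(1)] by blast
  show ?thesis
    unfolding lmod_hom_def add_hom_def
  proof (intro CollectI conjI ballI funcsetI)
    fix A assume "A \<in> carrier (N0 G)"
    then obtain z where z: "z \<in> FA R (gens G)" "A = pG G z" by (auto simp: N0_carrier)
    show "tr G G' A \<in> carrier (N0 G')" unfolding z(2) tr_pG[OF assms(1) z(1)] N0_carrier using F[OF z(1)] by (rule imageI)
    fix B assume "B \<in> carrier (N0 G)"
    then obtain w where w: "w \<in> FA R (gens G)" "B = pG G w" by (auto simp: N0_carrier)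
    show "tr G G' (A \<oplus>\<^bsub>N0 G\<^esub> B) = tr G G' A \<oplus>\<^bsub>N0 G'\<^esub> tr G G' B"
      unfolding z(2) w(2) s(1)[OF z(1) w(1)] tr_pG[OF assms(1) z(1)] tr_pG[OF assms(1) w(1)]
        s(2)[OF F[OF z(1)] F[OF w(1)]] by (rule tr_pG[OF assms(1) frags_add[OF z(1) w(1)]])
  next
    fix a A assume a: "a \<in> carrier R" and "A \<in> carrier (N0 G)"
    then obtain z where z: "z \<in> FA R (gens G)" "A = pG G z" by (auto simp: N0_carrier)
    show "tr G G' (a \<odot>\<^bsub>N0 G\<^esub> A) = a \<odot>\<^bsub>N0 G'\<^esub> tr G G' A"
      unfolding z(2) s(3)[OF a z(1)] tr_pG[OF assms(1) z(1)] s(4)[OF a F[OF z(1)]]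
      by (rule tr_pG[OF assms(1) R.lsm_frags[OF a z(1)]])
  qed
qed

lemma pr_hom:
  assumes "G \<subseteq> Ker" shows "pr G \<in> lmod_hom R (N0 G) M"
proof -
  note s = N0_add[OF assms] N0_smult[OF assms]
  have F: "z \<in> FA R (carrier M)" if "z \<in> FA R (gens G)" for z using that FA_M[OF assms(1)] by blast
  show ?thesis
    unfolding lmod_hom_def add_hom_def
  proof (intro CollectI conjI ballI funcsetI)
    fix A assume "A \<in> carrier (N0 G)"
    then obtain z where z: "z \<in> FA R (gens G)" "A = pG G z" by (auto simp: N0_carrier)
    show "pr G A \<in> carrier M" unfolding z(2) pr_pG[OF assms z(1)] by (rule L.lev_closed[OF idM F[OF z(1)]])
    fix B assume "B \<in> carrier (N0 G)"
    then obtain w where w: "w \<in> FA R (gens G)" "B = pG G w" by (auto simp: N0_carrier)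
    show "pr G (A \<oplus>\<^bsub>N0 G\<^esub> B) = pr G A \<oplus>\<^bsub>M\<^esub> pr G B"
      unfolding z(2) w(2) s(1)[OF z(1) w(1)] pr_pG[OF assms z(1)] pr_pG[OF assms w(1)] pr_pG[OF assms frags_add[OF z(1) w(1)]]
      by (rule L.lev_add[OF idM F[OF z(1)] F[OF w(1)]])
  next
    fix a A assume a: "a \<in> carrier R" and "A \<in> carrier (N0 G)"
    then obtain z where z: "z \<in> FA R (gens G)" "A = pG G z" by (auto simp: N0_carrier)
    show "pr G (a \<odot>\<^bsub>N0 G\<^esub> A) = a \<odot>\<^bsub>M\<^esub> pr G A"
      unfolding z(2) s(2)[OF a z(1)] pr_pG[OF assms z(1)] pr_pG[OF assms R.lsm_frags[OF a z(1)]]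
      by (rule L.lev_lsm[OF idM a F[OF z(1)]])
  qed
qed

text \<open>An element of \<open>M\<close> is reached once its trivial relation belongs to the
  index. Two combinations with equal value in \<open>M\<close> differ by a relation of
  \<open>M\<close>, and inserting this relation identifies them.\<close>

theorem dirlim0: "dirlim I0 r0 R N0 tr M pr"
proof (intro dirlim.intro dirsys.intro directed_preorder.intro dirsys_axioms.intro dirlim_axioms.intro)
  have IK: "G \<subseteq> Ker" if "G \<in> I0" for G using that by (simp add: I0_def)
  show "r0 \<subseteq> I0 \<times> I0" "\<And>i. i \<in> I0 \<Longrightarrow> (i, i) \<in> r0" "\<And>i j k. (i, j) \<in> r0 \<Longrightarrow> (j, k) \<in> r0 \<Longrightarrow> (i, k) \<in> r0"
    by (auto simp: r0_def)
  show "I0 \<noteq> {}" by (rule cpos)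
  show "\<exists>k. (i, k) \<in> r0 \<and> (j, k) \<in> r0" if "i \<in> I0" "j \<in> I0" for i j
    using that by (intro exI[of _ "i \<union> j"]) (auto simp: r0_def I0_def)
  show "left_module R (N0 i)" if "i \<in> I0" for i by (rule N0_mod[OF IK[OF that]])
  show "tr i j \<in> lmod_hom R (N0 i) (N0 j)" if "(i, j) \<in> r0" for i j using that by (intro tr_hom) (auto simp: r0_def I0_def)
  show "tr i i x = x" if "i \<in> I0" "x \<in> carrier (N0 i)" for i x using that by (auto simp: N0_carrier tr_pG)
  show "tr j k (tr i j x) = tr i k x" if a: "(i, j) \<in> r0" "(j, k) \<in> r0" "x \<in> carrier (N0 i)" for i j k x
  proof -
    obtain z where z: "z \<in> FA R (gens i)" "x = pG i z" using a(3) by (auto simp: N0_carrier)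
    have s: "i \<subseteq> j" "j \<subseteq> k" using a by (auto simp: r0_def)
    have "z \<in> FA R (gens j)" using FA_sub[OF s(1)] z by blast
    then show ?thesis using s z by (simp add: tr_pG)
  qed
  show "left_module R M" by (rule Mmod)
  show "pr i \<in> lmod_hom R (N0 i) M" if "i \<in> I0" for i by (rule pr_hom[OF IK[OF that]])
  show "pr j (tr i j x) = pr i x" if a: "(i, j) \<in> r0" "x \<in> carrier (N0 i)" for i j x
  proof -
    obtain z where z: "z \<in> FA R (gens i)" "x = pG i z" using a(2) by (auto simp: N0_carrier)
    have s: "i \<subseteq> j" "i \<subseteq> Ker" "j \<subseteq> Ker" using a by (auto simp: r0_def I0_def)
    have "z \<in> FA R (gens j)" using FA_sub[OF s(1)] z by blast
    then show ?thesis using s z by (simp add: tr_pG pr_pG)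
  qed
  show "\<exists>i\<in>I0. \<exists>y\<in>carrier (N0 i). pr i y = l" if "l \<in> carrier M" for l
  proof -
    let ?G = "{frag_of (\<zero>\<^bsub>R\<^esub>, l)}"
    have G: "?G \<in> I0" using zero_Ker[OF that] by (simp add: I0_def)
    have z: "frag_of (\<one>\<^bsub>R\<^esub>, l) \<in> FA R (gens ?G)" using gens_zero[of l ?G] by simp
    have "pr ?G (pG ?G (frag_of (\<one>\<^bsub>R\<^esub>, l))) = l" using pr_pG[OF IK[OF G] z] that by (simp add: L.lev_of L.smult_one)
    then show ?thesis using G z N0_carrier by blast
  qed
  show "\<exists>k. (i, k) \<in> r0 \<and> tr i k x = tr i k y" if i: "i \<in> I0" "x \<in> carrier (N0 i)" "y \<in> carrier (N0 i)" "pr i x = pr i y" for i x y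
  proof -
    obtain z w where z: "z \<in> FA R (gens i)" "x = pG i z" "w \<in> FA R (gens i)" "y = pG i w" using i(2,3) by (auto simp: N0_carrier)
    have zM: "z \<in> FA R (carrier M)" "w \<in> FA R (carrier M)" using z FA_M[OF IK[OF i(1)]] by auto
    have "lev M (\<lambda>x. x) (z - w) = \<zero>\<^bsub>M\<^esub>"
      using i(4) z pr_pG[OF IK[OF i(1)]] L.lev_diff[OF idM zM] L.lev_closed[OF idM zM(1)] L.lev_closed[OF idM zM(2)] by (simp add: L.minus_eq_zero)
    then have k: "z - w \<in> Ker" using zM by (auto simp: lker_def)
    let ?k = "insert (z - w) i"
    have kI: "?k \<subseteq> Ker" "(i, ?k) \<in> r0" using k i(1) by (auto simp: r0_def I0_def)
    have "pG ?k z = pG ?k w" by (rule pG_eq[OF kI(1) insertI1]) simp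
    then have "tr i ?k x = tr i ?k y" using z tr_pG[of i ?k] by auto
    then show ?thesis using kI by blast
  qed
qed

end

section \<open>Flatness of presented modules\<close>

lemma (in ring) linspan_empty_restrict:
  assumes "z \<in> linspan R X {}" "z \<in> FA R X'" shows "z \<in> linspan R X' {}"
  \<comment> \<open>Triviality is read off from coordinates, and these do not refer to the ambient
    set of generators.\<close>
  unfolding linspan_empty
  by (rule coords_zero[OF assms(2)], rule coord_addspan, rule assms(1)[unfolded linspan_empty])

text \<open>Through representatives, finitely many relations among elements of the module become
  combinations in the span of \<open>G\<close> and involve finitely many members \<open>F\<close> of
  \<open>G\<close>. A substitution of generators that trivialises \<open>F\<close> without changing
  classes trivialises all of them, and \<open>?J\<close> carries the result from generators back to
  elements of the module.\<close>

lemma (in ring) eqflat_pcomod: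
  assumes G: "G \<subseteq> FA R X"
    and ex: "\<And>F. finite F \<Longrightarrow> F \<subseteq> G \<Longrightarrow> \<exists>s. (\<forall>x\<in>X. s x \<in> FA R X \<and> pcls R X G (s x) = pcls R X G (frag_of (\<one>, x))) \<and>
      (\<forall>g\<in>F. lsubst R s g \<in> linspan R X {})"
  shows "eqflat R (pcomod R X G \<nu>)" (is "eqflat R ?N")
  unfolding eqflat_def
proof (intro allI impI)
  fix G0 X0 assume a: "finite G0 \<and> G0 \<subseteq> lker R ?N \<and> finite X0 \<and> X0 \<subseteq> carrier ?N"
  interpret N: left_module R ?N by (rule left_module_pcomod[OF G])
  let ?e = "\<lambda>x. pcls R X G (frag_of (\<one>, x))"
  have e: "?e \<in> X \<rightarrow> carrier ?N" by (auto simp: pcomod_simps)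
  note lv = lev_pcomod[OF G, where \<nu> = \<nu>]
  have rF: "prep R X G n \<in> FA R X" and rp: "pcls R X G (prep R X G n) = n" if "n \<in> carrier ?N" for n
    using pcls_prep[of n R X G] that by (simp_all add: pcomod_simps)
  have G0: "g \<in> FA R (carrier ?N)" "lev ?N (\<lambda>x. x) g = \<zero>\<^bsub>?N\<^esub>" if "g \<in> G0" for g
    using a that by (auto simp: lker_def)
  have "\<exists>F. finite F \<and> F \<subseteq> G \<and> lsubst R (prep R X G) g \<in> linspan R X F" if g: "g \<in> G0" for g
  proof (rule linspan_finite)
    have gF: "lsubst R (prep R X G) g \<in> FA R X" by (rule lsubst_frags[OF G0(1)[OF g] rF])
    have "pcls R X G (lsubst R (prep R X G) g) = lev ?N ?e (lsubst R (prep R X G) g)" by (rule lv[OF gF, symmetric])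
    also have "\<dots> = lev ?N (\<lambda>n. lev ?N ?e (prep R X G n)) g" by (rule N.lev_lsubst[OF e rF G0(1)[OF g]])
    also have "\<dots> = lev ?N (\<lambda>n. n) g" by (rule N.lev_cong[OF G0(1)[OF g]]) (auto simp: lv[OF rF] rp)
    also have "\<dots> = pcls R X G 0" using G0(2)[OF g] by (simp add: pcomod_simps)
    finally show "lsubst R (prep R X G) g \<in> linspan R X G" unfolding pcls_eq_iff by simp
  qed
  then obtain Fg where Fg: "\<And>g. g \<in> G0 \<Longrightarrow> finite (Fg g) \<and> Fg g \<subseteq> G \<and> lsubst R (prep R X G) g \<in> linspan R X (Fg g)" by metis
  let ?F = "\<Union>g\<in>G0. Fg g"
  have F: "finite ?F" "?F \<subseteq> G" using a Fg by auto
  from ex[OF F] obtain s where s0: "\<forall>x\<in>X. s x \<in> FA R X \<and> pcls R X G (s x) = ?e x" "\<forall>g\<in>?F. lsubst R s g \<in> linspan R X {}"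
    by (elim exE conjE)
  have s: "s x \<in> FA R X" "pcls R X G (s x) = ?e x" if "x \<in> X" for x using s0(1)[rule_format, OF that] by (rule conjunct1, rule conjunct2)
  note s3 = s0(2)[rule_format]
  let ?J = "lsubst R (\<lambda>x. frag_of (\<one>, ?e x))"
  have J: "?J z \<in> FA R (carrier ?N)" if "z \<in> FA R X" for z
    by (rule lsubst_frags[OF that]) (use e in \<open>auto simp: Pi_iff\<close>)
  have sF: "lsubst R s z \<in> FA R X" if "z \<in> FA R X" for z by (rule lsubst_frags[OF that s(1)])
  have lJ: "lev ?N (\<lambda>x. x) (?J z) = lev ?N ?e z" if z: "z \<in> FA R X" for z
  proof -
    have e1: "frag_of (\<one>, ?e x) \<in> FA R (carrier ?N)" if "x \<in> X" for x using that e by (auto simp: Pi_iff)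
    have "lev ?N (\<lambda>x. x) (?J z) = lev ?N (\<lambda>x. lev ?N (\<lambda>x. x) (frag_of (\<one>, ?e x))) z"
      by (rule N.lev_lsubst[OF _ e1 z]) simp
    also have "\<dots> = lev ?N ?e z" by (rule N.lev_cong[OF z e]) (use e in \<open>auto simp: Pi_iff N.lev_of N.smult_one\<close>)
    finally show ?thesis .
  qed
  let ?s = "\<lambda>n. ?J (lsubst R s (prep R X G n))"
  show "\<exists>s. (\<forall>x\<in>carrier ?N. s x \<in> FA R (carrier ?N)) \<and> (\<forall>x\<in>X0. lev ?N (\<lambda>x. x) (s x) = x) \<and>
      (\<forall>g\<in>G0. lsubst R s g \<in> linspan R (carrier ?N) {})"
  proof (rule exI[of _ ?s], intro conjI ballI)
    show "?s n \<in> FA R (carrier ?N)" if "n \<in> carrier ?N" for n by (rule J[OF sF[OF rF[OF that]]])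
    show "lev ?N (\<lambda>x. x) (?s n) = n" if n: "n \<in> X0" for n
    proof -
      have nN: "n \<in> carrier ?N" using a n by blast
      have "lev ?N (\<lambda>x. x) (?s n) = lev ?N ?e (lsubst R s (prep R X G n))" by (rule lJ[OF sF[OF rF[OF nN]]])
      also have "\<dots> = lev ?N (\<lambda>x. lev ?N ?e (s x)) (prep R X G n)" by (rule N.lev_lsubst[OF e s(1) rF[OF nN]])
      also have "\<dots> = lev ?N ?e (prep R X G n)" by (rule N.lev_cong[OF rF[OF nN] e]) (simp add: lv[OF s(1)] s(2))
      also have "\<dots> = n" by (simp add: lv[OF rF[OF nN]] rp[OF nN])
      finally show ?thesis .
    qed
    show "lsubst R ?s g \<in> linspan R (carrier ?N) {}" if g: "g \<in> G0" for g
    proof -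
      note gF = G0(1)[OF g]
      have r: "lsubst R (prep R X G) g \<in> linspan R X ?F"
        using Fg[OF g] g linspan_mono[of X X "Fg g" ?F R] by blast
      have FF: "?F \<subseteq> FA R X" using F(2) G by blast
      have 1: "lsubst R s (lsubst R (prep R X G) g) \<in> linspan R X {}"
        by (rule lsubst_linspan[OF r FF _ s(1) s3]) simp_all
      have 2: "?J (lsubst R s (lsubst R (prep R X G) g)) \<in> linspan R (carrier ?N) {}"
        by (rule lsubst_linspan[OF 1]) (use e in \<open>auto simp: Pi_iff\<close>)
      have "lsubst R ?s g = ?J (lsubst R (\<lambda>n. lsubst R s (prep R X G n)) g)"
        by (rule lsubst_lsubst[OF gF sF[OF rF], symmetric, where X'' = "carrier ?N"]) (use e in \<open>auto simp: Pi_iff\<close>)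
      also have "lsubst R (\<lambda>n. lsubst R s (prep R X G n)) g = lsubst R s (lsubst R (prep R X G) g)"
        by (rule lsubst_lsubst[OF gF rF s(1), symmetric])
      finally show ?thesis using 2 by simp
    qed
  qed
qed

section \<open>Lifting the coaction to sets of relations\<close>

context flat_comodule
begin

text \<open>
  Below, \<open>cgen G m\<close> is the element of \<open>C \<otimes> N\<close>, with \<open>N\<close> the module of \<open>G\<close>, obtained from a fixed representative of the
  coaction of \<open>m\<close> by replacing elements of \<open>M\<close> with the generators named after them; it is junk unless
  these are generators of \<open>G\<close>.  The element \<open>cgen2 G m\<close> is the analogue for the twofold coaction.
\<close>

definition crep :: "'u \<Rightarrow> ('c, 'u) fcomb" where
  "crep m = (SOME z. z \<in> frags (carrier C \<times> carrier M) \<and> tcls R C M z = coact M m)"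

lemma crep:
  assumes "m \<in> carrier M"
  shows "crep m \<in> frags (carrier C \<times> carrier M)" "tcls R C M (crep m) = coact M m"
proof -
  interpret T: tensor_pair R C M by (rule pairC[OF Mmod])
  have "coact M m \<in> carrier (tensor_ab R C M)" using coact_closed[OF MC assms] by simp
  then have "\<exists>z. z \<in> frags (carrier C \<times> carrier M) \<and> tcls R C M z = coact M m" unfolding T.carrier_tensor_ab by blast
  from someI_ex[OF this] show "crep m \<in> frags (carrier C \<times> carrier M)" "tcls R C M (crep m) = coact M m"
    unfolding crep_def by blast+
qed

abbreviation "sk z \<equiv> snd ` Poly_Mapping.keys z"

abbreviation "gen G m \<equiv> pG G (frag_of (\<one>\<^bsub>R\<^esub>, m))"

abbreviation "CN G \<equiv> tensor R C (N0 G)"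

definition "cgen G m = tcls R C (N0 G) (tmapf (\<lambda>c. c) (gen G) (crep m))"
definition "cgen2 G m = tcls R C (CN G) (tmapf (\<lambda>c. c) (cgen G) (crep m))"

lemma gen_closed: "m \<in> gens G \<Longrightarrow> gen G m \<in> carrier (N0 G)" by (simp add: N0_carrier)

lemma crep_X: "m \<in> carrier M \<Longrightarrow> sk (crep m) \<subseteq> X \<Longrightarrow> crep m \<in> frags (carrier C \<times> X)"
  using frags_mono[of "carrier C \<times> sk (crep m)" "carrier C \<times> X"] frags_snd_keys(1)[OF crep(1)] by blast

lemma tr_gen: "G \<subseteq> G' \<Longrightarrow> m \<in> gens G \<Longrightarrow> tr G G' (gen G m) = gen G' m" by (rule tr_pG) simp_all

lemma pr_gen: "G \<subseteq> Ker \<Longrightarrow> m \<in> gens G \<Longrightarrow> pr G (gen G m) = m"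
  using pr_pG[of G "frag_of (\<one>\<^bsub>R\<^esub>, m)"] gens_M[of G] by (auto simp: L.lev_of L.smult_one)

lemma cgen_frags: "m \<in> carrier M \<Longrightarrow> sk (crep m) \<subseteq> gens G \<Longrightarrow> tmapf (\<lambda>c. c) (gen G) (crep m) \<in> frags (carrier C \<times> carrier (N0 G))"
  by (rule tmapf_frags[OF crep_X]) (auto simp: gen_closed)

lemma cgen_closed:
  assumes "G \<subseteq> Ker" "m \<in> carrier M" "sk (crep m) \<subseteq> gens G" shows "cgen G m \<in> carrier (tensor_ab R C (N0 G))"
  unfolding cgen_def by (rule tensor_pair.tcls_closed[OF pairC[OF N0_mod[OF assms(1)]] cgen_frags[OF assms(2,3)]])

lemma cgen_tr:
  assumes G: "G \<subseteq> G'" "G' \<subseteq> Ker" and m: "m \<in> carrier M" "sk (crep m) \<subseteq> gens G"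
  shows "Cmap (N0 G') (tr G G') (cgen G m) = cgen G' m"
proof -
  have GK: "G \<subseteq> Ker" using G by blast
  have "Cmap (N0 G') (tr G G') (cgen G m) = tcls R C (N0 G') (tmapf (\<lambda>c. c) (tr G G') (tmapf (\<lambda>c. c) (gen G) (crep m)))"
    unfolding cgen_def by (rule tensor_map_tcls[OF pairC[OF N0_mod[OF GK]] pairC[OF N0_mod[OF G(2)]] rmod_hom_id tr_hom[OF G] cgen_frags[OF m]])
  also have "tmapf (\<lambda>c. c) (tr G G') (tmapf (\<lambda>c. c) (gen G) (crep m)) = tmapf (\<lambda>c. c) (gen G') (crep m)"
    unfolding tmapf_tmapf by (rule tmapf_cong[OF crep_X[OF m]]) (simp_all add: tr_gen[OF G(1)])
  finally show ?thesis unfolding cgen_def .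
qed

text \<open>Projection to \<open>M\<close> turns the generator named \<open>y\<close> back into
  \<open>y\<close>, which recovers the chosen representative of the coaction.\<close>

lemma cgen_pr:
  assumes G: "G \<subseteq> Ker" and m: "m \<in> carrier M" "sk (crep m) \<subseteq> gens G"
  shows "Cmap M (pr G) (cgen G m) = coact M m"
proof -
  have "Cmap M (pr G) (cgen G m) = tcls R C M (tmapf (\<lambda>c. c) (pr G) (tmapf (\<lambda>c. c) (gen G) (crep m)))"
    unfolding cgen_def by (rule tensor_map_tcls[OF pairC[OF N0_mod[OF G]] pairC[OF Mmod] rmod_hom_id pr_hom[OF G] cgen_frags[OF m]])
  also have "tmapf (\<lambda>c. c) (pr G) (tmapf (\<lambda>c. c) (gen G) (crep m)) = tmapf (\<lambda>c. c) (\<lambda>x. x) (crep m)"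
    unfolding tmapf_tmapf by (rule tmapf_cong[OF crep_X[OF m]]) (simp_all add: pr_gen[OF G(1)])
  finally show ?thesis by (simp add: tmapf_ident crep(2)[OF m(1)])
qed

text \<open>Two rounds, because \<open>cgen2\<close> applies the coaction to elements that
  themselves come from a coaction.\<close>

definition supp2 where "supp2 G m \<longleftrightarrow> m \<in> carrier M \<and> sk (crep m) \<subseteq> gens G \<and> (\<forall>m'\<in>sk (crep m). sk (crep m') \<subseteq> gens G)"

lemma crep_self: "m \<in> carrier M \<Longrightarrow> crep m \<in> frags (carrier C \<times> sk (crep m))" "m \<in> carrier M \<Longrightarrow> sk (crep m) \<subseteq> carrier M"
  by (rule frags_snd_keys[OF crep(1)], assumption)+

lemma supp2D:
  assumes "supp2 G m" "y \<in> sk (crep m)" shows "y \<in> carrier M" "sk (crep y) \<subseteq> gens G"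
proof -
  have m: "m \<in> carrier M" using assms(1) by (simp add: supp2_def)
  show "y \<in> carrier M" by (rule subsetD[OF crep_self(2)[OF m] assms(2)])
  show "sk (crep y) \<subseteq> gens G" using assms(1) unfolding supp2_def by (elim conjE) (rule bspec[OF _ assms(2)])
qed

lemma cgen2_frags:
  assumes "G \<subseteq> Ker" "supp2 G m" shows "tmapf (\<lambda>c. c) (cgen G) (crep m) \<in> frags (carrier C \<times> carrier (CN G))"
proof (rule tmapf_frags[OF crep_self(1)])
  show "m \<in> carrier M" using assms by (simp add: supp2_def)
  show "cgen G ` sk (crep m) \<subseteq> carrier (CN G)"
    unfolding carrier_tensor image_subset_iff by (intro ballI cgen_closed[OF assms(1) supp2D[OF assms(2)]])
qed simp

lemma TN0_mod: "G \<subseteq> Ker \<Longrightarrow> left_module R (CN G)" by (rule left_module_tensorC[OF N0_mod])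

lemma TM_mod: "left_module R (tensor R C M)" by (rule left_module_tensorC[OF Mmod])

lemma cgen2_tr:
  assumes G: "G \<subseteq> G'" "G' \<subseteq> Ker" and m: "supp2 G m"
  shows "Cmap (CN G') (Cmap (N0 G') (tr G G')) (cgen2 G m) = cgen2 G' m"
proof -
  have GK: "G \<subseteq> Ker" using G by blast
  have mM: "m \<in> carrier M" using m by (simp add: supp2_def)
  let ?t = "Cmap (N0 G') (tr G G')"
  have "Cmap (CN G') ?t (cgen2 G m) = tcls R C (CN G') (tmapf (\<lambda>c. c) ?t (tmapf (\<lambda>c. c) (cgen G) (crep m)))"
    unfolding cgen2_def
    by (rule tensor_map_tcls[OF pairC[OF TN0_mod[OF GK]] pairC[OF TN0_mod[OF G(2)]] rmod_hom_id Cmap_hom[OF N0_mod[OF GK] N0_mod[OF G(2)] tr_hom[OF G]] cgen2_frags[OF GK m]])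
  also have "tmapf (\<lambda>c. c) ?t (tmapf (\<lambda>c. c) (cgen G) (crep m)) = tmapf (\<lambda>c. c) (cgen G') (crep m)"
    unfolding tmapf_tmapf
  proof (rule tmapf_cong[OF crep_self(1)[OF mM]])
    fix y assume y: "y \<in> sk (crep m)"
    note supp2D[OF m y]
    then show "?t (cgen G y) = cgen G' y" by (rule cgen_tr[OF G])
  qed simp
  finally show ?thesis unfolding cgen2_def .
qed

text \<open>Inside the outer tensor factor this is \<open>cgen_pr\<close>. The result is the right
  side of coassociativity of \<open>M\<close> at \<open>m\<close>, to be matched with the image of
  \<open>coassL\<close> from a stage.\<close>

lemma cgen2_pr:
  assumes G: "G \<subseteq> Ker" and m: "supp2 G m"
  shows "Cmap (tensor R C M) (Cmap M (pr G)) (cgen2 G m) = Cmap (tensor R C M) (coact M) (coact M m)"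
proof -
  have mM: "m \<in> carrier M" using m by (simp add: supp2_def)
  let ?t = "Cmap M (pr G)"
  have "Cmap (tensor R C M) ?t (cgen2 G m) = tcls R C (tensor R C M) (tmapf (\<lambda>c. c) ?t (tmapf (\<lambda>c. c) (cgen G) (crep m)))"
    unfolding cgen2_def
    by (rule tensor_map_tcls[OF pairC[OF TN0_mod[OF G]] pairC[OF TM_mod] rmod_hom_id Cmap_hom[OF N0_mod[OF G] Mmod pr_hom[OF G]] cgen2_frags[OF G m]])
  also have "tmapf (\<lambda>c. c) ?t (tmapf (\<lambda>c. c) (cgen G) (crep m)) = tmapf (\<lambda>c. c) (coact M) (crep m)"
    unfolding tmapf_tmapf
  proof (rule tmapf_cong[OF crep_self(1)[OF mM]])
    fix y assume y: "y \<in> sk (crep m)"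
    note supp2D[OF m y]
    then show "?t (cgen G y) = coact M y" by (rule cgen_pr[OF G])
  qed simp
  also have "tcls R C (tensor R C M) (tmapf (\<lambda>c. c) (coact M) (crep m)) = Cmap (tensor R C M) (coact M) (tcls R C M (crep m))"
    by (rule tensor_map_tcls[OF pairC[OF Mmod] pairC[OF TM_mod] rmod_hom_id coact_lmod_hom[OF MC] crep(1)[OF mM], symmetric])
  finally show ?thesis by (simp add: crep(2)[OF mM])
qed

lemma zero_hom: "left_module R N \<Longrightarrow> left_module R P \<Longrightarrow> f \<in> lmod_hom R N P \<Longrightarrow> f \<zero>\<^bsub>N\<^esub> = \<zero>\<^bsub>P\<^esub>"
  by (rule add_hom_zero) (auto simp: lmod_hom_add_hom left_module_def)

text \<open>The closure conditions that a finite set \<open>F\<close> of relations of \<open>M\<close> imposes on a larger set \<open>G\<close>: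
  \<open>N0 G\<close> is a flat comodule once they hold for all finite \<open>F \<subseteq> G\<close>.\<close>

definition "supported F G \<longleftrightarrow> F \<subseteq> G \<and> (\<forall>m\<in>gens F. supp2 G m)"
definition "trivialises F G \<longleftrightarrow> (\<exists>s. (\<forall>x\<in>gens G. s x \<in> FA R (gens G) \<and> pG G (s x) = gen G x) \<and> (\<forall>g\<in>F. lsubst R s g \<in> linspan R (gens G) {}))"
definition "kills G g \<longleftrightarrow> lev (CN G) (cgen G) g = \<zero>\<^bsub>CN G\<^esub>"
definition "coassoc_at G m \<longleftrightarrow> coassL R C (N0 G) (cgen G m) = cgen2 G m"
definition "counit_at G m \<longleftrightarrow> counitL R C (N0 G) (cgen G m) = gen G m"
definition "closed_for F G \<longleftrightarrow> supported F G \<and> trivialises F G \<and> (\<forall>g\<in>F. kills G g) \<and> (\<forall>m\<in>gens F. coassoc_at G m \<and> counit_at G m)"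

lemma supp2_mono: "supp2 G m \<Longrightarrow> G \<subseteq> G' \<Longrightarrow> supp2 G' m"
  unfolding supp2_def using gens_mono[of G G'] by blast

lemma supported_mono: "supported F G \<Longrightarrow> G \<subseteq> G' \<Longrightarrow> supported F G'"
  unfolding supported_def using supp2_mono[of G _ G'] by blast

lemma supportedD:
  assumes "supported F G" shows "F \<subseteq> G" "m \<in> gens F \<Longrightarrow> supp2 G m"
    "m \<in> gens F \<Longrightarrow> m \<in> carrier M" "m \<in> gens F \<Longrightarrow> sk (crep m) \<subseteq> gens G"
  using assms by (simp_all add: supported_def supp2_def)

text \<open>The extended substitution leaves new generators alone. The relations in \<open>F\<close>
  mention generators of \<open>G\<close> only, so their substituted forms are unchanged, and the
  classes of old generators follow the transition map.\<close>

lemma trivialises_mono: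
  assumes closed_for: "trivialises F G" and F: "F \<subseteq> G" and G: "G \<subseteq> G'" "G' \<subseteq> Ker" shows "trivialises F G'"
proof -
  have GK: "G \<subseteq> Ker" using G by blast
  from closed_for obtain s where s: "\<forall>x\<in>gens G. s x \<in> FA R (gens G) \<and> pG G (s x) = gen G x" "\<forall>g\<in>F. lsubst R s g \<in> linspan R (gens G) {}"
    unfolding trivialises_def by (elim exE conjE)
  let ?s = "\<lambda>x. if x \<in> gens G then s x else frag_of (\<one>\<^bsub>R\<^esub>, x)"
  show ?thesis unfolding trivialises_def
  proof (rule exI[of _ ?s], intro conjI ballI)
    fix x assume x: "x \<in> gens G'"
    show "?s x \<in> FA R (gens G')" using x s(1) FA_sub[OF G(1)] by auto
    show "pG G' (?s x) = gen G' x"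
    proof (cases "x \<in> gens G")
      case True
      have sx: "s x \<in> FA R (gens G)" using s(1) True by blast
      have "pG G' (s x) = tr G G' (pG G (s x))" by (rule tr_pG[OF G(1) sx, symmetric])
      also have "\<dots> = tr G G' (gen G x)" using s(1) True by simp
      also have "\<dots> = gen G' x" by (rule tr_gen[OF G(1) True])
      finally show ?thesis using True by simp
    qed simp
  next
    fix g assume g: "g \<in> F"
    have gF: "g \<in> FA R (gens G)" using g F G_FA[OF GK] by blast
    have "lsubst R ?s g = lsubst R s g" by (rule lsubst_cong[OF gF]) simp
    then show "lsubst R ?s g \<in> linspan R (gens G') {}" using s(2) g linspan_mono[OF gens_mono[OF G(1)] subset_refl] by fastforce
  qed
qed

context
  fixes F G G' assumes X: "supported F G" and G: "G \<subseteq> G'" "G' \<subseteq> Ker"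
begin

private lemma GK: "G \<subseteq> Ker" using G by blast

private lemma F_FA: "g \<in> F \<Longrightarrow> g \<in> FA R (gens F)"
  using supportedD(1)[OF X] GK G_FA[of F] by blast

private lemma kapc: "cgen G \<in> gens F \<rightarrow> carrier (CN G)"
  using cgen_closed[OF GK supportedD(3,4)[OF X]] by simp

lemma lev_kap_tr: "g \<in> F \<Longrightarrow> Cmap (N0 G') (tr G G') (lev (CN G) (cgen G) g) = lev (CN G') (cgen G') g"
proof -
  assume g: "g \<in> F"
  interpret T: left_module R "CN G'" by (rule TN0_mod[OF G(2)])
  have X': "supported F G'" by (rule supported_mono[OF X G(1)])
  have c: "cgen G' \<in> gens F \<rightarrow> carrier (CN G')"
    using cgen_closed[OF G(2) supportedD(3,4)[OF X']] by simp
  have "Cmap (N0 G') (tr G G') (lev (CN G) (cgen G) g) = lev (CN G') (\<lambda>m. Cmap (N0 G') (tr G G') (cgen G m)) g"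
    by (rule lmod_hom_lev[OF TN0_mod[OF GK] TN0_mod[OF G(2)] Cmap_hom[OF N0_mod[OF GK] N0_mod[OF G(2)] tr_hom[OF G]] kapc F_FA[OF g]])
  also have "\<dots> = lev (CN G') (cgen G') g"
    by (rule T.lev_cong[OF F_FA[OF g] c]) (rule cgen_tr[OF G supportedD(3,4)[OF X]])
  finally show ?thesis .
qed

lemma kills_mono: "g \<in> F \<Longrightarrow> kills G g \<Longrightarrow> kills G' g"
  using lev_kap_tr[of g] zero_hom[OF TN0_mod[OF GK] TN0_mod[OF G(2)] Cmap_hom[OF N0_mod[OF GK] N0_mod[OF G(2)] tr_hom[OF G]]]
  by (simp add: kills_def)

lemma coass_kap_tr: "m \<in> gens F \<Longrightarrow> Cmap (CN G') (Cmap (N0 G') (tr G G')) (coassL R C (N0 G) (cgen G m)) = coassL R C (N0 G') (cgen G' m)"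
  using coassL_natural[OF N0_mod[OF GK] N0_mod[OF G(2)] tr_hom[OF G] cgen_closed[OF GK supportedD(3,4)[OF X]]] cgen_tr[OF G supportedD(3,4)[OF X]] by simp

lemma coassoc_at_mono: "m \<in> gens F \<Longrightarrow> coassoc_at G m \<Longrightarrow> coassoc_at G' m"
  using coass_kap_tr[of m] cgen2_tr[OF G supportedD(2)[OF X], of m] by (simp add: coassoc_at_def)

lemma counit_kap_tr: "m \<in> gens F \<Longrightarrow> tr G G' (counitL R C (N0 G) (cgen G m)) = counitL R C (N0 G') (cgen G' m)"
  using counitL_natural[OF N0_mod[OF GK] N0_mod[OF G(2)] tr_hom[OF G] cgen_closed[OF GK supportedD(3,4)[OF X]]] cgen_tr[OF G supportedD(3,4)[OF X]] by simp

lemma counit_at_mono: "m \<in> gens F \<Longrightarrow> counit_at G m \<Longrightarrow> counit_at G' m"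
  using counit_kap_tr tr_gen[OF G(1)] gens_mono[OF supportedD(1)[OF X]] by (simp add: counit_at_def subset_iff) metis

text \<open>Through this persistence, enlarging the set in the countable closing-up does not undo
  what has been achieved for a finite subset.\<close>

lemma closed_for_mono: "closed_for F G \<Longrightarrow> closed_for F G'"
  unfolding closed_for_def using supported_mono[OF X G(1)] trivialises_mono[OF _ supportedD(1)[OF X] G] kills_mono coassoc_at_mono counit_at_mono by blast

end

lemma KerM: "g \<in> Ker \<Longrightarrow> sk g \<subseteq> carrier M"
  using frags_snd_keys(2)[OF KerF] .

text \<open>The substitution comes from the equational criterion in \<open>M\<close>. For it to
  preserve classes, the relation identifying each generator \<open>x\<close> of \<open>F\<close>
  with \<open>s x\<close> is added, and trivial relations make the elements occurring in
  \<open>s x\<close> available as generators.\<close>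

lemma trivialises_ex:
  assumes F: "finite F" "F \<subseteq> Ker"
  shows "\<exists>G. finite G \<and> G \<subseteq> Ker \<and> F \<subseteq> G \<and> trivialises F G"
proof -
  have fX: "finite (gens F)" "gens F \<subseteq> carrier M" using F KerM by (auto simp: gens_def)
  from eqf[unfolded eqflat_def] F fX obtain s where s: "\<forall>x\<in>carrier M. s x \<in> FA R (carrier M)" "\<forall>x\<in>gens F. lev M (\<lambda>x. x) (s x) = x"
    "\<forall>g\<in>F. lsubst R s g \<in> linspan R (carrier M) {}" by metis
  have sF: "s x \<in> FA R (carrier M)" if "x \<in> gens F" for x using s(1) fX that by blast
  let ?B = "(\<lambda>y. frag_of (\<zero>\<^bsub>R\<^esub>, y)) ` (\<Union>x\<in>gens F. sk (s x))"
  let ?G = "F \<union> (\<lambda>x. frag_of (\<one>\<^bsub>R\<^esub>, x) - s x) ` gens F \<union> ?B"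
  have skM: "sk (s x) \<subseteq> carrier M" if "x \<in> gens F" for x by (rule frags_snd_keys(2)[OF sF[OF that]])
  have d: "frag_of (\<one>\<^bsub>R\<^esub>, x) - s x \<in> Ker" if x: "x \<in> gens F" for x
  proof -
    have xM: "x \<in> carrier M" using x fX by blast
    have f: "frag_of (\<one>\<^bsub>R\<^esub>, x) \<in> FA R (carrier M)" using xM by simp
    have "lev M (\<lambda>x. x) (frag_of (\<one>\<^bsub>R\<^esub>, x) - s x) = x \<ominus>\<^bsub>M\<^esub> x"
      using L.lev_diff[OF idM f sF[OF x]] s(2) x xM by (simp add: L.lev_of L.smult_one)
    then show ?thesis using f sF[OF x] xM by (simp add: lker_def frags_diff L.M.r_neg a_minus_def)
  qed
  have GK: "?G \<subseteq> Ker" using F(2) d skM zero_Ker by blast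
  have fin: "finite ?G" using F(1) fX(1) by simp
  have XF: "gens F \<subseteq> gens ?G" by (rule gens_mono) blast
  have sX: "s x \<in> FA R (gens ?G)" if x: "x \<in> gens F" for x
  proof -
    have "sk (s x) \<subseteq> gens ?G" using x gens_zero[of _ ?G] by blast
    then have "carrier R \<times> sk (s x) \<subseteq> carrier R \<times> gens ?G" by auto
    from subsetD[OF frags_mono[OF this] frags_snd_keys(1)[OF sF[OF x]]] show ?thesis .
  qed
  let ?s = "\<lambda>x. if x \<in> gens F then s x else frag_of (\<one>\<^bsub>R\<^esub>, x)"
  have "trivialises F ?G" unfolding trivialises_def
  proof (rule exI[of _ ?s], intro conjI ballI)
    fix x assume x: "x \<in> gens ?G"
    show "?s x \<in> FA R (gens ?G)" using x sX by simp
    show "pG ?G (?s x) = gen ?G x"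
    proof (cases "x \<in> gens F")
      case True
      have "gen ?G x = pG ?G (s x)" by (rule pG_eq[OF GK, of "frag_of (\<one>\<^bsub>R\<^esub>, x) - s x"]) (use True in auto)
      then show ?thesis using True by simp
    qed simp
  next
    fix g assume g: "g \<in> F"
    have gF: "g \<in> FA R (gens F)" using g G_FA[OF F(2)] by blast
    have "lsubst R ?s g = lsubst R s g" by (rule lsubst_cong[OF gF]) simp
    moreover have "lsubst R s g \<in> FA R (gens ?G)" by (rule lsubst_frags[OF gF sX])
    \<comment> \<open>Triviality known over all of \<open>M\<close> is restricted to the generators
      of \<open>?G\<close>.\<close>
    ultimately show "lsubst R ?s g \<in> linspan R (gens ?G) {}" using s(3) g R.linspan_empty_restrict by fastforce
  qed
  then show ?thesis using fin GK by (intro exI[of _ ?G]) blast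
qed

lemma supported_ex:
  assumes F: "finite F" "F \<subseteq> Ker"
  shows "\<exists>G. finite G \<and> G \<subseteq> Ker \<and> supported F G"
proof -
  have fX: "finite (gens F)" "gens F \<subseteq> carrier M" using F KerM by (auto simp: gens_def)
  define Y1 where "Y1 = (\<Union>m\<in>gens F. sk (crep m))"
  define Y2 where "Y2 = (\<Union>m\<in>Y1. sk (crep m))"
  have Y1: "finite Y1" "Y1 \<subseteq> carrier M" unfolding Y1_def using fX crep_self(2) by auto
  have Y2: "finite Y2" "Y2 \<subseteq> carrier M" unfolding Y2_def using Y1 crep_self(2) by auto
  let ?G = "F \<union> (\<lambda>y. frag_of (\<zero>\<^bsub>R\<^esub>, y)) ` (Y1 \<union> Y2)"
  have Y: "Y1 \<subseteq> gens ?G" "Y2 \<subseteq> gens ?G" using gens_zero[of _ ?G] by blast+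
  have "supp2 ?G m" if m: "m \<in> gens F" for m
  proof -
    have 1: "sk (crep m) \<subseteq> Y1" using m by (auto simp: Y1_def)
    have 2: "sk (crep m') \<subseteq> Y2" if "m' \<in> sk (crep m)" for m' using that 1 unfolding Y2_def by blast
    show ?thesis unfolding supp2_def using m fX(2) 1 2 Y by blast
  qed
  then have "supported F ?G" unfolding supported_def by blast
  moreover have "finite ?G" "?G \<subseteq> Ker" using F Y1 Y2 zero_Ker by auto
  ultimately show ?thesis by blast
qed

text \<open>Killing of relations, coassociativity and counit are equations in the module of a stage
  or in its single or double tensor product with \<open>C\<close>. They hold after projection,
  because \<open>M\<close> is a comodule, and these products are again directed systems with the
  expected colimits; so each equation holds at a later stage. Finiteness of \<open>F\<close> gives a
  common stage for each kind, and the three stages are merged by union.\<close>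

lemma closed_for_ex:
  assumes F: "finite F" "F \<subseteq> Ker" shows "\<exists>G\<in>I0. closed_for F G"
proof -
  interpret D: dirlim I0 r0 R N0 tr M pr by (rule dirlim0)
  obtain G1 where G1: "finite G1" "G1 \<subseteq> Ker" "F \<subseteq> G1" "trivialises F G1" using trivialises_ex[OF F] by blast
  obtain G2 where G2: "finite G2" "G2 \<subseteq> Ker" "supported F G2" using supported_ex[OF F] by blast
  define G where "G = G1 \<union> G2"
  have G: "G \<in> I0" "G \<subseteq> Ker" using G1 G2 by (auto simp: I0_def G_def countable_finite)
  have FG: "F \<subseteq> G" using G1 by (auto simp: G_def)
  have trivialises: "trivialises F G" by (rule trivialises_mono[OF G1(4,3) _ G(2)]) (simp add: G_def)
  have supported: "supported F G" by (rule supported_mono[OF G2(3)]) (simp add: G_def)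
  have fX: "finite (gens F)" using F by (auto simp: gens_def)
  have r0D: "k \<subseteq> l" "l \<subseteq> Ker" if "(k, l) \<in> r0" for k l using that by (auto simp: r0_def I0_def)
  have FX: "supported F k" if "(G, k) \<in> r0" for k by (rule supported_mono[OF supported r0D(1)[OF that]])
  interpret T: dirlim I0 r0 R "\<lambda>i. CN i" "\<lambda>i j. Cmap (N0 j) (tr i j)" "tensor R C M" "\<lambda>i. Cmap M (pr i)"
    by (rule D.dirlim_tensor[OF CB])
  interpret TT: dirlim I0 r0 R "\<lambda>i. tensor R C (CN i)" "\<lambda>i j. Cmap (CN j) (Cmap (N0 j) (tr i j))"
    "tensor R C (tensor R C M)" "\<lambda>i. Cmap (tensor R C M) (Cmap M (pr i))"
    by (rule T.dirlim_tensor[OF CB])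
  have kc: "cgen G m \<in> carrier (CN G)" if "m \<in> gens F" for m
    using cgen_closed[OF G(2) supportedD(3,4)[OF supported]] that by simp
  have k1: "\<exists>k. (G, k) \<in> r0 \<and> (\<forall>g\<in>F. kills k g)"
  proof (rule D.eventually_finite[OF F(1) G(1)])
    show "\<exists>k. (G, k) \<in> r0 \<and> kills k g" if g: "g \<in> F" for g
    proof -
      interpret TL: left_module R "tensor R C M" by (rule TM_mod)
      interpret TG: left_module R "CN G" by (rule TN0_mod[OF G(2)])
      have gF: "g \<in> FA R (gens F)" using g G_FA[OF F(2)] by blast
      have XM: "gens F \<subseteq> carrier M" by (rule gens_M[OF F(2)])
      have gM: "g \<in> FA R (carrier M)" by (rule KerF) (use g F in blast)
      have kF: "cgen G \<in> gens F \<rightarrow> carrier (CN G)" using kc by blast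
      have cM: "coact M \<in> carrier M \<rightarrow> carrier (tensor R C M)" using lmod_hom_closed[OF coact_lmod_hom[OF MC]] by blast
      have cX: "coact M \<in> gens F \<rightarrow> carrier (tensor R C M)" using cM XM by blast
      have "Cmap M (pr G) (lev (CN G) (cgen G) g) = lev (tensor R C M) (\<lambda>m. Cmap M (pr G) (cgen G m)) g"
        by (rule lmod_hom_lev[OF TN0_mod[OF G(2)] TM_mod Cmap_hom[OF N0_mod[OF G(2)] Mmod pr_hom[OF G(2)]] kF gF])
      also have "\<dots> = lev (tensor R C M) (\<lambda>m. coact M m) g"
        by (rule TL.lev_cong[OF gF cX]) (rule cgen_pr[OF G(2) supportedD(3,4)[OF supported]])
      also have "\<dots> = coact M (lev M (\<lambda>x. x) g)"
        by (rule lmod_hom_lev[OF Mmod TM_mod coact_lmod_hom[OF MC] idM gM, symmetric])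
      also have "\<dots> = \<zero>\<^bsub>tensor R C M\<^esub>" using g F zero_hom[OF Mmod TM_mod coact_lmod_hom[OF MC]] by (auto simp: lker_def)
      also have "\<dots> = Cmap M (pr G) \<zero>\<^bsub>CN G\<^esub>"
        by (rule zero_hom[OF TN0_mod[OF G(2)] TM_mod Cmap_hom[OF N0_mod[OF G(2)] Mmod pr_hom[OF G(2)]], symmetric])
      finally have eq: "Cmap M (pr G) (lev (CN G) (cgen G) g) = Cmap M (pr G) \<zero>\<^bsub>CN G\<^esub>" .
      have lc: "lev (CN G) (cgen G) g \<in> carrier (CN G)" by (rule TG.lev_closed[OF kF gF])
      from T.\<iota>_inj[OF G(1) lc TG.M.zero_closed eq]
      obtain k where k: "(G, k) \<in> r0" "Cmap (N0 k) (tr G k) (lev (CN G) (cgen G) g) = Cmap (N0 k) (tr G k) \<zero>\<^bsub>CN G\<^esub>"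
        by blast
      then have "kills k g" unfolding kills_def lev_kap_tr[OF supported r0D[OF k(1)] g, symmetric]
        using zero_hom[OF TN0_mod[OF G(2)] TN0_mod[OF r0D(2)[OF k(1)]] Cmap_hom[OF N0_mod[OF G(2)] N0_mod[OF r0D(2)[OF k(1)]] tr_hom[OF r0D[OF k(1)]]]] by simp
      then show ?thesis using k(1) by blast
    qed
    show "kills l g" if "g \<in> F" "(G, k) \<in> r0" "kills k g" "(k, l) \<in> r0" for g k l
      by (rule kills_mono[OF FX[OF that(2)] r0D[OF that(4)] that(1,3)])
  qed
  have k2: "\<exists>k. (G, k) \<in> r0 \<and> (\<forall>m\<in>gens F. coassoc_at k m)"
  proof (rule D.eventually_finite[OF fX G(1)])
    show "\<exists>k. (G, k) \<in> r0 \<and> coassoc_at k m" if m: "m \<in> gens F" for m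
    proof -
      have mM: "m \<in> carrier M" by (rule supportedD(3)[OF supported m])
      have kca: "cgen G m \<in> carrier (tensor_ab R C (N0 G))" using kc[OF m] by simp
      have c1: "coassL R C (N0 G) (cgen G m) \<in> carrier (tensor R C (CN G))"
        by (rule lmod_hom_closed[OF coassL_hom[OF N0_mod[OF G(2)]] kc[OF m]])
      have c2: "cgen2 G m \<in> carrier (tensor R C (CN G))"
        unfolding cgen2_def using tensor_pair.tcls_closed[OF pairC[OF TN0_mod[OF G(2)]] cgen2_frags[OF G(2) supportedD(2)[OF supported m]]] by simp
      have "Cmap (tensor R C M) (Cmap M (pr G)) (coassL R C (N0 G) (cgen G m)) = coassL R C M (Cmap M (pr G) (cgen G m))"
        by (rule coassL_natural[OF N0_mod[OF G(2)] Mmod pr_hom[OF G(2)] kca, symmetric])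
      also have "\<dots> = coassL R C M (coact M m)" by (simp add: cgen_pr[OF G(2) supportedD(3,4)[OF supported m]])
      also have "\<dots> = Cmap (tensor R C M) (coact M) (coact M m)" using MC mM by (simp add: comodule_iff)
      also have "\<dots> = Cmap (tensor R C M) (Cmap M (pr G)) (cgen2 G m)" by (rule cgen2_pr[OF G(2) supportedD(2)[OF supported m], symmetric])
      finally obtain k where k: "(G, k) \<in> r0" "Cmap (CN k) (Cmap (N0 k) (tr G k)) (coassL R C (N0 G) (cgen G m)) =
          Cmap (CN k) (Cmap (N0 k) (tr G k)) (cgen2 G m)"
        using TT.\<iota>_inj[OF G(1) c1 c2] by blast
      then have "coassoc_at k m" using coass_kap_tr[OF supported r0D[OF k(1)] m] cgen2_tr[OF r0D[OF k(1)] supportedD(2)[OF supported m]] by (simp add: coassoc_at_def)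
      then show ?thesis using k(1) by blast
    qed
    show "coassoc_at l m" if "m \<in> gens F" "(G, k) \<in> r0" "coassoc_at k m" "(k, l) \<in> r0" for m k l
      by (rule coassoc_at_mono[OF FX[OF that(2)] r0D[OF that(4)] that(1,3)])
  qed
  have k3: "\<exists>k. (G, k) \<in> r0 \<and> (\<forall>m\<in>gens F. counit_at k m)"
  proof (rule D.eventually_finite[OF fX G(1)])
    show "\<exists>k. (G, k) \<in> r0 \<and> counit_at k m" if m: "m \<in> gens F" for m
    proof -
      have mM: "m \<in> carrier M" by (rule supportedD(3)[OF supported m])
      have mG: "m \<in> gens G" using m gens_mono[OF FG] by blast
      have kca: "cgen G m \<in> carrier (tensor_ab R C (N0 G))" using kc[OF m] by simp
      have c1: "counitL R C (N0 G) (cgen G m) \<in> carrier (N0 G)"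
        by (rule lmod_hom_closed[OF counitL_hom[OF N0_mod[OF G(2)]] kc[OF m]])
      have "pr G (counitL R C (N0 G) (cgen G m)) = counitL R C M (Cmap M (pr G) (cgen G m))"
        by (rule counitL_natural[OF N0_mod[OF G(2)] Mmod pr_hom[OF G(2)] kca, symmetric])
      also have "\<dots> = counitL R C M (coact M m)" by (simp add: cgen_pr[OF G(2) supportedD(3,4)[OF supported m]])
      also have "\<dots> = m" using MC mM by (simp add: comodule_iff)
      also have "\<dots> = pr G (gen G m)" by (rule pr_gen[OF G(2) mG, symmetric])
      finally obtain k where k: "(G, k) \<in> r0" "tr G k (counitL R C (N0 G) (cgen G m)) = tr G k (gen G m)"
        using D.\<iota>_inj[OF G(1) c1 gen_closed[OF mG]] by blast
      then have "counit_at k m" using counit_kap_tr[OF supported r0D[OF k(1)] m] tr_gen[OF r0D(1)[OF k(1)] mG] by (simp add: counit_at_def)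
      then show ?thesis using k(1) by blast
    qed
    show "counit_at l m" if "m \<in> gens F" "(G, k) \<in> r0" "counit_at k m" "(k, l) \<in> r0" for m k l
      by (rule counit_at_mono[OF FX[OF that(2)] r0D[OF that(4)] that(1,3)])
  qed
  from k1 k2 k3 obtain k l n where k: "(G, k) \<in> r0" "\<forall>g\<in>F. kills k g" and l: "(G, l) \<in> r0" "\<forall>m\<in>gens F. coassoc_at l m"
    and n: "(G, n) \<in> r0" "\<forall>m\<in>gens F. counit_at n m" by (elim exE conjE)
  let ?H = "k \<union> l \<union> n"
  have H: "?H \<in> I0" "?H \<subseteq> Ker" using k(1) l(1) n(1) by (auto simp: r0_def I0_def)
  have s: "G \<subseteq> ?H" "k \<subseteq> ?H" "l \<subseteq> ?H" "n \<subseteq> ?H" using r0D(1)[OF k(1)] by blast+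
  have "closed_for F ?H" unfolding closed_for_def
  proof (intro conjI ballI)
    show "supported F ?H" by (rule supported_mono[OF supported s(1)])
    show "trivialises F ?H" by (rule trivialises_mono[OF trivialises FG s(1) H(2)])
    show "kills ?H g" if "g \<in> F" for g by (rule kills_mono[OF FX[OF k(1)] s(2) H(2) that k(2)[rule_format, OF that]])
    show "coassoc_at ?H m" if "m \<in> gens F" for m by (rule coassoc_at_mono[OF FX[OF l(1)] s(3) H(2) that l(2)[rule_format, OF that]])
    show "counit_at ?H m" if "m \<in> gens F" for m by (rule counit_at_mono[OF FX[OF n(1)] s(4) H(2) that n(2)[rule_format, OF that]])
  qed
  then show ?thesis using H(1) by blast
qed

end

section \<open>Closed sets of relations and their comodules\<close>

context flat_comodule
begin

text \<open>Finite subsets and not single relations are quantified over because of flatness: the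
  equational criterion has to trivialise finitely many relations by one substitution.\<close>

definition "Ic = {G \<in> I0. \<forall>F. finite F \<and> F \<subseteq> G \<longrightarrow> closed_for F G}"
definition "rc = r0 \<inter> Ic \<times> Ic"

text \<open>The closing-up yields a set that contains, with each finite subset \<open>F\<close>, a
  stage closed for \<open>F\<close>; by persistence the whole set is closed for
  \<open>F\<close>.\<close>

lemma Ic_ex:
  assumes U: "countable U" "U \<subseteq> Ker" shows "\<exists>G\<in>Ic. U \<subseteq> G"
proof -
  define W where "W F = (SOME G. G \<in> I0 \<and> closed_for F G)" for F
  have W: "W F \<in> I0" "closed_for F (W F)" if "finite F" "F \<subseteq> Ker" for F
  proof -
    have "\<exists>G. G \<in> I0 \<and> closed_for F G" using closed_for_ex[OF that] by blast
    from someI_ex[OF this] show "W F \<in> I0" "closed_for F (W F)" unfolding W_def by blast+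
  qed
  have W': "countable (W F) \<and> W F \<subseteq> Ker" if "finite F" "F \<subseteq> Ker" for F using W(1)[OF that] by (simp add: I0_def)
  have "\<exists>V. countable V \<and> U \<subseteq> V \<and> V \<subseteq> Ker \<and> (\<forall>F. finite F \<and> F \<subseteq> V \<longrightarrow> W F \<subseteq> V)"
    by (rule countable_closure[OF _ U]) (rule W')
  then obtain V where V: "countable V" "U \<subseteq> V" "V \<subseteq> Ker" "\<forall>F. finite F \<and> F \<subseteq> V \<longrightarrow> W F \<subseteq> V"
    by (elim exE conjE)
  have "closed_for F V" if F: "finite F" "F \<subseteq> V" for F
  proof -
    have FK: "F \<subseteq> Ker" using F V by blast
    have closed_for: "closed_for F (W F)" by (rule W(2)[OF F(1) FK])
    then have "supported F (W F)" by (simp add: closed_for_def)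
    from closed_for_mono[OF this _ V(3) closed_for] V(4) F show ?thesis by blast
  qed
  then have "V \<in> Ic" using V by (simp add: Ic_def I0_def)
  then show ?thesis using V(2) by blast
qed

lemma IcD:
  assumes "G \<in> Ic" shows "G \<subseteq> Ker" "countable G" "finite F \<Longrightarrow> F \<subseteq> G \<Longrightarrow> closed_for F G"
  using assms by (auto simp: Ic_def I0_def)

lemma Ic_gen:
  assumes "G \<in> Ic" "m \<in> gens G" shows "supp2 G m" "coassoc_at G m" "counit_at G m" "m \<in> carrier M" "sk (crep m) \<subseteq> gens G"
proof -
  obtain g where g: "g \<in> G" "m \<in> gens {g}" using assms(2) by (auto simp: gens_def)
  then have "closed_for {g} G" using IcD(3)[OF assms(1), of "{g}"] by simp
  then show "supp2 G m" "coassoc_at G m" "counit_at G m" using g(2) by (simp_all add: closed_for_def supported_def)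
  then show "m \<in> carrier M" "sk (crep m) \<subseteq> gens G" by (simp_all add: supp2_def)
qed

lemma Ic_rel: "G \<in> Ic \<Longrightarrow> g \<in> G \<Longrightarrow> lev (CN G) (cgen G) g = \<zero>\<^bsub>CN G\<^esub>"
  using IcD(3)[of G "{g}"] by (simp add: closed_for_def kills_def)

text \<open>The coaction on the module of \<open>G\<close>, obtained from its presentation:
  generators go to \<open>cgen G\<close>, and this respects the relations because \<open>G\<close>
  kills each of its members.\<close>

definition nu where
  "nu G = (SOME f. f \<in> lmod_hom R (N0 G) (CN G) \<and> (\<forall>z\<in>FA R (gens G). f (lev (N0 G) (gen G) z) = lev (CN G) (cgen G) z))"

lemma cgen_fun: "G \<in> Ic \<Longrightarrow> cgen G \<in> gens G \<rightarrow> carrier (CN G)"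
  using cgen_closed[OF IcD(1) Ic_gen(4,5)] by simp

lemma nu:
  assumes G: "G \<in> Ic"
  shows "nu G \<in> lmod_hom R (N0 G) (CN G)" "m \<in> gens G \<Longrightarrow> nu G (gen G m) = cgen G m"
proof -
  note GK = IcD(1)[OF G]
  have "\<exists>f. f \<in> lmod_hom R (N0 G) (CN G) \<and> (\<forall>z\<in>FA R (gens G). f (lev (N0 G) (gen G) z) = lev (CN G) (cgen G) z)"
    by (rule presented_lift[OF N0_presented[OF GK] N0_mod[OF GK] TN0_mod[OF GK] cgen_fun[OF G] Ic_rel[OF G]])
  note n = someI_ex[OF this, folded nu_def]
  show "nu G \<in> lmod_hom R (N0 G) (CN G)" using n by (rule conjunct1)
  assume m: "m \<in> gens G"
  interpret T: left_module R "CN G" by (rule TN0_mod[OF GK])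
  have k: "cgen G m \<in> carrier (CN G)" using cgen_fun[OF G] m by blast
  have "nu G (lev (N0 G) (gen G) (frag_of (\<one>\<^bsub>R\<^esub>, m))) = lev (CN G) (cgen G) (frag_of (\<one>\<^bsub>R\<^esub>, m))"
    using n m by simp
  then show "nu G (gen G m) = cgen G m" using m k by (simp add: N0_lev[OF GK] T.lev_of T.smult_one)
qed

definition piece :: "('a, 'u) fcomb set \<Rightarrow> ('a, 'c, ('a, 'u) fcomb set) comodule" where
  "piece G = pcomod R (gens G) G (nu G)"

lemma piece_simps: "carrier (piece G) = carrier (N0 G)" "add (piece G) = add (N0 G)" "smult (piece G) = smult (N0 G)" "coact (piece G) = nu G"
  by (simp_all add: piece_def N0_def pcomod_def)

lemma piece_hom: "lmod_hom R (piece G) X = lmod_hom R (N0 G) X" "lmod_hom R Y (piece G) = lmod_hom R Y (N0 G)"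
  by (simp_all add: lmod_hom_def add_hom_def piece_simps)

lemma piece_tensor: "tensor R C (piece G) = CN G" "tensor_map R C (piece G) f g = tensor_map R C (N0 G) f g"
  by (rule tensor_cong[OF piece_simps(1-3)])+

lemma piece_mod: "G \<in> Ic \<Longrightarrow> left_module R (piece G)"
  unfolding piece_def by (rule R.left_module_pcomod[OF G_FA[OF IcD(1)]])

lemma piece_coassL: "coassL R C (piece G) t = coassL R C (N0 G) t"
  by (simp add: coassL_def tensor_assoc_def tensor_cong[OF piece_simps(1-3)])

text \<open>The left unit map evaluates in the module record itself, where
  \<open>tensor_cong\<close> does not reach; naturality of \<open>counitL\<close> along the identity
  map bridges the two records.\<close>

lemma piece_counitL:
  assumes G: "G \<in> Ic" and t: "t \<in> carrier (tensor_ab R C (N0 G))" shows "counitL R C (piece G) t = counitL R C (N0 G) t"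
proof -
  have "(\<lambda>x. x) \<in> lmod_hom R (N0 G) (piece G)" unfolding piece_hom by (rule lmod_hom_id)
  from counitL_natural[OF N0_mod[OF IcD(1)[OF G]] piece_mod[OF G] this t] show ?thesis
    using Cmap_id[OF N0_mod[OF IcD(1)[OF G]] t] by (simp add: piece_tensor)
qed

lemma nu_kap:
  assumes G: "G \<in> Ic" and m: "m \<in> gens G" shows "Cmap (CN G) (nu G) (cgen G m) = cgen2 G m"
proof -
  note mG = Ic_gen[OF G m] and GK = IcD(1)[OF G]
  have "Cmap (CN G) (nu G) (cgen G m) = tcls R C (CN G) (tmapf (\<lambda>c. c) (nu G) (tmapf (\<lambda>c. c) (gen G) (crep m)))"
    unfolding cgen_def
    by (rule tensor_map_tcls[OF pairC[OF N0_mod[OF GK]] pairC[OF TN0_mod[OF GK]] rmod_hom_id nu(1)[OF G] cgen_frags[OF mG(4,5)]])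
  also have "tmapf (\<lambda>c. c) (nu G) (tmapf (\<lambda>c. c) (gen G) (crep m)) = tmapf (\<lambda>c. c) (cgen G) (crep m)"
    unfolding tmapf_tmapf by (rule tmapf_cong[OF crep_X[OF mG(4,5)]]) (simp_all add: nu(2)[OF G])
  finally show ?thesis unfolding cgen2_def .
qed

text \<open>Both axioms equate linear maps out of a presented module, so they are checked on
  generators, where they are \<open>coassoc_at\<close> and \<open>counit_at\<close>.\<close>

theorem piece_comodule:
  assumes G: "G \<in> Ic" shows "comodule R C (piece G)"
  unfolding comodule_iff
proof (intro conjI ballI)
  note GK = IcD(1)[OF G]
  note p = N0_presented[OF GK] and N = N0_mod[OF GK] and T = TN0_mod[OF GK]
  note TT = left_module_tensorC[OF T]
  show "left_module R (piece G)" by (rule piece_mod[OF G])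
  show "coact (piece G) \<in> lmod_hom R (piece G) (tensor R C (piece G))" unfolding piece_hom piece_tensor piece_simps by (rule nu(1)[OF G])
  fix x assume "x \<in> carrier (piece G)"
  then have x: "x \<in> carrier (N0 G)" by (simp add: piece_simps)
  have "coassL R C (N0 G) (nu G x) = Cmap (CN G) (nu G) (nu G x)"
    by (rule presented_hom_eq[OF p N TT lmod_hom_compose[OF nu(1)[OF G] coassL_hom[OF N]] lmod_hom_compose[OF nu(1)[OF G] Cmap_hom[OF N T nu(1)[OF G]]] _ x])
      (use Ic_gen(2)[OF G] in \<open>simp add: nu(2)[OF G] nu_kap[OF G] coassoc_at_def\<close>)
  then show "coassL R C (piece G) (coact (piece G) x) = Cmap (tensor R C (piece G)) (coact (piece G)) (coact (piece G) x)"
    by (simp add: piece_coassL piece_simps piece_tensor)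
  have "counitL R C (N0 G) (nu G x) = x"
    by (rule presented_hom_eq[OF p N N lmod_hom_compose[OF nu(1)[OF G] counitL_hom[OF N]] lmod_hom_id _ x])
      (use Ic_gen(3)[OF G] in \<open>simp add: nu(2)[OF G] counit_at_def\<close>)
  moreover have "nu G x \<in> carrier (tensor_ab R C (N0 G))" using lmod_hom_closed[OF nu(1)[OF G] x] by simp
  ultimately show "counitL R C (piece G) (coact (piece G) x) = x" by (simp add: piece_counitL[OF G] piece_simps)
qed

lemma piece_eqflat: "G \<in> Ic \<Longrightarrow> eqflat R (piece G)"
  unfolding piece_def
proof (rule R.eqflat_pcomod[OF G_FA[OF IcD(1)]])
  fix F assume "G \<in> Ic" "finite F" "F \<subseteq> G"
  from IcD(3)[OF this] show "\<exists>s. (\<forall>x\<in>gens G. s x \<in> FA R (gens G) \<and> pG G (s x) = gen G x) \<and> (\<forall>g\<in>F. lsubst R s g \<in> linspan R (gens G) {})"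
    by (simp add: closed_for_def trivialises_def)
qed

lemma piece_presented: "G \<in> Ic \<Longrightarrow> presented R (piece G) (gens G) (gen G) G"
  unfolding piece_def by (rule R.presented_pcomod[OF G_FA[OF IcD(1)]])

lemma rcD: "(G, G') \<in> rc \<Longrightarrow> G \<subseteq> G'" "(G, G') \<in> rc \<Longrightarrow> G \<in> Ic" "(G, G') \<in> rc \<Longrightarrow> G' \<in> Ic"
  by (auto simp: rc_def r0_def)

text \<open>Both sides are linear in \<open>x\<close>, and on generators the equation is
  \<open>cgen_tr\<close>.\<close>

lemma tr_coact:
  assumes r: "(G, G') \<in> rc" and x: "x \<in> carrier (piece G)"
  shows "coact (piece G') (tr G G' x) = Cmap (piece G') (tr G G') (coact (piece G) x)"
proof -
  note G = rcD(2)[OF r] and G' = rcD(3)[OF r] and s = rcD(1)[OF r]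
  note GK = IcD(1)[OF G] and GK' = IcD(1)[OF G']
  note t = tr_hom[OF s GK']
  have xN: "x \<in> carrier (N0 G)" using x by (simp add: piece_simps)
  have gG: "nu G' (gen G' m) = cgen G' m" if "m \<in> gens G" for m using that gens_mono[OF s] nu(2)[OF G'] by blast
  have "nu G' (tr G G' x) = Cmap (N0 G') (tr G G') (nu G x)"
    by (rule presented_hom_eq[OF N0_presented[OF GK] N0_mod[OF GK] TN0_mod[OF GK'] lmod_hom_compose[OF t nu(1)[OF G']]
          lmod_hom_compose[OF nu(1)[OF G] Cmap_hom[OF N0_mod[OF GK] N0_mod[OF GK'] t]] _ xN])
      (simp add: tr_gen[OF s] gG nu(2)[OF G] cgen_tr[OF s GK' Ic_gen(4,5)[OF G]])
  then show ?thesis by (simp add: piece_simps piece_tensor)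
qed

lemma pr_coact:
  assumes G: "G \<in> Ic" and x: "x \<in> carrier (piece G)"
  shows "coact M (pr G x) = Cmap M (pr G) (coact (piece G) x)"
proof -
  note GK = IcD(1)[OF G]
  note t = pr_hom[OF GK]
  have xN: "x \<in> carrier (N0 G)" using x by (simp add: piece_simps)
  have "coact M (pr G x) = Cmap M (pr G) (nu G x)"
    by (rule presented_hom_eq[OF N0_presented[OF GK] N0_mod[OF GK] TM_mod lmod_hom_compose[OF t coact_lmod_hom[OF MC]]
          lmod_hom_compose[OF nu(1)[OF G] Cmap_hom[OF N0_mod[OF GK] Mmod t]] _ xN])
      (simp add: pr_gen[OF GK] nu(2)[OF G] cgen_pr[OF GK Ic_gen(4,5)[OF G]])
  then show ?thesis by (simp add: piece_simps)
qed

text \<open>Every countable set of relations is contained in a closed one, so closed sets are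
  cofinal among the stages, and the pieces have the same module structure as the stages.\<close>

lemma dirlim_piece: "dirlim Ic rc R piece tr M pr"
proof -
  have "dirlim Ic rc R N0 tr M pr"
    unfolding rc_def
  proof (rule dirlim_cofinal[OF dirlim0])
    show "Ic \<subseteq> I0" by (auto simp: Ic_def)
    show "\<exists>j\<in>Ic. (i, j) \<in> r0" if "i \<in> I0" for i
      using Ic_ex[of i] that by (auto simp: r0_def I0_def Ic_def)
  qed
  then interpret dirlim Ic rc R N0 tr M pr .
  show ?thesis
  proof (intro dirlim.intro dirsys.intro dirsys_axioms.intro dirlim_axioms.intro)
    show "directed_preorder Ic rc" by (rule directed_preorder_axioms)
  qed (unfold piece_hom piece_simps, (rule piece_mod L_mod d_hom d_id d_comp \<iota>_hom \<iota>_comp \<iota>_surj \<iota>_inj; assumption?)+)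
qed

text \<open>The union of countably many closed sets is countable but cannot serve as bound directly,
  since a finite subset of it may be spread over several members; a closed set containing it is
  taken.\<close>

lemma Ic_directed: "aleph1_directed Ic rc"
  unfolding aleph1_directed_def
proof (intro conjI allI impI)
  have I0: "Ic \<subseteq> I0" by (auto simp: Ic_def)
  show "partial_order_on Ic rc"
    unfolding partial_order_on_def preorder_on_def
    using I0 by (auto simp: refl_on_def trans_def antisym_def rc_def r0_def)
  fix S assume S: "S \<subseteq> Ic \<and> countable S"
  have "countable G" if "G \<in> S" for G using S that by (intro IcD(2)) blast
  then have "countable (\<Union>S)" using S by (intro countable_UN[of S "\<lambda>x. x", simplified]) auto
  moreover have "\<Union>S \<subseteq> Ker" using S IcD(1) by blast
  ultimately obtain G where G: "G \<in> Ic" "\<Union>S \<subseteq> G" using Ic_ex by blast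
  then show "\<exists>u\<in>Ic. \<forall>s\<in>S. (s, u) \<in> rc" using S I0 by (intro bexI[of _ G]) (auto simp: rc_def r0_def)
qed

end

section \<open>Representatives of countably presentable comodules\<close>

text \<open>The pieces have sets of formal combinations as elements and sets of relations as
  indices. Conjugating by isomorphisms moves the elements into the universe type, and
  \<open>dirlim_reindex\<close> does the same for the indices.\<close>

lemma dirlim_transport:
  assumes lim: "dirlim I r R N t M p" and S: "\<And>i. i \<in> I \<Longrightarrow> left_module R (S i)"
    and f: "\<And>i. i \<in> I \<Longrightarrow> f i \<in> lmod_hom R (N i) (S i)" and g: "\<And>i. i \<in> I \<Longrightarrow> g i \<in> lmod_hom R (S i) (N i)"
    and gf: "\<And>i x. i \<in> I \<Longrightarrow> x \<in> carrier (N i) \<Longrightarrow> g i (f i x) = x" and fg: "\<And>i x. i \<in> I \<Longrightarrow> x \<in> carrier (S i) \<Longrightarrow> f i (g i x) = x"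
    and t': "\<And>i j x. (i, j) \<in> r \<Longrightarrow> x \<in> carrier (S i) \<Longrightarrow> t' i j x = f j (t i j (g i x))"
    and p': "\<And>i x. i \<in> I \<Longrightarrow> x \<in> carrier (S i) \<Longrightarrow> p' i x = p i (g i x)"
  shows "dirlim I r R S t' M p'"
proof -
  interpret dirlim I r R N t M p by (rule lim)
  have gc: "g i x \<in> carrier (N i)" if "i \<in> I" "x \<in> carrier (S i)" for i x by (rule lmod_hom_closed[OF g]) (rule that)+
  have fc: "f i x \<in> carrier (S i)" if "i \<in> I" "x \<in> carrier (N i)" for i x by (rule lmod_hom_closed[OF f]) (rule that)+
  have tc: "t' i j x \<in> carrier (S j)" if "(i, j) \<in> r" "x \<in> carrier (S i)" for i j x
    unfolding t'[OF that] by (rule fc[OF r_I(2)[OF that(1)] d_closed[OF that(1) gc[OF r_I(1)[OF that(1)] that(2)]]])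
  have gt: "g j (t' i j x) = t i j (g i x)" if "(i, j) \<in> r" "x \<in> carrier (S i)" for i j x
    unfolding t'[OF that] by (rule gf[OF r_I(2)[OF that(1)] d_closed[OF that(1) gc[OF r_I(1)[OF that(1)] that(2)]]])
  show ?thesis
  proof (intro dirlim.intro dirsys.intro dirsys_axioms.intro dirlim_axioms.intro)
    show "directed_preorder I r" by (rule directed_preorder_axioms)
    show "left_module R M" by (rule L_mod)
    show "left_module R (S i)" if "i \<in> I" for i by (rule S[OF that])
    show "t' i j \<in> lmod_hom R (S i) (S j)" if ij: "(i, j) \<in> r" for i j
      by (rule lmod_hom_cong[OF lmod_hom_compose[OF lmod_hom_compose[OF g[OF r_I(1)[OF ij]] d_hom[OF ij]] f[OF r_I(2)[OF ij]]] t'[OF ij] S[OF r_I(1)[OF ij]]])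
    show "t' i i x = x" if "i \<in> I" "x \<in> carrier (S i)" for i x
      using t'[OF r_refl[OF that(1)] that(2)] d_id[OF that(1) gc[OF that]] fg[OF that] by simp
    show "t' j k (t' i j x) = t' i k x" if r: "(i, j) \<in> r" "(j, k) \<in> r" and x: "x \<in> carrier (S i)" for i j k x
      using t'[OF r(2) tc[OF r(1) x]] gt[OF r(1) x] d_comp[OF r gc[OF r_I(1)[OF r(1)] x]] t'[OF r_trans[OF r] x] by simp
    show "p' i \<in> lmod_hom R (S i) M" if i: "i \<in> I" for i
      by (rule lmod_hom_cong[OF lmod_hom_compose[OF g[OF i] \<iota>_hom[OF i]] p'[OF i] S[OF i]])
    show "p' j (t' i j x) = p' i x" if r: "(i, j) \<in> r" and x: "x \<in> carrier (S i)" for i j x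
      using p'[OF r_I(2)[OF r] tc[OF r x]] gt[OF r x] \<iota>_comp[OF r gc[OF r_I(1)[OF r] x]] p'[OF r_I(1)[OF r] x] by simp
    show "\<exists>i\<in>I. \<exists>y\<in>carrier (S i). p' i y = l" if l: "l \<in> carrier M" for l
    proof -
      obtain i y where i: "i \<in> I" "y \<in> carrier (N i)" "p i y = l" using \<iota>_surj[OF l] by blast
      have "p' i (f i y) = l" using p'[OF i(1) fc[OF i(1,2)]] gf[OF i(1,2)] i(3) by simp
      then show ?thesis using i(1) fc[OF i(1,2)] by blast
    qed
    show "\<exists>k. (i, k) \<in> r \<and> t' i k x = t' i k y" if i: "i \<in> I" and x: "x \<in> carrier (S i)" and y: "y \<in> carrier (S i)" and eq: "p' i x = p' i y" for i x y
    proof -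
      have "p i (g i x) = p i (g i y)" using eq p'[OF i x] p'[OF i y] by simp
      then obtain k where k: "(i, k) \<in> r" "t i k (g i x) = t i k (g i y)" using \<iota>_inj[OF i gc[OF i x] gc[OF i y]] by blast
      then show ?thesis using t'[OF k(1) x] t'[OF k(1) y] by auto
    qed
  qed
qed

lemma dirlim_reindex:
  assumes lim: "dirlim I r R S t M p" and e: "inj_on e I"
  shows "dirlim (e ` I) ((\<lambda>(i, j). (e i, e j)) ` r) R (\<lambda>a. S (inv_into I e a)) (\<lambda>a b. t (inv_into I e a) (inv_into I e b)) M (\<lambda>a. p (inv_into I e a))"
proof -
  interpret dirlim I r R S t M p by (rule lim)
  have ie: "inv_into I e (e i) = i" if "i \<in> I" for i by (rule inv_into_f_f[OF e that])
  have rE: "\<exists>i j. (i, j) \<in> r \<and> a = e i \<and> b = e j \<and> inv_into I e a = i \<and> inv_into I e b = j" if "(a, b) \<in> (\<lambda>(i, j). (e i, e j)) ` r" for a b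
    using that ie r_I by fastforce
  have rI: "(a, b) \<in> (\<lambda>(i, j). (e i, e j)) ` r \<longleftrightarrow> a \<in> e ` I \<and> b \<in> e ` I \<and> (inv_into I e a, inv_into I e b) \<in> r" for a b
  proof
    assume "(a, b) \<in> (\<lambda>(i, j). (e i, e j)) ` r"
    from rE[OF this] show "a \<in> e ` I \<and> b \<in> e ` I \<and> (inv_into I e a, inv_into I e b) \<in> r"
      using r_I by (elim exE conjE) simp
  next
    assume "a \<in> e ` I \<and> b \<in> e ` I \<and> (inv_into I e a, inv_into I e b) \<in> r"
    then show "(a, b) \<in> (\<lambda>(i, j). (e i, e j)) ` r"
      by (intro rev_image_eqI[of "(inv_into I e a, inv_into I e b)"]) (auto simp: f_inv_into_f)
  qed
  show ?thesis
  proof (intro dirlim.intro dirsys.intro directed_preorder.intro dirsys_axioms.intro dirlim_axioms.intro)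
    show "(\<lambda>(i, j). (e i, e j)) ` r \<subseteq> e ` I \<times> e ` I" using r_I by auto
    show "(a, a) \<in> (\<lambda>(i, j). (e i, e j)) ` r" if "a \<in> e ` I" for a using that r_refl by force
    show "(a, c) \<in> (\<lambda>(i, j). (e i, e j)) ` r" if "(a, b) \<in> (\<lambda>(i, j). (e i, e j)) ` r" "(b, c) \<in> (\<lambda>(i, j). (e i, e j)) ` r" for a b c
      using that r_trans unfolding rI by blast
    show "e ` I \<noteq> {}" using I_nonempty by blast
    show "\<exists>c. (a, c) \<in> (\<lambda>(i, j). (e i, e j)) ` r \<and> (b, c) \<in> (\<lambda>(i, j). (e i, e j)) ` r" if "a \<in> e ` I" "b \<in> e ` I" for a b
    proof -
      obtain i j where i: "i \<in> I" "a = e i" "j \<in> I" "b = e j" using \<open>a \<in> e ` I\<close> \<open>b \<in> e ` I\<close> by blast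
      obtain k where "(i, k) \<in> r" "(j, k) \<in> r" using upper[OF i(1,3)] by blast
      then show ?thesis using i by force
    qed
    show "left_module R (S (inv_into I e a))" if "a \<in> e ` I" for a by (rule D_mod) (rule inv_into_into[OF that])
    show "left_module R M" by (rule L_mod)
    show "p (inv_into I e a) \<in> lmod_hom R (S (inv_into I e a)) M" if "a \<in> e ` I" for a by (rule \<iota>_hom) (rule inv_into_into[OF that])
    show "t (inv_into I e a) (inv_into I e b) \<in> lmod_hom R (S (inv_into I e a)) (S (inv_into I e b))" if "(a, b) \<in> (\<lambda>(i, j). (e i, e j)) ` r" for a b
      using rE[OF that] by (elim exE conjE) (simp add: d_hom)
    show "t (inv_into I e a) (inv_into I e a) x = x" if "a \<in> e ` I" "x \<in> carrier (S (inv_into I e a))" for a x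
      by (rule d_id[OF inv_into_into[OF that(1)] that(2)])
    show "t (inv_into I e b) (inv_into I e c) (t (inv_into I e a) (inv_into I e b) x) = t (inv_into I e a) (inv_into I e c) x"
      if ab: "(a, b) \<in> (\<lambda>(i, j). (e i, e j)) ` r" and bc: "(b, c) \<in> (\<lambda>(i, j). (e i, e j)) ` r" and x: "x \<in> carrier (S (inv_into I e a))" for a b c x
    proof -
      have "(inv_into I e a, inv_into I e b) \<in> r" using rE[OF ab] by (elim exE conjE) simp
      moreover have "(inv_into I e b, inv_into I e c) \<in> r" using rE[OF bc] by (elim exE conjE) simp
      ultimately show ?thesis by (rule d_comp[OF _ _ x])
    qed
    show "p (inv_into I e b) (t (inv_into I e a) (inv_into I e b) x) = p (inv_into I e a) x"
      if ab: "(a, b) \<in> (\<lambda>(i, j). (e i, e j)) ` r" and x: "x \<in> carrier (S (inv_into I e a))" for a b x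
    proof -
      have "(inv_into I e a, inv_into I e b) \<in> r" using rE[OF ab] by (elim exE conjE) simp
      then show ?thesis by (rule \<iota>_comp[OF _ x])
    qed
    show "\<exists>a\<in>e ` I. \<exists>y\<in>carrier (S (inv_into I e a)). p (inv_into I e a) y = l" if l: "l \<in> carrier M" for l
    proof -
      obtain i y where "i \<in> I" "y \<in> carrier (S i)" "p i y = l" using \<iota>_surj[OF l] by blast
      then show ?thesis using ie by (intro bexI[of _ "e i"] bexI[of _ y]) auto
    qed
    show "\<exists>c. (a, c) \<in> (\<lambda>(i, j). (e i, e j)) ` r \<and> t (inv_into I e a) (inv_into I e c) x = t (inv_into I e a) (inv_into I e c) y"
      if a: "a \<in> e ` I" and x: "x \<in> carrier (S (inv_into I e a))" "y \<in> carrier (S (inv_into I e a))" and eq: "p (inv_into I e a) x = p (inv_into I e a) y" for a x y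
    proof -
      obtain i where i: "i \<in> I" "a = e i" using a by blast
      obtain k where k: "(i, k) \<in> r" "t i k x = t i k y" using \<iota>_inj[of i x y] i x eq by (auto simp: ie)
      then show ?thesis using i ie[OF i(1)] ie[OF r_I(2)[OF k(1)]] by (intro exI[of _ "e k"]) (auto intro!: rev_image_eqI[OF k(1)])
    qed
  qed
qed

section \<open>Isomorphisms, copies and codes of comodules\<close>

context coring
begin

definition comod_iso where
  "comod_iso N S f g \<longleftrightarrow> f \<in> comod_hom R C N S \<and> g \<in> comod_hom R C S N \<and>
    (\<forall>x\<in>carrier N. g (f x) = x) \<and> (\<forall>x\<in>carrier S. f (g x) = x)"

lemma comod_iso_trans:
  assumes N: "comodule R C N" and S: "comodule R C S" and T: "comodule R C T" and i: "comod_iso N S f g" "comod_iso S T f' g'"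
  shows "comod_iso N T (compose (carrier N) f' f) (compose (carrier T) g g')"
proof -
  note i = i[unfolded comod_iso_def]
  have f: "f \<in> comod_hom R C N S" "f' \<in> comod_hom R C S T" "g \<in> comod_hom R C S N" "g' \<in> comod_hom R C T S" using i by simp_all
  show ?thesis unfolding comod_iso_def
    using i comod_hom_comp[OF N S T f(1,2)] comod_hom_comp[OF T S N f(4,3)] comod_homD(3)[OF f(1)] comod_homD(3)[OF f(4)]
      comod_homD(3)[OF f(2)] comod_homD(3)[OF f(3)]
    by (simp add: compose_eq)
qed

text \<open>A copy along an injection is the colimit of a one-point system, so the structure, the
  comodule axioms and the flatness of the copy come from the colimit lemmas.\<close>

lemma comodule_transport:
  fixes N :: "('a, 'c, 'n) comodule" and e :: "'n \<Rightarrow> 'l" and \<kappa> :: "'k rel"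
  assumes N: "comodule R C N" and e: "inj_on e (carrier N)"
  shows "\<exists>(L :: ('a, 'c, 'l) comodule) f g. comodule R C L \<and> carrier L = e ` carrier N \<and>
    (flat_module \<kappa> R N \<longrightarrow> flat_module \<kappa> R L) \<and> comod_iso N L f g"
proof -
  have NL: "left_module R N" by (rule comodule_left[OF N])
  have "setlim {()} {((), ())} R (\<lambda>_. N) (\<lambda>_ _ x. x) (e ` carrier N) (\<lambda>_. e)"
    by (intro setlim.intro dirsys.intro directed_preorder.intro dirsys_axioms.intro setlim_axioms.intro)
      (use NL e in \<open>auto simp: lmod_hom_id inj_on_eq_iff\<close>)
  from setlim_comodule[OF this] N obtain L :: "('a, 'c, 'l) comodule" where L: "carrier L = e ` carrier N" "comodule R C L"
    "dirlim {()} {((), ())} R (\<lambda>_. N) (\<lambda>_ _ x. x) L (\<lambda>_. e)" "\<And>x. x \<in> carrier N \<Longrightarrow> coact L (e x) = Cmap L e (coact N x)"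
    by (auto simp: Cmap_id[OF NL coact_closed[OF N]])
  interpret dirlim "{()}" "{((), ())}" R "\<lambda>_. N" "\<lambda>_ _ x. x" L "\<lambda>_. e" by (rule L(3))
  have LL: "left_module R L" by (rule L_mod)
  have eh: "e \<in> lmod_hom R N L" by (rule \<iota>_hom) simp
  let ?g = "inv_into (carrier N) e"
  have ge: "?g (e x) = x" if "x \<in> carrier N" for x by (rule inv_into_f_f[OF e that])
  interpret N: left_module R N by (rule NL)
  have gh: "?g \<in> lmod_hom R L N"
    unfolding lmod_hom_def add_hom_def
  proof (intro CollectI conjI ballI funcsetI)
    fix x assume "x \<in> carrier L"
    then obtain x' where x: "x' \<in> carrier N" "x = e x'" using L(1) by auto
    show "?g x \<in> carrier N" using x ge by simp
    fix y assume "y \<in> carrier L"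
    then obtain y' where y: "y' \<in> carrier N" "y = e y'" using L(1) by auto
    show "?g (x \<oplus>\<^bsub>L\<^esub> y) = ?g x \<oplus>\<^bsub>N\<^esub> ?g y"
      using lmod_hom_add[OF eh x(1) y(1)] x y ge N.M.a_closed by metis
  next
    fix a x assume a: "a \<in> carrier R" and "x \<in> carrier L"
    then obtain x' where x: "x' \<in> carrier N" "x = e x'" using L(1) by auto
    show "?g (a \<odot>\<^bsub>L\<^esub> x) = a \<odot>\<^bsub>N\<^esub> ?g x"
      using lmod_hom_smult[OF eh a x(1)] x ge N.smult_closed[OF a x(1)] by metis
  qed
  have gc: "coact N (?g x) = Cmap N ?g (coact L x)" if xL: "x \<in> carrier L" for x
  proof -
    obtain x' where x: "x' \<in> carrier N" "x = e x'" using L(1) xL by auto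
    have "Cmap N ?g (Cmap L e (coact N x')) = Cmap N (\<lambda>x. x) (coact N x')"
      by (rule Cmap_Cmap[OF NL LL NL eh gh coact_closed[OF N x(1)]]) (simp add: ge)
    then show ?thesis using x L(4)[OF x(1)] ge Cmap_id[OF NL coact_closed[OF N x(1)]] by simp
  qed
  have "comod_iso N L (restrict e (carrier N)) (restrict ?g (carrier L))"
    unfolding comod_iso_def using comod_hom_restrict[OF N L(2) eh L(4)] comod_hom_restrict[OF L(2) N gh gc] L(1) ge
    by (auto simp: lmod_hom_closed[OF gh])
  moreover have "flat_module \<kappa> R L" if "flat_module \<kappa> R N" by (rule flat_dirlim) (rule that)
  ultimately show ?thesis using L(1,2) by blast
qed

text \<open>An isomorphism is in particular a retraction, so \<open>presented_retract\<close>
  supplies the presentation.\<close>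

lemma presented_iso:
  assumes N: "comodule R C N" and S: "comodule R C S" and i: "comod_iso N S f g" and p: "presented R N X e G" and c: "countable X" "countable G"
  shows "countably_presentable R S"
proof -
  note i = i[unfolded comod_iso_def]
  have "f \<in> lmod_hom R N S" "g \<in> lmod_hom R S N" using i comod_homD(2) by blast+
  then obtain G' where "countable G'" "presented R S X (\<lambda>x. f (e x)) G'"
    using presented_retract[OF p comodule_left[OF N] comodule_left[OF S] _ _ _ c, of g f] i by blast
  then show ?thesis using presented_imp_countably_presentable comodule_left[OF S] c(1) by blast
qed

text \<open>
  A code \<open>(Y, H, k)\<close> determines a comodule up to isomorphism: \<open>Y\<close> generates, \<open>H\<close> are the relations, and
  \<open>k n\<close> represents the coaction of the generator \<open>n\<close>.
\<close>

definition coded where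
  "coded S p \<longleftrightarrow> (\<exists>e. presented R S (fst p) e (fst (snd p)) \<and>
     (\<forall>n\<in>fst p. snd (snd p) n \<in> frags (carrier C \<times> FA R (fst p)) \<and>
        coact S (e n) = tcls R C S (tmapf (\<lambda>c. c) (lev S e) (snd (snd p) n))))"

text \<open>The relations are shared, so the generators can be matched by a linear map. On
  generators both coactions are written by the same combination \<open>k n\<close>, hence the map
  respects them there, and by linearity everywhere.\<close>

lemma coded_hom:
  assumes S: "comodule R C S" and S': "comodule R C S'" and p: "presented R S Y e H" and p': "presented R S' Y e' H"
    and k: "\<And>n. n \<in> Y \<Longrightarrow> k n \<in> frags (carrier C \<times> FA R Y)"
    and c: "\<And>n. n \<in> Y \<Longrightarrow> coact S (e n) = tcls R C S (tmapf (\<lambda>c. c) (lev S e) (k n))"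
    and c': "\<And>n. n \<in> Y \<Longrightarrow> coact S' (e' n) = tcls R C S' (tmapf (\<lambda>c. c) (lev S' e') (k n))"
  shows "\<exists>f\<in>comod_hom R C S S'. \<forall>n\<in>Y. f (e n) = e' n"
proof -
  note SL = comodule_left[OF S] and SL' = comodule_left[OF S']
  interpret S: left_module R S by (rule SL)
  interpret S': left_module R S' by (rule SL')
  note e = presentedD(1)[OF p] and e' = presentedD(1)[OF p']
  have "lev S' e' g = \<zero>\<^bsub>S'\<^esub>" if g: "g \<in> H" for g
  proof -
    have gF: "g \<in> FA R Y" using presentedD(2)[OF p] g by blast
    have "lsm R \<one>\<^bsub>R\<^esub> g \<in> linspan R Y H" by (rule linspan_lsm_base[OF _ g]) simp
    then show ?thesis using presentedD(4)[OF p' gF] R.lsm_one[OF gF] by simp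
  qed
  from presented_lift[OF p SL SL' e' this] obtain f where f: "f \<in> lmod_hom R S S'" "\<And>z. z \<in> FA R Y \<Longrightarrow> f (lev S e z) = lev S' e' z" by blast
  have fe: "f (e n) = e' n" if n: "n \<in> Y" for n
  proof -
    have en: "e n \<in> carrier S" "e' n \<in> carrier S'" using e e' n by auto
    then show ?thesis using f(2)[of "frag_of (\<one>\<^bsub>R\<^esub>, n)"] n by (simp add: S.lev_of S'.lev_of S.smult_one S'.smult_one)
  qed
  have gen: "coact S' (f (e n)) = Cmap S' f (coact S (e n))" if n: "n \<in> Y" for n
  proof -
    have l: "lev S e ` FA R Y \<subseteq> carrier S" using S.lev_closed[OF e] by auto
    have kf: "tmapf (\<lambda>c. c) (lev S e) (k n) \<in> frags (carrier C \<times> carrier S)" by (rule tmapf_frags[OF k[OF n] _ l]) simp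
    have "Cmap S' f (coact S (e n)) = tcls R C S' (tmapf (\<lambda>c. c) f (tmapf (\<lambda>c. c) (lev S e) (k n)))"
      unfolding c[OF n] by (rule tensor_map_tcls[OF pairC[OF SL] pairC[OF SL'] rmod_hom_id f(1) kf])
    also have "tmapf (\<lambda>c. c) f (tmapf (\<lambda>c. c) (lev S e) (k n)) = tmapf (\<lambda>c. c) (lev S' e') (k n)"
      unfolding tmapf_tmapf by (rule tmapf_cong[OF k[OF n]]) (simp_all add: f(2))
    finally show ?thesis using c'[OF n] fe[OF n] by simp
  qed
  have co: "coact S' (f x) = Cmap S' f (coact S x)" if x: "x \<in> carrier S" for x
    by (rule presented_hom_eq[OF p SL left_module_tensorC[OF SL'] lmod_hom_compose[OF f(1) coact_lmod_hom[OF S']]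
        lmod_hom_compose[OF coact_lmod_hom[OF S] Cmap_hom[OF SL SL' f(1)]] gen x])
  show ?thesis
    by (rule bexI[OF _ comod_hom_restrict[OF S S' f(1) co]]) (use fe e in \<open>auto simp: Pi_iff\<close>)
qed

lemma coded_iso:
  assumes S: "comodule R C S" and S': "comodule R C S'" and c: "coded S p" and c': "coded S' p"
  shows "\<exists>f g. comod_iso S S' f g"
proof -
  from c obtain e where e: "presented R S (fst p) e (fst (snd p))" "\<forall>n\<in>fst p. snd (snd p) n \<in> frags (carrier C \<times> FA R (fst p)) \<and>
        coact S (e n) = tcls R C S (tmapf (\<lambda>c. c) (lev S e) (snd (snd p) n))" unfolding coded_def by (elim exE conjE)
  from c' obtain e' where e': "presented R S' (fst p) e' (fst (snd p))" "\<forall>n\<in>fst p. snd (snd p) n \<in> frags (carrier C \<times> FA R (fst p)) \<and>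
        coact S' (e' n) = tcls R C S' (tmapf (\<lambda>c. c) (lev S' e') (snd (snd p) n))" unfolding coded_def by (elim exE conjE)
  have k: "snd (snd p) n \<in> frags (carrier C \<times> FA R (fst p))" and
    c: "coact S (e n) = tcls R C S (tmapf (\<lambda>c. c) (lev S e) (snd (snd p) n))" and
    c': "coact S' (e' n) = tcls R C S' (tmapf (\<lambda>c. c) (lev S' e') (snd (snd p) n))" if "n \<in> fst p" for n
    using e(2) e'(2) that by blast+
  from coded_hom[OF S S' e(1) e'(1) k c c'] obtain f where f: "f \<in> comod_hom R C S S'" "\<forall>n\<in>fst p. f (e n) = e' n" by blast
  from coded_hom[OF S' S e'(1) e(1) k c' c] obtain g where g: "g \<in> comod_hom R C S' S" "\<forall>n\<in>fst p. g (e' n) = e n" by blast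
  note SL = comodule_left[OF S] and SL' = comodule_left[OF S']
  have "g (f x) = x" if "x \<in> carrier S" for x
    by (rule presented_hom_eq[OF e(1) SL SL lmod_hom_compose[OF comod_homD(2)[OF f(1)] comod_homD(2)[OF g(1)]] lmod_hom_id _ that])
      (use f g in simp)
  moreover have "f (g x) = x" if "x \<in> carrier S'" for x
    by (rule presented_hom_eq[OF e'(1) SL' SL' lmod_hom_compose[OF comod_homD(2)[OF g(1)] comod_homD(2)[OF f(1)]] lmod_hom_id _ that])
      (use f g in simp)
  ultimately show ?thesis unfolding comod_iso_def using f(1) g(1) by blast
qed

lemma coded_ex:
  assumes S: "comodule R C S" and cp: "countably_presentable R S"
  shows "\<exists>p. coded S p \<and> countable (fst (snd p)) \<and> fst (snd p) \<subseteq> FA R (UNIV :: nat set) \<and>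
    snd (snd p) \<in> UNIV \<rightarrow>\<^sub>E frags (carrier C \<times> FA R (UNIV :: nat set))"
proof -
  note SL = comodule_left[OF S]
  from countably_presentable_imp_presented[OF cp SL] obtain Y :: "nat set" and e G where p: "countable G" "presented R S Y e G" by blast
  note e = presentedD(1)[OF p(2)]
  interpret T: tensor_pair R C S by (rule pairC[OF SL])
  let ?q = "inv_into (FA R Y) (lev S e)"
  have q: "?q x \<in> FA R Y" "lev S e (?q x) = x" if "x \<in> carrier S" for x
  proof -
    have "x \<in> lev S e ` FA R Y" using presentedD(3)[OF p(2) that] by blast
    then show "?q x \<in> FA R Y" "lev S e (?q x) = x" by (rule inv_into_into, rule f_inv_into_f)
  qed
  have "\<exists>k. k \<in> frags (carrier C \<times> FA R Y) \<and> coact S (e n) = tcls R C S (tmapf (\<lambda>c. c) (lev S e) k)" if n: "n \<in> Y" for n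
  proof -
    have en: "e n \<in> carrier S" using e n by blast
    obtain z where z: "z \<in> frags (carrier C \<times> carrier S)" "coact S (e n) = tcls R C S z"
      using coact_closed[OF S en] unfolding T.carrier_tensor_ab by blast
    have "tmapf (\<lambda>c. c) ?q z \<in> frags (carrier C \<times> FA R Y)" by (rule tmapf_frags[OF z(1)]) (use q(1) in auto)
    moreover have "tmapf (\<lambda>c. c) (lev S e) (tmapf (\<lambda>c. c) ?q z) = tmapf (\<lambda>c. c) (\<lambda>x. x) z"
      unfolding tmapf_tmapf by (rule tmapf_cong[OF z(1)]) (simp_all add: q(2))
    ultimately show ?thesis using z(2) by (intro exI[of _ "tmapf (\<lambda>c. c) ?q z"]) (simp add: tmapf_ident)
  qed
  then obtain k where k: "\<And>n. n \<in> Y \<Longrightarrow> k n \<in> frags (carrier C \<times> FA R Y) \<and> coact S (e n) = tcls R C S (tmapf (\<lambda>c. c) (lev S e) (k n))" by metis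
  \<comment> \<open>Extended by zero off \<open>Y\<close>, so that the codes for all
    \<open>Y\<close> use total sequences from one set.\<close>
  let ?k = "\<lambda>n. if n \<in> Y then k n else 0"
  have FY: "FA R Y \<subseteq> FA R UNIV" by (rule frags_mono) auto
  have kU: "?k n \<in> frags (carrier C \<times> FA R UNIV)" for n
    using k[of n] frags_mono[of "carrier C \<times> FA R Y" "carrier C \<times> FA R UNIV"] FY by auto
  have "coded S (Y, G, ?k)" unfolding coded_def using p(2) k by (intro exI[of _ e]) simp
  moreover have "G \<subseteq> FA R UNIV" using presentedD(2)[OF p(2)] FY by blast
  ultimately show ?thesis using p(1) kU by (intro exI[of _ "(Y, G, ?k)"]) (simp add: PiE_def)
qed

text \<open>A code consists of a set of naturals, a countable set of relations and a sequence of
  combinations, so codes form a small set; one flat comodule is chosen for each code that is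
  realised.\<close>

theorem small_representatives:
  fixes \<kappa> :: "'u rel"
  assumes \<kappa>: "universe_cardinal \<kappa>" and R: "small \<kappa> (carrier R)" and C: "small \<kappa> (carrier C)"
  shows "\<exists>T. T \<subseteq> {S \<in> Ob (comod_flat_cat \<kappa> R C). countably_presentable R S} \<and> small \<kappa> T \<and>
    (\<forall>S\<in>Ob (comod_flat_cat \<kappa> R C). countably_presentable R S \<longrightarrow> (\<exists>S'\<in>T. \<exists>f g. comod_iso S S' f g))"
proof -
  let ?O = "{S \<in> Ob (comod_flat_cat \<kappa> R C). countably_presentable R S}"
  let ?P = "{Y. Y \<subseteq> (UNIV :: nat set) \<and> countable Y} \<times> {H. H \<subseteq> FA R (UNIV :: nat set) \<and> countable H} \<times>
    ((UNIV :: nat set) \<rightarrow>\<^sub>E frags (carrier C \<times> FA R (UNIV :: nat set)))"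
  have N: "small \<kappa> (UNIV :: nat set)" by (rule small_countable[OF \<kappa>]) simp
  have F: "small \<kappa> (FA R (UNIV :: nat set))" by (rule small_frags[OF \<kappa> small_Sigma[OF \<kappa> R N]])
  have P: "small \<kappa> ?P"
    by (intro small_Sigma[OF \<kappa>] small_countable_subsets[OF \<kappa>] small_funcs[OF \<kappa>] small_frags[OF \<kappa>] N F C)
  define rp where "rp p = (SOME S. S \<in> ?O \<and> coded S p)" for p :: "nat set \<times> _"
  define T where "T = rp ` {p \<in> ?P. \<exists>S\<in>?O. coded S p}"
  have rp: "rp p \<in> ?O" "coded (rp p) p" if "\<exists>S\<in>?O. coded S p" for p :: "nat set \<times> _"
  proof -
    have "\<exists>S. S \<in> ?O \<and> coded S p" using that by blast
    from someI_ex[OF this] show "rp p \<in> ?O" "coded (rp p) p" unfolding rp_def by blast+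
  qed
  have "T \<subseteq> ?O" unfolding T_def using rp(1) by blast
  moreover have "small \<kappa> T" unfolding T_def by (rule small_image[OF small_subset[OF P]]) blast
  moreover have "\<exists>S'\<in>T. \<exists>f g. comod_iso S S' f g" if S: "S \<in> ?O" for S
  proof -
    have SC: "comodule R C S" "countably_presentable R S" using S by (auto simp: comod_flat_cat_simps)
    obtain p where p: "coded S p" "countable (fst (snd p))" "fst (snd p) \<subseteq> FA R (UNIV :: nat set)"
      "snd (snd p) \<in> UNIV \<rightarrow>\<^sub>E frags (carrier C \<times> FA R (UNIV :: nat set))" using coded_ex[OF SC] by blast
    have "p \<in> ?P" using p(2-4) by (cases p) auto
    moreover have ex: "\<exists>S\<in>?O. coded S p" using S p(1) by blast
    ultimately have "rp p \<in> T" unfolding T_def by blast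
    moreover have "comodule R C (rp p)" using rp(1)[OF ex] by (simp add: comod_flat_cat_simps)
    ultimately show ?thesis using coded_iso[OF SC(1) _ p(1) rp(2)[OF ex]] by blast
  qed
  ultimately show ?thesis by (intro exI[of _ T]) blast
qed

end

section \<open>Accessibility\<close>

lemma aleph1_directed_reindex:
  assumes I: "aleph1_directed I r" and e: "inj_on e I"
  shows "aleph1_directed (e ` I) ((\<lambda>(i, j). (e i, e j)) ` r)"
proof -
  let ?r = "(\<lambda>(i, j). (e i, e j)) ` r"
  have r: "r \<subseteq> I \<times> I" "\<And>i. i \<in> I \<Longrightarrow> (i, i) \<in> r" "trans r" "antisym r"
    using I unfolding aleph1_directed_def partial_order_on_def preorder_on_def refl_on_def by auto
  have up: "\<exists>u\<in>I. \<forall>s\<in>S. (s, u) \<in> r" if "S \<subseteq> I" "countable S" for S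
    using I that unfolding aleph1_directed_def by blast
  have iff: "(e i, e j) \<in> ?r \<longleftrightarrow> (i, j) \<in> r" if "i \<in> I" "j \<in> I" for i j
  proof
    assume "(e i, e j) \<in> ?r"
    then obtain i' j' where k: "(i', j') \<in> r" "e i = e i'" "e j = e j'" by auto
    then have "i' \<in> I" "j' \<in> I" using r(1) by auto
    then have "i = i'" "j = j'" using k(2,3) e that by (auto simp: inj_on_eq_iff)
    then show "(i, j) \<in> r" using k(1) by simp
  next
    assume "(i, j) \<in> r" then show "(e i, e j) \<in> ?r" by force
  qed
  have sub: "?r \<subseteq> e ` I \<times> e ` I" using r(1) by auto
  have "partial_order_on (e ` I) ?r"
    unfolding partial_order_on_def preorder_on_def
  proof (intro conjI)
    show "refl_on (e ` I) ?r" using r(2) iff sub unfolding refl_on_def by auto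
    show "trans ?r"
    proof (rule transI)
      fix a b c assume ab: "(a, b) \<in> ?r" and bc: "(b, c) \<in> ?r"
      then obtain i j k where "i \<in> I" "j \<in> I" "k \<in> I" "a = e i" "b = e j" "c = e k" using sub by blast
      then show "(a, c) \<in> ?r" using ab bc iff transD[OF r(3), of i j k] by auto
    qed
    show "antisym ?r"
    proof (rule antisymI)
      fix a b assume ab: "(a, b) \<in> ?r" and ba: "(b, a) \<in> ?r"
      then obtain i j where "i \<in> I" "j \<in> I" "a = e i" "b = e j" using sub by blast
      then show "a = b" using ab ba iff antisymD[OF r(4), of i j] by auto
    qed
  qed (use sub in simp)?
  moreover have "\<exists>u\<in>e ` I. \<forall>s\<in>S. (s, u) \<in> ?r" if S: "S \<subseteq> e ` I" "countable S" for S
  proof -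
    let ?S = "inv_into I e ` S"
    have "?S \<subseteq> I" using S(1) inv_into_into[of _ e I] by auto
    moreover have "countable ?S" using S(2) by simp
    ultimately obtain u where u: "u \<in> I" "\<forall>s\<in>?S. (s, u) \<in> r" using up by blast
    have "(s, e u) \<in> ?r" if s: "s \<in> S" for s
    proof -
      have "(inv_into I e s, u) \<in> r" "e (inv_into I e s) = s" using u(2) s S(1) by (auto intro: f_inv_into_f)
      then show ?thesis by (intro rev_image_eqI[of "(inv_into I e s, u)"]) auto
    qed
    then show ?thesis using u(1) by blast
  qed
  ultimately show ?thesis unfolding aleph1_directed_def by blast
qed

text \<open>If no stage reached \<open>y\<close>, the constant map to \<open>a\<close> and the map
  differing from it at \<open>y\<close> alone would be two mediating maps for the same cocone into a
  two-element set.\<close>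

lemma set_colimit_surj:
  assumes c: "is_colimit set_cat I r F t (L :: 'x set) l" and r: "r \<subseteq> I \<times> I"
    and t: "\<And>i j x. (i, j) \<in> r \<Longrightarrow> x \<in> F i \<Longrightarrow> t i j x \<in> F j" and ab: "(a :: 'x) \<noteq> b" and y: "y \<in> L"
  shows "\<exists>i\<in>I. \<exists>x\<in>F i. l i x = y"
proof (rule ccontr)
  assume n: "\<not> ?thesis"
  have coc: "l i \<in> F i \<rightarrow>\<^sub>E L" if "i \<in> I" for i
    using c that by (simp add: is_colimit_def cocone_def set_cat_def)
  let ?\<phi> = "\<lambda>i. \<lambda>x\<in>F i. a"
  have "cocone set_cat I r F t {a, b} ?\<phi>"
    unfolding cocone_def set_cat_def using t r by (auto simp: compose_def restrict_def fun_eq_iff)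
  then have "\<exists>!h. h \<in> Hom set_cat L {a, b} \<and> (\<forall>i\<in>I. Comp set_cat (F i) L {a, b} h (l i) = ?\<phi> i)"
    using c by (simp add: is_colimit_def)
  moreover have "(\<lambda>z\<in>L. a) \<in> Hom set_cat L {a, b} \<and> (\<forall>i\<in>I. Comp set_cat (F i) L {a, b} (\<lambda>z\<in>L. a) (l i) = ?\<phi> i)"
    using coc by (fastforce simp: set_cat_def compose_def restrict_def fun_eq_iff)
  moreover have "(\<lambda>z\<in>L. if z = y then b else a) \<in> Hom set_cat L {a, b} \<and> (\<forall>i\<in>I. Comp set_cat (F i) L {a, b} (\<lambda>z\<in>L. if z = y then b else a) (l i) = ?\<phi> i)"
    using coc n by (fastforce simp: set_cat_def compose_def restrict_def fun_eq_iff)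
  ultimately have "(\<lambda>z\<in>L. a) = (\<lambda>z\<in>L. if z = y then b else a)" by (elim ex1E) metis
  from fun_cong[OF this, of y] show False using ab y by simp
qed

context coring
begin

lemma dirsys_diagram:
  assumes s: "dirsys I r R D d" and D: "\<And>i. i \<in> I \<Longrightarrow> D i \<in> Ob (comod_flat_cat \<kappa> R C)"
    and d: "\<And>i j. (i, j) \<in> r \<Longrightarrow> d i j \<in> comod_hom R C (D i) (D j)"
  shows "diagram (comod_flat_cat \<kappa> R C) I r D d"
proof -
  interpret dirsys I r R D d by (rule s)
  have ext: "d i j x = undefined" if "(i, j) \<in> r" "x \<notin> carrier (D i)" for i j x
    using comod_homD(1)[OF d[OF that(1)]] that(2) by (simp add: extensional_def)
  show ?thesis unfolding diagram_def comod_flat_cat_simps(2-4)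
  proof (intro conjI ballI allI impI)
    show "D i \<in> Ob (comod_flat_cat \<kappa> R C)" if "i \<in> I" for i by (rule D[OF that])
    show "case p of (i, j) \<Rightarrow> d i j \<in> comod_hom R C (D i) (D j)" if "p \<in> r" for p using that d by (cases p) auto
    show "d i i = (\<lambda>x\<in>carrier (D i). x)" if "i \<in> I" for i
    proof
      fix x show "d i i x = (\<lambda>x\<in>carrier (D i). x) x"
        using d_id[OF that] ext[OF r_refl[OF that]] by (cases "x \<in> carrier (D i)") simp_all
    qed
    show "d i k = compose (carrier (D i)) (d j k) (d i j)" if "(i, j) \<in> r \<and> (j, k) \<in> r" for i j k
    proof
      fix x show "d i k x = compose (carrier (D i)) (d j k) (d i j) x"
        using that d_comp[of i j k x] ext[of i k x] r_trans[of i j k] by (cases "x \<in> carrier (D i)") (simp_all add: compose_def)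
    qed
  qed
qed

text \<open>Each piece is first copied into the universe type, which makes it an object of the
  category, and then exchanged for its representative in \<open>T\<close>. Transition maps and
  cocone are conjugated by the isomorphisms, and the index set is renamed.\<close>

theorem flat_colimit:
  fixes \<kappa> :: "'u rel"
  assumes \<kappa>: "universe_cardinal \<kappa>" and R: "small \<kappa> (carrier R)" and M: "M \<in> Ob (comod_flat_cat \<kappa> R C)"
    and T: "T \<subseteq> Ob (comod_flat_cat \<kappa> R C)"
    and rep: "\<And>S. S \<in> Ob (comod_flat_cat \<kappa> R C) \<Longrightarrow> countably_presentable R S \<Longrightarrow> \<exists>S'\<in>T. \<exists>f g. comod_iso S S' f g"
  shows "aleph1_directed_colimit_of \<kappa> (comod_flat_cat \<kappa> R C) T M"
proof -
  have MC: "comodule R C M" and sM: "small \<kappa> (carrier M)" and fM: "flat_module \<kappa> R M" using M by (simp_all add: comod_flat_cat_simps)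
  obtain e0 :: "'a \<Rightarrow> 'u" where e0: "inj_on e0 (carrier R)" using small_inj[OF \<kappa> R] .
  have "eqflat R M" by (rule flat_imp_eqflat[OF comodule_left[OF MC] fM e0 R])
  then interpret F: flat_comodule R C M by (intro flat_comodule.intro flat_comodule_axioms.intro coring_axioms MC)
  note NC = F.piece_comodule
  have sI: "small \<kappa> F.Ic"
  proof (rule small_subset[OF small_countable_subsets[OF \<kappa> small_frags[OF \<kappa> small_Sigma[OF \<kappa> R sM]]]])
    show "F.Ic \<subseteq> {U. U \<subseteq> FA R (carrier M) \<and> countable U}" using F.IcD(1,2) F.KerF by blast
  qed
  have iso: "\<exists>S f g. S \<in> T \<and> comod_iso (F.piece G) S f g" if G: "G \<in> F.Ic" for G
  proof -
    have "carrier (F.piece G) = pcls R (F.gens G) G ` FA R (F.gens G)" by (simp add: F.piece_simps F.N0_carrier)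
    moreover have X: "countable (F.gens G)" by (rule F.countable_XG[OF F.IcD(2)[OF G]])
    ultimately have s: "small \<kappa> (carrier (F.piece G))"
      using small_image[OF small_frags[OF \<kappa> small_Sigma[OF \<kappa> R small_countable[OF \<kappa>]]]] by metis
    obtain e :: "('a, 'u) fcomb set \<Rightarrow> 'u" where e: "inj_on e (carrier (F.piece G))" using small_inj[OF \<kappa> s] .
    have "flat_module \<kappa> R (F.piece G)" by (rule eqflat_imp_flat[OF F.piece_mod[OF G] F.piece_eqflat[OF G]])
    with comodule_transport[OF NC[OF G] e, of \<kappa>] obtain L :: "('a, 'c, 'u) comodule" and f g
      where L: "comodule R C L" "carrier L = e ` carrier (F.piece G)" "flat_module \<kappa> R L" "comod_iso (F.piece G) L f g" by blast
    have LO: "L \<in> Ob (comod_flat_cat \<kappa> R C)" using L small_image[OF s] by (simp add: comod_flat_cat_simps)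
    have "countably_presentable R L" by (rule presented_iso[OF NC[OF G] L(1,4) F.piece_presented[OF G] X F.IcD(2)[OF G]])
    from rep[OF LO this] obtain S f' g' where S: "S \<in> T" "comod_iso L S f' g'" by blast
    have "comodule R C S" using S(1) T by (auto simp: comod_flat_cat_simps)
    from comod_iso_trans[OF NC[OF G] L(1) this L(4) S(2)] S(1) show ?thesis by blast
  qed
  \<comment> \<open>Object and isomorphisms are chosen once per index, so that the conjugated
    transition maps compose strictly.\<close>
  define S where "S G = (SOME S. \<exists>f g. S \<in> T \<and> comod_iso (F.piece G) S f g)" for G
  define f where "f G = (SOME f. \<exists>g. S G \<in> T \<and> comod_iso (F.piece G) (S G) f g)" for G
  define g where "g G = (SOME g. S G \<in> T \<and> comod_iso (F.piece G) (S G) (f G) g)" for G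
  have fg: "S G \<in> T \<and> comod_iso (F.piece G) (S G) (f G) (g G)" if G: "G \<in> F.Ic" for G
  proof -
    have "\<exists>f g. S G \<in> T \<and> comod_iso (F.piece G) (S G) f g" unfolding S_def by (rule someI_ex[OF iso[OF G]])
    then have "\<exists>g. S G \<in> T \<and> comod_iso (F.piece G) (S G) (f G) g" unfolding f_def by (rule someI_ex)
    then show ?thesis unfolding g_def by (rule someI_ex)
  qed
  have SO: "S G \<in> Ob (comod_flat_cat \<kappa> R C)" if "G \<in> F.Ic" for G using fg[OF that] T by blast
  have SC: "comodule R C (S G)" if "G \<in> F.Ic" for G using SO[OF that] by (simp add: comod_flat_cat_simps)
  have fh: "f G \<in> comod_hom R C (F.piece G) (S G)" and gh: "g G \<in> comod_hom R C (S G) (F.piece G)"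
    and gf: "\<And>x. x \<in> carrier (F.piece G) \<Longrightarrow> g G (f G x) = x" and fgi: "\<And>x. x \<in> carrier (S G) \<Longrightarrow> f G (g G x) = x"
    if "G \<in> F.Ic" for G using fg[OF that] by (simp_all add: comod_iso_def)
  have gc: "g G x \<in> carrier (F.piece G)" if "G \<in> F.Ic" "x \<in> carrier (S G)" for G x by (rule comod_homD(3)[OF gh[OF that(1)] that(2)])
  interpret D: dirlim F.Ic F.rc R F.piece F.tr M F.pr by (rule F.dirlim_piece)
  \<comment> \<open>The restriction turns the linear map \<open>F.tr i j\<close> into an extensional
    one, as morphisms of comodules are required to be.\<close>
  define t where "t i j = compose (carrier (S i)) (compose (carrier (F.piece i)) (f j) (restrict (F.tr i j) (carrier (F.piece i)))) (g i)" for i j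
  define p where "p i = compose (carrier (S i)) (restrict (F.pr i) (carrier (F.piece i))) (g i)" for i
  have th: "t i j \<in> comod_hom R C (S i) (S j)" if r: "(i, j) \<in> F.rc" for i j
  proof -
    note i = F.rcD(2)[OF r] and j = F.rcD(3)[OF r]
    show ?thesis unfolding t_def
      by (rule comod_hom_comp[OF SC[OF i] NC[OF i] SC[OF j] gh[OF i] comod_hom_comp[OF NC[OF i] NC[OF j] SC[OF j]
            comod_hom_restrict[OF NC[OF i] NC[OF j] D.d_hom[OF r] F.tr_coact[OF r]] fh[OF j]]])
  qed
  have ph: "p i \<in> comod_hom R C (S i) M" if i: "i \<in> F.Ic" for i
    unfolding p_def
    by (rule comod_hom_comp[OF SC[OF i] NC[OF i] MC gh[OF i] comod_hom_restrict[OF NC[OF i] MC D.\<iota>_hom[OF i] F.pr_coact[OF i]]])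
  have lim: "dirlim F.Ic F.rc R S t M p"
  proof (rule dirlim_transport[OF F.dirlim_piece, of S f g])
    show "left_module R (S i)" if "i \<in> F.Ic" for i by (rule comodule_left[OF SC[OF that]])
    show "f i \<in> lmod_hom R (F.piece i) (S i)" if "i \<in> F.Ic" for i by (rule comod_homD(2)[OF fh[OF that]])
    show "g i \<in> lmod_hom R (S i) (F.piece i)" if "i \<in> F.Ic" for i by (rule comod_homD(2)[OF gh[OF that]])
    show "g i (f i x) = x" if "i \<in> F.Ic" "x \<in> carrier (F.piece i)" for i x by (rule gf[OF that])
    show "f i (g i x) = x" if "i \<in> F.Ic" "x \<in> carrier (S i)" for i x by (rule fgi[OF that])
    show "t i j x = f j (F.tr i j (g i x))" if "(i, j) \<in> F.rc" "x \<in> carrier (S i)" for i j x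
      using gc[OF F.rcD(2)[OF that(1)] that(2)] that(2) by (simp add: t_def compose_eq)
    show "p i x = F.pr i (g i x)" if "i \<in> F.Ic" "x \<in> carrier (S i)" for i x
      using gc[OF that] that(2) by (simp add: p_def compose_eq)
  qed
  obtain enc :: "('a, 'u) fcomb set \<Rightarrow> 'u" where enc: "inj_on enc F.Ic" using small_inj[OF \<kappa> sI] .
  let ?J = "enc ` F.Ic" and ?r = "(\<lambda>(i, j). (enc i, enc j)) ` F.rc"
  let ?n = "inv_into F.Ic enc"
  let ?D = "\<lambda>a. S (?n a)" and ?d = "\<lambda>a b. t (?n a) (?n b)" and ?p = "\<lambda>a. p (?n a)"
  have lim': "dirlim ?J ?r R ?D ?d M ?p" by (rule dirlim_reindex[OF lim enc])
  have n: "?n a \<in> F.Ic" if "a \<in> ?J" for a by (rule inv_into_into[OF that])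
  have nr: "(?n a, ?n b) \<in> F.rc" if ab: "(a, b) \<in> ?r" for a b
  proof -
    obtain i j where "(i, j) \<in> F.rc" "a = enc i" "b = enc j" using ab by auto
    then show ?thesis using F.rcD(2,3) inv_into_f_f[OF enc] by simp
  qed
  have dia: "diagram (comod_flat_cat \<kappa> R C) ?J ?r ?D ?d"
    by (rule dirsys_diagram[OF dirlim.axioms(1)[OF lim'] SO[OF n] th[OF nr]])
  have "is_colimit (comod_flat_cat \<kappa> R C) ?J ?r ?D ?d M ?p"
    by (rule dirlim_is_colimit[OF dia M ph[OF n] lim'])
  moreover have "aleph1_diagram \<kappa> (comod_flat_cat \<kappa> R C) ?J ?r ?D ?d"
    unfolding aleph1_diagram_def by (intro conjI small_image[OF sI] aleph1_directed_reindex[OF F.Ic_directed enc] dia)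
  moreover have "\<forall>a\<in>?J. ?D a \<in> T" using fg[OF n] by blast
  ultimately show ?thesis unfolding aleph1_directed_colimit_of_def by blast
qed

text \<open>The identity of \<open>S\<close> is an element of the colimit of the sets of morphisms
  into the stages, so it factors through a stage. This makes \<open>S\<close> a retract of a
  countably presentable comodule.\<close>

theorem presentable_imp_countably_presentable:
  fixes \<kappa> :: "'u rel"
  assumes \<kappa>: "universe_cardinal \<kappa>" and S: "S \<in> Ob (comod_flat_cat \<kappa> R C)" and p: "aleph1_presentable \<kappa> (comod_flat_cat \<kappa> R C) S"
    and colim: "aleph1_directed_colimit_of \<kappa> (comod_flat_cat \<kappa> R C) {S \<in> Ob (comod_flat_cat \<kappa> R C). countably_presentable R S} S"
  shows "countably_presentable R S"
proof -
  let ?K = "comod_flat_cat \<kappa> R C"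
  from colim obtain I r D d \<iota> where dia: "aleph1_diagram \<kappa> ?K I r D d" and D: "\<forall>i\<in>I. D i \<in> {S \<in> Ob ?K. countably_presentable R S}"
    and col: "is_colimit ?K I r D d S \<iota>" unfolding aleph1_directed_colimit_of_def by (elim exE conjE)
  have SC: "comodule R C S" using S by (simp add: comod_flat_cat_simps)
  note SL = comodule_left[OF SC]
  have sc: "is_colimit set_cat I r (\<lambda>i. Hom ?K S (D i)) (\<lambda>i j. post_comp ?K S (D i) (D j) (d i j)) (Hom ?K S S) (\<lambda>i. post_comp ?K S (D i) S (\<iota> i))"
    using p dia col unfolding aleph1_presentable_def by blast
  have "infinite (Field \<kappa>)" using \<kappa> by (simp add: universe_cardinal_def cinfinite_def)
  then obtain u v :: 'u where uv: "u \<noteq> v" by (metis (full_types) finite.simps finite_subset insertI1 subsetI)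
  \<comment> \<open>Two distinct functions of the type of morphisms, from which the two-element test
    set is formed.\<close>
  then have "(\<lambda>_::'u. u) \<noteq> (\<lambda>_. v)" by (metis)
  moreover have "(\<lambda>x\<in>carrier S. x) \<in> Hom ?K S S" using comod_hom_ident[OF SC] by (simp add: comod_flat_cat_simps)
  moreover have rI: "r \<subseteq> I \<times> I"
    using dia unfolding aleph1_diagram_def aleph1_directed_def partial_order_on_def preorder_on_def refl_on_def by auto
  moreover have t: "post_comp ?K S (D i) (D j) (d i j) x \<in> Hom ?K S (D j)" if ij: "(i, j) \<in> r" and x: "x \<in> Hom ?K S (D i)" for i j x
  proof -
    have "D i \<in> Ob ?K" "D j \<in> Ob ?K" using D rI ij by auto
    moreover have "d i j \<in> Hom ?K (D i) (D j)" using dia ij unfolding aleph1_diagram_def diagram_def by blast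
    ultimately show ?thesis
      using category.Comp_closed[OF category_comod_flat_cat S _ _ x] x by (simp add: post_comp_def)
  qed
  ultimately obtain i f where i: "i \<in> I" and f: "f \<in> Hom ?K S (D i)" and eq: "post_comp ?K S (D i) S (\<iota> i) f = (\<lambda>x\<in>carrier S. x)"
    using set_colimit_surj[OF sc rI t] by blast
  have fh: "f \<in> comod_hom R C S (D i)" using f by (simp add: comod_flat_cat_simps)
  have c: "compose (carrier S) (\<iota> i) f = (\<lambda>x\<in>carrier S. x)" using eq f by (simp add: post_comp_def comod_flat_cat_simps)
  have id: "\<iota> i (f x) = x" if "x \<in> carrier S" for x using fun_cong[OF c, of x] that by (simp add: compose_eq)
  have \<iota>h: "\<iota> i \<in> comod_hom R C (D i) S" using col i by (simp add: is_colimit_def cocone_def comod_flat_cat_simps)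
  have DL: "left_module R (D i)" and Dp: "countably_presentable R (D i)" using D i by (auto simp: comod_flat_cat_simps comodule_left)
  from countably_presentable_imp_presented[OF Dp DL] obtain Y :: "nat set" and e G where G: "countable G" "presented R (D i) Y e G" by blast
  from presented_retract[OF G(2) DL SL comod_homD(2)[OF fh] comod_homD(2)[OF \<iota>h] id _ G(1)]
  obtain G' where "countable G'" "presented R S Y (\<lambda>x. \<iota> i (e x)) G'" by auto
  then show ?thesis using presented_imp_countably_presentable[OF _ SL] by auto
qed

end

lemma colimit_of_mono: "aleph1_directed_colimit_of \<kappa> K T X \<Longrightarrow> T \<subseteq> T' \<Longrightarrow> aleph1_directed_colimit_of \<kappa> K T' X"
  unfolding aleph1_directed_colimit_of_def by blast

theorem theorem3p1:
  fixes \<kappa> :: "'u rel"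
    and A :: "('a, 'r) ring_scheme"
    and C :: "('a, 'c, 'y) coring_scheme"
  assumes "universe_cardinal \<kappa>"
    and "ring A" and "small \<kappa> (carrier A)"
    and "coring A C" and "small \<kappa> (carrier C)"
  shows "aleph1_accessible \<kappa> (comod_flat_cat \<kappa> A C) \<and>
    {S \<in> Ob (comod_flat_cat \<kappa> A C). aleph1_presentable \<kappa> (comod_flat_cat \<kappa> A C) S} =
      {S \<in> Ob (comod_flat_cat \<kappa> A C). countably_presentable A S} \<and>
    (\<forall>M \<in> Ob (comod_flat_cat \<kappa> A C).
      aleph1_directed_colimit_of \<kappa> (comod_flat_cat \<kappa> A C)
        {S \<in> Ob (comod_flat_cat \<kappa> A C). countably_presentable A S} M)"
proof -
  interpret coring A C by fact
  let ?K = "comod_flat_cat \<kappa> A C"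
  \<comment> \<open>Accessibility asks for a small set of presentable objects, which the
    representatives provide; the decomposition into arbitrary countably presentable comodules
    follows by enlarging \<open>T\<close>.\<close>
  obtain T where T: "T \<subseteq> {S \<in> Ob ?K. countably_presentable A S}" "small \<kappa> T"
    "\<forall>S\<in>Ob ?K. countably_presentable A S \<longrightarrow> (\<exists>S'\<in>T. \<exists>f g. comod_iso S S' f g)"
    using small_representatives[OF assms(1,3,5)] by (elim exE conjE)
  have TO: "T \<subseteq> Ob ?K" using T(1) by blast
  have colT: "aleph1_directed_colimit_of \<kappa> ?K T M" if "M \<in> Ob ?K" for M
    by (rule flat_colimit[OF assms(1,3) that TO]) (use T(3) in blast)
  have col: "aleph1_directed_colimit_of \<kappa> ?K {S \<in> Ob ?K. countably_presentable A S} M" if "M \<in> Ob ?K" for M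
    by (rule colimit_of_mono[OF colT[OF that] T(1)])
  have cp: "aleph1_presentable \<kappa> ?K S \<longleftrightarrow> countably_presentable A S" if S: "S \<in> Ob ?K" for S
    using countably_presentable_imp_presentable[OF assms(1) S] presentable_imp_countably_presentable[OF assms(1) S _ col[OF S]] by blast
  have "has_aleph1_directed_colimits \<kappa> ?K"
    unfolding has_aleph1_directed_colimits_def using colimit_exists[OF assms(1)] by blast
  then have "aleph1_accessible \<kappa> ?K"
    unfolding aleph1_accessible_def using category_comod_flat_cat T(1,2) colT cp by (intro conjI exI[of _ T]) auto
  then show ?thesis using cp col by blast
qed

end
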